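(* Let $\alpha>0$ and $\beta\ge 0$. Then $\partial_t^\alpha:\ {}^{-\beta}H(0,T)\longrightarrow {}^{-\alpha-\beta}H(0,T)$ and $\partial_t^\alpha:\ H_{\alpha+\beta}(0,T)\longrightarrow H_\beta(0,T)$ are both isomorphisms.
   Context: Let $T>0$; all functions are real valued. "Isomorphism" between Banach spaces means a linear bijection that is bounded with bounded inverse. Spaces. For $0<\sigma<1$, $H^\sigma(0,T)$ is the Sobolev–Slobodeckij space with norm $\|v\|_{H^\sigma(0,T)}=\big(\|v\|_{L^2(0,T)}^2+\int_0^T\int_0^T\frac{|v(t)-v(s)|^2}{|t-s|^{1+2\sigma}}dtds\big)^{1/2}$; for $m\in\mathbb{N}$, $H^m(0,T)$ is the usual Sobolev space. Set $H_0(0,T)={}^{0}H(0,T)=L^2(0,T)$. For $0<\sigma\le1$: $H_\sigma(0,T)=H^\sigma(0,T)$ if $\sigma<\frac12$; $H_{1/2}(0,T)=\{v\in H^{1/2}(0,T): \int_0^T\frac{|v(t)|^2}{t}dt<\infty\}$; $H_\sigma(0,T)=\{v\in H^\sigma(0,T): v(0)=0\}$ if $\frac12<\sigma\le 1$. The norm is that of $H^\sigma(0,T)$, except for $\sigma=\frac12$ where it is $(\|v\|_{H^{1/2}(0,T)}^2+\int_0^T\frac{|v(t)|^2}{t}dt)^{1/2}$. For $m\in\mathbb{N}$ let $H_m(0,T)=\{v\in H^m(0,T): v(0)=\dots=\frac{d^{m-1}v}{dt^{m-1}}(0)=0\}$, and for $0<\sigma\le1$ let $H_{m+\sigma}(0,T)=\{v\in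 H_m(0,T):\frac{d^mv}{dt^m}\in H_\sigma(0,T)\}$ with norm $(\|\frac{d^mv}{dt^m}\|_{L^2}^2+\|\frac{d^mv}{dt^m}\|_{H_\sigma}^2)^{1/2}$. The spaces ${}^{\alpha}H(0,T)$, $\alpha>0$, are defined in the same way with the endpoint $t=0$ replaced by $t=T$ (conditions $v(T)=0$ etc., weight $\frac1{T-t}$ instead of $\frac1t$). For $\alpha>0$, ${}^{-\alpha}H(0,T):=({}^{\alpha}H(0,T))'$ is the dual space, where $L^2(0,T)$ is identified with its own dual, so that ${}^{\alpha}H(0,T)\subset L^2(0,T)\subset{}^{-\alpha}H(0,T)$. Operators. For $\alpha>0$, $(J^\alpha v)(t)=\frac1{\Gamma(\alpha)}\int_0^t(t-s)^{\alpha-1}v(s)ds$ and $(J_\alpha v)(t)=\frac1{\Gamma(\alpha)}\int_t^T(\xi-t)^{\alpha-1}v(\xi)d\xi$. For $\beta\ge0$, $J_\alpha$ is a bounded bijection ${}^{\beta}H(0,T)\to{}^{\alpha+\beta}H(0,T)$, and $J_\alpha':{}^{-\alpha-\beta}H(0,T)\to{}^{-\beta}H(0,T)$ denotes its dual operator, $\langle J_\alpha'f,\varphi\rangle=\langle f,J_\alpha\varphi\rangle$ for $\varphi\in{}^{\beta}H(0,T)$. These operators are consistent for different $\beta$, and $J_\alpha'v=J^\alpha v$ for $v\in L^2(0,T)$. The fractional derivative is $\partial_t^\alpha:=(J_\alpha')^{-1}$, considered with domain ${}^{-\beta}H(0,T)$ ($\beta\ge 0$), or restricted to $H_{\alpha+\beta}(0,T)\subset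 L^2(0,T)$, where it coincides with $(J^\alpha)^{-1}$. *)

theory Defs
  imports "HOL-Analysis.Analysis" "HOL-Library.Function_Algebras"
begin

section \<open>Measurable functions modulo almost everywhere equality\<close>

text \<open>
  Every Lebesgue measurable function agrees a.e. with a Borel one, so Borel representatives and
  \<^const>\<open>lborel\<close> suffice.  A function on $(0,T)$ is identified with its extension by zero, so that
  one type serves all \<open>T\<close>.
\<close>

quotient_type aefun = "real \<Rightarrow> real" / partial:
  "\<lambda>f g. f \<in> borel_measurable borel \<and> g \<in> borel_measurable borel \<and> (AE x in lborel. f x = g x)"
  morphisms rep_ae abs_ae
proof (rule part_equivpI)
  show "\<exists>f::real \<Rightarrow> real. f \<in> borel_measurable borel \<and> f \<in> borel_measurable borel
          \<and> (AE x in lborel. f x = f x)"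
    by (rule exI[of _ "\<lambda>_. 0"]) simp
  show "symp (\<lambda>f g::real \<Rightarrow> real. f \<in> borel_measurable borel \<and> g \<in> borel_measurable borel
          \<and> (AE x in lborel. f x = g x))"
    by (rule sympI) (auto elim: eventually_mono)
  show "transp (\<lambda>f g::real \<Rightarrow> real. f \<in> borel_measurable borel \<and> g \<in> borel_measurable borel
          \<and> (AE x in lborel. f x = g x))"
    by (rule transpI) (auto elim: eventually_elim2)
qed

instantiation aefun :: real_vector
begin

lift_definition zero_aefun :: aefun is "\<lambda>_. 0"
  by simp

lift_definition plus_aefun :: "aefun \<Rightarrow> aefun \<Rightarrow> aefun" is "\<lambda>f g x. f x + g x"
  by (auto elim: eventually_elim2)

lift_definition minus_aefun :: "aefun \<Rightarrow> aefun \<Rightarrow> aefun" is "\<lambda>f g x. f x - g x"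
  by (auto elim: eventually_elim2)

lift_definition uminus_aefun :: "aefun \<Rightarrow> aefun" is "\<lambda>f x. - f x"
  by (auto elim: eventually_mono)

lift_definition scaleR_aefun :: "real \<Rightarrow> aefun \<Rightarrow> aefun" is "\<lambda>c f x. c * f x"
  by (auto elim: eventually_mono)

instance
  by standard (transfer; auto simp: algebra_simps)+

end

definition ae_on :: "real \<Rightarrow> (real \<Rightarrow> real) \<Rightarrow> aefun" where
  "ae_on T f = abs_ae (\<lambda>t. if t \<in> {0<..<T} then f t else 0)"

section \<open>Normed spaces carried by subsets of a vector space\<close>

instantiation "fun" :: (type, real_vector) real_vector
begin

definition scaleR_fun :: "real \<Rightarrow> ('a \<Rightarrow> 'b) \<Rightarrow> 'a \<Rightarrow> 'b" where
  "scaleR_fun c f = (\<lambda>x. c *\<^sub>R f x)"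

instance
  by standard (auto simp: scaleR_fun_def fun_eq_iff scaleR_add_left scaleR_add_right)

end

record 'a nspace =
  elems :: "'a set"
  nrm :: "'a \<Rightarrow> real"

definition bounded_linear_map ::
  "'a::real_vector nspace \<Rightarrow> 'b::real_vector nspace \<Rightarrow> ('a \<Rightarrow> 'b) \<Rightarrow> bool" where
  "bounded_linear_map X Y D \<longleftrightarrow>
     (\<forall>x\<in>elems X. D x \<in> elems Y) \<and>
     (\<forall>x\<in>elems X. \<forall>y\<in>elems X. D (x + y) = D x + D y) \<and>
     (\<forall>c. \<forall>x\<in>elems X. D (c *\<^sub>R x) = c *\<^sub>R D x) \<and>
     (\<exists>C. \<forall>x\<in>elems X. nrm Y (D x) \<le> C * nrm X x)"

definition is_isomorphism ::
  "'a::real_vector nspace \<Rightarrow> 'b::real_vector nspace \<Rightarrow> ('a \<Rightarrow> 'b) \<Rightarrow> bool" where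
  "is_isomorphism X Y D \<longleftrightarrow>
     bij_betw D (elems X) (elems Y) \<and>
     bounded_linear_map X Y D \<and>
     bounded_linear_map Y X (the_inv_into (elems X) D)"

text \<open>
  A functional on a space is a total function on the ambient type; it is required to be zero
  outside the space, so that distinct functions are distinct functionals.
\<close>

definition dual :: "'a::real_vector nspace \<Rightarrow> ('a \<Rightarrow> real) nspace" where
  "dual X =
    \<lparr> elems = {F. (\<forall>x\<in>elems X. \<forall>y\<in>elems X. F (x + y) = F x + F y) \<and>
                  (\<forall>c. \<forall>x\<in>elems X. F (c *\<^sub>R x) = c * F x) \<and>
                  (\<exists>C. \<forall>x\<in>elems X. \<bar>F x\<bar> \<le> C * nrm X x) \<and>
                  (\<forall>x. x \<notin> elems X \<longrightarrow> F x = 0)},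
      nrm = (\<lambda>F. Sup {\<bar>F x\<bar> |x. x \<in> elems X \<and> nrm X x \<le> 1}) \<rparr>"

section \<open>Sobolev spaces on $(0,T)$\<close>

definition L2_sq :: "real \<Rightarrow> aefun \<Rightarrow> ennreal" where
  "L2_sq T u = (\<integral>\<^sup>+t\<in>{0<..<T}. ennreal ((rep_ae u t)\<^sup>2) \<partial>lborel)"

definition L2 :: "real \<Rightarrow> aefun set" where
  "L2 T = {u. (AE t in lborel. t \<notin> {0<..<T} \<longrightarrow> rep_ae u t = 0) \<and> L2_sq T u < \<infinity>}"

definition slobodeckij_sq :: "real \<Rightarrow> real \<Rightarrow> aefun \<Rightarrow> ennreal" where
  "slobodeckij_sq T \<sigma> u =
     (\<integral>\<^sup>+t\<in>{0<..<T}. (\<integral>\<^sup>+s\<in>{0<..<T}.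
        ennreal (\<bar>rep_ae u t - rep_ae u s\<bar>\<^sup>2 / \<bar>t - s\<bar> powr (1 + 2 * \<sigma>)) \<partial>lborel) \<partial>lborel)"

definition test_function :: "real \<Rightarrow> (real \<Rightarrow> real) \<Rightarrow> bool" where
  "test_function T \<phi> \<longleftrightarrow>
     (\<forall>k x. (deriv ^^ k) \<phi> differentiable at x) \<and>
     (\<exists>a b. 0 < a \<and> b < T \<and> (\<forall>x. x \<notin> {a..b} \<longrightarrow> \<phi> x = 0))"

definition has_weak_deriv :: "real \<Rightarrow> nat \<Rightarrow> aefun \<Rightarrow> aefun \<Rightarrow> bool" where
  "has_weak_deriv T k u w \<longleftrightarrow>
     (\<forall>\<phi>. test_function T \<phi> \<longrightarrow>
        (LINT t:{0<..<T}|lborel. rep_ae u t * (deriv ^^ k) \<phi> t)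
        = (-1) ^ k * (LINT t:{0<..<T}|lborel. rep_ae w t * \<phi> t))"

definition weak_deriv :: "real \<Rightarrow> nat \<Rightarrow> aefun \<Rightarrow> aefun" where
  "weak_deriv T k u = (THE w. w \<in> L2 T \<and> has_weak_deriv T k u w)"

definition sobolev_nat :: "real \<Rightarrow> nat \<Rightarrow> aefun set" where
  "sobolev_nat T m = {u \<in> L2 T. \<forall>k\<le>m. \<exists>w\<in>L2 T. has_weak_deriv T k u w}"

definition sobolev_frac :: "real \<Rightarrow> real \<Rightarrow> aefun set" where
  "sobolev_frac T \<sigma> = {u \<in> L2 T. slobodeckij_sq T \<sigma> u < \<infinity>}"

text \<open>The value of a class at an endpoint \<open>e\<close> is that of its continuous representative.\<close>

definition vanishes_at :: "real \<Rightarrow> real \<Rightarrow> aefun \<Rightarrow> bool" where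
  "vanishes_at T e u \<longleftrightarrow> (\<exists>f. continuous_on {0..T} f \<and> u = ae_on T f \<and> f e = 0)"

definition weight_sq :: "real \<Rightarrow> real \<Rightarrow> aefun \<Rightarrow> ennreal" where
  "weight_sq T e u = (\<integral>\<^sup>+t\<in>{0<..<T}. ennreal ((rep_ae u t)\<^sup>2 / \<bar>t - e\<bar>) \<partial>lborel)"

section \<open>Spaces with zero conditions at an endpoint\<close>

text \<open>
  The endpoint \<open>e\<close> is \<open>0\<close> for $H_\alpha(0,T)$ and \<open>T\<close> for ${}^{\alpha}H(0,T)$.  The next two
  definitions are meant for $0 < \sigma \le 1$.
\<close>

definition Hz_unit :: "real \<Rightarrow> real \<Rightarrow> real \<Rightarrow> aefun set" where
  "Hz_unit T e \<sigma> =
     (if \<sigma> < 1/2 then sobolev_frac T \<sigma>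
      else if \<sigma> = 1/2 then {u \<in> sobolev_frac T \<sigma>. weight_sq T e u < \<infinity>}
      else if \<sigma> < 1 then {u \<in> sobolev_frac T \<sigma>. vanishes_at T e u}
      else {u \<in> sobolev_nat T 1. vanishes_at T e u})"

definition Hz_unit_sq :: "real \<Rightarrow> real \<Rightarrow> real \<Rightarrow> aefun \<Rightarrow> ennreal" where
  "Hz_unit_sq T e \<sigma> u =
     (if \<sigma> = 1/2 then L2_sq T u + slobodeckij_sq T \<sigma> u + weight_sq T e u
      else if \<sigma> < 1 then L2_sq T u + slobodeckij_sq T \<sigma> u
      else L2_sq T u + L2_sq T (weak_deriv T 1 u))"

definition Hz_nat :: "real \<Rightarrow> real \<Rightarrow> nat \<Rightarrow> aefun set" where
  "Hz_nat T e m = {u \<in> sobolev_nat T m. \<forall>k<m. vanishes_at T e (weak_deriv T k u)}"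

text \<open>
  An order $\alpha > 0$ is split as $\alpha = m + \sigma$ with \<open>m\<close> a natural number and
  $0 < \sigma \le 1$; in particular an integer order has $\sigma = 1$.
\<close>

definition Hz :: "real \<Rightarrow> real \<Rightarrow> real \<Rightarrow> aefun nspace" where
  "Hz T e \<alpha> =
     (let m = nat (\<lceil>\<alpha>\<rceil> - 1); \<sigma> = \<alpha> - real m in
      if \<alpha> = 0 then \<lparr> elems = L2 T, nrm = (\<lambda>u. sqrt (enn2real (L2_sq T u))) \<rparr>
      else if m = 0 then
        \<lparr> elems = Hz_unit T e \<sigma>, nrm = (\<lambda>u. sqrt (enn2real (Hz_unit_sq T e \<sigma> u))) \<rparr>
      else
        \<lparr> elems = {u \<in> Hz_nat T e m. weak_deriv T m u \<in> Hz_unit T e \<sigma>},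
          nrm = (\<lambda>u. sqrt (enn2real (L2_sq T (weak_deriv T m u)
                                      + Hz_unit_sq T e \<sigma> (weak_deriv T m u)))) \<rparr>)"

abbreviation H_left :: "real \<Rightarrow> real \<Rightarrow> aefun nspace" where
  "H_left T \<alpha> \<equiv> Hz T 0 \<alpha>"

abbreviation H_right :: "real \<Rightarrow> real \<Rightarrow> aefun nspace" where
  "H_right T \<alpha> \<equiv> Hz T T \<alpha>"

text \<open>\<open>H_dual T \<alpha>\<close> is ${}^{-\alpha}H(0,T)$.\<close>

definition H_dual :: "real \<Rightarrow> real \<Rightarrow> (aefun \<Rightarrow> real) nspace" where
  "H_dual T \<alpha> = dual (H_right T \<alpha>)"

text \<open>
  The inclusion $L^2(0,T) \subset {}^{-\gamma}H(0,T)$ sends \<open>u\<close> to integration against \<open>u\<close>.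
  A space \<open>X\<close> of $L^2$ functions becomes a subspace of ${}^{-\gamma}H(0,T)$ that keeps the norm
  of \<open>X\<close>.
\<close>

definition L2_incl :: "real \<Rightarrow> real \<Rightarrow> aefun \<Rightarrow> aefun \<Rightarrow> real" where
  "L2_incl T \<gamma> u =
     (\<lambda>\<phi>. if \<phi> \<in> elems (H_right T \<gamma>)
           then LINT t:{0<..<T}|lborel. rep_ae u t * rep_ae \<phi> t else 0)"

definition as_subspace :: "real \<Rightarrow> real \<Rightarrow> aefun nspace \<Rightarrow> (aefun \<Rightarrow> real) nspace" where
  "as_subspace T \<gamma> X =
     \<lparr> elems = L2_incl T \<gamma> ` elems X,
       nrm = (\<lambda>F. nrm X (the_inv_into (elems X) (L2_incl T \<gamma>) F)) \<rparr>"

section \<open>Fractional integral and fractional derivative\<close>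

definition J_right :: "real \<Rightarrow> real \<Rightarrow> aefun \<Rightarrow> aefun" where
  "J_right T \<alpha> v =
     ae_on T (\<lambda>t. 1 / Gamma \<alpha> *
       (LINT \<xi>:{t<..<T}|lborel. (\<xi> - t) powr (\<alpha> - 1) * rep_ae v \<xi>))"

text \<open>
  \<open>J_dual T \<alpha> \<beta>\<close> is $J_\alpha' : {}^{-\alpha-\beta}H(0,T) \to {}^{-\beta}H(0,T)$ and
  \<open>frac_deriv T \<alpha> \<beta>\<close> is $\partial_t^\alpha$ with domain ${}^{-\beta}H(0,T)$.  Since
  $H_{\alpha+\beta}(0,T) \subset L^2(0,T) \subset {}^{-\gamma}H(0,T)$ for every $\gamma \ge 0$, each
  \<open>frac_deriv T \<alpha> \<gamma>\<close> restricts to $H_{\alpha+\beta}(0,T)$ via \<open>as_subspace T \<gamma>\<close>.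
\<close>

definition J_dual :: "real \<Rightarrow> real \<Rightarrow> real \<Rightarrow> (aefun \<Rightarrow> real) \<Rightarrow> aefun \<Rightarrow> real" where
  "J_dual T \<alpha> \<beta> F = (\<lambda>\<phi>. if \<phi> \<in> elems (H_right T \<beta>) then F (J_right T \<alpha> \<phi>) else 0)"

definition frac_deriv :: "real \<Rightarrow> real \<Rightarrow> real \<Rightarrow> (aefun \<Rightarrow> real) \<Rightarrow> aefun \<Rightarrow> real" where
  "frac_deriv T \<alpha> \<beta> = the_inv_into (elems (H_dual T (\<alpha> + \<beta>))) (J_dual T \<alpha> \<beta>)"

end

theory Submission
  imports Defs
begin

text \<open>
  Everything rests on one fact about the Riemann-Liouville integral
  $J^\gamma v(t) = \Gamma(\gamma)^{-1} \int_0^t (t-s)^{\gamma-1} v(s) ds$: for every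
  $\gamma > 0$ it maps $L^2(0,T)$ isomorphically onto $H_\gamma(0,T)$ (\<open>Jz_into_Hz\<close>,
  \<open>Hz_preimage\<close>). The semigroup law $J^\alpha J^\beta = J^{\alpha+\beta}$ then shows that
  $J^\alpha$ maps $H_\beta = J^\beta L^2$ isomorphically onto
  $H_{\alpha+\beta} = J^{\alpha+\beta} L^2$ (\<open>Jl_left_isomorphism\<close>), and the reflection
  \<open>t \<mapsto> T - t\<close>, which exchanges the two scales and the two integrals, gives the same for
  $J_\alpha$ and ${}^{\beta}H$ (\<open>J_right_isomorphism\<close>). The dual of an isomorphism is an
  isomorphism (\<open>dual_isomorphism\<close>), and the fractional derivative is the inverse of the dual
  of $J_\alpha$: this is the first claim. For the second one, Fubini's theorem gives
  $J_\alpha' U = J^\alpha U$ for $U$ in $L^2$, so the fractional derivative sends $J^\alpha U$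
  back to $U$ (\<open>frac_deriv_L2_incl\<close>). This determines it on functions because a function in
  $L^2$ is determined by its pairing with the elements of ${}^{\gamma}H = J_\gamma L^2$
  (\<open>L2_incl_inj\<close>).

  For $0 < \sigma < 1$ the isomorphism is first obtained on the line, for functions that
  vanish on the negative half-line, and it is obtained without Fourier transform or
  interpolation. The function $J^\sigma 1_{(0,a]}$ is a difference of two translates of a
  multiple of the truncated power $t_+^\sigma$. By the behaviour of the Gagliardo seminorm
  under translations and dilations, the squared seminorm of
  $J^\sigma 1_{(0,a]} - J^\sigma 1_{(0,b]}$ is a constant times $|a-b|$, which is the same
  constant times the squared $L^2$ norm of $1_{(0,a]} - 1_{(0,b]}$. Norms of differences
  determine inner products, so $J^\sigma$ carries the $L^2$ norm to a constant multiple of the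
  seminorm on all step functions (\<open>rl_step_isometry\<close>), and density extends this to a two-sided
  estimate on $L^2$ (\<open>rl_gag_upper\<close>, \<open>rl_gag_lower\<close>). For surjectivity, the Steklov means of a
  given $u$ are $J^1$ of difference quotients of $u$, hence $J^\sigma$ of $J^{1-\sigma}$ of
  these quotients; these preimages stay bounded in $L^2$ by the lower estimate, and
  approximate solutions of least norm converge (\<open>rl_gag_surj\<close>).

  To descend from the line to \<open>(0,T)\<close>, a function is extended by zero to the left of \<open>0\<close> and
  by reflection to the right of \<open>T\<close>. The reflection costs a constant factor; the extension by
  zero costs exactly a multiple of $\int_0^T t^{-2\sigma} |u(t)|^2 dt$. This weighted integral
  is bounded by the norm of $H_\sigma$: through fractional Hardy inequalities for \<open>\<sigma> \<noteq> 1/2\<close>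
  (\<open>hardy_small\<close>, \<open>hardy_large\<close>, the latter using \<open>u(0) = 0\<close>), and by the definition of the
  norm for \<open>\<sigma> = 1/2\<close>. Finally, $U = J^1 W$ holds exactly if $U$ has weak derivative $W$ and
  vanishes at \<open>0\<close> (\<open>H1_characterization\<close>); applied repeatedly this reduces order $m + \sigma$
  to order $\sigma$.
\<close>

section \<open>Squared norms and completeness\<close>

text \<open>
  Squared norms are taken with values in \<open>ennreal\<close>, so that every estimate can be stated
  before finiteness is known and finiteness of the right-hand side carries over to the left.
\<close>

definition sqn :: "'a measure \<Rightarrow> ('a \<Rightarrow> real) \<Rightarrow> ennreal" where
  "sqn M f = (\<integral>\<^sup>+x. ennreal ((f x)\<^sup>2) \<partial>M)"

lemma sqn_cong_AE: "AE x in M. f x = g x \<Longrightarrow> sqn M f = sqn M g"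
  unfolding sqn_def by (rule nn_integral_cong_AE) (auto elim!: eventually_mono)

lemma sqn_mono_AE: "AE x in M. \<bar>f x\<bar> \<le> \<bar>g x\<bar> \<Longrightarrow> sqn M f \<le> sqn M g"
  unfolding sqn_def
  by (rule nn_integral_mono_AE) (auto elim!: eventually_mono simp: abs_le_square_iff intro!: ennreal_leI)

lemma sqn_mono: "(\<And>x. x \<in> space M \<Longrightarrow> \<bar>f x\<bar> \<le> \<bar>g x\<bar>) \<Longrightarrow> sqn M f \<le> sqn M g"
  by (rule sqn_mono_AE) auto

lemma sqn_cmult:
  assumes [measurable]: "f \<in> borel_measurable M"
  shows "sqn M (\<lambda>x. c * f x) = ennreal (c\<^sup>2) * sqn M f"
proof -
  have "sqn M (\<lambda>x. c * f x) = (\<integral>\<^sup>+x. ennreal (c\<^sup>2) * ennreal ((f x)\<^sup>2) \<partial>M)"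
    unfolding sqn_def by (simp add: power_mult_distrib ennreal_mult')
  also have "\<dots> = ennreal (c\<^sup>2) * sqn M f" unfolding sqn_def by (rule nn_integral_cmult) simp
  finally show ?thesis .
qed

lemma sqn_diff_commute: "sqn M (\<lambda>x. f x - g x) = sqn M (\<lambda>x. g x - f x)"
  unfolding sqn_def by (simp add: power2_commute)

text \<open>
  Young's inequality $2xy \le e x^2 + y^2/e$ under the integral. The weight \<open>e\<close> keeps the
  factor of the first term close to \<open>1\<close>, so that a contraction survives a perturbation.
\<close>

lemma sqn_add_le_weighted:
  assumes [measurable]: "f \<in> borel_measurable M" "g \<in> borel_measurable M" and e: "e > 0"
  shows "sqn M (\<lambda>x. f x + g x) \<le> ennreal (1 + e) * sqn M f + ennreal (1 + 1 / e) * sqn M g"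
proof -
  have *: "(a + b)\<^sup>2 \<le> (1 + e) * a\<^sup>2 + (1 + 1 / e) * b\<^sup>2" for a b :: real
  proof -
    have "0 \<le> (e * a - b)\<^sup>2 / e" using e by simp
    also have "\<dots> = (1 + e) * a\<^sup>2 + (1 + 1 / e) * b\<^sup>2 - (a + b)\<^sup>2"
      using e by (simp add: field_simps power2_eq_square)
    finally show ?thesis by simp
  qed
  have "sqn M (\<lambda>x. f x + g x)
      \<le> (\<integral>\<^sup>+x. ennreal (1 + e) * ennreal ((f x)\<^sup>2) + ennreal (1 + 1 / e) * ennreal ((g x)\<^sup>2) \<partial>M)"
    unfolding sqn_def using e *
    by (intro nn_integral_mono) (auto simp flip: ennreal_mult ennreal_plus)
  also have "\<dots> = ennreal (1 + e) * sqn M f + ennreal (1 + 1 / e) * sqn M g"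
    unfolding sqn_def by (simp add: nn_integral_add nn_integral_cmult)
  finally show ?thesis .
qed

lemma sqn_add_le:
  assumes "f \<in> borel_measurable M" "g \<in> borel_measurable M"
  shows "sqn M (\<lambda>x. f x + g x) \<le> 2 * sqn M f + 2 * sqn M g"
  using sqn_add_le_weighted[OF assms, of 1] by simp

lemma sqn_le_add_diff:
  assumes [measurable]: "f \<in> borel_measurable M" "g \<in> borel_measurable M"
  shows "sqn M f \<le> 2 * sqn M g + 2 * sqn M (\<lambda>x. f x - g x)"
  using sqn_add_le[of g M "\<lambda>x. f x - g x"] by simp

lemma sqn_parallelogram:
  assumes [measurable]: "f \<in> borel_measurable M" "g \<in> borel_measurable M"
  shows "sqn M (\<lambda>x. f x + g x) + sqn M (\<lambda>x. f x - g x) = 2 * sqn M f + 2 * sqn M g"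
proof -
  have "sqn M (\<lambda>x. f x + g x) + sqn M (\<lambda>x. f x - g x)
      = (\<integral>\<^sup>+x. ennreal ((f x + g x)\<^sup>2) + ennreal ((f x - g x)\<^sup>2) \<partial>M)"
    unfolding sqn_def by (simp add: nn_integral_add)
  also have "\<dots> = (\<integral>\<^sup>+x. ennreal 2 * ennreal ((f x)\<^sup>2) + ennreal 2 * ennreal ((g x)\<^sup>2) \<partial>M)"
  proof (rule nn_integral_cong)
    fix x
    have "ennreal ((f x + g x)\<^sup>2) + ennreal ((f x - g x)\<^sup>2) = ennreal ((f x + g x)\<^sup>2 + (f x - g x)\<^sup>2)"
      by (rule ennreal_plus[symmetric]) auto
    also have "(f x + g x)\<^sup>2 + (f x - g x)\<^sup>2 = 2 * (f x)\<^sup>2 + 2 * (g x)\<^sup>2"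
      by (simp add: power2_eq_square algebra_simps)
    also have "ennreal (2 * (f x)\<^sup>2 + 2 * (g x)\<^sup>2)
        = ennreal 2 * ennreal ((f x)\<^sup>2) + ennreal 2 * ennreal ((g x)\<^sup>2)"
      by (subst ennreal_plus) (auto simp: ennreal_mult')
    finally show "ennreal ((f x + g x)\<^sup>2) + ennreal ((f x - g x)\<^sup>2)
        = ennreal 2 * ennreal ((f x)\<^sup>2) + ennreal 2 * ennreal ((g x)\<^sup>2)" .
  qed
  also have "\<dots> = 2 * sqn M f + 2 * sqn M g"
    unfolding sqn_def by (simp add: nn_integral_add nn_integral_cmult)
  finally show ?thesis .
qed

lemma sqn_zero_iff:
  assumes [measurable]: "f \<in> borel_measurable M"
  shows "sqn M f = 0 \<longleftrightarrow> (AE x in M. f x = 0)"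
  unfolding sqn_def by (subst nn_integral_0_iff_AE) auto

text \<open>
  Lower semicontinuity of the norm under pointwise convergence, by Fatou's lemma.
\<close>

lemma sqn_lim_le:
  assumes [measurable]: "\<And>n. f n \<in> borel_measurable M"
    and lim: "AE x in M. (\<lambda>n. f n x) \<longlonglongrightarrow> g x"
    and le: "\<And>n. n \<ge> N \<Longrightarrow> sqn M (f n) \<le> c"
  shows "sqn M g \<le> c"
proof -
  have "sqn M g \<le> (\<integral>\<^sup>+x. liminf (\<lambda>n. ennreal ((f n x)\<^sup>2)) \<partial>M)"
    unfolding sqn_def
  proof (rule nn_integral_mono_AE)
    show "AE x in M. ennreal ((g x)\<^sup>2) \<le> liminf (\<lambda>n. ennreal ((f n x)\<^sup>2))"
      using lim
    proof eventually_elim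
      case (elim x)
      then have "(\<lambda>n. ennreal ((f n x)\<^sup>2)) \<longlonglongrightarrow> ennreal ((g x)\<^sup>2)"
        by (intro tendsto_ennrealI tendsto_intros)
      then have "liminf (\<lambda>n. ennreal ((f n x)\<^sup>2)) = ennreal ((g x)\<^sup>2)"
        by (intro lim_imp_Liminf) auto
      then show ?case by simp
    qed
  qed
  also have "\<dots> \<le> liminf (\<lambda>n. sqn M (f n))"
    unfolding sqn_def by (rule nn_integral_liminf) simp
  also have "\<dots> \<le> c"
    by (rule Liminf_le) (use le in \<open>auto simp: eventually_sequentially\<close>)
  finally show ?thesis .
qed

text \<open>
  The series $\sum_n 4^n |f_n|^2$ has finite integral, so it converges almost everywhere and
  dominates each of its terms.
\<close>

lemma sqn_fast_AE_bound:
  assumes [measurable]: "\<And>n. f n \<in> borel_measurable M"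
    and le: "\<And>n. sqn M (f n) \<le> ennreal ((1/8)^n)"
  shows "AE x in M. \<exists>C. \<forall>n. \<bar>f n x\<bar> \<le> C * (1/2)^n"
proof -
  have "(\<integral>\<^sup>+x. (\<Sum>n. ennreal (4^n * (f n x)\<^sup>2)) \<partial>M) = (\<Sum>n. ennreal (4^n) * sqn M (f n))"
    unfolding sqn_def by (subst nn_integral_suminf) (auto simp: ennreal_mult' nn_integral_cmult)
  also have "\<dots> \<le> (\<Sum>n. ennreal ((1/2)^n))"
  proof (rule suminf_le)
    fix n
    have "ennreal (4^n) * sqn M (f n) \<le> ennreal (4^n) * ennreal ((1/8)^n)"
      by (rule mult_left_mono[OF le]) simp
    also have "\<dots> = ennreal ((1/2)^n)"
      by (simp add: power_mult_distrib[symmetric] flip: ennreal_mult)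
    finally show "ennreal (4^n) * sqn M (f n) \<le> ennreal ((1/2)^n)" .
  qed auto
  also have "\<dots> < \<infinity>"
    by (subst suminf_ennreal2) (auto simp: summable_geometric)
  finally have "AE x in M. (\<Sum>n. ennreal (4^n * (f n x)\<^sup>2)) \<noteq> \<infinity>"
    by (intro nn_integral_PInf_AE) auto
  then show ?thesis
  proof eventually_elim
    case (elim x)
    define S where "S = enn2real (\<Sum>n. ennreal (4^n * (f n x)\<^sup>2))"
    have S: "(\<Sum>n. ennreal (4^n * (f n x)\<^sup>2)) = ennreal S"
      using elim by (simp add: S_def less_top)
    have S0: "S \<ge> 0" by (simp add: S_def)
    have "\<bar>f n x\<bar> \<le> sqrt S * (1/2)^n" for n
    proof -
      have "sum (\<lambda>n. ennreal (4^n * (f n x)\<^sup>2)) {n} \<le> (\<Sum>n. ennreal (4^n * (f n x)\<^sup>2))"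
        by (rule sum_le_suminf) auto
      then have "4^n * (f n x)\<^sup>2 \<le> S" unfolding S using S0 by simp
      then have "sqrt (4^n * (f n x)\<^sup>2) \<le> sqrt S" by simp
      moreover have "sqrt (4^n * (f n x)\<^sup>2) = 2^n * \<bar>f n x\<bar>"
        using real_sqrt_power[of 4 n] real_sqrt_four by (simp add: real_sqrt_mult real_sqrt_abs)
      ultimately show ?thesis by (simp add: field_simps power_one_over)
    qed
    then show ?case by blast
  qed
qed

lemma sqn_fast_AE_lim:
  assumes "\<And>n. f n \<in> borel_measurable M" "g \<in> borel_measurable M"
    and le: "\<And>n. sqn M (\<lambda>x. f n x - g x) \<le> ennreal ((1/8)^n)"
  shows "AE x in M. (\<lambda>n. f n x) \<longlonglongrightarrow> g x"
proof -
  have "AE x in M. \<exists>C. \<forall>n. \<bar>f n x - g x\<bar> \<le> C * (1/2)^n"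
    by (rule sqn_fast_AE_bound) (use assms in auto)
  then show ?thesis
  proof eventually_elim
    case (elim x)
    then obtain C where C: "\<And>n. \<bar>f n x - g x\<bar> \<le> C * (1/2)^n" by blast
    have "(\<lambda>n. C * (1/2)^n) \<longlonglongrightarrow> 0"
      by (intro tendsto_mult_right_zero LIMSEQ_realpow_zero) auto
    then have "(\<lambda>n. f n x - g x) \<longlonglongrightarrow> 0"
      by (rule Lim_null_comparison[rotated]) (use C in auto)
    then show ?case by (simp add: LIM_zero_iff)
  qed
qed

text \<open>
  The Riesz-Fischer theorem: a subsequence with summable increments converges almost
  everywhere, and Fatou's lemma turns its pointwise limit into a limit in the norm.
\<close>

lemma sqn_complete:
  fixes f :: "nat \<Rightarrow> 'a \<Rightarrow> real"
  assumes [measurable]: "\<And>n. f n \<in> borel_measurable M"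
    and Cauchy: "\<And>e::real. e > 0 \<Longrightarrow> \<exists>N. \<forall>m\<ge>N. \<forall>n\<ge>N. sqn M (\<lambda>x. f m x - f n x) \<le> ennreal e"
  obtains g where "g \<in> borel_measurable M"
    "\<And>e::real. e > 0 \<Longrightarrow> \<exists>N. \<forall>n\<ge>N. sqn M (\<lambda>x. f n x - g x) \<le> ennreal e"
proof -
  have "\<exists>N. \<forall>k. (\<forall>m\<ge>N k. \<forall>n\<ge>N k. sqn M (\<lambda>x. f m x - f n x) \<le> ennreal ((1/8)^k))"
    by (rule choice) (use Cauchy in auto)
  then obtain N :: "nat \<Rightarrow> nat" where N: "\<And>k m n. m \<ge> N k \<Longrightarrow> n \<ge> N k \<Longrightarrow> sqn M (\<lambda>x. f m x - f n x) \<le> ennreal ((1/8)^k)"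
    by blast
  \<comment> \<open>The summand \<open>k\<close> makes \<open>r\<close> tend to infinity, the partial sums keep it above every \<open>N j\<close>
    with \<open>j \<le> k\<close>.\<close>
  define r where "r k = k + (\<Sum>j\<le>k. N j)" for k
  have r1: "r k \<ge> N k" for k
    unfolding r_def using member_le_sum[of k "{..k}" N] by simp
  have r2: "r (Suc k) \<ge> N k" for k
    unfolding r_def using member_le_sum[of k "{..Suc k}" N] by simp
  have rk: "r k \<ge> k" for k by (simp add: r_def)
  have "AE x in M. \<exists>C. \<forall>n. \<bar>f (r (Suc n)) x - f (r n) x\<bar> \<le> C * (1/2)^n"
    by (rule sqn_fast_AE_bound) (use N[OF r2 r1] in auto)
  then have conv: "AE x in M. convergent (\<lambda>n. f (r n) x)"
  proof eventually_elim
    case (elim x)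
    then obtain C where C: "\<And>n. \<bar>f (r (Suc n)) x - f (r n) x\<bar> \<le> C * (1/2)^n" by blast
    have "summable (\<lambda>n. f (r (Suc n)) x - f (r n) x)"
      by (rule summable_comparison_test'[where g="\<lambda>n. C * (1/2)^n" and N=0])
         (use C in \<open>auto simp: summable_geometric intro!: summable_mult\<close>)
    then have "convergent (\<lambda>n. \<Sum>i<n. f (r (Suc i)) x - f (r i) x)"
      by (simp add: summable_iff_convergent)
    then have "convergent (\<lambda>n. f (r n) x - f (r 0) x)"
      unfolding sum_lessThan_telescope[of "\<lambda>n. f (r n) x"] .
    then have "convergent (\<lambda>n. (f (r n) x - f (r 0) x) + f (r 0) x)"
      by (intro convergent_add convergent_const)
    then show ?case by simp
  qed
  define g where "g x = lim (\<lambda>n. f (r n) x)" for x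
  have [measurable]: "g \<in> borel_measurable M"
    unfolding g_def by measurable
  from conv have lim: "AE x in M. (\<lambda>n. f (r n) x) \<longlonglongrightarrow> g x"
    unfolding g_def by eventually_elim (simp add: convergent_LIMSEQ_iff)
  show ?thesis
  proof (rule that[of g])
    fix e :: real assume "e > 0"
    then obtain K where K: "\<And>m n. m \<ge> K \<Longrightarrow> n \<ge> K \<Longrightarrow> sqn M (\<lambda>x. f m x - f n x) \<le> ennreal e"
      using Cauchy by blast
    have "sqn M (\<lambda>x. f n x - g x) \<le> ennreal e" if "n \<ge> K" for n
    proof (rule sqn_lim_le[where f="\<lambda>k x. f n x - f (r k) x" and N=K])
      show "AE x in M. (\<lambda>k. f n x - f (r k) x) \<longlonglongrightarrow> f n x - g x"
        using lim by eventually_elim (intro tendsto_intros)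
      show "sqn M (\<lambda>x. f n x - f (r k) x) \<le> ennreal e" if "k \<ge> K" for k
        by (rule K) (use \<open>n \<ge> K\<close> that rk[of k] in auto)
    qed auto
    then show "\<exists>N. \<forall>n\<ge>N. sqn M (\<lambda>x. f n x - g x) \<le> ennreal e" by blast
  qed auto
qed

section \<open>The Riemann-Liouville integral of causal functions\<close>

text \<open>
  The kernel $x_+^{a-1}/\Gamma(a)$. Truncated on the line, it makes fractional integration a
  convolution, so that the upper limit of integration never has to be written.
\<close>

definition kern :: "real \<Rightarrow> real \<Rightarrow> real" where
  "kern a x = (if 0 < x then x powr (a - 1) / Gamma a else 0)"

definition rl :: "real \<Rightarrow> (real \<Rightarrow> real) \<Rightarrow> real \<Rightarrow> real" where
  "rl a v t = (LINT s|lborel. kern a (t - s) * v s)"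

text \<open>
  Causal functions that are square integrable up to every finite time. Fractional integrals of
  square integrable functions need not be square integrable at infinity; this larger class is
  stable under them.
\<close>

definition L2loc :: "(real \<Rightarrow> real) \<Rightarrow> bool" where
  "L2loc v \<longleftrightarrow> v \<in> borel_measurable borel \<and> (\<forall>t\<le>0. v t = 0) \<and>
     (\<forall>R. sqn lborel (\<lambda>t. indicator {..R} t * v t) < \<infinity>)"

lemma kern_measurable [measurable]: "kern a \<in> borel_measurable borel"
  unfolding kern_def by measurable

lemma kern_nonneg: "a > 0 \<Longrightarrow> kern a x \<ge> 0"
  by (simp add: kern_def Gamma_real_pos less_imp_le)

lemma kern_nonpos [simp]: "x \<le> 0 \<Longrightarrow> kern a x = 0"
  by (simp add: kern_def)

lemma kern_1: "kern 1 x = indicator {0<..} x"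
  by (simp add: kern_def)

lemma nn_integral_reflect_shift:
  fixes f :: "real \<Rightarrow> ennreal"
  assumes [measurable]: "f \<in> borel_measurable borel"
  shows "(\<integral>\<^sup>+s. f (t - s) \<partial>lborel) = (\<integral>\<^sup>+s. f s \<partial>lborel)"
  using nn_integral_real_affine[of f "-1" t] by simp

lemma nn_integral_shift:
  fixes f :: "real \<Rightarrow> ennreal"
  assumes [measurable]: "f \<in> borel_measurable borel"
  shows "(\<integral>\<^sup>+s. f (s + t) \<partial>lborel) = (\<integral>\<^sup>+s. f s \<partial>lborel)"
  using nn_integral_real_affine[of f 1 t] by (simp add: add.commute)

lemma nn_integral_powr_Ioc:
  fixes p c :: real
  assumes "p > -1" "c \<ge> 0"
  shows "(\<integral>\<^sup>+x. ennreal (x powr p) * indicator {0<..c} x \<partial>lborel) = ennreal (c powr (p + 1) / (p + 1))"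
proof -
  have "(\<integral>\<^sup>+x. ennreal (x powr p) * indicator {0<..c} x \<partial>lborel)
      = (\<integral>\<^sup>+x. ennreal (indicator {0..c} x * x powr p) \<partial>lborel)"
    by (intro nn_integral_cong) (auto simp: indicator_def)
  also have "\<dots> = ennreal (c powr (p + 1) / (p + 1))"
    by (rule nn_integral_has_integral_lebesgue[OF _ has_integral_powr_from_0]) (use assms in auto)
  finally show ?thesis .
qed

lemma kern_integral:
  assumes a: "a > 0" and R: "R \<ge> 0"
  shows "(\<integral>\<^sup>+x. ennreal (kern a x) * indicator {..R} x \<partial>lborel) = ennreal (R powr a / Gamma (a + 1))"
proof -
  have "(\<integral>\<^sup>+x. ennreal (kern a x) * indicator {..R} x \<partial>lborel)
      = (\<integral>\<^sup>+x. ennreal (1 / Gamma a) * (ennreal (x powr (a - 1)) * indicator {0<..R} x) \<partial>lborel)"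
    using a by (intro nn_integral_cong)
      (auto simp: kern_def indicator_def divide_inverse mult.commute ennreal_mult' Gamma_real_pos less_imp_le)
  also have "\<dots> = ennreal (1 / Gamma a) * ennreal (R powr (a - 1 + 1) / (a - 1 + 1))"
    by (subst nn_integral_cmult) (use a R in \<open>auto simp: nn_integral_powr_Ioc\<close>)
  also have "\<dots> = ennreal (R powr a / Gamma (a + 1))"
  proof -
    have "Gamma (a + 1) = a * Gamma a" using a by (intro Gamma_plus1) (auto dest: nonpos_Ints_nonpos)
    then show ?thesis
      using a by (simp add: ennreal_mult'[symmetric] Gamma_real_pos less_imp_le mult.commute)
  qed
  finally show ?thesis .
qed

text \<open>
  After \<open>r = s + (t - s) x\<close> this is Euler's Beta integral.
\<close>

lemma kern_convolution:
  assumes a: "a > 0" and b: "b > 0"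
  shows "(\<integral>\<^sup>+r. ennreal (kern a (t - r) * kern b (r - s)) \<partial>lborel) = ennreal (kern (a + b) (t - s))"
proof (cases "s < t")
  case False
  then have *: "kern a (t - r) * kern b (r - s) = 0" for r
    by (cases "r < t") auto
  show ?thesis unfolding * using False by simp
next
  case True
  define u where "u = t - s"
  have u: "u > 0" using True by (simp add: u_def)
  define C where "C = u powr (a + b - 2) / (Gamma a * Gamma b)"
  have C: "C \<ge> 0" using a b by (simp add: C_def Gamma_real_pos less_imp_le)
  have eq: "kern a (t - (s + u * x)) * kern b (s + u * x - s)
      = C * (indicator {0..1} x * (x powr (b - 1) * (1 - x) powr (a - 1)))" if "x \<noteq> 0" "x \<noteq> 1" for x
  proof (cases "0 < x \<and> x < 1")
    case True
    have "t - (s + u * x) = u * (1 - x)" by (simp add: u_def algebra_simps)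
    moreover have "u * (1 - x) > 0" "u * x > 0" using True u by auto
    moreover have "u powr (a - 1) * u powr (b - 1) = u powr (a + b - 2)"
      by (simp add: powr_add[symmetric])
    ultimately show ?thesis using True u
      by (simp add: kern_def C_def powr_mult)
  next
    case False
    have "t - (s + u * x) = u * (1 - x)" by (simp add: u_def algebra_simps)
    then have "kern a (t - (s + u * x)) * kern b (s + u * x - s) = 0"
      using u that False by (auto simp: kern_def zero_less_mult_iff)
    then show ?thesis using False that by auto
  qed
  have "(\<integral>\<^sup>+r. ennreal (kern a (t - r) * kern b (r - s)) \<partial>lborel)
     = ennreal u * (\<integral>\<^sup>+x. ennreal (kern a (t - (s + u * x)) * kern b (s + u * x - s)) \<partial>lborel)"
    using u by (subst nn_integral_real_affine[where c=u and t=s]) auto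
  also have "(\<integral>\<^sup>+x. ennreal (kern a (t - (s + u * x)) * kern b (s + u * x - s)) \<partial>lborel)
      = (\<integral>\<^sup>+x. ennreal C * ennreal (indicator {0..1} x * (x powr (b - 1) * (1 - x) powr (a - 1))) \<partial>lborel)"
  proof (rule nn_integral_cong_AE)
    have "AE x in lborel. x \<noteq> 0 \<and> x \<noteq> (1::real)"
      using AE_lborel_singleton[of 0] AE_lborel_singleton[of 1] by eventually_elim simp
    then show "AE x in lborel. ennreal (kern a (t - (s + u * x)) * kern b (s + u * x - s))
       = ennreal C * ennreal (indicator {0..1} x * (x powr (b - 1) * (1 - x) powr (a - 1)))"
    proof eventually_elim
      case (elim x)
      then show ?case using C eq[of x] by (metis ennreal_mult')
    qed
  qed
  also have "\<dots> = ennreal C * (\<integral>\<^sup>+x. ennreal (indicator {0..1} x * (x powr (b - 1) * (1 - x) powr (a - 1))) \<partial>lborel)"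
    by (rule nn_integral_cmult) simp
  also have "(\<integral>\<^sup>+x. ennreal (indicator {0..1} x * (x powr (b - 1) * (1 - x) powr (a - 1))) \<partial>lborel) = ennreal (Beta b a)"
    by (rule nn_integral_has_integral_lebesgue[OF _ has_integral_Beta_real[OF b a]]) auto
  also have "ennreal u * (ennreal C * ennreal (Beta b a)) = ennreal (u * C * Beta b a)"
    using u C by (simp add: ennreal_mult' mult.assoc)
  also have "u * C * Beta b a = kern (a + b) (t - s)"
  proof -
    have "u * u powr (a + b - 2) = u powr 1 * u powr (a + b - 2)" using u by simp
    also have "\<dots> = u powr (a + b - 1)" unfolding powr_add[symmetric] by simp
    finally show ?thesis
      using u Gamma_real_pos[OF a, THEN less_imp_neq] Gamma_real_pos[OF b, THEN less_imp_neq]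
      by (simp add: C_def Beta_def kern_def u_def[symmetric] add.commute)
  qed
  finally show ?thesis .
qed

lemma L2loc_measurable: "L2loc v \<Longrightarrow> v \<in> borel_measurable borel"
  by (simp add: L2loc_def)

lemma L2locD: "L2loc v \<Longrightarrow> t \<le> 0 \<Longrightarrow> v t = 0" "L2loc v \<Longrightarrow> sqn lborel (\<lambda>t. indicator {..R} t * v t) < \<infinity>"
  by (auto simp: L2loc_def)

lemma rl_measurable [measurable]:
  assumes [measurable]: "v \<in> borel_measurable borel"
  shows "rl a v \<in> borel_measurable borel"
  unfolding rl_def by measurable

text \<open>
  Schur's test. The kernel has mass $R^a/\Gamma(a+1)$ on \<open>(0,R]\<close>; splitting it into two square
  roots and applying the Cauchy-Schwarz inequality spends this mass once, and Tonelli's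
  theorem spends it a second time.
\<close>

lemma rl_schur:
  assumes a: "a > 0" and R: "R \<ge> 0" and [measurable]: "v \<in> borel_measurable borel"
    and v0: "\<And>t. t \<le> 0 \<Longrightarrow> v t = 0"
  shows "(\<integral>\<^sup>+t. indicator {..R} t * (\<integral>\<^sup>+s. ennreal (kern a (t - s) * \<bar>v s\<bar>) \<partial>lborel)\<^sup>2 \<partial>lborel)
      \<le> ennreal ((R powr a / Gamma (a + 1))\<^sup>2) * sqn lborel (\<lambda>t. indicator {..R} t * v t)"
proof -
  define K where "K = R powr a / Gamma (a + 1)"
  have K: "K \<ge> 0" using a by (simp add: K_def Gamma_real_pos less_imp_le)
  have CS: "indicator {..R} t * (\<integral>\<^sup>+s. ennreal (kern a (t - s) * \<bar>v s\<bar>) \<partial>lborel)\<^sup>2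
     \<le> ennreal K * (\<integral>\<^sup>+s. indicator {..R} t * ennreal (kern a (t - s) * (v s)\<^sup>2) \<partial>lborel)" for t
  proof (cases "t \<le> R")
    case True
    have "(\<integral>\<^sup>+s. ennreal (kern a (t - s) * \<bar>v s\<bar>) \<partial>lborel)
        = (\<integral>\<^sup>+s. ennreal (sqrt (kern a (t - s)) * indicator {0<..} s) * ennreal (sqrt (kern a (t - s)) * \<bar>v s\<bar>) \<partial>lborel)"
    proof (intro nn_integral_cong)
      fix s
      show "ennreal (kern a (t - s) * \<bar>v s\<bar>) =
        ennreal (sqrt (kern a (t - s)) * indicator {0<..} s) * ennreal (sqrt (kern a (t - s)) * \<bar>v s\<bar>)"
        using kern_nonneg[OF a, of "t - s"] v0[of s]
        by (cases "s > 0") (auto simp: mult.assoc[symmetric] simp flip: ennreal_mult)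
    qed
    then have "(\<integral>\<^sup>+s. ennreal (kern a (t - s) * \<bar>v s\<bar>) \<partial>lborel)\<^sup>2
       \<le> (\<integral>\<^sup>+s. (ennreal (sqrt (kern a (t - s)) * indicator {0<..} s))\<^sup>2 \<partial>lborel)
         * (\<integral>\<^sup>+s. (ennreal (sqrt (kern a (t - s)) * \<bar>v s\<bar>))\<^sup>2 \<partial>lborel)"
      by (simp add: Cauchy_Schwarz_nn_integral)
    also have "(\<integral>\<^sup>+s. (ennreal (sqrt (kern a (t - s)) * \<bar>v s\<bar>))\<^sup>2 \<partial>lborel)
        = (\<integral>\<^sup>+s. indicator {..R} t * ennreal (kern a (t - s) * (v s)\<^sup>2) \<partial>lborel)"
      using True kern_nonneg[OF a]
      by (intro nn_integral_cong) (simp add: ennreal_power power_mult_distrib)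
    also have "(\<integral>\<^sup>+s. (ennreal (sqrt (kern a (t - s)) * indicator {0<..} s))\<^sup>2 \<partial>lborel)
        \<le> (\<integral>\<^sup>+s. ennreal (kern a (t - s)) * indicator {..R} (t - s) \<partial>lborel)"
      using True kern_nonneg[OF a]
      by (intro nn_integral_mono) (auto simp: ennreal_power power_mult_distrib indicator_def)
    also have "\<dots> = (\<integral>\<^sup>+x. ennreal (kern a x) * indicator {..R} x \<partial>lborel)"
      by (rule nn_integral_reflect_shift) simp
    also have "\<dots> = ennreal K" using kern_integral[OF a R] by (simp add: K_def)
    finally show ?thesis using True by (simp add: mult_right_mono)
  qed simp
  have "(\<integral>\<^sup>+t. indicator {..R} t * (\<integral>\<^sup>+s. ennreal (kern a (t - s) * \<bar>v s\<bar>) \<partial>lborel)\<^sup>2 \<partial>lborel)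
     \<le> (\<integral>\<^sup>+t. ennreal K * (\<integral>\<^sup>+s. indicator {..R} t * ennreal (kern a (t - s) * (v s)\<^sup>2) \<partial>lborel) \<partial>lborel)"
    by (rule nn_integral_mono) (rule CS)
  also have "\<dots> = ennreal K * (\<integral>\<^sup>+t. (\<integral>\<^sup>+s. indicator {..R} t * ennreal (kern a (t - s) * (v s)\<^sup>2) \<partial>lborel) \<partial>lborel)"
    by (rule nn_integral_cmult) simp
  also have "(\<integral>\<^sup>+t. (\<integral>\<^sup>+s. indicator {..R} t * ennreal (kern a (t - s) * (v s)\<^sup>2) \<partial>lborel) \<partial>lborel)
      = (\<integral>\<^sup>+s. (\<integral>\<^sup>+t. indicator {..R} t * ennreal (kern a (t - s) * (v s)\<^sup>2) \<partial>lborel) \<partial>lborel)"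
    by (rule lborel_pair.Fubini') simp
  also have "\<dots> \<le> (\<integral>\<^sup>+s. ennreal K * ennreal ((indicator {..R} s * v s)\<^sup>2) \<partial>lborel)"
  proof (rule nn_integral_mono)
    fix s :: real
    show "(\<integral>\<^sup>+t. indicator {..R} t * ennreal (kern a (t - s) * (v s)\<^sup>2) \<partial>lborel)
        \<le> ennreal K * ennreal ((indicator {..R} s * v s)\<^sup>2)"
    proof (cases "0 < s \<and> s \<le> R")
      case True
      have "(\<integral>\<^sup>+t. indicator {..R} t * ennreal (kern a (t - s) * (v s)\<^sup>2) \<partial>lborel)
          \<le> (\<integral>\<^sup>+t. ennreal ((v s)\<^sup>2) * (ennreal (kern a (t + -s)) * indicator {..R} (t + -s)) \<partial>lborel)"
        using True kern_nonneg[OF a]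
        by (intro nn_integral_mono) (auto simp: indicator_def ennreal_mult' mult.commute)
      also have "\<dots> = ennreal ((v s)\<^sup>2) * (\<integral>\<^sup>+t. (ennreal (kern a (t + -s)) * indicator {..R} (t + -s)) \<partial>lborel)"
        by (rule nn_integral_cmult) simp
      also have "(\<integral>\<^sup>+t. (ennreal (kern a (t + -s)) * indicator {..R} (t + -s)) \<partial>lborel)
          = (\<integral>\<^sup>+x. ennreal (kern a x) * indicator {..R} x \<partial>lborel)"
        by (rule nn_integral_shift) simp
      also have "\<dots> = ennreal K" using kern_integral[OF a R] by (simp add: K_def)
      finally show ?thesis using True by (simp add: mult.commute)
    next
      case False
      then have *: "indicator {..R} t * ennreal (kern a (t - s) * (v s)\<^sup>2) = 0" for t
        using v0[of s] by (cases "t \<le> R") auto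
      show ?thesis unfolding * by simp
    qed
  qed
  also have "\<dots> = ennreal K * sqn lborel (\<lambda>t. indicator {..R} t * v t)"
    unfolding sqn_def by (rule nn_integral_cmult) simp
  finally show ?thesis
    using K by (simp add: K_def[symmetric] mult_left_mono mult.assoc[symmetric] power2_eq_square ennreal_mult)
qed

lemma rl_integrable_AE:
  assumes a: "a > 0" and v: "L2loc v"
  shows "AE t in lborel. integrable lborel (\<lambda>s. kern a (t - s) * v s)"
proof -
  have [measurable]: "v \<in> borel_measurable borel" using v by (rule L2loc_measurable)
  have "AE t in lborel. indicator {..real n} t * (\<integral>\<^sup>+s. ennreal (kern a (t - s) * \<bar>v s\<bar>) \<partial>lborel)\<^sup>2 \<noteq> \<infinity>" for n
  proof (rule nn_integral_PInf_AE)
    have "(\<integral>\<^sup>+t. indicator {..real n} t * (\<integral>\<^sup>+s. ennreal (kern a (t - s) * \<bar>v s\<bar>) \<partial>lborel)\<^sup>2 \<partial>lborel)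
       \<le> ennreal ((real n powr a / Gamma (a + 1))\<^sup>2) * sqn lborel (\<lambda>t. indicator {..real n} t * v t)"
      by (rule rl_schur) (use a v in \<open>auto simp: L2loc_def\<close>)
    also have "\<dots> < \<infinity>" using L2locD(2)[OF v, of "real n"] by (simp add: ennreal_mult_less_top)
    finally show "(\<integral>\<^sup>+t. indicator {..real n} t * (\<integral>\<^sup>+s. ennreal (kern a (t - s) * \<bar>v s\<bar>) \<partial>lborel)\<^sup>2 \<partial>lborel) \<noteq> \<infinity>"
      by simp
  qed measurable
  then have "AE t in lborel. \<forall>n. indicator {..real n} t * (\<integral>\<^sup>+s. ennreal (kern a (t - s) * \<bar>v s\<bar>) \<partial>lborel)\<^sup>2 \<noteq> \<infinity>"
    by (simp add: AE_all_countable)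
  then show ?thesis
  proof eventually_elim
    case (elim t)
    obtain n where "t \<le> real n" using real_arch_simple by blast
    with elim[rule_format, of n] have "(\<integral>\<^sup>+s. ennreal (kern a (t - s) * \<bar>v s\<bar>) \<partial>lborel) \<noteq> \<infinity>"
      by (auto simp: power2_eq_square ennreal_mult_eq_top_iff)
    then have "(\<integral>\<^sup>+s. ennreal (norm (kern a (t - s) * v s)) \<partial>lborel) < \<infinity>"
      using kern_nonneg[OF a] by (simp add: abs_mult less_top)
    then show ?case by (intro integrableI_bounded) auto
  qed
qed

lemma rl_causal: "(\<And>t. t \<le> 0 \<Longrightarrow> v t = 0) \<Longrightarrow> t \<le> 0 \<Longrightarrow> rl a v t = 0"
proof -
  assume v: "\<And>t. t \<le> 0 \<Longrightarrow> v t = 0" and t: "t \<le> 0"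
  have *: "kern a (t - s) * v s = 0" for s
    using v[of s] t by (cases "s \<le> 0") auto
  show ?thesis unfolding rl_def * by simp
qed

lemma rl_cong_before: "(\<And>s. s < t \<Longrightarrow> v s = w s) \<Longrightarrow> rl a v t = rl a w t"
  unfolding rl_def by (intro Bochner_Integration.integral_cong refl) (auto simp: kern_def)

lemma rl_cong_AE:
  assumes [measurable]: "v \<in> borel_measurable borel" "w \<in> borel_measurable borel"
    and "AE s in lborel. v s = w s"
  shows "rl a v t = rl a w t"
  unfolding rl_def by (intro integral_cong_AE) (use assms(3) in \<open>auto elim!: eventually_mono\<close>)

lemma rl_cmult: "rl a (\<lambda>s. c * v s) t = c * rl a v t"
proof -
  have "(\<lambda>s. kern a (t - s) * (c * v s)) = (\<lambda>s. c * (kern a (t - s) * v s))" by auto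
  then show ?thesis unfolding rl_def by (metis integral_mult_right_zero)
qed

lemma rl_add_AE:
  assumes "a > 0" "L2loc v" "L2loc w"
  shows "AE t in lborel. rl a (\<lambda>s. v s + w s) t = rl a v t + rl a w t"
  using rl_integrable_AE[OF assms(1,2)] rl_integrable_AE[OF assms(1,3)]
  by eventually_elim (simp add: rl_def distrib_left)

lemma rl_diff_AE:
  assumes "a > 0" "L2loc v" "L2loc w"
  shows "AE t in lborel. rl a (\<lambda>s. v s - w s) t = rl a v t - rl a w t"
  using rl_integrable_AE[OF assms(1,2)] rl_integrable_AE[OF assms(1,3)]
  by eventually_elim (simp add: rl_def right_diff_distrib)

lemma rl_abs_le:
  assumes a: "a > 0"
  shows "ennreal \<bar>rl a v t\<bar> \<le> (\<integral>\<^sup>+s. ennreal (kern a (t - s) * \<bar>v s\<bar>) \<partial>lborel)"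
proof (cases "integrable lborel (\<lambda>s. kern a (t - s) * v s)")
  case True
  from integral_norm_bound_ennreal[OF this] show ?thesis
    using kern_nonneg[OF a] by (simp add: rl_def abs_mult)
next
  case False
  then show ?thesis by (simp add: rl_def not_integrable_integral_eq)
qed

lemma rl_sqn_le:
  assumes a: "a > 0" and R: "R \<ge> 0" and v: "v \<in> borel_measurable borel"
    and v0: "\<And>t. t \<le> 0 \<Longrightarrow> v t = 0"
  shows "sqn lborel (\<lambda>t. indicator {..R} t * rl a v t)
     \<le> ennreal ((R powr a / Gamma (a + 1))\<^sup>2) * sqn lborel (\<lambda>t. indicator {..R} t * v t)"
proof -
  have "sqn lborel (\<lambda>t. indicator {..R} t * rl a v t)
    \<le> (\<integral>\<^sup>+t. indicator {..R} t * (\<integral>\<^sup>+s. ennreal (kern a (t - s) * \<bar>v s\<bar>) \<partial>lborel)\<^sup>2 \<partial>lborel)"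
    unfolding sqn_def
  proof (rule nn_integral_mono)
    fix t :: real
    have "ennreal ((rl a v t)\<^sup>2) = (ennreal \<bar>rl a v t\<bar>)\<^sup>2" by (simp add: ennreal_power)
    also have "\<dots> \<le> (\<integral>\<^sup>+s. ennreal (kern a (t - s) * \<bar>v s\<bar>) \<partial>lborel)\<^sup>2"
      by (rule power_mono[OF rl_abs_le[OF a]]) simp
    finally show "ennreal ((indicator {..R} t * rl a v t)\<^sup>2)
        \<le> indicator {..R} t * (\<integral>\<^sup>+s. ennreal (kern a (t - s) * \<bar>v s\<bar>) \<partial>lborel)\<^sup>2"
      by (auto simp: indicator_def)
  qed
  also note rl_schur[OF assms]
  finally show ?thesis .
qed

lemma L2loc_rl:
  assumes a: "a > 0" and v: "L2loc v"
  shows "L2loc (rl a v)"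
  unfolding L2loc_def
proof (intro conjI allI impI)
  have [measurable]: "v \<in> borel_measurable borel" using v by (rule L2loc_measurable)
  show "rl a v \<in> borel_measurable borel" by simp
  show "rl a v t = 0" if "t \<le> 0" for t by (rule rl_causal) (use v that in \<open>auto simp: L2loc_def\<close>)
  show "sqn lborel (\<lambda>t. indicator {..R} t * rl a v t) < \<infinity>" for R
  proof -
    have "sqn lborel (\<lambda>t. indicator {..R} t * rl a v t) \<le> sqn lborel (\<lambda>t. indicator {..\<bar>R\<bar>} t * rl a v t)"
      by (rule sqn_mono) (auto simp: indicator_def)
    also have "\<dots> \<le> ennreal ((\<bar>R\<bar> powr a / Gamma (a + 1))\<^sup>2) * sqn lborel (\<lambda>t. indicator {..\<bar>R\<bar>} t * v t)"
      by (rule rl_sqn_le) (use a v in \<open>auto simp: L2loc_def\<close>)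
    also have "\<dots> < \<infinity>" using L2locD(2)[OF v, of "\<bar>R\<bar>"] by (simp add: ennreal_mult_less_top)
    finally show ?thesis .
  qed
qed

text \<open>
  Fubini's theorem reduces the composition to the convolution of the two kernels. Absolute
  integrability holds only for almost every \<open>t\<close>, and it comes from the Schur test.
\<close>

lemma rl_semigroup_AE:
  assumes a: "a > 0" and b: "b > 0" and v: "L2loc v"
  shows "AE t in lborel. rl a (rl b v) t = rl (a + b) v t"
proof -
  have [measurable]: "v \<in> borel_measurable borel" using v by (rule L2loc_measurable)
  have "a + b > 0" using a b by simp
  from rl_integrable_AE[OF this v] show ?thesis
  proof eventually_elim
    case (elim t)
    let ?g = "\<lambda>s r. kern a (t - r) * kern b (r - s) * v s"
    have conv: "(\<integral>\<^sup>+r. ennreal (norm (?g s r)) \<partial>lborel) = ennreal (norm (kern (a + b) (t - s) * v s))" for s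
    proof -
      have "(\<integral>\<^sup>+r. ennreal (norm (?g s r)) \<partial>lborel)
          = (\<integral>\<^sup>+r. ennreal (kern a (t - r) * kern b (r - s)) * ennreal \<bar>v s\<bar> \<partial>lborel)"
        using kern_nonneg[OF a] kern_nonneg[OF b]
        by (intro nn_integral_cong) (simp add: abs_mult ennreal_mult')
      also have "\<dots> = ennreal (kern (a + b) (t - s)) * ennreal \<bar>v s\<bar>"
        by (simp add: nn_integral_multc kern_convolution[OF a b])
      finally show ?thesis using kern_nonneg[of "a + b"] a b
        by (simp add: abs_mult ennreal_mult')
    qed
    have int: "integrable (lborel \<Otimes>\<^sub>M lborel) (\<lambda>(s, r). ?g s r)"
    proof (rule integrableI_bounded)
      have "(\<integral>\<^sup>+x. ennreal (norm (case x of (s, r) \<Rightarrow> ?g s r)) \<partial>(lborel \<Otimes>\<^sub>M lborel))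
          = (\<integral>\<^sup>+s. (\<integral>\<^sup>+r. ennreal (norm (?g s r)) \<partial>lborel) \<partial>lborel)"
        by (subst lborel.nn_integral_fst[symmetric]) (simp_all add: split_beta')
      also have "\<dots> < \<infinity>" using elim unfolding conv integrable_iff_bounded by simp
      finally show "(\<integral>\<^sup>+x. ennreal (norm (case x of (s, r) \<Rightarrow> ?g s r)) \<partial>(lborel \<Otimes>\<^sub>M lborel)) < \<infinity>" .
    qed measurable
    have inner: "(LINT r|lborel. ?g s r) = kern (a + b) (t - s) * v s" for s
    proof -
      have "(LINT r|lborel. kern a (t - r) * kern b (r - s)) = kern (a + b) (t - s)"
        by (rule integral_eq_nn_integral[THEN trans])
           (use kern_nonneg[OF a] kern_nonneg[OF b] kern_nonneg[of "a + b"] a b in \<open>auto simp: kern_convolution[OF a b]\<close>)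
      then show ?thesis by simp
    qed
    have "rl a (rl b v) t = (LINT r|lborel. LINT s|lborel. ?g s r)"
      unfolding rl_def by (simp add: mult.assoc)
    also have "\<dots> = (LINT s|lborel. LINT r|lborel. ?g s r)"
      by (rule lborel_pair.Fubini_integral[OF int])
    also have "\<dots> = rl (a + b) v t" unfolding inner rl_def ..
    finally show ?case .
  qed
qed

section \<open>The Gagliardo seminorm\<close>

text \<open>
  The quotient is kept as a function on the plane: the Gagliardo seminorm becomes an $L^2$
  norm over \<open>lborel \<Otimes>\<^sub>M lborel\<close>, and the estimates for squared norms apply to it.
\<close>

definition gag :: "real \<Rightarrow> (real \<Rightarrow> real) \<Rightarrow> real \<times> real \<Rightarrow> real" where
  "gag \<sigma> u = (\<lambda>(t, s). (u t - u s) / \<bar>t - s\<bar> powr (\<sigma> + 1/2))"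

definition gag_sq :: "real \<Rightarrow> (real \<Rightarrow> real) \<Rightarrow> ennreal" where
  "gag_sq \<sigma> u = sqn (lborel \<Otimes>\<^sub>M lborel) (gag \<sigma> u)"

lemma gag_measurable [measurable]:
  assumes [measurable]: "u \<in> borel_measurable borel"
  shows "gag \<sigma> u \<in> borel_measurable (lborel \<Otimes>\<^sub>M lborel)"
  unfolding gag_def by measurable

lemma gag_power2: "(gag \<sigma> u (t, s))\<^sup>2 = (u t - u s)\<^sup>2 / \<bar>t - s\<bar> powr (1 + 2 * \<sigma>)"
proof -
  have "(\<bar>t - s\<bar> powr (\<sigma> + 1/2))\<^sup>2 = \<bar>t - s\<bar> powr (1 + 2 * \<sigma>)"
    by (simp add: power2_eq_square powr_add[symmetric] add.commute)
  then show ?thesis by (simp add: gag_def power_divide)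
qed

lemma gag_sq_iterated:
  assumes [measurable]: "u \<in> borel_measurable borel"
  shows "gag_sq \<sigma> u = (\<integral>\<^sup>+t. \<integral>\<^sup>+s. ennreal ((u t - u s)\<^sup>2 / \<bar>t - s\<bar> powr (1 + 2 * \<sigma>)) \<partial>lborel \<partial>lborel)"
  unfolding gag_sq_def sqn_def gag_power2[symmetric]
  by (rule lborel.nn_integral_fst[symmetric]) measurable

lemma AE_lborel_pair:
  assumes "AE t in lborel. P t"
  shows "AE x in lborel \<Otimes>\<^sub>M lborel. P (fst x :: real) \<and> P (snd x :: real)"
proof -
  obtain N where N: "{x \<in> space lborel. \<not> P x} \<subseteq> N" "emeasure lborel N = 0" "N \<in> sets lborel"
    using assms by (rule AE_E)
  have null: "N \<times> UNIV \<union> UNIV \<times> N \<in> null_sets (lborel \<Otimes>\<^sub>M lborel :: (real \<times> real) measure)"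
  proof (rule null_sets.Un)
    show "N \<times> UNIV \<in> null_sets (lborel \<Otimes>\<^sub>M lborel :: (real \<times> real) measure)"
      using N by (auto simp: null_sets_def lborel.emeasure_pair_measure_Times intro!: pair_measureI)
    show "UNIV \<times> N \<in> null_sets (lborel \<Otimes>\<^sub>M lborel :: (real \<times> real) measure)"
      using N by (auto simp: null_sets_def lborel.emeasure_pair_measure_Times intro!: pair_measureI)
  qed
  show ?thesis
    by (rule AE_I'[OF null]) (use N(1) in auto)
qed

lemma gag_AE_cong:
  assumes "AE t in lborel. u t = w t"
  shows "AE x in lborel \<Otimes>\<^sub>M lborel. gag \<sigma> u x = gag \<sigma> w x"
  using AE_lborel_pair[OF assms] by eventually_elim (auto simp: gag_def)

lemma gag_sq_cong_AE:
  assumes "AE t in lborel. u t = w t"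
  shows "gag_sq \<sigma> u = gag_sq \<sigma> w"
  unfolding gag_sq_def by (rule sqn_cong_AE[OF gag_AE_cong[OF assms]])

lemma gag_sq_cmult:
  assumes [measurable]: "u \<in> borel_measurable borel"
  shows "gag_sq \<sigma> (\<lambda>t. c * u t) = ennreal (c\<^sup>2) * gag_sq \<sigma> u"
proof -
  have *: "gag \<sigma> (\<lambda>t. c * u t) = (\<lambda>x. c * gag \<sigma> u x)"
    by (auto simp: gag_def right_diff_distrib diff_divide_distrib)
  show ?thesis unfolding gag_sq_def * by (rule sqn_cmult) simp
qed

text \<open>
  With \<open>s = t + h\<close> the seminorm is a weighted integral over the step size \<open>h\<close>, and the step
  sizes \<open>h\<close> and \<open>- h\<close> contribute equally.
\<close>

lemma gag_sq_by_differences: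
  assumes [measurable]: "u \<in> borel_measurable borel"
  shows "gag_sq \<sigma> u = 2 * (\<integral>\<^sup>+h. ennreal (h powr - (1 + 2 * \<sigma>)) * sqn lborel (\<lambda>t. u (t + h) - u t) * indicator {0<..} h \<partial>lborel)"
proof -
  define F where "F h = ennreal (\<bar>h\<bar> powr - (1 + 2 * \<sigma>)) * sqn lborel (\<lambda>t. u (t + h) - u t)" for h
  have [measurable]: "F \<in> borel_measurable borel" unfolding F_def sqn_def by measurable
  have F_minus: "F (- h) = F h" for h
  proof -
    have "sqn lborel (\<lambda>t. u (t + - h) - u t) = (\<integral>\<^sup>+t. ennreal ((u (t + h + - h) - u (t + h))\<^sup>2) \<partial>lborel)"
      unfolding sqn_def by (rule nn_integral_shift[symmetric]) simp
    also have "\<dots> = sqn lborel (\<lambda>t. u (t + h) - u t)"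
      unfolding sqn_def by (simp add: power2_commute)
    finally show ?thesis by (simp add: F_def)
  qed
  have "gag_sq \<sigma> u = (\<integral>\<^sup>+t. \<integral>\<^sup>+s. ennreal ((u t - u s)\<^sup>2 / \<bar>t - s\<bar> powr (1 + 2 * \<sigma>)) \<partial>lborel \<partial>lborel)"
    by (rule gag_sq_iterated) simp
  also have "\<dots> = (\<integral>\<^sup>+t. \<integral>\<^sup>+h. ennreal ((u t - u (h + t))\<^sup>2 / \<bar>t - (h + t)\<bar> powr (1 + 2 * \<sigma>)) \<partial>lborel \<partial>lborel)"
    by (rule nn_integral_cong, rule nn_integral_shift[symmetric]) simp
  also have "\<dots> = (\<integral>\<^sup>+h. \<integral>\<^sup>+t. ennreal ((u t - u (h + t))\<^sup>2 / \<bar>t - (h + t)\<bar> powr (1 + 2 * \<sigma>)) \<partial>lborel \<partial>lborel)"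
    by (rule lborel_pair.Fubini') simp
  also have "\<dots> = (\<integral>\<^sup>+h. F h \<partial>lborel)"
  proof (rule nn_integral_cong)
    fix h
    have *: "\<bar>h\<bar> powr - (1 + 2 * \<sigma>) = inverse (\<bar>h\<bar> powr (1 + 2 * \<sigma>))" by (rule powr_minus)
    have "(\<integral>\<^sup>+t. ennreal ((u t - u (h + t))\<^sup>2 / \<bar>t - (h + t)\<bar> powr (1 + 2 * \<sigma>)) \<partial>lborel)
        = (\<integral>\<^sup>+t. ennreal (\<bar>h\<bar> powr - (1 + 2 * \<sigma>)) * ennreal ((u (t + h) - u t)\<^sup>2) \<partial>lborel)"
      unfolding *
    proof (rule nn_integral_cong)
      fix t
      have "ennreal (inverse (\<bar>h\<bar> powr (1 + 2 * \<sigma>))) * ennreal ((u (t + h) - u t)\<^sup>2)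
        = ennreal (inverse (\<bar>h\<bar> powr (1 + 2 * \<sigma>)) * (u (t + h) - u t)\<^sup>2)"
        by (rule ennreal_mult[symmetric]) auto
      also have "inverse (\<bar>h\<bar> powr (1 + 2 * \<sigma>)) * (u (t + h) - u t)\<^sup>2 = (u t - u (h + t))\<^sup>2 / \<bar>t - (h + t)\<bar> powr (1 + 2 * \<sigma>)"
      proof -
        have a: "\<bar>t - (t + h)\<bar> = \<bar>h\<bar>" by simp
        show ?thesis unfolding add.commute[of h t] power2_commute[of "u t" "u (t + h)"] a divide_inverse
          by (rule mult.commute)
      qed
      finally show "ennreal ((u t - u (h + t))\<^sup>2 / \<bar>t - (h + t)\<bar> powr (1 + 2 * \<sigma>))
        = ennreal (inverse (\<bar>h\<bar> powr (1 + 2 * \<sigma>))) * ennreal ((u (t + h) - u t)\<^sup>2)" by (rule sym)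
    qed
    also have "\<dots> = F h" unfolding F_def sqn_def by (rule nn_integral_cmult) simp
    finally show "(\<integral>\<^sup>+t. ennreal ((u t - u (h + t))\<^sup>2 / \<bar>t - (h + t)\<bar> powr (1 + 2 * \<sigma>)) \<partial>lborel) = F h" .
  qed
  also have "\<dots> = (\<integral>\<^sup>+h. F h * indicator {0<..} h + F h * indicator {..0} h \<partial>lborel)"
    by (intro nn_integral_cong) (auto simp: indicator_def)
  also have "\<dots> = (\<integral>\<^sup>+h. F h * indicator {0<..} h \<partial>lborel) + (\<integral>\<^sup>+h. F h * indicator {..0} h \<partial>lborel)"
    by (rule nn_integral_add) simp_all
  also have "(\<integral>\<^sup>+h. F h * indicator {..0} h \<partial>lborel) = (\<integral>\<^sup>+h. F (0 - h) * indicator {..0} (0 - h) \<partial>lborel)"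
    by (rule nn_integral_reflect_shift[symmetric]) simp
  also have "\<dots> = (\<integral>\<^sup>+h. F h * indicator {0<..} h \<partial>lborel)"
  proof (rule nn_integral_cong_AE)
    show "AE h in lborel. F (0 - h) * indicator {..0} (0 - h) = F h * indicator {0<..} h"
      using AE_lborel_singleton[of 0]
      by eventually_elim (auto simp: F_minus indicator_def)
  qed
  also have "(\<integral>\<^sup>+h. F h * indicator {0<..} h \<partial>lborel) = (\<integral>\<^sup>+h. ennreal (h powr - (1 + 2 * \<sigma>)) * sqn lborel (\<lambda>t. u (t + h) - u t) * indicator {0<..} h \<partial>lborel)"
    by (intro nn_integral_cong) (auto simp: F_def indicator_def)
  finally show ?thesis by (simp only: mult_2)
qed

lemma gag_sq_shift:
  assumes [measurable]: "u \<in> borel_measurable borel"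
  shows "gag_sq \<sigma> (\<lambda>t. u (t + a)) = gag_sq \<sigma> u"
proof -
  have *: "sqn lborel (\<lambda>t. u (t + h + a) - u (t + a)) = sqn lborel (\<lambda>t. u (t + h) - u t)" for h
  proof -
    have "sqn lborel (\<lambda>t. u (t + h + a) - u (t + a)) = (\<integral>\<^sup>+t. ennreal ((u (t + a + h) - u (t + a))\<^sup>2) \<partial>lborel)"
      unfolding sqn_def by (simp add: add_ac)
    also have "\<dots> = sqn lborel (\<lambda>t. u (t + h) - u t)"
      unfolding sqn_def by (rule nn_integral_shift) simp
    finally show ?thesis .
  qed
  have m: "(\<lambda>t. u (t + a)) \<in> borel_measurable borel" by measurable
  show ?thesis unfolding gag_sq_by_differences[OF assms] gag_sq_by_differences[OF m] * ..
qed

lemma gag_sq_scale: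
  assumes [measurable]: "u \<in> borel_measurable borel" and c: "c > 0"
  shows "gag_sq \<sigma> (\<lambda>t. u (c * t)) = ennreal (c powr (2 * \<sigma> - 1)) * gag_sq \<sigma> u"
proof -
  let ?G = "\<lambda>t s. (u t - u s)\<^sup>2 / \<bar>t - s\<bar> powr (1 + 2 * \<sigma>)"
  have eq: "?G (c * t) (c * s) = c powr - (1 + 2 * \<sigma>) * ((u (c * t) - u (c * s))\<^sup>2 / \<bar>t - s\<bar> powr (1 + 2 * \<sigma>))" for t s
  proof -
    have "\<bar>c * t - c * s\<bar> = c * \<bar>t - s\<bar>" using c by (simp add: abs_mult flip: right_diff_distrib)
    moreover have "c powr - (1 + 2 * \<sigma>) = inverse (c powr (1 + 2 * \<sigma>))" by (rule powr_minus)
    ultimately show ?thesis using c by (simp only: powr_mult) (simp add: inverse_eq_divide)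
  qed
  have "gag_sq \<sigma> u = (\<integral>\<^sup>+t. \<integral>\<^sup>+s. ennreal (?G t s) \<partial>lborel \<partial>lborel)"
    by (rule gag_sq_iterated) simp
  also have "\<dots> = (\<integral>\<^sup>+t. ennreal c * (\<integral>\<^sup>+s. ennreal (?G t (c * s)) \<partial>lborel) \<partial>lborel)"
    using c by (intro nn_integral_cong) (subst nn_integral_real_affine[where c=c and t=0], auto)
  also have "\<dots> = ennreal c * (\<integral>\<^sup>+t. (\<integral>\<^sup>+s. ennreal (?G t (c * s)) \<partial>lborel) \<partial>lborel)"
    by (rule nn_integral_cmult) simp
  also have "(\<integral>\<^sup>+t. (\<integral>\<^sup>+s. ennreal (?G t (c * s)) \<partial>lborel) \<partial>lborel) = ennreal c * (\<integral>\<^sup>+t. (\<integral>\<^sup>+s. ennreal (?G (c * t) (c * s)) \<partial>lborel) \<partial>lborel)"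
    using c by (subst nn_integral_real_affine[where c=c and t=0]) auto
  also have "(\<integral>\<^sup>+t. (\<integral>\<^sup>+s. ennreal (?G (c * t) (c * s)) \<partial>lborel) \<partial>lborel)
     = (\<integral>\<^sup>+t. ennreal (c powr - (1 + 2 * \<sigma>)) * (\<integral>\<^sup>+s. ennreal ((u (c * t) - u (c * s))\<^sup>2 / \<bar>t - s\<bar> powr (1 + 2 * \<sigma>)) \<partial>lborel) \<partial>lborel)"
    unfolding eq by (intro nn_integral_cong) (simp add: ennreal_mult' nn_integral_cmult del: times_divide_eq_right)
  also have "\<dots> = ennreal (c powr - (1 + 2 * \<sigma>)) * gag_sq \<sigma> (\<lambda>t. u (c * t))"
    by (simp add: gag_sq_iterated nn_integral_cmult)
  finally have "gag_sq \<sigma> u = ennreal c * (ennreal c * (ennreal (c powr - (1 + 2 * \<sigma>)) * gag_sq \<sigma> (\<lambda>t. u (c * t))))" .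
  then have "ennreal (c powr (2 * \<sigma> - 1)) * gag_sq \<sigma> u
     = (ennreal (c powr (2 * \<sigma> - 1)) * ennreal c * ennreal c * ennreal (c powr - (1 + 2 * \<sigma>))) * gag_sq \<sigma> (\<lambda>t. u (c * t))"
    by (simp only: mult.assoc)
  also have "ennreal (c powr (2 * \<sigma> - 1)) * ennreal c * ennreal c * ennreal (c powr - (1 + 2 * \<sigma>))
      = ennreal (c powr (2 * \<sigma> - 1) * c powr 1 * c powr 1 * c powr - (1 + 2 * \<sigma>))"
    using c by (simp flip: ennreal_mult)
  also have "c powr (2 * \<sigma> - 1) * c powr 1 * c powr 1 * c powr - (1 + 2 * \<sigma>) = 1"
    unfolding powr_add[symmetric] using c by simp
  finally show ?thesis by simp
qed

section \<open>The truncated powers and their increments\<close>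

definition ppow :: "real \<Rightarrow> real \<Rightarrow> real" where
  "ppow \<sigma> t = (if t > 0 then t powr \<sigma> else 0)"

text \<open>
  Up to the factor $\Gamma(\sigma+1)$ this is $J^\sigma 1_{(0,1]}$.
\<close>

definition ppow_diff :: "real \<Rightarrow> real \<Rightarrow> real" where
  "ppow_diff \<sigma> t = ppow \<sigma> t - ppow \<sigma> (t - 1)"

lemma ppow_measurable [measurable]: "ppow \<sigma> \<in> borel_measurable borel"
  unfolding ppow_def by measurable

lemma ppow_diff_measurable [measurable]: "ppow_diff \<sigma> \<in> borel_measurable borel"
  unfolding ppow_diff_def by measurable

lemma ppow_scale: "c > 0 \<Longrightarrow> ppow \<sigma> (c * t) = c powr \<sigma> * ppow \<sigma> t"
  by (simp add: ppow_def powr_mult zero_less_mult_iff)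

lemma ppow_diff_bound:
  assumes s: "0 < \<sigma>" "\<sigma> < 1" and t: "t > 0"
  shows "(ppow_diff \<sigma> t)\<^sup>2 \<le> t powr (\<sigma> - 1)"
proof (cases "t \<le> 1")
  case True
  then have "(ppow_diff \<sigma> t)\<^sup>2 = t powr (2 * \<sigma>)"
    using t by (simp add: ppow_diff_def ppow_def power2_eq_square powr_add[symmetric])
  also have "\<dots> \<le> t powr (\<sigma> - 1)" using t True s by (intro powr_mono') auto
  finally show ?thesis .
next
  case False
  have "(t - 1) powr \<sigma> = t powr \<sigma> * (1 - 1 / t) powr \<sigma>"
    using False by (simp add: powr_mult[symmetric] algebra_simps)
  moreover have "(1 - 1 / t) powr \<sigma> \<ge> (1 - 1 / t) powr 1"
    using False s by (intro powr_mono') auto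
  ultimately have "(t - 1) powr \<sigma> \<ge> t powr \<sigma> * (1 - 1 / t)"
    using False by (auto intro!: mult_left_mono)
  also have "t powr \<sigma> * (1 - 1 / t) = t powr \<sigma> - t powr (\<sigma> - 1)"
    using False by (simp add: powr_diff algebra_simps)
  finally have up: "ppow_diff \<sigma> t \<le> t powr (\<sigma> - 1)"
    using False by (simp add: ppow_diff_def ppow_def)
  have lo: "0 \<le> ppow_diff \<sigma> t"
    using False s by (simp add: ppow_diff_def ppow_def powr_mono2)
  have "(ppow_diff \<sigma> t)\<^sup>2 \<le> t powr (\<sigma> - 1) * t powr (\<sigma> - 1)"
    unfolding power2_eq_square by (rule mult_mono[OF up up]) (use lo in auto)
  also have "\<dots> \<le> t powr (\<sigma> - 1) * 1"
    using False s powr_mono[of "\<sigma> - 1" 0 t] by (intro mult_left_mono) auto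
  finally show ?thesis by simp
qed

text \<open>
  The increment is a second difference of $t^\sigma$, so the mean value theorem applies twice
  and produces the second derivative, of size $t^{\sigma-2}$. The point \<open>t \<ge> 2\<close> keeps \<open>t - 1\<close>
  above \<open>t / 2\<close>.
\<close>

lemma ppow_second_diff_bound:
  assumes s: "0 < \<sigma>" "\<sigma> < 1" and h: "h > 0" and t: "t \<ge> 2"
  shows "(ppow_diff \<sigma> (t + h) - ppow_diff \<sigma> t)\<^sup>2 \<le> h\<^sup>2 * (t / 2) powr (2 * \<sigma> - 4)"
proof -
  have d: "((\<lambda>x. x powr \<sigma> - (x - 1) powr \<sigma>) has_real_derivative \<sigma> * x powr (\<sigma> - 1) - \<sigma> * (x - 1) powr (\<sigma> - 1)) (at x)"
    if "x > 1" for x using that by (auto intro!: derivative_eq_intros)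
  obtain x where x: "t < x" "x < t + h"
    and 1: "((t + h) powr \<sigma> - (t + h - 1) powr \<sigma>) - (t powr \<sigma> - (t - 1) powr \<sigma>)
       = (t + h - t) * (\<sigma> * x powr (\<sigma> - 1) - \<sigma> * (x - 1) powr (\<sigma> - 1))"
    using MVT2[of t "t + h" "\<lambda>x. x powr \<sigma> - (x - 1) powr \<sigma>"
        "\<lambda>x. \<sigma> * x powr (\<sigma> - 1) - \<sigma> * (x - 1) powr (\<sigma> - 1)"] d h t by auto
  have d2: "((\<lambda>x. \<sigma> * x powr (\<sigma> - 1)) has_real_derivative \<sigma> * ((\<sigma> - 1) * y powr (\<sigma> - 2))) (at y)" if "y > 0" for y
    using that by (auto intro!: derivative_eq_intros)
  obtain y where y: "x - 1 < y" "y < x"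
    and 2: "\<sigma> * x powr (\<sigma> - 1) - \<sigma> * (x - 1) powr (\<sigma> - 1) = (x - (x - 1)) * (\<sigma> * ((\<sigma> - 1) * y powr (\<sigma> - 2)))"
    using MVT2[of "x - 1" x "\<lambda>x. \<sigma> * x powr (\<sigma> - 1)" "\<lambda>y. \<sigma> * ((\<sigma> - 1) * y powr (\<sigma> - 2))"] d2 x t by auto
  have eq: "ppow_diff \<sigma> (t + h) - ppow_diff \<sigma> t = h * (\<sigma> * ((\<sigma> - 1) * y powr (\<sigma> - 2)))"
    using 1 2 t h by (simp add: ppow_diff_def ppow_def)
  have "y powr (\<sigma> - 2) \<le> (t / 2) powr (\<sigma> - 2)"
    using s t x y by (intro powr_mono2') auto
  moreover have "\<bar>\<sigma> * (\<sigma> - 1)\<bar> \<le> 1 * 1"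
    unfolding abs_mult using s by (intro mult_mono) auto
  ultimately have "\<bar>\<sigma> * (\<sigma> - 1)\<bar> * y powr (\<sigma> - 2) \<le> 1 * (t / 2) powr (\<sigma> - 2)"
    by (intro mult_mono) auto
  then have "\<bar>ppow_diff \<sigma> (t + h) - ppow_diff \<sigma> t\<bar> \<le> h * (t / 2) powr (\<sigma> - 2)"
    unfolding eq using h by (simp add: abs_mult mult.assoc mult_left_mono)
  then have "\<bar>ppow_diff \<sigma> (t + h) - ppow_diff \<sigma> t\<bar>\<^sup>2 \<le> (h * (t / 2) powr (\<sigma> - 2))\<^sup>2"
    by (rule power_mono) simp
  also have "\<dots> = h\<^sup>2 * (t / 2) powr (2 * \<sigma> - 4)"
    by (simp add: power_mult_distrib power2_eq_square powr_add[symmetric])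
  finally show ?thesis by simp
qed

lemma nn_integral_powr_Ici:
  fixes p c :: real
  assumes "p < -1" "c > 0"
  shows "(\<integral>\<^sup>+x. ennreal (x powr p) * indicator {c..} x \<partial>lborel) = ennreal (- (c powr (p + 1)) / (p + 1))"
proof -
  have "(\<integral>\<^sup>+x. ennreal (x powr p) * indicator {c..} x \<partial>lborel)
      = (\<integral>\<^sup>+x. ennreal (indicator {c..} x * x powr p) \<partial>lborel)"
    by (intro nn_integral_cong) (auto simp: indicator_def)
  also have "\<dots> = ennreal (- (c powr (p + 1)) / (p + 1))"
    by (rule nn_integral_has_integral_lebesgue[OF _ has_integral_powr_to_inf]) (use assms in auto)
  finally show ?thesis .
qed

text \<open>
  Up to times of order \<open>h\<close> the squares of the two terms of the increment are bounded
  separately, by powers with exponent $\sigma-1$, whose integral has order $h^\sigma$. Beyond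
  \<open>2 h\<close> the decay of second differences makes the tail small.
\<close>

lemma ppow_diff_increment_bound:
  assumes s: "0 < \<sigma>" "\<sigma> < 1" and h: "h \<ge> 1"
  shows "sqn lborel (\<lambda>t. ppow_diff \<sigma> (t + h) - ppow_diff \<sigma> t) \<le> ennreal ((12 / \<sigma> + 16) * h powr \<sigma>)"
proof -
  let ?g = "ppow_diff \<sigma>"
  let ?p = "\<lambda>t. ennreal (t powr (\<sigma> - 1)) * indicator {0<..3*h} t"
  let ?q = "\<lambda>t. ennreal (t powr (2 * \<sigma> - 4)) * indicator {2*h..} t"
  have g0: "?g t = 0" if "t \<le> 0" for t using that by (simp add: ppow_diff_def ppow_def)
  have pw: "ennreal ((?g (t + h) - ?g t)\<^sup>2) \<le> 2 * ?p (t + h) + 2 * ?p t + ennreal (16 * h\<^sup>2) * ?q t" for t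
  proof (cases "t \<le> 2 * h")
    case True
    have *: "ennreal ((?g x)\<^sup>2) \<le> ?p x" if "x \<le> 3 * h" for x
      using that ppow_diff_bound[OF s, of x] g0[of x] by (auto simp: indicator_def intro!: ennreal_leI)
    have "(?g (t + h) - ?g t)\<^sup>2 \<le> 2 * (?g (t + h))\<^sup>2 + 2 * (?g t)\<^sup>2"
      using zero_le_power2[of "?g (t + h) + ?g t"] by (simp add: power2_eq_square algebra_simps)
    then have "ennreal ((?g (t + h) - ?g t)\<^sup>2) \<le> ennreal (2 * (?g (t + h))\<^sup>2 + 2 * (?g t)\<^sup>2)"
      by (rule ennreal_leI)
    also have "\<dots> = 2 * ennreal ((?g (t + h))\<^sup>2) + 2 * ennreal ((?g t)\<^sup>2)"
      by (simp add: ennreal_mult')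
    also have "\<dots> \<le> 2 * ?p (t + h) + 2 * ?p t"
      using True h by (intro add_mono mult_left_mono *) auto
    also have "\<dots> \<le> 2 * ?p (t + h) + 2 * ?p t + ennreal (16 * h\<^sup>2) * ?q t" by simp
    finally show ?thesis .
  next
    case False
    then have "(?g (t + h) - ?g t)\<^sup>2 \<le> h\<^sup>2 * (t / 2) powr (2 * \<sigma> - 4)"
      using h by (intro ppow_second_diff_bound s) auto
    also have "\<dots> \<le> h\<^sup>2 * (16 * t powr (2 * \<sigma> - 4))"
    proof (rule mult_left_mono)
      have "(t / 2) powr (2 * \<sigma> - 4) = t powr (2 * \<sigma> - 4) * 2 powr (4 - 2 * \<sigma>)"
        using False h by (simp add: powr_divide powr_diff)
      also have "\<dots> \<le> t powr (2 * \<sigma> - 4) * 2 powr 4"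
        using s by (intro mult_left_mono powr_mono) auto
      finally show "(t / 2) powr (2 * \<sigma> - 4) \<le> 16 * t powr (2 * \<sigma> - 4)"
        using powr_realpow[of 2 4] by simp
    qed simp
    finally have "(?g (t + h) - ?g t)\<^sup>2 \<le> 16 * h\<^sup>2 * t powr (2 * \<sigma> - 4)"
      by (simp add: mult_ac)
    then have "ennreal ((?g (t + h) - ?g t)\<^sup>2) \<le> ennreal (16 * h\<^sup>2) * ?q t"
      using False h by (simp add: ennreal_leI flip: ennreal_mult)
    also have "\<dots> \<le> 2 * ?p (t + h) + 2 * ?p t + ennreal (16 * h\<^sup>2) * ?q t" by simp
    finally show ?thesis .
  qed
  have intp: "(\<integral>\<^sup>+t. ?p t \<partial>lborel) = ennreal ((3 * h) powr \<sigma> / \<sigma>)"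
    using nn_integral_powr_Ioc[of "\<sigma> - 1" "3 * h"] s h by simp
  have intp': "(\<integral>\<^sup>+t. ?p (t + h) \<partial>lborel) = ennreal ((3 * h) powr \<sigma> / \<sigma>)"
    using nn_integral_shift[of ?p h] intp by simp
  have intq: "(\<integral>\<^sup>+t. ?q t \<partial>lborel) = ennreal ((2 * h) powr (2 * \<sigma> - 3) / (3 - 2 * \<sigma>))"
    using nn_integral_powr_Ici[of "2 * \<sigma> - 4" "2 * h"] s h by (simp add: minus_divide_left[symmetric] divide_minus_right[symmetric] del: divide_minus_right)
  have "sqn lborel (\<lambda>t. ?g (t + h) - ?g t) \<le> (\<integral>\<^sup>+t. 2 * ?p (t + h) + 2 * ?p t + ennreal (16 * h\<^sup>2) * ?q t \<partial>lborel)"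
    unfolding sqn_def by (rule nn_integral_mono) (rule pw)
  also have "\<dots> = 2 * (\<integral>\<^sup>+t. ?p (t + h) \<partial>lborel) + 2 * (\<integral>\<^sup>+t. ?p t \<partial>lborel) + ennreal (16 * h\<^sup>2) * (\<integral>\<^sup>+t. ?q t \<partial>lborel)"
    by (simp add: nn_integral_add nn_integral_cmult)
  also have "\<dots> = ennreal (4 * ((3 * h) powr \<sigma> / \<sigma>) + 16 * h\<^sup>2 * ((2 * h) powr (2 * \<sigma> - 3) / (3 - 2 * \<sigma>)))"
    unfolding intp intp' intq using s h
    by (simp add: ennreal_mult'[symmetric] ennreal_plus[symmetric] del: ennreal_plus flip: ennreal_numeral)
  also have "\<dots> \<le> ennreal ((12 / \<sigma> + 16) * h powr \<sigma>)"
  proof (rule ennreal_leI)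
    have "(3 * h) powr \<sigma> = 3 powr \<sigma> * h powr \<sigma>" using h by (simp add: powr_mult)
    also have "\<dots> \<le> 3 powr 1 * h powr \<sigma>" using s by (intro mult_right_mono powr_mono) auto
    finally have A: "4 * ((3 * h) powr \<sigma> / \<sigma>) \<le> 12 / \<sigma> * h powr \<sigma>" using s by (simp add: divide_right_mono)
    have "(2 * h) powr (2 * \<sigma> - 3) / (3 - 2 * \<sigma>) \<le> h powr (2 * \<sigma> - 3) / 1"
      using s h by (intro frac_le powr_mono2') auto
    then have "h\<^sup>2 * ((2 * h) powr (2 * \<sigma> - 3) / (3 - 2 * \<sigma>)) \<le> h\<^sup>2 * h powr (2 * \<sigma> - 3)"
      by (intro mult_left_mono) auto
    also have "h\<^sup>2 * h powr (2 * \<sigma> - 3) = h powr (2 + (2 * \<sigma> - 3))"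
      unfolding powr_add using h powr_realpow[of h 2] by simp
    also have "\<dots> \<le> h powr \<sigma>" using h s by (intro powr_mono) auto
    finally show "4 * ((3 * h) powr \<sigma> / \<sigma>) + 16 * h\<^sup>2 * ((2 * h) powr (2 * \<sigma> - 3) / (3 - 2 * \<sigma>)) \<le> (12 / \<sigma> + 16) * h powr \<sigma>"
      using A unfolding distrib_right by (simp only: mult.assoc)
  qed
  finally show ?thesis .
qed

text \<open>
  The increment is the mixed second difference of $t_+^\sigma$ with steps \<open>1\<close> and \<open>h\<close>. It is
  symmetric in the two steps, and dividing time by \<open>h\<close> turns the steps \<open>(1, h)\<close> into
  \<open>(1/h, 1)\<close>. Small steps are thereby reduced to large ones.
\<close>

lemma ppow_diff_increment_symmetric:
  assumes h: "h > 0"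
  shows "sqn lborel (\<lambda>t. ppow_diff \<sigma> (t + h) - ppow_diff \<sigma> t)
     = ennreal (h powr (2 * \<sigma> + 1)) * sqn lborel (\<lambda>t. ppow_diff \<sigma> (t + 1 / h) - ppow_diff \<sigma> t)"
proof -
  have eq: "ppow_diff \<sigma> (1 + h * x + h) - ppow_diff \<sigma> (1 + h * x)
     = h powr \<sigma> * (ppow_diff \<sigma> (x + 1 + 1 / h) - ppow_diff \<sigma> (x + 1))" for x
  proof -
    have "ppow \<sigma> (1 + h * x + h) = h powr \<sigma> * ppow \<sigma> (x + 1 + 1 / h)"
      "ppow \<sigma> (h * x + h) = h powr \<sigma> * ppow \<sigma> (x + 1)"
      "ppow \<sigma> (1 + h * x) = h powr \<sigma> * ppow \<sigma> (x + 1 / h)"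
      "ppow \<sigma> (h * x) = h powr \<sigma> * ppow \<sigma> x"
      unfolding ppow_scale[OF h, symmetric] using h by (simp_all add: distrib_left add_ac)
    then show ?thesis by (simp add: ppow_diff_def algebra_simps)
  qed
  have "sqn lborel (\<lambda>t. ppow_diff \<sigma> (t + h) - ppow_diff \<sigma> t)
    = ennreal h * (\<integral>\<^sup>+x. ennreal ((ppow_diff \<sigma> (1 + h * x + h) - ppow_diff \<sigma> (1 + h * x))\<^sup>2) \<partial>lborel)"
    unfolding sqn_def using h by (subst nn_integral_real_affine[where c=h and t=1]) auto
  also have "(\<integral>\<^sup>+x. ennreal ((ppow_diff \<sigma> (1 + h * x + h) - ppow_diff \<sigma> (1 + h * x))\<^sup>2) \<partial>lborel)
     = sqn lborel (\<lambda>x. h powr \<sigma> * (ppow_diff \<sigma> (x + 1 + 1 / h) - ppow_diff \<sigma> (x + 1)))"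
    unfolding eq sqn_def ..
  also have "\<dots> = ennreal ((h powr \<sigma>)\<^sup>2) * sqn lborel (\<lambda>x. ppow_diff \<sigma> (x + 1 + 1 / h) - ppow_diff \<sigma> (x + 1))"
    by (rule sqn_cmult) simp
  also have "sqn lborel (\<lambda>x. ppow_diff \<sigma> (x + 1 + 1 / h) - ppow_diff \<sigma> (x + 1)) = sqn lborel (\<lambda>t. ppow_diff \<sigma> (t + 1 / h) - ppow_diff \<sigma> t)"
    unfolding sqn_def by (rule nn_integral_shift[of "\<lambda>t. ennreal ((ppow_diff \<sigma> (t + 1 / h) - ppow_diff \<sigma> t)\<^sup>2)"]) simp
  also have "ennreal h * (ennreal ((h powr \<sigma>)\<^sup>2) * sqn lborel (\<lambda>t. ppow_diff \<sigma> (t + 1 / h) - ppow_diff \<sigma> t))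
     = ennreal (h * (h powr \<sigma>)\<^sup>2) * sqn lborel (\<lambda>t. ppow_diff \<sigma> (t + 1 / h) - ppow_diff \<sigma> t)"
    using h by (simp add: ennreal_mult' mult.assoc)
  also have "h * (h powr \<sigma>)\<^sup>2 = h powr 1 * (h powr \<sigma> * h powr \<sigma>)" using h by (simp add: power2_eq_square)
  also have "\<dots> = h powr (2 * \<sigma> + 1)" unfolding powr_add[symmetric] by (simp add: add.commute)
  finally show ?thesis .
qed

text \<open>
  Let $F(h)$ be the squared norm of the increment of step \<open>h\<close>. For \<open>h \<ge> 1\<close> the bound
  $F(h) \le C h^\sigma$ leaves the integrand $h^{-1-\sigma}$. For \<open>h < 1\<close> the symmetry leaves
  $F(1/h) \le C h^{-\sigma}$. Both are integrable.
\<close>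

lemma gag_sq_ppow_diff_finite:
  assumes s: "0 < \<sigma>" "\<sigma> < 1"
  shows "gag_sq \<sigma> (ppow_diff \<sigma>) < \<infinity>"
proof -
  define C where "C = 12 / \<sigma> + 16"
  have C: "C \<ge> 0" using s by (simp add: C_def)
  let ?F = "\<lambda>h. sqn lborel (\<lambda>t. ppow_diff \<sigma> (t + h) - ppow_diff \<sigma> t)"
  let ?r = "\<lambda>h. ennreal C * (ennreal (h powr - \<sigma>) * indicator {0<..1} h) + ennreal C * (ennreal (h powr (- 1 - \<sigma>)) * indicator {1..} h)"
  have "ennreal (h powr - (1 + 2 * \<sigma>)) * ?F h * indicator {0<..} h \<le> ?r h" for h
  proof -
    consider "h \<le> 0" | "0 < h" "h \<le> 1" | "1 < h" by linarith
    then show ?thesis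
    proof cases
      case 2
      have "ennreal (h powr - (1 + 2 * \<sigma>)) * ?F h = ennreal (h powr - (1 + 2 * \<sigma>)) * (ennreal (h powr (2 * \<sigma> + 1)) * ?F (1 / h))"
        using ppow_diff_increment_symmetric[OF 2(1)] by simp
      also have "\<dots> = ?F (1 / h)"
        using 2 by (simp add: mult.assoc[symmetric] ennreal_mult'[symmetric] powr_add[symmetric])
      also have "\<dots> \<le> ennreal (C * (1 / h) powr \<sigma>)"
        unfolding C_def by (rule ppow_diff_increment_bound) (use s 2 in auto)
      also have "\<dots> = ennreal C * ennreal (h powr - \<sigma>)"
      proof -
        have "(1 / h) powr \<sigma> = h powr - \<sigma>" unfolding powr_minus using 2 by (simp add: powr_divide inverse_eq_divide)
        then show ?thesis using C by (simp add: ennreal_mult')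
      qed
      finally show ?thesis using 2 by (auto simp: add_increasing2)
    next
      case 3
      have "ennreal (h powr - (1 + 2 * \<sigma>)) * ?F h \<le> ennreal (h powr - (1 + 2 * \<sigma>)) * ennreal (C * h powr \<sigma>)"
        unfolding C_def by (rule mult_left_mono[OF ppow_diff_increment_bound]) (use s 3 in auto)
      also have "\<dots> = ennreal C * ennreal (h powr (- 1 - \<sigma>))"
      proof -
        have "h powr - (1 + 2 * \<sigma>) * h powr \<sigma> = h powr (- 1 - \<sigma>)"
          unfolding powr_add[symmetric] by (simp add: algebra_simps)
        then have "h powr - (1 + 2 * \<sigma>) * (C * h powr \<sigma>) = C * h powr (- 1 - \<sigma>)"
          by (simp only: mult.left_commute)
        then show ?thesis using C by (simp only: ennreal_mult'[symmetric] ennreal_mult''[symmetric] powr_ge_zero)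
      qed
      finally show ?thesis using 3 by simp
    qed simp
  qed
  then have "gag_sq \<sigma> (ppow_diff \<sigma>) \<le> 2 * (\<integral>\<^sup>+h. ?r h \<partial>lborel)"
    by (subst gag_sq_by_differences) (auto intro!: mult_left_mono nn_integral_mono)
  also have "(\<integral>\<^sup>+h. ?r h \<partial>lborel) = ennreal C * (\<integral>\<^sup>+h. ennreal (h powr - \<sigma>) * indicator {0<..1} h \<partial>lborel)
     + ennreal C * (\<integral>\<^sup>+h. ennreal (h powr (- 1 - \<sigma>)) * indicator {1..} h \<partial>lborel)"
    by (simp add: nn_integral_add nn_integral_cmult)
  also have "2 * \<dots> < \<infinity>"
    using nn_integral_powr_Ioc[of "- \<sigma>" 1] nn_integral_powr_Ici[of "- 1 - \<sigma>" 1] s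
    by (simp add: ennreal_mult_less_top)
  finally show ?thesis .
qed

lemma gag_sq_ppow_diff_pos:
  assumes s: "0 < \<sigma>" "\<sigma> < 1"
  shows "gag_sq \<sigma> (ppow_diff \<sigma>) > 0"
proof -
  define d where "d = (1/2) powr (2 * \<sigma>) / 2 powr (1 + 2 * \<sigma>)"
  have d: "d > 0" by (simp add: d_def)
  \<comment> \<open>On \<open>[1/2,1] \<times> [-1,0]\<close> the function equals $t^\sigma$ at the first and zero at the second
    point.\<close>
  have pw: "d \<le> (ppow_diff \<sigma> t - ppow_diff \<sigma> x)\<^sup>2 / \<bar>t - x\<bar> powr (1 + 2 * \<sigma>)"
    if "t \<in> {1/2..1}" "x \<in> {-1..0}" for t x
  proof -
    have "(ppow_diff \<sigma> t - ppow_diff \<sigma> x)\<^sup>2 = t powr (2 * \<sigma>)"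
      using that by (simp add: ppow_diff_def ppow_def power2_eq_square powr_add[symmetric])
    moreover have "(1/2) powr (2 * \<sigma>) \<le> t powr (2 * \<sigma>)" using that s by (intro powr_mono2) auto
    moreover have "\<bar>t - x\<bar> powr (1 + 2 * \<sigma>) \<le> 2 powr (1 + 2 * \<sigma>)" using that s by (intro powr_mono2) auto
    ultimately show ?thesis unfolding d_def using that by (simp add: frac_le)
  qed
  have "0 < ennreal (d * (1 / 2))" using d by simp
  also have "ennreal (d * (1 / 2)) = (\<integral>\<^sup>+t. ennreal d * indicator {1/2..1::real} t \<partial>lborel)"
    using d by (simp only: nn_integral_cmult_indicator sets_lborel borel_closed closed_atLeastAtMost emeasure_lborel_Icc)
       (simp only: ennreal_mult'[symmetric] ennreal_mult''[symmetric], simp)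
  also have "\<dots> = (\<integral>\<^sup>+t. \<integral>\<^sup>+x. ennreal d * indicator {-1..0::real} x * indicator {1/2..1::real} t \<partial>lborel \<partial>lborel)"
    by (simp add: nn_integral_cmult nn_integral_multc)
  also have "\<dots> \<le> gag_sq \<sigma> (ppow_diff \<sigma>)"
    unfolding gag_sq_iterated[OF ppow_diff_measurable]
    using pw by (intro nn_integral_mono) (auto simp: indicator_def intro!: ennreal_leI)
  finally show ?thesis .
qed

section \<open>Density of step functions\<close>

definition ivl :: "real \<Rightarrow> real \<Rightarrow> real" where
  "ivl a = indicator {0<..a}"

definition step :: "(real \<Rightarrow> real) \<Rightarrow> bool" where
  "step v \<longleftrightarrow> (\<exists>A c. finite A \<and> A \<subseteq> {0..} \<and> v = (\<lambda>t. \<Sum>a\<in>A. c a * ivl a t))"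

lemma ivl_measurable [measurable]: "ivl a \<in> borel_measurable borel"
  unfolding ivl_def by measurable

lemma step_measurable: "step v \<Longrightarrow> v \<in> borel_measurable borel"
  unfolding step_def by auto

lemma step_extend:
  assumes "finite B" "A \<subseteq> B"
  shows "(\<Sum>a\<in>A. c a * ivl a t) = (\<Sum>a\<in>B. (if a \<in> A then c a else 0) * ivl a t)"
  by (rule sum.mono_neutral_cong_left) (use assms in auto)

lemma step_lincomb:
  assumes "step v" "step w"
  shows "step (\<lambda>t. x * v t + w t)"
proof -
  obtain A c where A: "finite A" "A \<subseteq> {0..}" "v = (\<lambda>t. \<Sum>a\<in>A. c a * ivl a t)"
    using assms(1) unfolding step_def by blast
  obtain B d where B: "finite B" "B \<subseteq> {0..}" "w = (\<lambda>t. \<Sum>a\<in>B. d a * ivl a t)"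
    using assms(2) unfolding step_def by blast
  have "x * v t + w t = (\<Sum>a\<in>A\<union>B. (x * (if a \<in> A then c a else 0) + (if a \<in> B then d a else 0)) * ivl a t)" for t
    unfolding A(3) B(3) using A(1) B(1)
    by (simp add: step_extend[of "A \<union> B" A c] step_extend[of "A \<union> B" B d] sum_distrib_left sum.distrib[symmetric] distrib_right mult.assoc)
  then show ?thesis unfolding step_def using A B
    by (intro exI[of _ "A \<union> B"] exI[of _ "\<lambda>a. x * (if a \<in> A then c a else 0) + (if a \<in> B then d a else 0)"]) auto
qed

lemma step_ivl: "a \<ge> 0 \<Longrightarrow> step (ivl a)"
  unfolding step_def by (intro exI[of _ "{a}"] exI[of _ "\<lambda>_. 1"]) auto

lemma step_zero: "step (\<lambda>_. 0)"
  unfolding step_def by (intro exI[of _ "{}"]) auto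

definition step_closure :: "(real \<Rightarrow> real) \<Rightarrow> bool" where
  "step_closure v \<longleftrightarrow> v \<in> borel_measurable borel \<and>
     (\<forall>e::real. e > 0 \<longrightarrow> (\<exists>w. step w \<and> sqn lborel (\<lambda>t. v t - w t) \<le> ennreal e))"

lemma step_closure_step: "step v \<Longrightarrow> step_closure v"
  unfolding step_closure_def
  by (auto intro!: exI[of _ v] simp: step_measurable) (simp add: sqn_def)

lemma two_times_ennreal: "y \<ge> 0 \<Longrightarrow> 2 * ennreal y = ennreal (2 * y)"
  by (simp add: ennreal_mult')

lemma step_closure_closed:
  assumes [measurable]: "v \<in> borel_measurable borel"
    and "\<And>e::real. e > 0 \<Longrightarrow> \<exists>w. step_closure w \<and> sqn lborel (\<lambda>t. v t - w t) \<le> ennreal e"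
  shows "step_closure v"
  unfolding step_closure_def
proof (intro conjI allI impI)
  fix e :: real assume e: "e > 0"
  then obtain w where w: "step_closure w" "sqn lborel (\<lambda>t. v t - w t) \<le> ennreal (e / 4)"
    using assms(2)[of "e / 4"] by auto
  then obtain z where z: "step z" "sqn lborel (\<lambda>t. w t - z t) \<le> ennreal (e / 4)"
    unfolding step_closure_def using e by (meson zero_less_divide_iff zero_less_numeral)
  have [measurable]: "w \<in> borel_measurable borel" "z \<in> borel_measurable borel"
    using w z by (auto simp: step_closure_def step_measurable)
  have "sqn lborel (\<lambda>t. v t - z t) = sqn lborel (\<lambda>t. (v t - w t) + (w t - z t))" by simp
  also have "\<dots> \<le> 2 * sqn lborel (\<lambda>t. v t - w t) + 2 * sqn lborel (\<lambda>t. w t - z t)"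
    by (rule sqn_add_le) auto
  also have "\<dots> \<le> 2 * ennreal (e / 4) + 2 * ennreal (e / 4)"
    by (intro add_mono mult_left_mono w z) auto
  also have "\<dots> = ennreal (2 * (e / 4) + 2 * (e / 4))"
    using e by (simp add: two_times_ennreal flip: ennreal_plus)
  finally show "\<exists>w. step w \<and> sqn lborel (\<lambda>t. v t - w t) \<le> ennreal e"
    using z(1) by auto
qed simp

lemma step_closure_lincomb:
  assumes v: "step_closure v" and w: "step_closure w"
  shows "step_closure (\<lambda>t. x * v t + w t)"
  unfolding step_closure_def
proof (intro conjI allI impI)
  have [measurable]: "v \<in> borel_measurable borel" "w \<in> borel_measurable borel"
    using v w by (auto simp: step_closure_def)
  show "(\<lambda>t. x * v t + w t) \<in> borel_measurable borel" by simp
  fix e :: real assume e: "e > 0"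
  define d where "d = e / (4 * (1 + x\<^sup>2))"
  have x2: "1 + x\<^sup>2 > 0" by (rule add_pos_nonneg) auto
  have d: "d > 0" "x\<^sup>2 * d \<le> e / 4" "d \<le> e / 4" using e x2 by (auto simp: d_def field_simps)
  obtain p where p: "step p" "sqn lborel (\<lambda>t. v t - p t) \<le> ennreal d"
    using v d unfolding step_closure_def by blast
  obtain q where q: "step q" "sqn lborel (\<lambda>t. w t - q t) \<le> ennreal d"
    using w d unfolding step_closure_def by blast
  have [measurable]: "p \<in> borel_measurable borel" "q \<in> borel_measurable borel"
    using p q by (auto simp: step_measurable)
  have "sqn lborel (\<lambda>t. (x * v t + w t) - (x * p t + q t)) = sqn lborel (\<lambda>t. x * (v t - p t) + (w t - q t))"
    by (simp add: algebra_simps)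
  also have "\<dots> \<le> 2 * sqn lborel (\<lambda>t. x * (v t - p t)) + 2 * sqn lborel (\<lambda>t. w t - q t)"
    by (rule sqn_add_le) auto
  also have "sqn lborel (\<lambda>t. x * (v t - p t)) = ennreal (x\<^sup>2) * sqn lborel (\<lambda>t. v t - p t)"
    by (rule sqn_cmult) simp
  also have "2 * (ennreal (x\<^sup>2) * sqn lborel (\<lambda>t. v t - p t)) + 2 * sqn lborel (\<lambda>t. w t - q t)
      \<le> 2 * (ennreal (x\<^sup>2) * ennreal d) + 2 * ennreal d"
    by (intro add_mono mult_left_mono p q) auto
  also have "\<dots> = ennreal (2 * (x\<^sup>2 * d) + 2 * d)"
    using d by (subst ennreal_plus) (auto simp: ennreal_mult')
  also have "\<dots> \<le> ennreal e" using d by (intro ennreal_leI) auto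
  finally show "\<exists>z. step z \<and> sqn lborel (\<lambda>t. (x * v t + w t) - z t) \<le> ennreal e"
    using step_lincomb[OF p(1) q(1), of x] by (intro exI[of _ "\<lambda>t. x * p t + q t"]) auto
qed

lemma step_closure_sum:
  "finite I \<Longrightarrow> (\<And>i. i \<in> I \<Longrightarrow> step_closure (f i)) \<Longrightarrow> step_closure (\<lambda>t. \<Sum>i\<in>I. c i * f i t)"
proof (induction I rule: finite_induct)
  case empty
  then show ?case using step_closure_step[OF step_zero] by simp
next
  case (insert i I)
  then have "step_closure (\<lambda>t. c i * f i t + (\<Sum>i\<in>I. c i * f i t))"
    by (intro step_closure_lincomb) auto
  then show ?case using insert by simp
qed

lemma sqn_tendsto_0:
  assumes [measurable]: "\<And>n. f n \<in> borel_measurable M"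
    and [measurable]: "g \<in> borel_measurable M" and fin: "sqn M g < \<infinity>"
    and lim: "\<And>x. x \<in> space M \<Longrightarrow> (\<lambda>n. f n x) \<longlonglongrightarrow> 0" and bd: "\<And>n x. x \<in> space M \<Longrightarrow> \<bar>f n x\<bar> \<le> \<bar>g x\<bar>"
    and e: "e > 0"
  shows "\<exists>n. sqn M (f n) \<le> ennreal e"
proof -
  have "(\<lambda>n. \<integral>\<^sup>+x. ennreal ((f n x)\<^sup>2) \<partial>M) \<longlonglongrightarrow> (\<integral>\<^sup>+x. 0 \<partial>M)"
  proof (rule nn_integral_dominated_convergence[where w="\<lambda>x. ennreal ((g x)\<^sup>2)"])
    show "AE x in M. ennreal ((f n x)\<^sup>2) \<le> ennreal ((g x)\<^sup>2)" for n
      using bd by (intro AE_I2 ennreal_leI) (auto simp: abs_le_square_iff[symmetric])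
    show "(\<integral>\<^sup>+x. ennreal ((g x)\<^sup>2) \<partial>M) < \<infinity>" using fin by (simp add: sqn_def)
    show "AE x in M. (\<lambda>n. ennreal ((f n x)\<^sup>2)) \<longlonglongrightarrow> 0"
    proof (rule AE_I2)
      fix x assume "x \<in> space M"
      then have "(\<lambda>n. ennreal ((f n x)\<^sup>2)) \<longlonglongrightarrow> ennreal (0\<^sup>2)"
        by (intro tendsto_ennrealI tendsto_intros lim)
      then show "(\<lambda>n. ennreal ((f n x)\<^sup>2)) \<longlonglongrightarrow> 0" by simp
    qed
  qed auto
  then have "(\<lambda>n. sqn M (f n)) \<longlonglongrightarrow> 0" by (simp add: sqn_def)
  then have "eventually (\<lambda>n. sqn M (f n) < ennreal e) sequentially"
    by (rule order_tendstoD) (use e in simp)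
  then show ?thesis by (auto simp: eventually_sequentially intro: less_imp_le)
qed

lemma sqn_ivl: "sqn lborel (ivl a) < \<infinity>"
proof -
  have "sqn lborel (ivl a) = (\<integral>\<^sup>+x. indicator {0<..a} x \<partial>lborel)"
    unfolding sqn_def ivl_def by (intro nn_integral_cong) (auto simp: indicator_def)
  also have "\<dots> < \<infinity>" by (cases "a \<ge> 0") auto
  finally show ?thesis .
qed

text \<open>
  By the \<open>\<pi>\<close>-\<open>\<lambda>\<close> theorem it suffices to treat half-lines, complements and disjoint unions. The
  truncation to \<open>(0,R]\<close> keeps every set of finite measure.
\<close>

lemma step_closure_indicator:
  assumes R: "R \<ge> 0" and A: "A \<in> sets borel"
  shows "step_closure (indicator (A \<inter> {0<..R}))"
proof -
  have "Int_stable (range (\<lambda>a::real. {..a}))"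
    by (auto simp: Int_stable_def)
  moreover have "range (\<lambda>a::real. {..a}) \<subseteq> Pow UNIV" by simp
  moreover have "A \<in> sigma_sets UNIV (range (\<lambda>a::real. {..a}))"
    using A unfolding borel_eq_atMost by (simp add: sets_measure_of)
  ultimately show ?thesis
  proof (induction rule: sigma_sets_induct_disjoint)
    case (basic A)
    then obtain a where a: "A = {..a}" by auto
    have "A \<inter> {0<..R} = {0<..max 0 (min a R)}" using R by (auto simp: a)
    then show ?case
      using step_closure_step[OF step_ivl[of "max 0 (min a R)"]] by (simp add: ivl_def)
  next
    case empty
    have "(indicator {} :: real \<Rightarrow> real) = (\<lambda>_. 0)" by auto
    then show ?case using step_closure_step[OF step_zero] by simp
  next
    case (compl A)
    have "(indicator ((UNIV - A) \<inter> {0<..R}) :: real \<Rightarrow> real) = (\<lambda>t. (-1) * indicator (A \<inter> {0<..R}) t + ivl R t)"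
      by (auto simp: indicator_def ivl_def)
    then show ?case
      using step_closure_lincomb[OF compl(2) step_closure_step[OF step_ivl[OF R]], of "-1"] by simp
  next
    case (union A)
    have sets: "A i \<in> sets borel" for i
      using union(2) unfolding borel_eq_atMost by (auto simp: sets_measure_of)
    define f :: "nat \<Rightarrow> real \<Rightarrow> real" where "f n = (\<lambda>t. \<Sum>i<n. 1 * indicator (A i \<inter> {0<..R}) t)" for n
    let ?I = "indicator (\<Union> (range A) \<inter> {0<..R}) :: real \<Rightarrow> real"
    have f: "step_closure (f n)" for n unfolding f_def by (rule step_closure_sum) (use union in auto)
    have f_eq: "f n t = indicator (\<Union>i<n. A i \<inter> {0<..R}) t" for n t
      unfolding f_def mult_1
      by (rule indicator_UN_disjoint[symmetric]) (use union(1) in \<open>auto simp: disjoint_family_on_def\<close>)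
    show ?case
    proof (rule step_closure_closed)
      show "?I \<in> borel_measurable borel" using sets by auto
      fix e :: real assume e: "e > 0"
      have "\<exists>n. sqn lborel (\<lambda>t. ?I t - f n t) \<le> ennreal e"
      proof (rule sqn_tendsto_0[where g="ivl R"])
        show "(\<lambda>t. ?I t - f n t) \<in> borel_measurable lborel" for n
          using sets f[of n] by (auto simp: step_closure_def)
        show "(\<lambda>n. ?I t - f n t) \<longlonglongrightarrow> 0" for t
        proof (cases "t \<in> \<Union> (range A) \<inter> {0<..R}")
          case True
          then obtain i where i: "t \<in> A i \<inter> {0<..R}" by auto
          have "eventually (\<lambda>n. ?I t - f n t = 0) sequentially"
            using eventually_gt_at_top[of i] by eventually_elim (use i True in \<open>auto simp: f_eq indicator_def\<close>)
          then show ?thesis by (rule tendsto_eventually)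
        next
          case False
          then have "?I t - f n t = 0" for n by (auto simp: f_eq indicator_def)
          then show ?thesis by simp
        qed
        show "\<bar>?I t - f n t\<bar> \<le> \<bar>ivl R t\<bar>" for n t
          by (auto simp: f_eq indicator_def ivl_def)
      qed (use sqn_ivl e in auto)
      then show "\<exists>w. step_closure w \<and> sqn lborel (\<lambda>t. ?I t - w t) \<le> ennreal e" using f by blast
    qed
  qed
qed

lemma step_closure_L2:
  assumes [measurable]: "v \<in> borel_measurable borel" and v0: "\<And>t. t \<le> 0 \<Longrightarrow> v t = 0"
    and fin: "sqn lborel v < \<infinity>"
  shows "step_closure v"
proof (rule step_closure_closed)
  fix e :: real assume e: "e > 0"
  obtain F where F: "\<And>i. simple_function borel (F i)" "\<And>x. (\<lambda>i. F i x) \<longlonglongrightarrow> v x"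
     "\<And>i x. norm (F i x) \<le> 2 * norm (v x)"
    using borel_measurable_implies_sequence_metric[of v borel 0] by auto
  have Fm [measurable]: "F i \<in> borel_measurable borel" for i
    using F(1) by (rule borel_measurable_simple_function)
  define f where "f i = (\<lambda>t. F i t * ivl (real i) t)" for i
  have fm [measurable]: "f i \<in> borel_measurable borel" for i unfolding f_def by simp
  have f: "step_closure (f i)" for i
  proof -
    have "f i = (\<lambda>t. \<Sum>y\<in>F i ` UNIV. y * indicator (F i -` {y} \<inter> {0<..real i}) t)"
    proof
      fix t
      have fin: "finite (F i ` UNIV)" using F(1)[of i] by (simp add: simple_function_def)
      have "(\<Sum>y\<in>F i ` UNIV. y * indicator (F i -` {y} \<inter> {0<..real i}) t)
         = (\<Sum>y\<in>F i ` UNIV. if y = F i t then y * ivl (real i) t else 0)"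
        by (rule sum.cong) (auto simp: indicator_def ivl_def)
      also have "\<dots> = f i t" using fin by (simp add: f_def)
      finally show "f i t = (\<Sum>y\<in>F i ` UNIV. y * indicator (F i -` {y} \<inter> {0<..real i}) t)" ..
    qed
    moreover have "step_closure (\<lambda>t. \<Sum>y\<in>F i ` UNIV. y * indicator (F i -` {y} \<inter> {0<..real i}) t)"
    proof (rule step_closure_sum)
      show "finite (range (F i))" using F(1)[of i] by (simp add: simple_function_def)
      show "step_closure (indicator (F i -` {y} \<inter> {0<..real i}))" if "y \<in> range (F i)" for y
        by (rule step_closure_indicator) (use F(1)[of i] that in \<open>auto simp: simple_function_def\<close>)
    qed
    ultimately show ?thesis by simp
  qed
  \<comment> \<open>The approximants are bounded by twice the modulus of the limit, which gives the
    dominating function.\<close>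
  have "\<exists>i. sqn lborel (\<lambda>t. v t - f i t) \<le> ennreal e"
  proof (rule sqn_tendsto_0[where g="\<lambda>t. 3 * v t"])
    show "sqn lborel (\<lambda>t. 3 * v t) < \<infinity>" using fin by (subst sqn_cmult) (auto simp: ennreal_mult_less_top)
    show "(\<lambda>i. v t - f i t) \<longlonglongrightarrow> 0" for t
    proof (cases "t \<le> 0")
      case True
      then have "v t - f i t = 0" for i using v0[of t] by (simp add: f_def ivl_def)
      then show ?thesis by simp
    next
      case False
      have "eventually (\<lambda>i. v t - F i t = v t - f i t) sequentially"
        using eventually_ge_at_top[of "nat \<lceil>t\<rceil>"]
      proof eventually_elim
        case (elim i)
        then have "t \<le> real i" by linarith
        then show ?case using False by (simp add: f_def ivl_def)
      qed
      moreover have "(\<lambda>i. v t - F i t) \<longlonglongrightarrow> v t - v t" by (intro tendsto_intros F)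
      ultimately have "(\<lambda>i. v t - f i t) \<longlonglongrightarrow> v t - v t" by (rule Lim_transform_eventually[rotated])
      then show ?thesis by simp
    qed
    show "\<bar>v t - f i t\<bar> \<le> \<bar>3 * v t\<bar>" for i t
    proof -
      have "\<bar>f i t\<bar> \<le> 2 * \<bar>v t\<bar>" using F(3)[of i t] by (auto simp: f_def ivl_def indicator_def)
      then show ?thesis by linarith
    qed
  qed (use e in auto)
  then show "\<exists>w. step_closure w \<and> sqn lborel (\<lambda>t. v t - w t) \<le> ennreal e" using f by blast
qed simp

section \<open>The fractional integral as an isometry on the line\<close>

text \<open>
  The ratio between the squared seminorm of $J^\sigma v$ and the squared $L^2$ norm of $v$,
  read off at $v = 1_{(0,1]}$.
\<close>

definition gagc :: "real \<Rightarrow> real" where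
  "gagc \<sigma> = enn2real (gag_sq \<sigma> (ppow_diff \<sigma>)) / (Gamma (\<sigma> + 1))\<^sup>2"

lemma gagc_pos: "0 < \<sigma> \<Longrightarrow> \<sigma> < 1 \<Longrightarrow> gagc \<sigma> > 0"
  using gag_sq_ppow_diff_finite[of \<sigma>] gag_sq_ppow_diff_pos[of \<sigma>] Gamma_real_pos[of "\<sigma> + 1"]
  by (auto simp: gagc_def enn2real_positive_iff zero_less_power2 intro!: divide_pos_pos simp del: Gamma_real_pos)

lemma kern_atMost_integral:
  assumes a: "a > 0"
  shows "integrable lborel (\<lambda>x. kern a x * indicator {..R} x)"
    and "(LINT x|lborel. kern a x * indicator {..R} x) = ppow a R / Gamma (a + 1)"
proof -
  have *: "(\<integral>\<^sup>+x. ennreal (kern a x * indicator {..R} x) \<partial>lborel) = ennreal (ppow a R / Gamma (a + 1))"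
  proof (cases "R > 0")
    case True
    have "(\<integral>\<^sup>+x. ennreal (kern a x * indicator {..R} x) \<partial>lborel) = (\<integral>\<^sup>+x. ennreal (kern a x) * indicator {..R} x \<partial>lborel)"
      by (intro nn_integral_cong) (auto simp: indicator_def)
    then show ?thesis using kern_integral[OF a, of R] True by (simp add: ppow_def)
  next
    case False
    then have "kern a x * indicator {..R} x = 0" for x by (auto simp: indicator_def)
    then have "(\<integral>\<^sup>+x. ennreal (kern a x * indicator {..R} x) \<partial>lborel) = 0" by (simp only: ennreal_0) simp
    then show ?thesis using False by (simp add: ppow_def)
  qed
  have nn: "0 \<le> kern a x * indicator {..R} x" for x using kern_nonneg[OF a, of x] by simp
  show "integrable lborel (\<lambda>x. kern a x * indicator {..R} x)"
    by (rule integrableI_nonneg) (use nn * in auto)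
  show "(LINT x|lborel. kern a x * indicator {..R} x) = ppow a R / Gamma (a + 1)"
  proof -
    have "0 \<le> ppow a R / Gamma (a + 1)" using a by (simp add: ppow_def Gamma_real_pos less_imp_le)
    then show ?thesis using nn * by (subst integral_eq_nn_integral) auto
  qed
qed

lemma rl_ivl_AE_eq:
  "a \<ge> 0 \<Longrightarrow> AE x in lborel. kern \<sigma> x * ivl a (t - x) = kern \<sigma> x * indicator {..t} x - kern \<sigma> x * indicator {..t - a} x"
  using AE_lborel_singleton[of t] AE_lborel_singleton[of "t - a"]
  by eventually_elim (auto simp: ivl_def indicator_def)

lemma rl_ivl_integrable:
  assumes s: "0 < \<sigma>" and a: "a \<ge> 0"
  shows "integrable lborel (\<lambda>s. kern \<sigma> (t - s) * ivl a s)"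
proof -
  have "integrable lborel (\<lambda>x. kern \<sigma> x * indicator {..t} x - kern \<sigma> x * indicator {..t - a} x)"
    by (intro Bochner_Integration.integrable_diff kern_atMost_integral s)
  then have "integrable lborel (\<lambda>x. kern \<sigma> x * ivl a (t - x))"
    by (rule integrable_cong_AE_imp) (use AE_symmetric[OF rl_ivl_AE_eq[OF a]] in auto)
  then show ?thesis
    using lborel_integrable_real_affine_iff[of "-1" "\<lambda>x. kern \<sigma> x * ivl a (t - x)" t] by simp
qed

lemma rl_ivl:
  assumes s: "0 < \<sigma>" and a: "a \<ge> 0"
  shows "rl \<sigma> (ivl a) t = (ppow \<sigma> t - ppow \<sigma> (t - a)) / Gamma (\<sigma> + 1)"
proof -
  have "rl \<sigma> (ivl a) t = (LINT x|lborel. kern \<sigma> x * ivl a (t - x))"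
    unfolding rl_def using lborel_integral_real_affine[of "-1" "\<lambda>x. kern \<sigma> x * ivl a (t - x)" t] by simp
  also have "\<dots> = (LINT x|lborel. kern \<sigma> x * indicator {..t} x - kern \<sigma> x * indicator {..t - a} x)"
    by (rule integral_cong_AE) (use rl_ivl_AE_eq[OF a] in auto)
  also have "\<dots> = (ppow \<sigma> t - ppow \<sigma> (t - a)) / Gamma (\<sigma> + 1)"
    by (subst Bochner_Integration.integral_diff) (auto simp: kern_atMost_integral[OF s] diff_divide_distrib)
  finally show ?thesis .
qed

lemma gag_diff: "gag \<sigma> (\<lambda>t. u t - w t) x = gag \<sigma> u x - gag \<sigma> w x"
  by (auto simp: gag_def split_beta' diff_divide_distrib[symmetric])

text \<open>
  The difference is $J^\sigma 1_{(b,a]}$, which is a translate and dilate of \<open>ppow_diff \<sigma>\<close>.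
  The scaling exponents $2\sigma$ of the power and \<open>1 - 2\<sigma>\<close> of the seminorm add up to one.
\<close>

lemma gag_sq_rl_ivl_diff:
  assumes s: "0 < \<sigma>" "\<sigma> < 1" and a: "0 \<le> a" "0 \<le> b"
  shows "gag_sq \<sigma> (\<lambda>t. rl \<sigma> (ivl a) t - rl \<sigma> (ivl b) t) = ennreal (gagc \<sigma> * \<bar>a - b\<bar>)"
proof -
  have *: "gag_sq \<sigma> (\<lambda>t. rl \<sigma> (ivl a) t - rl \<sigma> (ivl b) t) = ennreal (gagc \<sigma> * (a - b))"
    if ab: "b < a" "0 \<le> b" for a b
  proof -
    define c where "c = a - b"
    have c: "c > 0" using ab by (simp add: c_def)
    define k where "k = c powr \<sigma> / Gamma (\<sigma> + 1)"
    have "rl \<sigma> (ivl a) t - rl \<sigma> (ivl b) t = k * ppow_diff \<sigma> (1 / c * (t + - b))" for t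
    proof -
      have "c powr \<sigma> * ppow \<sigma> (1 / c * (t + - b)) = ppow \<sigma> (t - b)"
        using c by (simp add: ppow_scale[symmetric])
      moreover have "c powr \<sigma> * ppow \<sigma> (1 / c * (t + - b) - 1) = ppow \<sigma> (t - a)"
        using c by (simp add: ppow_scale[symmetric] right_diff_distrib) (simp add: c_def)
      ultimately have "c powr \<sigma> * ppow_diff \<sigma> (1 / c * (t + - b)) = ppow \<sigma> (t - b) - ppow \<sigma> (t - a)"
        unfolding ppow_diff_def right_diff_distrib by simp
      then have "k * ppow_diff \<sigma> (1 / c * (t + - b)) = (ppow \<sigma> (t - b) - ppow \<sigma> (t - a)) / Gamma (\<sigma> + 1)"
        unfolding k_def by (simp add: divide_simps)
      then show ?thesis using s ab by (simp add: rl_ivl diff_divide_distrib)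
    qed
    then have "gag_sq \<sigma> (\<lambda>t. rl \<sigma> (ivl a) t - rl \<sigma> (ivl b) t) = gag_sq \<sigma> (\<lambda>t. k * ppow_diff \<sigma> (1 / c * (t + - b)))"
      by simp
    also have "\<dots> = ennreal (k\<^sup>2) * gag_sq \<sigma> (\<lambda>t. ppow_diff \<sigma> (1 / c * (t + - b)))"
      by (rule gag_sq_cmult) simp
    also have "gag_sq \<sigma> (\<lambda>t. ppow_diff \<sigma> (1 / c * (t + - b))) = gag_sq \<sigma> (\<lambda>t. ppow_diff \<sigma> (1 / c * t))"
      by (rule gag_sq_shift) simp
    also have "\<dots> = ennreal ((1 / c) powr (2 * \<sigma> - 1)) * gag_sq \<sigma> (ppow_diff \<sigma>)"
      by (rule gag_sq_scale) (use c in auto)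
    also have "gag_sq \<sigma> (ppow_diff \<sigma>) = ennreal (enn2real (gag_sq \<sigma> (ppow_diff \<sigma>)))"
      using gag_sq_ppow_diff_finite[OF s] by simp
    also have "ennreal (k\<^sup>2) * (ennreal ((1 / c) powr (2 * \<sigma> - 1)) * ennreal (enn2real (gag_sq \<sigma> (ppow_diff \<sigma>))))
       = ennreal (k\<^sup>2 * ((1 / c) powr (2 * \<sigma> - 1) * enn2real (gag_sq \<sigma> (ppow_diff \<sigma>))))"
      by (simp add: ennreal_mult)
    also have "k\<^sup>2 * ((1 / c) powr (2 * \<sigma> - 1) * enn2real (gag_sq \<sigma> (ppow_diff \<sigma>)))
        = ((c powr \<sigma>)\<^sup>2 * (1 / c) powr (2 * \<sigma> - 1)) * gagc \<sigma>"
      unfolding k_def gagc_def by (simp add: power_divide)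
    also have "(c powr \<sigma>)\<^sup>2 * (1 / c) powr (2 * \<sigma> - 1) = c"
    proof -
      have "(1 / c) powr (2 * \<sigma> - 1) = c powr - (2 * \<sigma> - 1)"
        unfolding powr_minus using c by (simp add: powr_divide inverse_eq_divide)
      moreover have "c powr \<sigma> * c powr \<sigma> * c powr - (2 * \<sigma> - 1) = c"
        unfolding powr_add[symmetric] using c by simp
      ultimately show ?thesis by (simp only: power2_eq_square)
    qed
    finally show ?thesis by (simp add: c_def mult.commute)
  qed
  consider "a < b" | "b < a" | "a = b" by linarith
  then show ?thesis
  proof cases
    case 1
    have "gag_sq \<sigma> (\<lambda>t. rl \<sigma> (ivl a) t - rl \<sigma> (ivl b) t) = gag_sq \<sigma> (\<lambda>t. (-1) * (rl \<sigma> (ivl b) t - rl \<sigma> (ivl a) t))"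
      by simp
    also have "\<dots> = ennreal ((-1)\<^sup>2) * gag_sq \<sigma> (\<lambda>t. rl \<sigma> (ivl b) t - rl \<sigma> (ivl a) t)"
      by (rule gag_sq_cmult) simp
    finally show ?thesis using *[of a b] 1 a by simp
  next
    case 2
    then show ?thesis using *[of b a] a by simp
  next
    case 3
    then show ?thesis by (simp add: gag_sq_def sqn_def gag_def split_beta')
  qed
qed

lemma sqn_eq_integral:
  "integrable M (\<lambda>x. (f x)\<^sup>2) \<Longrightarrow> sqn M f = ennreal (LINT x|M. (f x)\<^sup>2)"
  unfolding sqn_def by (rule nn_integral_eq_integral) auto

lemma sqn_finite_integrable:
  assumes "f \<in> borel_measurable M" "sqn M f < \<infinity>"
  shows "integrable M (\<lambda>x. (f x)\<^sup>2)"
  using assms by (intro integrableI_nonneg) (auto simp: sqn_def)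

text \<open>
  Polarization: the norms of the increments determine all inner products, here
  \<open>\<langle>f a, f b\<rangle> = k min a b\<close> as for the covariance of Brownian motion. Two families with the
  same increments therefore have the same norms on all linear combinations.
\<close>

lemma sqn_sum_of_increments:
  fixes f :: "real \<Rightarrow> 'a \<Rightarrow> real"
  assumes [measurable]: "\<And>a. f a \<in> borel_measurable M"
    and k: "k \<ge> 0" and f0: "\<And>x. x \<in> space M \<Longrightarrow> f 0 x = 0"
    and inc: "\<And>a b. a \<ge> 0 \<Longrightarrow> b \<ge> 0 \<Longrightarrow> sqn M (\<lambda>x. f a x - f b x) = ennreal (k * \<bar>a - b\<bar>)"
    and A: "finite A" "A \<subseteq> {0..}"
  shows "sqn M (\<lambda>x. \<Sum>a\<in>A. c a * f a x) = ennreal (k * (\<Sum>a\<in>A. \<Sum>b\<in>A. c a * c b * min a b))"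
proof -
  have d: "integrable M (\<lambda>x. (f a x - f b x)\<^sup>2)" "(LINT x|M. (f a x - f b x)\<^sup>2) = k * \<bar>a - b\<bar>"
    if "a \<ge> 0" "b \<ge> 0" for a b
  proof -
    show i: "integrable M (\<lambda>x. (f a x - f b x)\<^sup>2)"
      by (rule sqn_finite_integrable) (use inc[OF that] in auto)
    have "ennreal (LINT x|M. (f a x - f b x)\<^sup>2) = ennreal (k * \<bar>a - b\<bar>)"
      using sqn_eq_integral[OF i] inc[OF that] by simp
    then show "(LINT x|M. (f a x - f b x)\<^sup>2) = k * \<bar>a - b\<bar>"
      using k by (subst (asm) ennreal_inj) auto
  qed
  have s: "integrable M (\<lambda>x. (f a x)\<^sup>2)" "(LINT x|M. (f a x)\<^sup>2) = k * a" if "a \<ge> 0" for a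
  proof -
    have eq: "(f a x - f 0 x)\<^sup>2 = (f a x)\<^sup>2" if "x \<in> space M" for x using f0[OF that] by simp
    show "integrable M (\<lambda>x. (f a x)\<^sup>2)" using d(1)[of a 0] that eq by (simp cong: Bochner_Integration.integrable_cong)
    show "(LINT x|M. (f a x)\<^sup>2) = k * a" using d(2)[of a 0] that eq by (simp cong: Bochner_Integration.integral_cong)
  qed
  have p: "integrable M (\<lambda>x. f a x * f b x)" "(LINT x|M. f a x * f b x) = k * min a b"
    if ab: "a \<ge> 0" "b \<ge> 0" for a b
  proof -
    have eq: "f a x * f b x = ((f a x)\<^sup>2 + (f b x)\<^sup>2 - (f a x - f b x)\<^sup>2) / 2" for x
      by (simp add: power2_eq_square algebra_simps)
    show "integrable M (\<lambda>x. f a x * f b x)" unfolding eq using ab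
      by (intro integrable_divide Bochner_Integration.integrable_diff Bochner_Integration.integrable_add s d) auto
    have "(LINT x|M. f a x * f b x) = (k * a + k * b - k * \<bar>a - b\<bar>) / 2" unfolding eq using ab s d
      by simp
    also have "\<dots> = k * min a b" by (auto simp: min_def abs_if algebra_simps)
    finally show "(LINT x|M. f a x * f b x) = k * min a b" .
  qed
  have eq: "(\<Sum>a\<in>A. c a * f a x)\<^sup>2 = (\<Sum>a\<in>A. \<Sum>b\<in>A. c a * c b * (f a x * f b x))" for x
    by (simp add: power2_eq_square sum_product mult_ac)
  have int: "integrable M (\<lambda>x. (\<Sum>a\<in>A. c a * f a x)\<^sup>2)"
    unfolding eq using A by (intro Bochner_Integration.integrable_sum integrable_mult_right p) auto
  have "(LINT x|M. (\<Sum>a\<in>A. c a * f a x)\<^sup>2) = (\<Sum>a\<in>A. \<Sum>b\<in>A. c a * c b * (k * min a b))"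
  proof -
    have A0: "a \<ge> 0" if "a \<in> A" for a using A that by auto
    have i: "integrable M (\<lambda>x. c a * c b * (f a x * f b x))" if "a \<in> A" "b \<in> A" for a b
      by (intro integrable_mult_right p) (use that A in auto)
    have "(LINT x|M. (\<Sum>b\<in>A. c a * c b * (f a x * f b x))) = (\<Sum>b\<in>A. c a * c b * (k * min a b))" if "a \<in> A" for a
      by (subst Bochner_Integration.integral_sum) (use i that A0 in \<open>auto intro!: sum.cong simp: p\<close>)
    moreover have "(LINT x|M. (\<Sum>a\<in>A. \<Sum>b\<in>A. c a * c b * (f a x * f b x)))
       = (\<Sum>a\<in>A. LINT x|M. (\<Sum>b\<in>A. c a * c b * (f a x * f b x)))"
      by (rule Bochner_Integration.integral_sum) (intro Bochner_Integration.integrable_sum i)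
    ultimately show ?thesis unfolding eq by simp
  qed
  also have "\<dots> = k * (\<Sum>a\<in>A. \<Sum>b\<in>A. c a * c b * min a b)"
    by (simp add: sum_distrib_left mult_ac)
  finally show ?thesis using sqn_eq_integral[OF int] by simp
qed

lemma rl_step:
  assumes s: "0 < \<sigma>" and A: "finite A" "A \<subseteq> {0..}"
  shows "rl \<sigma> (\<lambda>t. \<Sum>a\<in>A. c a * ivl a t) t = (\<Sum>a\<in>A. c a * rl \<sigma> (ivl a) t)"
proof -
  have "rl \<sigma> (\<lambda>t. \<Sum>a\<in>A. c a * ivl a t) t = (LINT x|lborel. (\<Sum>a\<in>A. c a * (kern \<sigma> (t - x) * ivl a x)))"
    unfolding rl_def by (simp add: sum_distrib_left mult_ac)
  also have "\<dots> = (\<Sum>a\<in>A. LINT x|lborel. c a * (kern \<sigma> (t - x) * ivl a x))"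
    by (rule Bochner_Integration.integral_sum) (use A rl_ivl_integrable[OF s] in auto)
  finally show ?thesis by (simp add: rl_def)
qed

text \<open>
  The functions \<open>ivl a\<close> and the quotients of their fractional integrals are two families with
  proportional increments.
\<close>

lemma rl_step_isometry:
  assumes s: "0 < \<sigma>" "\<sigma> < 1" and v: "step v"
  shows "gag_sq \<sigma> (rl \<sigma> v) = ennreal (gagc \<sigma>) * sqn lborel v"
proof -
  obtain A c where A: "finite A" "A \<subseteq> {0..}" and v: "v = (\<lambda>t. \<Sum>a\<in>A. c a * ivl a t)"
    using v unfolding step_def by blast
  have "gag \<sigma> (rl \<sigma> v) x = (\<Sum>a\<in>A. c a * gag \<sigma> (rl \<sigma> (ivl a)) x)" for x
    unfolding v gag_def
    by (simp add: split_beta' rl_step[OF s(1) A] sum_subtractf[symmetric] right_diff_distrib[symmetric] sum_divide_distrib)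
  then have "gag_sq \<sigma> (rl \<sigma> v) = sqn (lborel \<Otimes>\<^sub>M lborel) (\<lambda>x. \<Sum>a\<in>A. c a * gag \<sigma> (rl \<sigma> (ivl a)) x)"
    by (simp add: gag_sq_def sqn_def)
  also have "\<dots> = ennreal (gagc \<sigma> * (\<Sum>a\<in>A. \<Sum>b\<in>A. c a * c b * min a b))"
  proof (rule sqn_sum_of_increments[OF _ _ _ _ A])
    show "gag \<sigma> (rl \<sigma> (ivl 0)) x = 0" for x
      by (simp add: gag_def split_beta' rl_ivl[OF s(1)])
    show "sqn (lborel \<Otimes>\<^sub>M lborel) (\<lambda>x. gag \<sigma> (rl \<sigma> (ivl a)) x - gag \<sigma> (rl \<sigma> (ivl b)) x) = ennreal (gagc \<sigma> * \<bar>a - b\<bar>)"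
      if "a \<ge> 0" "b \<ge> 0" for a b
      unfolding gag_sq_rl_ivl_diff[OF s that, symmetric] gag_sq_def
      by (simp add: gag_diff[symmetric])
  qed (use gagc_pos[OF s] in auto)
  also have "\<dots> = ennreal (gagc \<sigma>) * ennreal (1 * (\<Sum>a\<in>A. \<Sum>b\<in>A. c a * c b * min a b))"
    using gagc_pos[OF s] by (simp add: ennreal_mult')
  also have "ennreal (1 * (\<Sum>a\<in>A. \<Sum>b\<in>A. c a * c b * min a b)) = sqn lborel v"
    unfolding v
  proof (rule sqn_sum_of_increments[symmetric, OF _ _ _ _ A])
    show "sqn lborel (\<lambda>x. ivl a x - ivl b x) = ennreal (1 * \<bar>a - b\<bar>)" if "a \<ge> 0" "b \<ge> 0" for a b
    proof -
      have "sqn lborel (\<lambda>x. ivl a x - ivl b x) = (\<integral>\<^sup>+x. indicator {min a b<..max a b} x \<partial>lborel)"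
        unfolding sqn_def ivl_def using that by (intro nn_integral_cong) (auto simp: indicator_def)
      also have "\<dots> = ennreal (max a b - min a b)" by simp
      also have "max a b - min a b = 1 * \<bar>a - b\<bar>" by auto
      finally show ?thesis .
    qed
  qed (auto simp: ivl_def)
  finally show ?thesis .
qed

section \<open>Two-sided estimate by density\<close>

definition L2half :: "(real \<Rightarrow> real) \<Rightarrow> bool" where
  "L2half v \<longleftrightarrow> v \<in> borel_measurable borel \<and> (\<forall>t\<le>0. v t = 0) \<and> sqn lborel v < \<infinity>"

lemma L2halfD:
  assumes "L2half v"
  shows "v \<in> borel_measurable borel" "t \<le> 0 \<Longrightarrow> v t = 0" "sqn lborel v < \<infinity>" "L2loc v"
proof -
  show "v \<in> borel_measurable borel" "t \<le> 0 \<Longrightarrow> v t = 0" "sqn lborel v < \<infinity>"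
    using assms by (auto simp: L2half_def)
  have "sqn lborel (\<lambda>t. indicator {..R} t * v t) \<le> sqn lborel v" for R
    by (rule sqn_mono) (auto simp: indicator_def)
  then show "L2loc v" using assms unfolding L2half_def L2loc_def
    by (auto intro: le_less_trans)
qed

lemma L2half_lincomb:
  assumes v: "L2half v" and w: "L2half w"
  shows "L2half (\<lambda>t. x * v t + y * w t)"
  unfolding L2half_def
proof (intro conjI allI impI)
  note [measurable] = L2halfD(1)[OF v] L2halfD(1)[OF w]
  show "(\<lambda>t. x * v t + y * w t) \<in> borel_measurable borel" by simp
  show "x * v t + y * w t = 0" if "t \<le> 0" for t using L2halfD(2)[OF v that] L2halfD(2)[OF w that] by simp
  have "sqn lborel (\<lambda>t. x * v t + y * w t) \<le> 2 * sqn lborel (\<lambda>t. x * v t) + 2 * sqn lborel (\<lambda>t. y * w t)"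
    by (rule sqn_add_le) auto
  also have "\<dots> < \<infinity>" using L2halfD(3)[OF v] L2halfD(3)[OF w]
    by (simp add: sqn_cmult ennreal_mult_less_top)
  finally show "sqn lborel (\<lambda>t. x * v t + y * w t) < \<infinity>" .
qed

lemma L2half_diff: "L2half v \<Longrightarrow> L2half w \<Longrightarrow> L2half (\<lambda>t. v t - w t)"
  using L2half_lincomb[of v w 1 "-1"] by simp

lemma step_L2half:
  assumes "step v"
  shows "L2half v"
proof -
  obtain A c where A: "finite A" "A \<subseteq> {0..}" "v = (\<lambda>t. \<Sum>a\<in>A. c a * ivl a t)"
    using assms unfolding step_def by blast
  have ivl: "L2half (ivl a)" for a
    using sqn_ivl[of a] by (auto simp: L2half_def) (auto simp: ivl_def)
  have "L2half (\<lambda>t. \<Sum>a\<in>A. c a * ivl a t)"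
    using A(1)
  proof (induction A rule: finite_induct)
    case empty
    then show ?case by (simp add: L2half_def sqn_def)
  next
    case (insert a A)
    then show ?case using L2half_lincomb[OF ivl[of a], of "\<lambda>t. \<Sum>a\<in>A. c a * ivl a t" "c a" 1] by simp
  qed
  then show ?thesis by (simp add: A(3))
qed

lemma L2half_step_approx:
  assumes "L2half v" "e > 0"
  obtains w where "step w" "sqn lborel (\<lambda>t. v t - w t) \<le> ennreal e"
  using step_closure_L2[of v] assms unfolding L2half_def step_closure_def by blast

text \<open>
  The form in which approximation arguments conclude: an error \<open>c e\<close> with finite \<open>c\<close> is
  dropped.
\<close>

lemma ennreal_le_of_all_pos:
  fixes x y :: ennreal
  assumes c: "c < \<infinity>" and le: "\<And>e::real. e > 0 \<Longrightarrow> x \<le> y + c * ennreal e"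
  shows "x \<le> y"
proof (rule ennreal_le_epsilon)
  fix e :: real assume e: "e > 0"
  define k where "k = enn2real c"
  have k: "c = ennreal k" "k \<ge> 0" using c by (auto simp: k_def)
  have "c * ennreal (e / (1 + k)) = ennreal (k * (e / (1 + k)))"
    unfolding k(1) by (rule ennreal_mult[symmetric]) (use k e in auto)
  also have "\<dots> \<le> ennreal e" using k e by (intro ennreal_leI) (simp add: field_simps)
  finally have "y + c * ennreal (e / (1 + k)) \<le> y + ennreal e" by (rule add_left_mono)
  moreover have "x \<le> y + c * ennreal (e / (1 + k))" using k e by (intro le) auto
  ultimately show "x \<le> y + ennreal e" by (rule order.trans[rotated])
qed

text \<open>
  Step functions converging fast to $v$ have fractional integrals that converge almost
  everywhere, so Fatou's lemma transfers the isometry as an inequality. The constant \<open>2\<close>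
  absorbs the passage from the approximants to $v$.
\<close>

lemma rl_gag_upper:
  assumes s: "0 < \<sigma>" "\<sigma> < 1" and v: "L2half v"
  shows "gag_sq \<sigma> (rl \<sigma> v) \<le> ennreal (2 * gagc \<sigma>) * sqn lborel v"
proof -
  note [measurable] = L2halfD(1)[OF v]
  \<comment> \<open>A bound for the squared norm of $J^\sigma$ on \<open>(0,n)\<close>. The approximants are chosen close
    enough to outweigh its growth, so the fractional integrals converge on every bounded
    interval.\<close>
  define K where "K n = (real n powr \<sigma> / Gamma (\<sigma> + 1))\<^sup>2" for n :: nat
  have K: "K n \<ge> 0" for n by (simp add: K_def)
  have "\<exists>w. step w \<and> sqn lborel (\<lambda>t. v t - w t) \<le> ennreal ((1/8)^n / (1 + K n))" for n
    by (rule L2half_step_approx[OF v, of "(1/8)^n / (1 + K n)"]) (use K[of n] in \<open>auto intro!: divide_pos_pos\<close>)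
  then obtain w where w: "\<And>n. step (w n)" "\<And>n. sqn lborel (\<lambda>t. v t - w n t) \<le> ennreal ((1/8)^n / (1 + K n))"
    by metis
  have wh: "L2half (w n)" for n by (rule step_L2half[OF w(1)])
  have [measurable]: "w n \<in> borel_measurable borel" for n by (rule L2halfD(1)[OF wh])
  have d1: "sqn lborel (\<lambda>t. v t - w n t) \<le> ennreal ((1/8)^n)" for n
  proof (rule order.trans[OF w(2) ennreal_leI])
    have "(1/8 :: real)^n / (1 + K n) \<le> (1/8)^n / 1" using K[of n] by (intro divide_left_mono) auto
    then show "(1/8 :: real)^n / (1 + K n) \<le> (1/8)^n" by simp
  qed
  have d2: "sqn lborel (\<lambda>t. indicator {..real n} t * (rl \<sigma> (w n) t - rl \<sigma> v t) - 0) \<le> ennreal ((1/8)^n)" for n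
  proof -
    have "AE t in lborel. indicator {..real n} t * (rl \<sigma> (w n) t - rl \<sigma> v t) - 0 = indicator {..real n} t * rl \<sigma> (\<lambda>t. w n t - v t) t"
      using rl_diff_AE[OF s(1) L2halfD(4)[OF wh[of n]] L2halfD(4)[OF v]] by eventually_elim simp
    then have "sqn lborel (\<lambda>t. indicator {..real n} t * (rl \<sigma> (w n) t - rl \<sigma> v t) - 0)
        = sqn lborel (\<lambda>t. indicator {..real n} t * rl \<sigma> (\<lambda>t. w n t - v t) t)"
      by (rule sqn_cong_AE)
    also have "\<dots> \<le> ennreal (K n) * sqn lborel (\<lambda>t. indicator {..real n} t * (w n t - v t))"
      unfolding K_def by (rule rl_sqn_le) (use s L2halfD(2)[OF v] L2halfD(2)[OF wh] in auto)
    also have "\<dots> \<le> ennreal (K n) * sqn lborel (\<lambda>t. w n t - v t)"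
      by (intro mult_left_mono sqn_mono) (auto simp: indicator_def)
    also have "\<dots> \<le> ennreal (K n) * ennreal ((1/8)^n / (1 + K n))"
      by (subst sqn_diff_commute) (intro mult_left_mono w, simp)
    also have "\<dots> = ennreal (K n * ((1/8)^n / (1 + K n)))"
      by (rule ennreal_mult[symmetric]) (use K[of n] in auto)
    also have "\<dots> \<le> ennreal ((1/8)^n)"
    proof (rule ennreal_leI)
      have "K n / (1 + K n) \<le> 1" using K[of n] by simp
      then have "(1/8)^n * (K n / (1 + K n)) \<le> (1/8 :: real)^n * 1" by (rule mult_left_mono) simp
      then show "K n * ((1/8)^n / (1 + K n)) \<le> (1/8)^n" by (simp add: mult.commute)
    qed
    finally show ?thesis .
  qed
  have "AE t in lborel. (\<lambda>n. indicator {..real n} t * (rl \<sigma> (w n) t - rl \<sigma> v t)) \<longlonglongrightarrow> 0"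
    by (rule sqn_fast_AE_lim[OF _ _ d2]) auto
  then have lim: "AE t in lborel. (\<lambda>n. rl \<sigma> (w n) t) \<longlonglongrightarrow> rl \<sigma> v t"
  proof eventually_elim
    case (elim t)
    have "eventually (\<lambda>n. indicator {..real n} t * (rl \<sigma> (w n) t - rl \<sigma> v t) = rl \<sigma> (w n) t - rl \<sigma> v t) sequentially"
      using eventually_ge_at_top[of "nat \<lceil>t\<rceil>"]
    proof eventually_elim
      case (elim n)
      then have "t \<le> real n" by linarith
      then show ?case by simp
    qed
    with elim have "(\<lambda>n. rl \<sigma> (w n) t - rl \<sigma> v t) \<longlonglongrightarrow> 0" by (rule Lim_transform_eventually)
    then show ?case by (simp add: LIM_zero_iff)
  qed
  have glim: "AE x in lborel \<Otimes>\<^sub>M lborel. (\<lambda>n. gag \<sigma> (rl \<sigma> (w n)) x) \<longlonglongrightarrow> gag \<sigma> (rl \<sigma> v) x"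
    using AE_lborel_pair[OF lim]
  proof eventually_elim
    case (elim x)
    then show ?case unfolding gag_def split_beta' divide_inverse
      by (intro tendsto_mult tendsto_diff tendsto_const) auto
  qed
  have c: "gagc \<sigma> > 0" by (rule gagc_pos[OF s])
  show ?thesis
  proof (rule ennreal_le_of_all_pos[where c="ennreal (2 * gagc \<sigma>)"])
    fix e :: real assume e: "e > 0"
    obtain N where N: "(1/8 :: real)^N < e" using real_arch_pow_inv[of e "1/8"] e by auto
    show "gag_sq \<sigma> (rl \<sigma> v) \<le> ennreal (2 * gagc \<sigma>) * sqn lborel v + ennreal (2 * gagc \<sigma>) * ennreal e"
      unfolding gag_sq_def
    proof (rule sqn_lim_le[OF _ glim])
      fix n assume n: "n \<ge> N"
      have "sqn lborel (w n) \<le> 2 * sqn lborel v + 2 * sqn lborel (\<lambda>t. w n t - v t)"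
        by (rule sqn_le_add_diff) auto
      also have "sqn lborel (\<lambda>t. w n t - v t) \<le> ennreal e"
      proof -
        have "(1/8 :: real)^n \<le> (1/8)^N" using n by (intro power_decreasing) auto
        then have "ennreal ((1/8)^n) \<le> ennreal e" using N by (intro ennreal_leI) linarith
        then show ?thesis using d1[of n] by (subst sqn_diff_commute) (rule order.trans)
      qed
      finally have "sqn lborel (w n) \<le> 2 * sqn lborel v + 2 * ennreal e" by (simp add: mult_left_mono)
      then have "ennreal (gagc \<sigma>) * sqn lborel (w n) \<le> ennreal (gagc \<sigma>) * (2 * sqn lborel v + 2 * ennreal e)"
        by (rule mult_left_mono) simp
      also have "\<dots> = (ennreal (gagc \<sigma>) * ennreal 2) * sqn lborel v + (ennreal (gagc \<sigma>) * ennreal 2) * ennreal e"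
        by (simp only: distrib_left mult.assoc ennreal_numeral)
      also have "ennreal (gagc \<sigma>) * ennreal 2 = ennreal (2 * gagc \<sigma>)"
        using c by (simp add: ennreal_mult[symmetric] mult.commute del: ennreal_numeral)
      finally show "sqn (lborel \<Otimes>\<^sub>M lborel) (gag \<sigma> (rl \<sigma> (w n))) \<le> ennreal (2 * gagc \<sigma>) * sqn lborel v + ennreal (2 * gagc \<sigma>) * ennreal e"
        using rl_step_isometry[OF s w(1)] by (simp add: gag_sq_def)
    qed simp
  qed simp
qed

text \<open>
  For a step function close to $v$ the isometry bounds its norm from below, and the upper
  estimate controls the difference. The constant \<open>4\<close> comes from two applications of
  $|x+y|^2 \le 2|x|^2 + 2|y|^2$.
\<close>

lemma rl_gag_lower:
  assumes s: "0 < \<sigma>" "\<sigma> < 1" and v: "L2half v"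
  shows "ennreal (gagc \<sigma>) * sqn lborel v \<le> 4 * gag_sq \<sigma> (rl \<sigma> v)"
proof (rule ennreal_le_of_all_pos[where c="ennreal (10 * gagc \<sigma>)"])
  note [measurable] = L2halfD(1)[OF v]
  have c: "gagc \<sigma> > 0" by (rule gagc_pos[OF s])
  fix e :: real assume e: "e > 0"
  obtain w where w: "step w" "sqn lborel (\<lambda>t. v t - w t) \<le> ennreal e"
    using L2half_step_approx[OF v e] by blast
  note wh = step_L2half[OF w(1)]
  note [measurable] = L2halfD(1)[OF wh]
  have w': "sqn lborel (\<lambda>t. w t - v t) \<le> ennreal e" using w(2) by (subst sqn_diff_commute)
  have "gag_sq \<sigma> (rl \<sigma> w) \<le> 2 * gag_sq \<sigma> (rl \<sigma> v) + 2 * sqn (lborel \<Otimes>\<^sub>M lborel) (\<lambda>x. gag \<sigma> (rl \<sigma> w) x - gag \<sigma> (rl \<sigma> v) x)"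
    unfolding gag_sq_def by (rule sqn_le_add_diff) auto
  also have "sqn (lborel \<Otimes>\<^sub>M lborel) (\<lambda>x. gag \<sigma> (rl \<sigma> w) x - gag \<sigma> (rl \<sigma> v) x) = gag_sq \<sigma> (\<lambda>t. rl \<sigma> w t - rl \<sigma> v t)"
    unfolding gag_sq_def by (simp add: gag_diff[symmetric])
  also have "\<dots> = gag_sq \<sigma> (rl \<sigma> (\<lambda>t. w t - v t))"
    by (rule gag_sq_cong_AE) (use rl_diff_AE[OF s(1) L2halfD(4)[OF wh] L2halfD(4)[OF v]] in \<open>auto elim: eventually_mono\<close>)
  also have "\<dots> \<le> ennreal (2 * gagc \<sigma>) * sqn lborel (\<lambda>t. w t - v t)"
    by (rule rl_gag_upper[OF s L2half_diff[OF wh v]])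
  also have "\<dots> \<le> ennreal (2 * gagc \<sigma>) * ennreal e" by (intro mult_left_mono w') simp
  finally have 1: "gag_sq \<sigma> (rl \<sigma> w) \<le> 2 * gag_sq \<sigma> (rl \<sigma> v) + 2 * (ennreal (2 * gagc \<sigma>) * ennreal e)"
    by (simp add: mult_left_mono)
  have "ennreal (gagc \<sigma>) * sqn lborel v \<le> ennreal (gagc \<sigma>) * (2 * sqn lborel w + 2 * sqn lborel (\<lambda>t. v t - w t))"
    by (intro mult_left_mono sqn_le_add_diff) auto
  also have "\<dots> \<le> ennreal (gagc \<sigma>) * (2 * sqn lborel w + 2 * ennreal e)"
    by (intro mult_left_mono add_left_mono w) auto
  also have "\<dots> = 2 * gag_sq \<sigma> (rl \<sigma> w) + 2 * (ennreal (gagc \<sigma>) * ennreal e)"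
    unfolding rl_step_isometry[OF s w(1)] by (simp add: distrib_left mult.left_commute)
  also have "\<dots> \<le> 2 * (2 * gag_sq \<sigma> (rl \<sigma> v) + 2 * (ennreal (2 * gagc \<sigma>) * ennreal e)) + 2 * (ennreal (gagc \<sigma>) * ennreal e)"
    by (intro add_right_mono mult_left_mono 1) simp
  also have "\<dots> = 4 * gag_sq \<sigma> (rl \<sigma> v) + (4 * (ennreal (2 * gagc \<sigma>) * ennreal e) + 2 * (ennreal (gagc \<sigma>) * ennreal e))"
    by (simp add: distrib_left mult.assoc[symmetric] add.assoc)
  also have "4 * (ennreal (2 * gagc \<sigma>) * ennreal e) + 2 * (ennreal (gagc \<sigma>) * ennreal e) = ennreal (10 * gagc \<sigma>) * ennreal e"
  proof -
    have "ennreal 4 * (ennreal (2 * gagc \<sigma>) * ennreal e) + ennreal 2 * (ennreal (gagc \<sigma>) * ennreal e)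
      = ennreal (4 * (2 * gagc \<sigma> * e) + 2 * (gagc \<sigma> * e))"
      using c e by (simp only: ennreal_mult[symmetric] ennreal_plus mult_nonneg_nonneg less_imp_le zero_le_numeral)
    also have "\<dots> = ennreal (10 * gagc \<sigma>) * ennreal e"
      using c e by (simp add: ennreal_mult[symmetric])
    finally show ?thesis by simp
  qed
  finally show "ennreal (gagc \<sigma>) * sqn lborel v \<le> 4 * gag_sq \<sigma> (rl \<sigma> v) + ennreal (10 * gagc \<sigma>) * ennreal e" .
qed simp

section \<open>The range of the fractional integral\<close>

lemma ivl_average_jensen:
  assumes h: "h > 0" and [measurable]: "f \<in> borel_measurable borel"
  shows "ennreal ((1 / h * (LINT r|lborel. ivl h r * f r))\<^sup>2)
     \<le> (\<integral>\<^sup>+r. ennreal (1 / h * ivl h r) * ennreal ((f r)\<^sup>2) \<partial>lborel)"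
proof (cases "integrable lborel (\<lambda>r. ivl h r * f r)")
  case True
  have i0: "ivl h r \<ge> 0" for r by (simp add: ivl_def)
  have "ennreal \<bar>LINT r|lborel. ivl h r * f r\<bar> \<le> (\<integral>\<^sup>+r. ennreal \<bar>ivl h r * f r\<bar> \<partial>lborel)"
    using integral_norm_bound_ennreal[OF True] by simp
  also have "\<dots> = (\<integral>\<^sup>+r. ennreal (ivl h r) * ennreal (ivl h r * \<bar>f r\<bar>) \<partial>lborel)"
    by (intro nn_integral_cong) (auto simp: ivl_def indicator_def)
  finally have "(ennreal \<bar>LINT r|lborel. ivl h r * f r\<bar>)\<^sup>2 \<le> (\<integral>\<^sup>+r. ennreal (ivl h r) * ennreal (ivl h r * \<bar>f r\<bar>) \<partial>lborel)\<^sup>2"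
    by (rule power_mono) simp
  also have "\<dots> \<le> (\<integral>\<^sup>+r. (ennreal (ivl h r))\<^sup>2 \<partial>lborel) * (\<integral>\<^sup>+r. (ennreal (ivl h r * \<bar>f r\<bar>))\<^sup>2 \<partial>lborel)"
    by (rule Cauchy_Schwarz_nn_integral) auto
  also have "(\<integral>\<^sup>+r. (ennreal (ivl h r))\<^sup>2 \<partial>lborel) = (\<integral>\<^sup>+r. indicator {0<..h} r \<partial>lborel)"
    by (intro nn_integral_cong) (auto simp: ivl_def indicator_def)
  also have "\<dots> = ennreal h" using h by simp
  also have "(\<integral>\<^sup>+r. (ennreal (ivl h r * \<bar>f r\<bar>))\<^sup>2 \<partial>lborel) = (\<integral>\<^sup>+r. ennreal (ivl h r) * ennreal ((f r)\<^sup>2) \<partial>lborel)"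
    by (intro nn_integral_cong) (auto simp: ivl_def indicator_def ennreal_power)
  finally have "ennreal ((1/h)\<^sup>2) * (ennreal \<bar>LINT r|lborel. ivl h r * f r\<bar>)\<^sup>2
     \<le> ennreal ((1/h)\<^sup>2) * (ennreal h * (\<integral>\<^sup>+r. ennreal (ivl h r) * ennreal ((f r)\<^sup>2) \<partial>lborel))"
    by (rule mult_left_mono) simp
  also have "\<dots> = ennreal ((1/h)\<^sup>2 * h) * (\<integral>\<^sup>+r. ennreal (ivl h r) * ennreal ((f r)\<^sup>2) \<partial>lborel)"
    using h by (simp add: ennreal_mult' mult.assoc)
  also have "(1/h)\<^sup>2 * h = 1 / h" using h by (simp add: power2_eq_square)
  also have "ennreal (1 / h) * (\<integral>\<^sup>+r. ennreal (ivl h r) * ennreal ((f r)\<^sup>2) \<partial>lborel)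
      = (\<integral>\<^sup>+r. ennreal (1 / h * ivl h r) * ennreal ((f r)\<^sup>2) \<partial>lborel)"
  proof (subst nn_integral_cmult[symmetric])
    show "(\<integral>\<^sup>+r. ennreal (1 / h) * (ennreal (ivl h r) * ennreal ((f r)\<^sup>2)) \<partial>lborel)
      = (\<integral>\<^sup>+r. ennreal (1 / h * ivl h r) * ennreal ((f r)\<^sup>2) \<partial>lborel)"
    proof (rule nn_integral_cong)
      fix r
      have "ennreal (1 / h * ivl h r) = ennreal (1 / h) * ennreal (ivl h r)" using h by (intro ennreal_mult') simp
      then show "ennreal (1 / h) * (ennreal (ivl h r) * ennreal ((f r)\<^sup>2)) = ennreal (1 / h * ivl h r) * ennreal ((f r)\<^sup>2)"
        by (simp only: mult.assoc)
    qed
  qed simp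
  finally have *: "ennreal ((1/h)\<^sup>2) * (ennreal \<bar>LINT r|lborel. ivl h r * f r\<bar>)\<^sup>2
     \<le> (\<integral>\<^sup>+r. ennreal (1 / h * ivl h r) * ennreal ((f r)\<^sup>2) \<partial>lborel)" .
  have "(1 / h * (LINT r|lborel. ivl h r * f r))\<^sup>2 = (1/h)\<^sup>2 * \<bar>LINT r|lborel. ivl h r * f r\<bar>\<^sup>2"
    by (simp only: power_mult_distrib power2_abs)
  then have "ennreal ((1 / h * (LINT r|lborel. ivl h r * f r))\<^sup>2) = ennreal ((1/h)\<^sup>2) * (ennreal \<bar>LINT r|lborel. ivl h r * f r\<bar>)\<^sup>2"
    by (simp only: ennreal_mult' zero_le_power2 ennreal_power abs_ge_zero)
  with * show ?thesis by (simp only:)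
next
  case False
  then show ?thesis by (simp add: not_integrable_integral_eq)
qed

lemma ivl_average_mass:
  assumes "h > 0" shows "(\<integral>\<^sup>+r. ennreal (1 / h * ivl h r) * c \<partial>lborel) = c"
proof -
  have "(\<integral>\<^sup>+r. ennreal (1 / h * ivl h r) * c \<partial>lborel) = (\<integral>\<^sup>+r. (ennreal (1 / h) * c) * indicator {0<..h} r \<partial>lborel)"
    by (intro nn_integral_cong) (auto simp: ivl_def indicator_def)
  also have "\<dots> = (ennreal (1 / h) * c) * ennreal h" using assms by (simp add: nn_integral_cmult_indicator)
  also have "\<dots> = c * (ennreal (1 / h) * ennreal h)" by (simp only: mult_ac)
  also have "ennreal (1 / h) * ennreal h = 1" using assms by (simp flip: ennreal_mult)
  finally show ?thesis by simp
qed

text \<open>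
  The mean of $u$ over \<open>[t - h, t)\<close>; looking backwards keeps it causal.
\<close>

definition steklov :: "real \<Rightarrow> (real \<Rightarrow> real) \<Rightarrow> real \<Rightarrow> real" where
  "steklov h u t = 1 / h * (LINT r|lborel. ivl h r * u (t - r))"

lemma steklov_measurable [measurable]:
  assumes [measurable]: "u \<in> borel_measurable borel"
  shows "steklov h u \<in> borel_measurable borel"
  unfolding steklov_def by measurable

lemma ivl_mult_integrable:
  assumes "integrable lborel u"
  shows "integrable lborel (\<lambda>r. ivl h r * u (t - r))"
proof -
  have "integrable lborel (\<lambda>r. u (t - r))"
    using lborel_integrable_real_affine_iff[of "-1" u t] assms by simp
  then show ?thesis
    by (rule Bochner_Integration.integrable_bound) (use assms in \<open>auto simp: ivl_def indicator_def\<close>)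
qed

lemma emeasure_lborel_Ioc_eq: "emeasure lborel {a<..b::real} = ennreal (b - a)"
  by (cases "a \<le> b") (auto simp: ennreal_neg)

lemma ivl_integrable: "integrable lborel (\<lambda>r. ivl h r * c)"
  unfolding ivl_def by (intro integrable_mult_left integrable_real_indicator) (auto simp: emeasure_lborel_Ioc_eq)

lemma ivl_integral: "h > 0 \<Longrightarrow> (LINT r|lborel. ivl h r * c) = h * c"
  unfolding ivl_def by simp

text \<open>
  By Jensen's inequality the seminorm of a mean is at most the mean of the seminorms of the
  translates, and these all agree.
\<close>

lemma gag_sq_steklov_le:
  assumes h: "h > 0" and u: "integrable lborel u"
  shows "gag_sq \<sigma> (steklov h u) \<le> gag_sq \<sigma> u"
proof -
  have [measurable]: "u \<in> borel_measurable borel" using u by auto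
  let ?w = "\<lambda>t s :: real. 1 / \<bar>t - s\<bar> powr (1 + 2 * \<sigma>)"
  have pw: "ennreal ((steklov h u t - steklov h u s)\<^sup>2 / \<bar>t - s\<bar> powr (1 + 2 * \<sigma>))
    \<le> (\<integral>\<^sup>+r. ennreal (1 / h * ivl h r) * ennreal ((u (t - r) - u (s - r))\<^sup>2 / \<bar>t - s\<bar> powr (1 + 2 * \<sigma>)) \<partial>lborel)" for t s
  proof -
    have "steklov h u t - steklov h u s = 1 / h * (LINT r|lborel. ivl h r * (u (t - r) - u (s - r)))"
      unfolding steklov_def right_diff_distrib
      by (subst Bochner_Integration.integral_diff) (use u in \<open>auto intro!: ivl_mult_integrable simp: right_diff_distrib\<close>)
    then have "ennreal ((steklov h u t - steklov h u s)\<^sup>2) \<le> (\<integral>\<^sup>+r. ennreal (1 / h * ivl h r) * ennreal ((u (t - r) - u (s - r))\<^sup>2) \<partial>lborel)"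
      using ivl_average_jensen[OF h, of "\<lambda>r. u (t - r) - u (s - r)"] by simp
    then have "ennreal (?w t s) * ennreal ((steklov h u t - steklov h u s)\<^sup>2)
       \<le> ennreal (?w t s) * (\<integral>\<^sup>+r. ennreal (1 / h * ivl h r) * ennreal ((u (t - r) - u (s - r))\<^sup>2) \<partial>lborel)"
      by (rule mult_left_mono) simp
    also have "\<dots> = (\<integral>\<^sup>+r. ennreal (?w t s) * (ennreal (1 / h * ivl h r) * ennreal ((u (t - r) - u (s - r))\<^sup>2)) \<partial>lborel)"
      by (rule nn_integral_cmult[symmetric]) simp
    also have "\<dots> = (\<integral>\<^sup>+r. ennreal (1 / h * ivl h r) * ennreal ((u (t - r) - u (s - r))\<^sup>2 / \<bar>t - s\<bar> powr (1 + 2 * \<sigma>)) \<partial>lborel)"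
      by (intro nn_integral_cong) (simp add: mult.left_commute[of "ennreal (?w t s)"] ennreal_mult'[symmetric])
    finally show ?thesis by (simp add: ennreal_mult'[symmetric])
  qed
  have "gag_sq \<sigma> (steklov h u) = (\<integral>\<^sup>+t. \<integral>\<^sup>+s. ennreal ((steklov h u t - steklov h u s)\<^sup>2 / \<bar>t - s\<bar> powr (1 + 2 * \<sigma>)) \<partial>lborel \<partial>lborel)"
    by (rule gag_sq_iterated) simp
  also have "\<dots> \<le> (\<integral>\<^sup>+t. \<integral>\<^sup>+s. (\<integral>\<^sup>+r. ennreal (1 / h * ivl h r) * ennreal ((u (t - r) - u (s - r))\<^sup>2 / \<bar>t - s\<bar> powr (1 + 2 * \<sigma>)) \<partial>lborel) \<partial>lborel \<partial>lborel)"
    by (intro nn_integral_mono pw)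
  also have "\<dots> = (\<integral>\<^sup>+t. \<integral>\<^sup>+r. (\<integral>\<^sup>+s. ennreal (1 / h * ivl h r) * ennreal ((u (t - r) - u (s - r))\<^sup>2 / \<bar>t - s\<bar> powr (1 + 2 * \<sigma>)) \<partial>lborel) \<partial>lborel \<partial>lborel)"
    by (intro nn_integral_cong lborel_pair.Fubini') simp
  also have "\<dots> = (\<integral>\<^sup>+r. \<integral>\<^sup>+t. (\<integral>\<^sup>+s. ennreal (1 / h * ivl h r) * ennreal ((u (t - r) - u (s - r))\<^sup>2 / \<bar>t - s\<bar> powr (1 + 2 * \<sigma>)) \<partial>lborel) \<partial>lborel \<partial>lborel)"
    by (rule lborel_pair.Fubini') simp
  also have "\<dots> = (\<integral>\<^sup>+r. ennreal (1 / h * ivl h r) * gag_sq \<sigma> u \<partial>lborel)"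
  proof (rule nn_integral_cong)
    fix r
    have "(\<integral>\<^sup>+t. (\<integral>\<^sup>+s. ennreal (1 / h * ivl h r) * ennreal ((u (t - r) - u (s - r))\<^sup>2 / \<bar>t - s\<bar> powr (1 + 2 * \<sigma>)) \<partial>lborel) \<partial>lborel)
      = ennreal (1 / h * ivl h r) * (\<integral>\<^sup>+t. (\<integral>\<^sup>+s. ennreal ((u (t - r) - u (s - r))\<^sup>2 / \<bar>t - s\<bar> powr (1 + 2 * \<sigma>)) \<partial>lborel) \<partial>lborel)"
    proof -
      let ?f = "\<lambda>t s. ennreal ((u (t - r) - u (s - r))\<^sup>2 / \<bar>t - s\<bar> powr (1 + 2 * \<sigma>))"
      have "(\<integral>\<^sup>+s. ennreal (1 / h * ivl h r) * ?f t s \<partial>lborel) = ennreal (1 / h * ivl h r) * (\<integral>\<^sup>+s. ?f t s \<partial>lborel)" for t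
        by (rule nn_integral_cmult) simp
      moreover have "(\<integral>\<^sup>+t. ennreal (1 / h * ivl h r) * (\<integral>\<^sup>+s. ?f t s \<partial>lborel) \<partial>lborel)
        = ennreal (1 / h * ivl h r) * (\<integral>\<^sup>+t. (\<integral>\<^sup>+s. ?f t s \<partial>lborel) \<partial>lborel)"
        by (rule nn_integral_cmult) simp
      ultimately show ?thesis by (simp only:)
    qed
    also have "(\<integral>\<^sup>+t. (\<integral>\<^sup>+s. ennreal ((u (t - r) - u (s - r))\<^sup>2 / \<bar>t - s\<bar> powr (1 + 2 * \<sigma>)) \<partial>lborel) \<partial>lborel) = gag_sq \<sigma> (\<lambda>t. u (t + - r))"
      by (subst gag_sq_iterated) simp_all
    also have "\<dots> = gag_sq \<sigma> u" by (rule gag_sq_shift) simp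
    finally show "(\<integral>\<^sup>+t. (\<integral>\<^sup>+s. ennreal (1 / h * ivl h r) * ennreal ((u (t - r) - u (s - r))\<^sup>2 / \<bar>t - s\<bar> powr (1 + 2 * \<sigma>)) \<partial>lborel) \<partial>lborel)
      = ennreal (1 / h * ivl h r) * gag_sq \<sigma> u" .
  qed
  also have "\<dots> = gag_sq \<sigma> u" by (rule ivl_average_mass[OF h])
  finally show ?thesis .
qed

lemma ennreal_le_double: "(x :: ennreal) \<le> 2 * x"
  unfolding mult_2 by simp

text \<open>
  The difference is a mean of increments of step \<open>r \<le> h\<close>, and on this range the weight $1/h$
  is at most $h^{2\sigma} r^{-1-2\sigma}$.
\<close>

lemma steklov_approx:
  assumes s: "0 < \<sigma>" and h: "h > 0" and u: "integrable lborel u"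
  shows "sqn lborel (\<lambda>t. steklov h u t - u t) \<le> ennreal (h powr (2 * \<sigma>)) * gag_sq \<sigma> u"
proof -
  have [measurable]: "u \<in> borel_measurable borel" using u by auto
  let ?D = "\<lambda>r. sqn lborel (\<lambda>t. u (t + r) - u t)"
  have D: "(\<integral>\<^sup>+t. ennreal ((u (t - r) - u t)\<^sup>2) \<partial>lborel) = ?D r" for r
    using nn_integral_shift[of "\<lambda>t. ennreal ((u (t - r) - u t)\<^sup>2)" r] unfolding sqn_def
    by (simp add: power2_commute)
  have pw: "ennreal ((steklov h u t - u t)\<^sup>2) \<le> (\<integral>\<^sup>+r. ennreal (1 / h * ivl h r) * ennreal ((u (t - r) - u t)\<^sup>2) \<partial>lborel)" for t
  proof -
    have "steklov h u t - u t = 1 / h * (LINT r|lborel. ivl h r * (u (t - r) - u t))"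
    proof -
      have "(LINT r|lborel. ivl h r * (u (t - r) - u t)) = (LINT r|lborel. ivl h r * u (t - r)) - (LINT r|lborel. ivl h r * u t)"
        unfolding right_diff_distrib by (rule Bochner_Integration.integral_diff[OF ivl_mult_integrable[OF u] ivl_integrable])
      also have "(LINT r|lborel. ivl h r * u t) = h * u t" by (rule ivl_integral[OF h])
      finally show ?thesis using h by (simp add: steklov_def diff_divide_distrib)
    qed
    then show ?thesis using ivl_average_jensen[OF h, of "\<lambda>r. u (t - r) - u t"] by simp
  qed
  have w: "ennreal (1 / h * ivl h r) * ?D r \<le> ennreal (h powr (2 * \<sigma>)) * (ennreal (r powr - (1 + 2 * \<sigma>)) * ?D r * indicator {0<..} r)" for r
  proof (cases "0 < r \<and> r \<le> h")
    case True
    have "1 / h = h powr (2 * \<sigma>) * h powr - (1 + 2 * \<sigma>)"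
      unfolding powr_add[symmetric] using h by (simp add: powr_minus_divide)
    also have "\<dots> \<le> h powr (2 * \<sigma>) * r powr - (1 + 2 * \<sigma>)"
      using True s by (intro mult_left_mono powr_mono2') auto
    finally have "ennreal (1 / h) * ?D r \<le> ennreal (h powr (2 * \<sigma>) * r powr - (1 + 2 * \<sigma>)) * ?D r"
      by (intro mult_right_mono ennreal_leI) auto
    then show ?thesis using True by (simp add: ivl_def ennreal_mult mult.assoc)
  next
    case False
    then have "ivl h r = 0" by (auto simp: ivl_def)
    then show ?thesis by simp
  qed
  have "sqn lborel (\<lambda>t. steklov h u t - u t) \<le> (\<integral>\<^sup>+t. \<integral>\<^sup>+r. ennreal (1 / h * ivl h r) * ennreal ((u (t - r) - u t)\<^sup>2) \<partial>lborel \<partial>lborel)"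
    unfolding sqn_def by (intro nn_integral_mono pw)
  also have "\<dots> = (\<integral>\<^sup>+r. \<integral>\<^sup>+t. ennreal (1 / h * ivl h r) * ennreal ((u (t - r) - u t)\<^sup>2) \<partial>lborel \<partial>lborel)"
    by (rule lborel_pair.Fubini') simp
  also have "\<dots> = (\<integral>\<^sup>+r. ennreal (1 / h * ivl h r) * ?D r \<partial>lborel)"
    by (intro nn_integral_cong) (simp add: nn_integral_cmult D)
  also have "\<dots> \<le> (\<integral>\<^sup>+r. ennreal (h powr (2 * \<sigma>)) * (ennreal (r powr - (1 + 2 * \<sigma>)) * ?D r * indicator {0<..} r) \<partial>lborel)"
    by (intro nn_integral_mono w)
  also have "\<dots> = ennreal (h powr (2 * \<sigma>)) * (\<integral>\<^sup>+r. ennreal (r powr - (1 + 2 * \<sigma>)) * ?D r * indicator {0<..} r \<partial>lborel)"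
    unfolding sqn_def by (rule nn_integral_cmult) measurable
  also have "\<dots> \<le> ennreal (h powr (2 * \<sigma>)) * gag_sq \<sigma> u"
    unfolding gag_sq_by_differences[OF \<open>u \<in> borel_measurable borel\<close>]
    by (intro mult_left_mono ennreal_le_double) simp
  finally show ?thesis .
qed

lemma L2_compact_integrable:
  assumes v: "L2half v" and R: "\<And>t. t > R \<Longrightarrow> v t = 0"
  shows "integrable lborel v"
proof (rule Bochner_Integration.integrable_bound)
  note [measurable] = L2halfD(1)[OF v]
  show "integrable lborel (\<lambda>t. (v t)\<^sup>2 + ivl R t * 1)"
    by (intro Bochner_Integration.integrable_add sqn_finite_integrable ivl_integrable L2halfD(3)[OF v]) simp
  show "v \<in> borel_measurable lborel" by simp
  show "AE t in lborel. norm (v t) \<le> norm ((v t)\<^sup>2 + ivl R t * 1)"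
  proof (rule AE_I2)
    fix t
    have "\<bar>v t\<bar> \<le> (v t)\<^sup>2 + 1"
    proof -
      have "0 \<le> (\<bar>v t\<bar> - 1/2)\<^sup>2" by simp
      then show ?thesis by (simp add: power2_eq_square algebra_simps abs_if split: if_splits)
    qed
    then show "norm (v t) \<le> norm ((v t)\<^sup>2 + ivl R t * 1)"
      using L2halfD(2)[OF v, of t] R[of t] by (cases "0 < t \<and> t \<le> R") (auto simp: ivl_def)
  qed
qed

lemma rl_1: "rl 1 v t = (LINT s|lborel. indicator {..<t} s * v s)"
  unfolding rl_def by (intro Bochner_Integration.integral_cong refl) (auto simp: kern_1 indicator_def)

lemma integrable_indicator_mult:
  fixes u :: "real \<Rightarrow> real"
  assumes "integrable lborel u" "A \<in> sets borel"
  shows "integrable lborel (\<lambda>s. indicator A s * u s)"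
  by (rule Bochner_Integration.integrable_bound[OF assms(1)]) (use assms in \<open>auto simp: indicator_def\<close>)

text \<open>
  Telescoping: integrating $u(t) - u(t-h)$ up to time \<open>t\<close> leaves the integral of $u$ over the
  last interval of length \<open>h\<close>.
\<close>

lemma rl_1_difference_quotient:
  assumes h: "h > 0" and u: "integrable lborel u"
  shows "rl 1 (\<lambda>t. (u t - u (t - h)) / h) t = steklov h u t"
proof -
  have [measurable]: "u \<in> borel_measurable borel" using u by auto
  have uh: "integrable lborel (\<lambda>s. u (s - h))"
    using lborel_integrable_real_affine_iff[of 1 u "- h"] u by simp
  have "rl 1 (\<lambda>t. (u t - u (t - h)) / h) t = 1 / h * rl 1 (\<lambda>t. u t - u (t - h)) t"
    using rl_cmult[of 1 "1 / h" "\<lambda>t. u t - u (t - h)" t] by simp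
  also have "rl 1 (\<lambda>t. u t - u (t - h)) t
     = (LINT s|lborel. indicator {..<t} s * u s) - (LINT s|lborel. indicator {..<t} s * u (s - h))"
    unfolding rl_1 right_diff_distrib
    by (rule Bochner_Integration.integral_diff) (use u uh in \<open>auto intro!: integrable_indicator_mult\<close>)
  also have "(LINT s|lborel. indicator {..<t} s * u (s - h)) = (LINT s|lborel. indicator {..<t - h} s * u s)"
  proof -
    have "(LINT s|lborel. indicator {..<t} s * u (s - h)) = (LINT s|lborel. indicator {..<t} (h + 1 * s) * u (h + 1 * s - h))"
      using lborel_integral_real_affine[of 1 "\<lambda>s. indicator {..<t} s * u (s - h)" h] by simp
    also have "\<dots> = (LINT s|lborel. indicator {..<t - h} s * u s)"
      by (intro Bochner_Integration.integral_cong refl) (auto simp: indicator_def)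
    finally show ?thesis .
  qed
  also have "(LINT s|lborel. indicator {..<t} s * u s) - (LINT s|lborel. indicator {..<t - h} s * u s)
      = (LINT s|lborel. indicator {..<t} s * u s - indicator {..<t - h} s * u s)"
    by (rule Bochner_Integration.integral_diff[symmetric]) (use u in \<open>auto intro!: integrable_indicator_mult\<close>)
  also have "\<dots> = (LINT s|lborel. ivl h (t - s) * u s)"
    using h by (intro Bochner_Integration.integral_cong refl) (auto simp: indicator_def ivl_def)
  also have "\<dots> = (LINT r|lborel. ivl h r * u (t - r))"
    using lborel_integral_real_affine[of "-1" "\<lambda>s. ivl h (t - s) * u s" t] by simp
  finally show ?thesis by (simp only: steklov_def)
qed

text \<open>
  The mean value theorem; the hypothesis \<open>2 R \<le> t\<close> keeps \<open>t - s\<close> above \<open>t / 2\<close>.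
\<close>

lemma kern_difference_bound:
  assumes a: "0 < a" "a < 1" and s: "0 < s" "s \<le> R" and t: "2 * R \<le> t"
  shows "\<bar>kern a (t - s) - kern a t\<bar> \<le> 2 * R / Gamma a * t powr (a - 2)"
proof -
  have G: "Gamma a > 0" using a by (intro Gamma_real_pos) auto
  define x where "x = s / t"
  have t0: "t > 0" using s t by linarith
  have x: "0 < x" "x \<le> 1/2" using s t t0 by (auto simp: x_def field_simps)
  have ts: "t - s = t * (1 - x)" using t0 by (simp add: x_def right_diff_distrib)
  have lo: "1 \<le> (1 - x) powr (a - 1)"
    using powr_mono2'[of "a - 1" "1 - x" 1] x a by simp
  have "(1 - x) powr (a - 1) \<le> (1 - x) powr (- 1)" using x a by (intro powr_mono') auto
  also have "\<dots> = 1 / (1 - x)" using x by (simp add: powr_minus_divide)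
  also have "\<dots> \<le> 1 + 2 * x"
  proof -
    have "x * x \<le> x * (1/2)" using x by (intro mult_left_mono) auto
    then show ?thesis using x by (simp add: divide_simps algebra_simps)
  qed
  finally have up: "(1 - x) powr (a - 1) - 1 \<le> 2 * x" by simp
  have "kern a (t - s) - kern a t = t powr (a - 1) / Gamma a * ((1 - x) powr (a - 1) - 1)"
  proof -
    have "(t - s) powr (a - 1) = t powr (a - 1) * (1 - x) powr (a - 1)"
      unfolding ts by (rule powr_mult)
    moreover have "t - s > 0" using s t by linarith
    ultimately show ?thesis using t0 by (simp add: kern_def right_diff_distrib diff_divide_distrib)
  qed
  then have "\<bar>kern a (t - s) - kern a t\<bar> = t powr (a - 1) / Gamma a * ((1 - x) powr (a - 1) - 1)"
    using lo G by (simp add: abs_mult)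
  also have "\<dots> \<le> t powr (a - 1) / Gamma a * (2 * x)"
    using up G by (intro mult_left_mono) auto
  also have "\<dots> \<le> t powr (a - 1) / Gamma a * (2 * (R / t))"
    using s t0 G by (intro mult_left_mono) (auto simp: x_def divide_right_mono)
  also have "\<dots> = 2 * R / Gamma a * (t powr (a - 1) * t powr (- 1))"
    using t0 by (simp add: powr_minus_divide)
  also have "t powr (a - 1) * t powr (- 1) = t powr (a - 2)"
    unfolding powr_add[symmetric] by simp
  finally show ?thesis .
qed

text \<open>
  Since $q$ has mean zero, $k(t)$ may be subtracted from the kernel $k(t-s)$. This improves
  the decay of the fractional integral from $t^{a-1}$, which need not be square integrable, to
  $t^{a-2}$.
\<close>

lemma rl_decay:
  assumes a: "0 < a" "a < 1" and q: "integrable lborel q" and q0: "\<And>s. s \<le> 0 \<or> s > R \<Longrightarrow> q s = 0"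
    and mean: "(LINT s|lborel. q s) = 0" and t: "2 * R \<le> t"
  shows "\<bar>rl a q t\<bar> \<le> 2 * R / Gamma a * t powr (a - 2) * (LINT s|lborel. \<bar>q s\<bar>)"
proof -
  have [measurable]: "q \<in> borel_measurable borel" using q by auto
  let ?B = "2 * R / Gamma a * t powr (a - 2)"
  have pw: "\<bar>(kern a (t - s) - kern a t) * q s\<bar> \<le> ?B * \<bar>q s\<bar>" for s
  proof (cases "0 < s \<and> s \<le> R")
    case True
    then show ?thesis unfolding abs_mult
      using kern_difference_bound[OF a _ _ t] by (intro mult_right_mono) auto
  next
    case False
    then show ?thesis using q0[of s] by auto
  qed
  have iB: "integrable lborel (\<lambda>s. ?B * \<bar>q s\<bar>)" using q by (intro integrable_mult_right integrable_abs)
  have i: "integrable lborel (\<lambda>s. (kern a (t - s) - kern a t) * q s)"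
    by (rule Bochner_Integration.integrable_bound[OF iB]) (measurable, intro AE_I2, metis pw real_norm_def abs_ge_self order.trans)
  have "(LINT s|lborel. (kern a (t - s) - kern a t) * q s + kern a t * q s)
      = (LINT s|lborel. (kern a (t - s) - kern a t) * q s) + (LINT s|lborel. kern a t * q s)"
    using i q by (intro Bochner_Integration.integral_add integrable_mult_right)
  then have "rl a q t = (LINT s|lborel. (kern a (t - s) - kern a t) * q s)"
    unfolding rl_def using mean by (simp add: left_diff_distrib)
  then have "\<bar>rl a q t\<bar> \<le> (LINT s|lborel. \<bar>(kern a (t - s) - kern a t) * q s\<bar>)"
    by (simp only: integral_abs_bound)
  also have "\<dots> \<le> (LINT s|lborel. ?B * \<bar>q s\<bar>)"
    using i iB pw by (intro integral_mono integrable_abs)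
  also have "\<dots> = ?B * (LINT s|lborel. \<bar>q s\<bar>)" by (rule integral_mult_right_zero)
  finally show ?thesis .
qed

lemma rl_L2half:
  assumes a: "0 < a" "a < 1" and q: "L2half q" and R: "R > 0" "\<And>s. s > R \<Longrightarrow> q s = 0"
    and mean: "(LINT s|lborel. q s) = 0"
  shows "L2half (rl a q)"
proof -
  note qm [measurable] = L2halfD(1)[OF q]
  have qi: "integrable lborel q" by (rule L2_compact_integrable[OF q R(2)])
  have ll: "L2loc (rl a q)" by (rule L2loc_rl[OF a(1) L2halfD(4)[OF q]])
  define C where "C = 2 * R / Gamma a * (LINT s|lborel. \<bar>q s\<bar>)"
  have pw: "ennreal ((rl a q t)\<^sup>2) \<le> ennreal ((indicator {..2*R} t * rl a q t)\<^sup>2) + ennreal (C\<^sup>2) * (ennreal (t powr (2 * a - 4)) * indicator {2*R..} t)" for t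
  proof (cases "t \<le> 2 * R")
    case False
    then have "\<bar>rl a q t\<bar> \<le> 2 * R / Gamma a * t powr (a - 2) * (LINT s|lborel. \<bar>q s\<bar>)"
      by (intro rl_decay[OF a qi _ mean]) (use L2halfD(2)[OF q] R in auto)
    also have "\<dots> = C * t powr (a - 2)" by (simp add: C_def)
    finally have "\<bar>rl a q t\<bar>\<^sup>2 \<le> (C * t powr (a - 2))\<^sup>2" by (rule power_mono) simp
    also have "\<dots> = C\<^sup>2 * t powr (2 * a - 4)"
      unfolding power_mult_distrib power2_eq_square[of "t powr (a - 2)"] powr_add[symmetric] by simp
    finally show ?thesis using False by (simp add: ennreal_mult'[symmetric] ennreal_leI)
  qed simp
  have "sqn lborel (rl a q) \<le> (\<integral>\<^sup>+t. ennreal ((indicator {..2*R} t * rl a q t)\<^sup>2) + ennreal (C\<^sup>2) * (ennreal (t powr (2 * a - 4)) * indicator {2*R..} t) \<partial>lborel)"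
    unfolding sqn_def by (intro nn_integral_mono pw)
  also have "\<dots> = sqn lborel (\<lambda>t. indicator {..2*R} t * rl a q t) + ennreal (C\<^sup>2) * (\<integral>\<^sup>+t. ennreal (t powr (2 * a - 4)) * indicator {2*R..} t \<partial>lborel)"
    unfolding sqn_def by (simp add: nn_integral_add nn_integral_cmult)
  also have "\<dots> < \<infinity>"
    using nn_integral_powr_Ici[of "2 * a - 4" "2 * R"] R a L2locD(2)[OF ll, of "2 * R"]
    by (simp add: ennreal_mult_less_top)
  finally show ?thesis using ll by (auto simp: L2half_def L2loc_def)
qed

text \<open>
  Nested convex sets of bounded minimal norm have elements of almost minimal norm that form a
  Cauchy sequence: the midpoint of two of them lies in the larger set, whose minimal norm it
  cannot undercut, so the parallelogram law makes their difference small. This extracts a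
  strong limit where a weak limit would be the usual choice.
\<close>

lemma midpoint_convex_minimizing:
  fixes P :: "nat \<Rightarrow> ('a \<Rightarrow> real) \<Rightarrow> bool"
  assumes meas: "\<And>n f. P n f \<Longrightarrow> f \<in> borel_measurable M"
    and anti: "\<And>m n f. n \<le> m \<Longrightarrow> P m f \<Longrightarrow> P n f"
    and mid: "\<And>n f g. P n f \<Longrightarrow> P n g \<Longrightarrow> P n (\<lambda>x. 1/2 * f x + 1/2 * g x)"
    and ex: "\<And>n. \<exists>f. P n f \<and> sqn M f \<le> ennreal c" and c: "c \<ge> 0"
  shows "\<exists>x g. g \<in> borel_measurable M \<and> (\<forall>n. P n (x n) \<and> sqn M (x n) \<le> ennreal (c + 1 / real (Suc n))) \<and>
    (\<forall>e::real. e > 0 \<longrightarrow> (\<exists>N. \<forall>n\<ge>N. sqn M (\<lambda>t. x n t - g t) \<le> ennreal e))"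
proof -
  define S where "S n = {r. r \<ge> 0 \<and> (\<exists>f. P n f \<and> sqn M f = ennreal r)}" for n
  define d where "d n = Inf (S n)" for n
  have bdd: "bdd_below (S n)" for n by (auto simp: S_def bdd_below_def)
  have S_c: "\<exists>r\<in>S n. r \<le> c" for n
  proof -
    obtain f where f: "P n f" "sqn M f \<le> ennreal c" using ex by blast
    then obtain r where "sqn M f = ennreal r" "r \<ge> 0" "r \<le> c"
      using c by (cases "sqn M f") (auto simp: top_unique)
    then show ?thesis using f by (auto simp: S_def)
  qed
  have S_ne: "S n \<noteq> {}" for n using S_c[of n] by auto
  have d_c: "d n \<le> c" for n using S_c[of n] bdd[of n] unfolding d_def by (meson cInf_lower order.trans)
  have d_mono: "d n \<le> d m" if "n \<le> m" for n m
    unfolding d_def by (rule cInf_superset_mono[OF S_ne bdd]) (use anti[OF that] in \<open>auto simp: S_def\<close>)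
  have "\<exists>f r. P n f \<and> sqn M f = ennreal r \<and> 0 \<le> r \<and> r < d n + 1 / real (Suc n)" for n
  proof -
    have "Inf (S n) < d n + 1 / real (Suc n)" by (simp add: d_def)
    from cInf_lessD[OF S_ne this] show ?thesis by (auto simp: S_def)
  qed
  then obtain x r where x: "\<And>n. P n (x n)" "\<And>n. sqn M (x n) = ennreal (r n)" "\<And>n. 0 \<le> r n"
    "\<And>n. r n < d n + 1 / real (Suc n)" by metis
  have [measurable]: "x n \<in> borel_measurable M" for n by (rule meas[OF x(1)])
  \<comment> \<open>The parallelogram law for the halves of \<open>x n\<close> and \<open>x m\<close>; their sum is the midpoint, of
    squared norm at least \<open>d n\<close>.\<close>
  have close: "sqn M (\<lambda>t. x n t - x m t) \<le> ennreal (2 * (d m - d n) + 4 / real (Suc n))" if nm: "n \<le> m" for n m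
  proof -
    let ?a = "\<lambda>t. 1/2 * x n t" and ?b = "\<lambda>t. 1/2 * x m t"
    have h: "ennreal ((1/2)\<^sup>2) * ennreal y = ennreal (y / 4)" if "y \<ge> 0" for y
      using that by (simp add: ennreal_mult[symmetric] power2_eq_square)
    have ab: "sqn M ?a = ennreal (r n / 4)" "sqn M ?b = ennreal (r m / 4)"
      using x h by (simp_all only: sqn_cmult[OF meas[OF x(1)]])
    have "sqn M (\<lambda>t. ?a t + ?b t) + sqn M (\<lambda>t. ?a t - ?b t) = 2 * sqn M ?a + 2 * sqn M ?b"
      by (rule sqn_parallelogram) auto
    also have "\<dots> = ennreal ((r n + r m) / 2)"
      unfolding ab using x(3)[of n] x(3)[of m]
      by (simp add: two_times_ennreal add_divide_distrib flip: ennreal_plus)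
    finally have eq: "sqn M (\<lambda>t. ?a t + ?b t) + sqn M (\<lambda>t. ?a t - ?b t) = ennreal ((r n + r m) / 2)" .
    obtain s where s: "sqn M (\<lambda>t. ?a t + ?b t) = ennreal s" "s \<ge> 0"
      using eq by (cases "sqn M (\<lambda>t. ?a t + ?b t)") auto
    obtain D where D: "sqn M (\<lambda>t. ?a t - ?b t) = ennreal D" "D \<ge> 0"
      using eq by (cases "sqn M (\<lambda>t. ?a t - ?b t)") auto
    have "s \<in> S n" using s mid[OF x(1)[of n] anti[OF nm x(1)[of m]]] by (auto simp: S_def)
    then have sd: "s \<ge> d n" unfolding d_def by (intro cInf_lower bdd)
    have sD: "s + D = (r n + r m) / 2"
      using eq x(3)[of n] x(3)[of m] s D by (simp flip: ennreal_plus)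
    have "sqn M (\<lambda>t. x n t - x m t) = sqn M (\<lambda>t. 2 * (?a t - ?b t))" by simp
    also have "\<dots> = ennreal (2\<^sup>2) * sqn M (\<lambda>t. ?a t - ?b t)" by (rule sqn_cmult) simp
    also have "\<dots> = ennreal (4 * D)" unfolding D(1) using D(2) by (simp add: ennreal_mult')
    also have "\<dots> \<le> ennreal (2 * (d m - d n) + 4 / real (Suc n))"
    proof (rule ennreal_leI)
      have "1 / real (Suc m) \<le> 1 / real (Suc n)" using nm by (simp add: field_simps)
      then have rm: "r m < d m + 1 / real (Suc n)" using x(4)[of m] by linarith
      have "4 / real (Suc n) = 4 * (1 / real (Suc n))" by simp
      then show "4 * D \<le> 2 * (d m - d n) + 4 / real (Suc n)"
        using sD sd x(4)[of n] rm by argo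
    qed
    finally show ?thesis .
  qed
  have Cau: "\<exists>N. \<forall>m\<ge>N. \<forall>n\<ge>N. sqn M (\<lambda>t. x m t - x n t) \<le> ennreal e" if e: "e > 0" for e :: real
  proof -
    have "incseq d" using d_mono by (auto simp: incseq_def)
    then obtain L where L: "d \<longlonglongrightarrow> L" "\<And>n. d n \<le> L"
      using incseq_convergent[of d c] d_c by auto
    then have "eventually (\<lambda>n. d n > L - e / 4) sequentially"
      using e by (intro order_tendstoD(1)[OF L(1)]) auto
    moreover have "eventually (\<lambda>n. 4 / real (Suc n) < e / 2) sequentially"
    proof -
      obtain k where k: "1 / real (Suc k) < e / 8" using nat_approx_posE[of "e / 8"] e by auto
      show ?thesis
        using eventually_ge_at_top[of k]
      proof eventually_elim
        case (elim n)
        then have "1 / real (Suc n) \<le> 1 / real (Suc k)" by (simp add: field_simps)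
        moreover have "4 / real (Suc n) = 4 * (1 / real (Suc n))" by simp
        ultimately show ?case using k by argo
      qed
    qed
    ultimately obtain N where N: "\<And>n. n \<ge> N \<Longrightarrow> d n > L - e / 4" "\<And>n. n \<ge> N \<Longrightarrow> 4 / real (Suc n) < e / 2"
      unfolding eventually_sequentially by (metis nat_le_linear order.trans)
    have *: "sqn M (\<lambda>t. x n t - x m t) \<le> ennreal e" if "N \<le> n" "n \<le> m" for n m
      by (rule order.trans[OF close[OF that(2)] ennreal_leI]) (use N[OF that(1)] L(2)[of m] in argo)
    have "sqn M (\<lambda>t. x m t - x n t) \<le> ennreal e" if "m \<ge> N" "n \<ge> N" for m n
    proof (cases "n \<le> m")
      case True
      then show ?thesis using *[OF that(2) True] by (subst sqn_diff_commute)
    next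
      case False
      then show ?thesis using *[OF that(1), of n] by simp
    qed
    then show ?thesis by blast
  qed
  obtain g where g: "g \<in> borel_measurable M" "\<And>e::real. e > 0 \<Longrightarrow> \<exists>N. \<forall>n\<ge>N. sqn M (\<lambda>t. x n t - g t) \<le> ennreal e"
    using sqn_complete[of x M, OF _ Cau] by auto
  have "sqn M (x n) \<le> ennreal (c + 1 / real (Suc n))" for n
    unfolding x(2) by (rule ennreal_leI) (use x(4)[of n] d_c[of n] in linarith)
  then show ?thesis using g x(1) by blast
qed

lemma difference_quotient_facts:
  assumes h: "0 < h" "h \<le> 1" and u: "L2half u" and R: "\<And>t. t > R \<Longrightarrow> u t = 0"
  shows "L2half (\<lambda>t. (u t - u (t - h)) / h)" "t > R + 1 \<Longrightarrow> (u t - u (t - h)) / h = 0"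
    "(LINT t|lborel. (u t - u (t - h)) / h) = 0"
proof -
  note [measurable] = L2halfD(1)[OF u]
  have sh: "L2half (\<lambda>t. u (t - h))"
  proof -
    have "sqn lborel (\<lambda>t. u (t + - h)) = sqn lborel u"
      unfolding sqn_def by (rule nn_integral_shift[of "\<lambda>t. ennreal ((u t)\<^sup>2)"]) simp
    then show ?thesis using u h by (auto simp: L2half_def)
  qed
  show "L2half (\<lambda>t. (u t - u (t - h)) / h)"
    using L2half_lincomb[OF u sh, of "1 / h" "- (1 / h)"] by (simp add: diff_divide_distrib)
  show "(u t - u (t - h)) / h = 0" if "t > R + 1" using that h R[of t] R[of "t - h"] by simp
  have i: "integrable lborel u" by (rule L2_compact_integrable[OF u R])
  have ih: "integrable lborel (\<lambda>t. u (t - h))"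
    by (rule L2_compact_integrable[OF sh, of "R + h"]) (use R in auto)
  have "(LINT t|lborel. u (t - h)) = (LINT t|lborel. u t)"
    using lborel_integral_real_affine[of 1 u "- h"] by simp
  then show "(LINT t|lborel. (u t - u (t - h)) / h) = 0" using i ih by simp
qed

text \<open>
  A Steklov mean is $J^1 q = J^\sigma J^{1-\sigma} q$ for the difference quotient $q$. That
  $q$ has mean zero puts $J^{1-\sigma} q$ into $L^2$ of the whole line, where the lower
  estimate bounds it uniformly in \<open>h\<close>.
\<close>

lemma rl_steklov_preimage:
  assumes s: "0 < \<sigma>" "\<sigma> < 1" and u: "L2half u" and R: "R > 0" "\<And>t. t > R \<Longrightarrow> u t = 0"
    and h: "0 < h" "h \<le> 1"
  obtains v where "L2half v" "AE t in lborel. rl \<sigma> v t = steklov h u t"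
    "ennreal (gagc \<sigma>) * sqn lborel v \<le> 4 * gag_sq \<sigma> u"
proof -
  let ?q = "\<lambda>t. (u t - u (t - h)) / h"
  note q = difference_quotient_facts[OF h u R(2)]
  have i: "integrable lborel u" by (rule L2_compact_integrable[OF u R(2)])
  have v: "L2half (rl (1 - \<sigma>) ?q)"
    by (rule rl_L2half[OF _ _ q(1) _ q(2) q(3)]) (use s R in auto)
  have "AE t in lborel. rl \<sigma> (rl (1 - \<sigma>) ?q) t = rl (\<sigma> + (1 - \<sigma>)) ?q t"
    by (rule rl_semigroup_AE) (use s L2halfD(4)[OF q(1)] in auto)
  then have eq: "AE t in lborel. rl \<sigma> (rl (1 - \<sigma>) ?q) t = steklov h u t"
    using rl_1_difference_quotient[OF h(1) i] by simp
  have "ennreal (gagc \<sigma>) * sqn lborel (rl (1 - \<sigma>) ?q) \<le> 4 * gag_sq \<sigma> (rl \<sigma> (rl (1 - \<sigma>) ?q))"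
    by (rule rl_gag_lower[OF s v])
  also have "gag_sq \<sigma> (rl \<sigma> (rl (1 - \<sigma>) ?q)) = gag_sq \<sigma> (steklov h u)"
    by (rule gag_sq_cong_AE[OF eq])
  also have "4 * \<dots> \<le> 4 * gag_sq \<sigma> u"
    by (intro mult_left_mono gag_sq_steklov_le[OF h(1) i]) simp
  finally show ?thesis using that v eq by blast
qed

text \<open>
  The sets of $v$ supported in \<open>[0,T]\<close> that solve $J^\sigma v = u$ on \<open>(0,T)\<close> up to the error
  \<open>1/(n+1)\<close> are nested and convex, and they contain truncated preimages of Steklov means,
  whose norms are bounded. Almost minimal elements of these sets converge, and since
  $J^\sigma$ is bounded on \<open>(0,T)\<close>, the limit is a solution.
\<close>

theorem rl_gag_surj:
  assumes s: "0 < \<sigma>" "\<sigma> < 1" and u: "L2half u" and R: "R > 0" "\<And>t. t > R \<Longrightarrow> u t = 0"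
    and fin: "gag_sq \<sigma> u < \<infinity>" and T: "T > 0"
  obtains v where "L2half v" "\<And>t. t > T \<Longrightarrow> v t = 0" "AE t in lborel. t \<le> T \<longrightarrow> rl \<sigma> v t = u t"
    "ennreal (gagc \<sigma>) * sqn lborel v \<le> 8 * gag_sq \<sigma> u"
proof -
  note [measurable] = L2halfD(1)[OF u]
  have i: "integrable lborel u" by (rule L2_compact_integrable[OF u R(2)])
  have c: "gagc \<sigma> > 0" by (rule gagc_pos[OF s])
  define G where "G = enn2real (gag_sq \<sigma> u)"
  have G: "gag_sq \<sigma> u = ennreal G" "G \<ge> 0" using fin by (auto simp: G_def)
  define cc where "cc = 4 * G / gagc \<sigma>"
  have cc: "cc \<ge> 0" using G c by (simp add: cc_def)
  define P where "P n f \<longleftrightarrow> L2half f \<and> (\<forall>t>T. f t = 0) \<and>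
     sqn lborel (\<lambda>t. indicator {..T} t * (rl \<sigma> f t - u t)) \<le> ennreal (1 / real (Suc n))" for n f
  have P_ex: "\<exists>f. P n f \<and> sqn lborel f \<le> ennreal cc" for n
  proof -
    \<comment> \<open>The step for which the approximation rate $h^{2\sigma} G$ of the Steklov mean is at
      most \<open>1/(n+1)\<close>; the summand \<open>1\<close> covers \<open>G = 0\<close> and keeps \<open>h \<le> 1\<close>.\<close>
    define h where "h = (1 / (real (Suc n) * (G + 1))) powr (1 / (2 * \<sigma>))"
    have b: "0 < 1 / (real (Suc n) * (G + 1))" "1 / (real (Suc n) * (G + 1)) \<le> 1"
      using G mult_mono[of 1 "real (Suc n)" 1 "G + 1"] by auto
    have h: "0 < h" "h \<le> 1" using b s powr_mono2[of "1 / (2 * \<sigma>)" "1 / (real (Suc n) * (G + 1))" 1]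
      by (auto simp: h_def simp del: of_nat_Suc)
    have hp: "h powr (2 * \<sigma>) = 1 / (real (Suc n) * (G + 1))"
      unfolding h_def powr_powr using s b by simp
    obtain v where v: "L2half v" "AE t in lborel. rl \<sigma> v t = steklov h u t"
        "ennreal (gagc \<sigma>) * sqn lborel v \<le> 4 * gag_sq \<sigma> u"
      using rl_steklov_preimage[OF s u R h] by blast
    note [measurable] = L2halfD(1)[OF v(1)]
    let ?f = "\<lambda>t. indicator {..T} t * v t"
    have fv: "sqn lborel ?f \<le> sqn lborel v" by (rule sqn_mono) (auto simp: indicator_def)
    have "L2half ?f" using v(1) le_less_trans[OF fv] by (auto simp: L2half_def)
    moreover have "\<forall>t>T. ?f t = 0" by simp
    moreover have "sqn lborel (\<lambda>t. indicator {..T} t * (rl \<sigma> ?f t - u t)) \<le> ennreal (1 / real (Suc n))"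
    proof -
      have eq: "rl \<sigma> ?f t = rl \<sigma> v t" if "t \<le> T" for t
        by (rule rl_cong_before) (use that in auto)
      have "sqn lborel (\<lambda>t. indicator {..T} t * (rl \<sigma> ?f t - u t)) \<le> sqn lborel (\<lambda>t. steklov h u t - u t)"
      proof (rule sqn_mono_AE, use v(2) in eventually_elim)
        case (elim t)
        have "indicator {..T} t * (rl \<sigma> ?f t - u t) = indicator {..T} t * (steklov h u t - u t)"
          by (cases "t \<le> T") (simp_all only: eq elim, simp)
        then show ?case by (simp only:) (simp add: indicator_def)
      qed
      also have "\<dots> \<le> ennreal (h powr (2 * \<sigma>)) * gag_sq \<sigma> u"
        by (rule steklov_approx[OF s(1) h(1) i])
      also have "\<dots> = ennreal (1 / (real (Suc n) * (G + 1)) * G)"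
        unfolding hp G(1) using b G by (intro ennreal_mult[symmetric]) auto
      also have "\<dots> \<le> ennreal (1 / real (Suc n))"
        using G by (intro ennreal_leI) (simp add: divide_simps)
      finally show ?thesis .
    qed
    moreover have "sqn lborel ?f \<le> ennreal cc"
    proof -
      have "ennreal (1 / gagc \<sigma>) * (ennreal (gagc \<sigma>) * sqn lborel v) \<le> ennreal (1 / gagc \<sigma>) * (4 * ennreal G)"
        using v(3) unfolding G(1) by (rule mult_left_mono) simp
      also have "4 * ennreal G = ennreal (4 * G)" using G by (simp add: ennreal_mult')
      also have "ennreal (1 / gagc \<sigma>) * ennreal (4 * G) = ennreal (1 / gagc \<sigma> * (4 * G))"
        using c G by (intro ennreal_mult[symmetric]) auto
      also have "1 / gagc \<sigma> * (4 * G) = cc" by (simp add: cc_def)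
      also have "ennreal (1 / gagc \<sigma>) * (ennreal (gagc \<sigma>) * sqn lborel v) = ennreal (1 / gagc \<sigma> * gagc \<sigma>) * sqn lborel v"
        using c by (simp only: ennreal_mult less_imp_le zero_le_divide_1_iff mult.assoc)
      also have "\<dots> = sqn lborel v" using c by simp
      finally show ?thesis using fv by simp
    qed
    ultimately show ?thesis unfolding P_def by blast
  qed
  have P_mid: "P n (\<lambda>t. 1/2 * f t + 1/2 * g t)" if f: "P n f" and g: "P n g" for n f g
  proof -
    have L: "L2half f" "L2half g" using f g by (auto simp: P_def)
    note [measurable] = L2halfD(1)[OF L(1)] L2halfD(1)[OF L(2)]
    have L': "L2half (\<lambda>t. 1/2 * f t)" "L2half (\<lambda>t. 1/2 * g t)"
      using L2half_lincomb[OF L, of "1/2" 0] L2half_lincomb[OF L, of 0 "1/2"] by simp_all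
    let ?A = "\<lambda>t. indicator {..T} t * (rl \<sigma> f t - u t)" and ?B = "\<lambda>t. indicator {..T} t * (rl \<sigma> g t - u t)"
    have "AE t in lborel. indicator {..T} t * (rl \<sigma> (\<lambda>t. 1/2 * f t + 1/2 * g t) t - u t) = 1/2 * ?A t + 1/2 * ?B t"
      using rl_add_AE[OF s(1) L2halfD(4)[OF L'(1)] L2halfD(4)[OF L'(2)]]
    proof eventually_elim
      case (elim t)
      show ?case unfolding elim rl_cmult by (simp add: indicator_def field_simps)
    qed
    then have "sqn lborel (\<lambda>t. indicator {..T} t * (rl \<sigma> (\<lambda>t. 1/2 * f t + 1/2 * g t) t - u t)) = sqn lborel (\<lambda>t. 1/2 * ?A t + 1/2 * ?B t)"
      by (rule sqn_cong_AE)
    also have "\<dots> \<le> 2 * sqn lborel (\<lambda>t. 1/2 * ?A t) + 2 * sqn lborel (\<lambda>t. 1/2 * ?B t)"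
      by (rule sqn_add_le) auto
    also have "\<dots> = 2 * (ennreal ((1/2)\<^sup>2) * sqn lborel ?A) + 2 * (ennreal ((1/2)\<^sup>2) * sqn lborel ?B)"
      by (subst (1 2) sqn_cmult) auto
    also have "\<dots> \<le> 2 * (ennreal ((1/2)\<^sup>2) * ennreal (1 / real (Suc n))) + 2 * (ennreal ((1/2)\<^sup>2) * ennreal (1 / real (Suc n)))"
      using f g by (intro add_mono mult_left_mono) (auto simp: P_def)
    also have "\<dots> = ennreal (2 * ((1/2)\<^sup>2 * (1 / real (Suc n))) + 2 * ((1/2)\<^sup>2 * (1 / real (Suc n))))"
    proof -
      have "2 * (ennreal ((1/2)\<^sup>2) * ennreal (1 / real (Suc n))) = ennreal (2 * ((1/2)\<^sup>2 * (1 / real (Suc n))))"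
        by (subst ennreal_mult[symmetric]) (auto simp: two_times_ennreal)
      then show ?thesis by (subst ennreal_plus) auto
    qed
    also have "2 * ((1/2)\<^sup>2 * (1 / real (Suc n))) + 2 * ((1/2)\<^sup>2 * (1 / real (Suc n))) = 1 / real (Suc n)"
    proof -
      have "2 * ((1/2)\<^sup>2 * y) + 2 * ((1/2)\<^sup>2 * y) = y" for y :: real by (simp add: power2_eq_square)
      then show ?thesis .
    qed
    finally have fin: "sqn lborel (\<lambda>t. indicator {..T} t * (rl \<sigma> (\<lambda>t. 1/2 * f t + 1/2 * g t) t - u t)) \<le> ennreal (1 / real (Suc n))" .
    show ?thesis unfolding P_def
      using fin f g L2half_lincomb[OF L, of "1/2" "1/2"] by (auto simp: P_def)
  qed
  have P_anti: "P n f" if "n \<le> m" "P m f" for n m f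
  proof -
    have "ennreal (1 / real (Suc m)) \<le> ennreal (1 / real (Suc n))" using that by (intro ennreal_leI) (simp add: field_simps)
    then show ?thesis using that unfolding P_def by (meson order.trans)
  qed
  have P_meas: "f \<in> borel_measurable lborel" if "P n f" for n f
    using that by (auto simp: P_def L2half_def)
  obtain x g where gm [measurable]: "g \<in> borel_measurable lborel" and x: "\<And>n. P n (x n)"
    and xc: "\<And>n. sqn lborel (x n) \<le> ennreal (cc + 1 / real (Suc n))"
    and lim: "\<And>e::real. e > 0 \<Longrightarrow> \<exists>N. \<forall>n\<ge>N. sqn lborel (\<lambda>t. x n t - g t) \<le> ennreal e"
  proof -
    have "\<exists>x g. g \<in> borel_measurable lborel \<and> (\<forall>n. P n (x n) \<and> sqn lborel (x n) \<le> ennreal (cc + 1 / real (Suc n))) \<and>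
      (\<forall>e::real. e > 0 \<longrightarrow> (\<exists>N. \<forall>n\<ge>N. sqn lborel (\<lambda>t. x n t - g t) \<le> ennreal e))"
      by (rule midpoint_convex_minimizing) (fact P_meas P_anti P_mid P_ex cc)+
    then show ?thesis using that by blast
  qed
  define v where "v = (\<lambda>t. ivl T t * g t)"
  have vm [measurable]: "v \<in> borel_measurable borel" unfolding v_def by simp
  have xL: "L2half (x n)" for n using x by (auto simp: P_def)
  note [measurable] = L2halfD(1)[OF xL]
  have xv: "sqn lborel (\<lambda>t. x n t - v t) \<le> sqn lborel (\<lambda>t. x n t - g t)" for n
  proof (rule sqn_mono)
    fix t show "\<bar>x n t - v t\<bar> \<le> \<bar>x n t - g t\<bar>"
      using x[of n] L2halfD(2)[OF xL[of n], of t] by (auto simp: P_def v_def ivl_def indicator_def)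
  qed
  have near: "\<exists>n. sqn lborel (\<lambda>t. x n t - v t) \<le> ennreal e \<and> 1 / real (Suc n) \<le> e" if e: "e > 0" for e
  proof -
    obtain N where N: "\<And>n. n \<ge> N \<Longrightarrow> sqn lborel (\<lambda>t. x n t - g t) \<le> ennreal e" using lim[OF e] by blast
    obtain k where k: "1 / real (Suc k) < e" using nat_approx_posE[OF e] by blast
    have "1 / real (Suc (max N k)) \<le> 1 / real (Suc k)" by (simp add: field_simps)
    then show ?thesis using k N[of "max N k"] order.trans[OF xv[of "max N k"]] by (intro exI[of _ "max N k"]) auto
  qed
  have vL: "L2half v" unfolding L2half_def
  proof (intro conjI)
    show "\<forall>t\<le>0. v t = 0" by (auto simp: v_def ivl_def)
    obtain n where n: "sqn lborel (\<lambda>t. x n t - v t) \<le> ennreal 1" using near[of 1] by auto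
    have "sqn lborel v \<le> 2 * sqn lborel (x n) + 2 * sqn lborel (\<lambda>t. v t - x n t)"
      by (rule sqn_le_add_diff) auto
    also have "sqn lborel (\<lambda>t. v t - x n t) = sqn lborel (\<lambda>t. x n t - v t)" by (rule sqn_diff_commute)
    also have "2 * sqn lborel (x n) + 2 * sqn lborel (\<lambda>t. x n t - v t) < \<infinity>"
      using le_less_trans[OF n, of top] L2halfD(3)[OF xL[of n]] by (simp add: ennreal_mult_less_top)
    finally show "sqn lborel v < \<infinity>" .
  qed simp
  show ?thesis
  proof (rule that[OF vL])
    show "v t = 0" if "t > T" for t using that by (simp add: v_def ivl_def)
    define K where "K = (T powr \<sigma> / Gamma (\<sigma> + 1))\<^sup>2"
    have K: "K \<ge> 0" by (simp add: K_def)
    have "sqn lborel (\<lambda>t. indicator {..T} t * (rl \<sigma> v t - u t)) \<le> 0"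
    proof (rule ennreal_le_of_all_pos[where c="ennreal (2 * K + 2)"])
      fix e :: real assume e: "e > 0"
      obtain n where n: "sqn lborel (\<lambda>t. x n t - v t) \<le> ennreal e" "1 / real (Suc n) \<le> e" using near[OF e] by blast
      let ?A = "\<lambda>t. indicator {..T} t * rl \<sigma> (\<lambda>t. v t - x n t) t" and ?B = "\<lambda>t. indicator {..T} t * (rl \<sigma> (x n) t - u t)"
      have "AE t in lborel. indicator {..T} t * (rl \<sigma> v t - u t) = ?A t + ?B t"
        using rl_diff_AE[OF s(1) L2halfD(4)[OF vL] L2halfD(4)[OF xL[of n]]]
      proof eventually_elim
        case (elim t)
        show ?case unfolding elim by (simp only: right_diff_distrib)
      qed
      then have "sqn lborel (\<lambda>t. indicator {..T} t * (rl \<sigma> v t - u t)) = sqn lborel (\<lambda>t. ?A t + ?B t)"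
        by (rule sqn_cong_AE)
      also have "\<dots> \<le> 2 * sqn lborel ?A + 2 * sqn lborel ?B" by (rule sqn_add_le) auto
      also have "\<dots> \<le> 2 * (ennreal K * ennreal e) + 2 * ennreal e"
      proof (intro add_mono mult_left_mono)
        have "sqn lborel ?A \<le> ennreal K * sqn lborel (\<lambda>t. indicator {..T} t * (v t - x n t))"
          unfolding K_def by (rule rl_sqn_le) (use s T L2halfD(2)[OF vL] L2halfD(2)[OF xL] in auto)
        also have "\<dots> \<le> ennreal K * sqn lborel (\<lambda>t. v t - x n t)"
          by (intro mult_left_mono sqn_mono) (auto simp: indicator_def)
        also have "\<dots> \<le> ennreal K * ennreal e"
          using n(1) by (subst sqn_diff_commute) (rule mult_left_mono, simp_all)
        finally show "sqn lborel ?A \<le> ennreal K * ennreal e" .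
        show "sqn lborel ?B \<le> ennreal e"
          using x[of n] order.trans[OF _ ennreal_leI[OF n(2)]] by (auto simp: P_def)
      qed auto
      also have "\<dots> = ennreal (2 * K + 2) * ennreal e"
      proof -
        have "2 * (ennreal K * ennreal e) + 2 * ennreal e = ennreal (2 * (K * e) + 2 * e)"
          using K e by (subst ennreal_mult[symmetric]) (auto simp: two_times_ennreal)
        also have "\<dots> = ennreal ((2 * K + 2) * e)" by (simp add: algebra_simps)
        also have "\<dots> = ennreal (2 * K + 2) * ennreal e" using K e by (intro ennreal_mult) auto
        finally show ?thesis .
      qed
      finally show "sqn lborel (\<lambda>t. indicator {..T} t * (rl \<sigma> v t - u t)) \<le> 0 + ennreal (2 * K + 2) * ennreal e" by simp
    qed simp
    then have "AE t in lborel. indicator {..T} t * (rl \<sigma> v t - u t) = 0"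
      by (subst sqn_zero_iff[symmetric]) auto
    then show "AE t in lborel. t \<le> T \<longrightarrow> rl \<sigma> v t = u t"
      by eventually_elim (auto simp: indicator_def)
    have "sqn lborel v \<le> ennreal (2 * cc)"
    proof (rule ennreal_le_of_all_pos[where c="ennreal 4"])
      fix e :: real assume e: "e > 0"
      obtain n where n: "sqn lborel (\<lambda>t. x n t - v t) \<le> ennreal e" "1 / real (Suc n) \<le> e" using near[OF e] by blast
      have "sqn lborel v \<le> 2 * sqn lborel (x n) + 2 * sqn lborel (\<lambda>t. v t - x n t)"
        by (rule sqn_le_add_diff) auto
      also have "\<dots> \<le> 2 * ennreal (cc + e) + 2 * ennreal e"
      proof (intro add_mono mult_left_mono)
        show "sqn lborel (x n) \<le> ennreal (cc + e)" by (rule order.trans[OF xc ennreal_leI]) (use n(2) in simp)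
        show "sqn lborel (\<lambda>t. v t - x n t) \<le> ennreal e" using n(1) by (subst sqn_diff_commute)
      qed auto
      also have "\<dots> = ennreal (2 * (cc + e) + 2 * e)" using cc e by (simp add: two_times_ennreal flip: ennreal_plus)
      also have "\<dots> = ennreal (2 * cc + 4 * e)" by (simp add: algebra_simps)
      also have "\<dots> = ennreal (2 * cc) + ennreal 4 * ennreal e" using cc e by (simp add: ennreal_mult')
      finally show "sqn lborel v \<le> ennreal (2 * cc) + ennreal 4 * ennreal e" .
    qed simp
    then have "ennreal (gagc \<sigma>) * sqn lborel v \<le> ennreal (gagc \<sigma>) * ennreal (2 * cc)" by (rule mult_left_mono) simp
    also have "\<dots> = ennreal (gagc \<sigma> * (2 * cc))" using c cc by (intro ennreal_mult[symmetric]) auto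
    also have "gagc \<sigma> * (2 * cc) = 8 * G" using c by (simp add: cc_def)
    also have "ennreal (8 * G) = 8 * gag_sq \<sigma> u" unfolding G(1) using G(2) by (simp add: ennreal_mult')
    finally show "ennreal (gagc \<sigma>) * sqn lborel v \<le> 8 * gag_sq \<sigma> u" .
  qed
qed

section \<open>Restriction to an interval\<close>

definition gag_on :: "real \<Rightarrow> real set \<Rightarrow> (real \<Rightarrow> real) \<Rightarrow> ennreal" where
  "gag_on \<sigma> A u = (\<integral>\<^sup>+t. indicator A t * (\<integral>\<^sup>+s. indicator A s * ennreal ((u t - u s)\<^sup>2 / \<bar>t - s\<bar> powr (1 + 2 * \<sigma>)) \<partial>lborel) \<partial>lborel)"

text \<open>
  Composition with this map extends a function evenly beyond \<open>T\<close>.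
\<close>

definition fold_at :: "real \<Rightarrow> real \<Rightarrow> real" where
  "fold_at T t = T - \<bar>t - T\<bar>"

lemma fold_at_measurable [measurable]: "fold_at T \<in> borel_measurable borel"
  unfolding fold_at_def by measurable

lemma nn_integral_fold_at:
  fixes f :: "real \<Rightarrow> ennreal"
  assumes [measurable]: "f \<in> borel_measurable borel"
  shows "(\<integral>\<^sup>+t. f (fold_at T t) \<partial>lborel) \<le> 2 * (\<integral>\<^sup>+t. indicator {..T} t * f t \<partial>lborel)"
proof -
  have "(\<integral>\<^sup>+t. f (fold_at T t) \<partial>lborel) \<le> (\<integral>\<^sup>+t. indicator {..T} t * f t + indicator {..T} (2 * T - t) * f (2 * T - t) \<partial>lborel)"
  proof (rule nn_integral_mono)
    fix t
    show "f (fold_at T t) \<le> indicator {..T} t * f t + indicator {..T} (2 * T - t) * f (2 * T - t)"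
    proof (cases "t \<le> T")
      case True
      then have "fold_at T t = t" by (simp add: fold_at_def)
      then show ?thesis using True by simp
    next
      case False
      then have "fold_at T t = 2 * T - t" by (simp add: fold_at_def)
      then show ?thesis using False by simp
    qed
  qed
  also have "\<dots> = (\<integral>\<^sup>+t. indicator {..T} t * f t \<partial>lborel) + (\<integral>\<^sup>+t. indicator {..T} (2 * T - t) * f (2 * T - t) \<partial>lborel)"
    by (rule nn_integral_add) simp_all
  also have "(\<integral>\<^sup>+t. indicator {..T} (2 * T - t) * f (2 * T - t) \<partial>lborel) = (\<integral>\<^sup>+t. indicator {..T} t * f t \<partial>lborel)"
    by (rule nn_integral_reflect_shift) simp
  finally show ?thesis unfolding mult_2 .
qed

text \<open>
  Folding does not increase distances and is at most two-to-one in each of the two variables.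
\<close>

lemma gag_sq_fold:
  assumes s: "0 < \<sigma>" and [measurable]: "u \<in> borel_measurable borel"
  shows "gag_sq \<sigma> (\<lambda>t. u (fold_at T t)) \<le> 4 * gag_on \<sigma> {..T} u"
proof -
  let ?H = "\<lambda>t s. ennreal ((u t - u s)\<^sup>2 / \<bar>t - s\<bar> powr (1 + 2 * \<sigma>))"
  have pw: "ennreal ((u (fold_at T t) - u (fold_at T r))\<^sup>2 / \<bar>t - r\<bar> powr (1 + 2 * \<sigma>)) \<le> ?H (fold_at T t) (fold_at T r)" for t r
  proof (cases "fold_at T t = fold_at T r")
    case False
    have "\<bar>fold_at T t - fold_at T r\<bar> \<le> \<bar>t - r\<bar>" by (simp add: fold_at_def)
    then have "\<bar>fold_at T t - fold_at T r\<bar> powr (1 + 2 * \<sigma>) \<le> \<bar>t - r\<bar> powr (1 + 2 * \<sigma>)"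
      using s by (intro powr_mono2) auto
    then show ?thesis using False by (intro ennreal_leI divide_left_mono mult_pos_pos) auto
  qed simp
  have "gag_sq \<sigma> (\<lambda>t. u (fold_at T t)) \<le> (\<integral>\<^sup>+t. \<integral>\<^sup>+r. ?H (fold_at T t) (fold_at T r) \<partial>lborel \<partial>lborel)"
    by (subst gag_sq_iterated) (auto intro!: nn_integral_mono pw)
  also have "\<dots> \<le> (\<integral>\<^sup>+t. 2 * (\<integral>\<^sup>+r. indicator {..T} r * ?H (fold_at T t) r \<partial>lborel) \<partial>lborel)"
    by (intro nn_integral_mono nn_integral_fold_at) simp
  also have "\<dots> = 2 * (\<integral>\<^sup>+t. (\<integral>\<^sup>+r. indicator {..T} r * ?H (fold_at T t) r \<partial>lborel) \<partial>lborel)"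
    by (rule nn_integral_cmult) simp
  also have "\<dots> \<le> 2 * (2 * (\<integral>\<^sup>+t. indicator {..T} t * (\<integral>\<^sup>+r. indicator {..T} r * ?H t r \<partial>lborel) \<partial>lborel))"
    by (intro mult_left_mono nn_integral_fold_at) simp_all
  also have "\<dots> = 4 * gag_on \<sigma> {..T} u"
    unfolding gag_on_def by (simp add: mult.assoc[symmetric])
  finally show ?thesis .
qed

text \<open>
  The Hardy weight $t^{-\sigma}$, with the function cut off to an interval so that the domain
  can shrink in scaling arguments.
\<close>

definition wt :: "real \<Rightarrow> real \<Rightarrow> real \<Rightarrow> (real \<Rightarrow> real) \<Rightarrow> real \<Rightarrow> real" where
  "wt \<sigma> a b f t = indicator {a<..<b} t * (t powr - \<sigma> * f t)"

lemma wt_measurable [measurable]: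
  assumes [measurable]: "f \<in> borel_measurable borel"
  shows "wt \<sigma> a b f \<in> borel_measurable borel"
  unfolding wt_def by measurable

lemma wt_add: "wt \<sigma> a b (\<lambda>t. f t + g t) t = wt \<sigma> a b f t + wt \<sigma> a b g t"
  by (simp add: wt_def distrib_left)

lemma nn_integral_gag_left_tail:
  assumes s: "0 < \<sigma>" and t: "t > 0"
  shows "(\<integral>\<^sup>+r. indicator {..0} r * ennreal (c\<^sup>2 / \<bar>t - r\<bar> powr (1 + 2 * \<sigma>)) \<partial>lborel)
     = ennreal (1 / (2 * \<sigma>)) * ennreal ((t powr - \<sigma> * c)\<^sup>2)"
proof -
  have "(\<integral>\<^sup>+r. indicator {..0} r * ennreal (c\<^sup>2 / \<bar>t - r\<bar> powr (1 + 2 * \<sigma>)) \<partial>lborel)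
     = (\<integral>\<^sup>+r. indicator {..0} (t - r) * ennreal (c\<^sup>2 / \<bar>t - (t - r)\<bar> powr (1 + 2 * \<sigma>)) \<partial>lborel)"
    by (rule nn_integral_reflect_shift[symmetric]) simp
  also have "\<dots> = (\<integral>\<^sup>+r. ennreal (c\<^sup>2) * (ennreal (r powr (- 1 - 2 * \<sigma>)) * indicator {t..} r) \<partial>lborel)"
  proof (rule nn_integral_cong)
    fix r
    have "c\<^sup>2 / \<bar>r\<bar> powr (1 + 2 * \<sigma>) = c\<^sup>2 * r powr (- 1 - 2 * \<sigma>)" if "r > 0"
      using powr_minus_divide[of r "1 + 2 * \<sigma>"] that by simp
    then show "indicator {..0} (t - r) * ennreal (c\<^sup>2 / \<bar>t - (t - r)\<bar> powr (1 + 2 * \<sigma>))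
       = ennreal (c\<^sup>2) * (ennreal (r powr (- 1 - 2 * \<sigma>)) * indicator {t..} r)"
      using t by (auto simp: indicator_def ennreal_mult')
  qed
  also have "\<dots> = ennreal (c\<^sup>2) * ennreal (- (t powr (- 1 - 2 * \<sigma> + 1)) / (- 1 - 2 * \<sigma> + 1))"
    by (subst nn_integral_cmult) (use s t in \<open>auto simp: nn_integral_powr_Ici\<close>)
  also have "\<dots> = ennreal (c\<^sup>2 * (- (t powr (- 1 - 2 * \<sigma> + 1)) / (- 1 - 2 * \<sigma> + 1)))"
    using s by (intro ennreal_mult[symmetric]) (auto intro: divide_nonpos_nonpos)
  also have "c\<^sup>2 * (- (t powr (- 1 - 2 * \<sigma> + 1)) / (- 1 - 2 * \<sigma> + 1)) = 1 / (2 * \<sigma>) * (t powr - \<sigma> * c)\<^sup>2"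
  proof -
    have "(t powr - \<sigma>)\<^sup>2 = t powr (- 2 * \<sigma>)" unfolding power2_eq_square powr_add[symmetric] by simp
    then show ?thesis by (simp add: power_mult_distrib)
  qed
  also have "ennreal \<dots> = ennreal (1 / (2 * \<sigma>)) * ennreal ((t powr - \<sigma> * c)\<^sup>2)"
    by (rule ennreal_mult) (use s in auto)
  finally show ?thesis .
qed

lemma gag_on_le_gag_sq:
  assumes [measurable]: "u \<in> borel_measurable borel"
  shows "gag_on \<sigma> A u \<le> gag_sq \<sigma> u"
  unfolding gag_sq_iterated[OF assms] gag_on_def
  by (intro nn_integral_mono) (auto simp: indicator_def intro!: nn_integral_mono)

lemma weight_le_gag_sq:
  assumes s: "0 < \<sigma>" and [measurable]: "u \<in> borel_measurable borel" and u0: "\<And>t. t \<le> 0 \<Longrightarrow> u t = 0"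
  shows "ennreal (1 / (2 * \<sigma>)) * sqn lborel (wt \<sigma> 0 T u) \<le> gag_sq \<sigma> u"
proof -
  have "ennreal (1 / (2 * \<sigma>)) * sqn lborel (wt \<sigma> 0 T u) = (\<integral>\<^sup>+t. ennreal (1 / (2 * \<sigma>)) * ennreal ((wt \<sigma> 0 T u t)\<^sup>2) \<partial>lborel)"
    unfolding sqn_def by (rule nn_integral_cmult[symmetric]) simp
  also have "\<dots> \<le> gag_sq \<sigma> u"
    unfolding gag_sq_iterated[OF assms(2)]
  proof (rule nn_integral_mono)
    fix t :: real
    show "ennreal (1 / (2 * \<sigma>)) * ennreal ((wt \<sigma> 0 T u t)\<^sup>2) \<le> (\<integral>\<^sup>+r. ennreal ((u t - u r)\<^sup>2 / \<bar>t - r\<bar> powr (1 + 2 * \<sigma>)) \<partial>lborel)"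
    proof (cases "0 < t \<and> t < T")
      case True
      then have "ennreal (1 / (2 * \<sigma>)) * ennreal ((wt \<sigma> 0 T u t)\<^sup>2)
         = (\<integral>\<^sup>+r. indicator {..0} r * ennreal ((u t)\<^sup>2 / \<bar>t - r\<bar> powr (1 + 2 * \<sigma>)) \<partial>lborel)"
        by (simp add: nn_integral_gag_left_tail[OF s] wt_def)
      also have "\<dots> \<le> (\<integral>\<^sup>+r. ennreal ((u t - u r)\<^sup>2 / \<bar>t - r\<bar> powr (1 + 2 * \<sigma>)) \<partial>lborel)"
        by (intro nn_integral_mono) (auto simp: indicator_def u0)
      finally show ?thesis .
    qed (auto simp: wt_def)
  qed
  finally show ?thesis .
qed

text \<open>
  For $u$ vanishing on the negative half-line, the pairs with one point on each side of \<open>0\<close>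
  contribute $|u(t)|^2 \int_t^\infty x^{-1-2\sigma} dx$, which is the Hardy weight up to a
  constant. The same computation gives the converse bound of the weight by the seminorm on the
  line.
\<close>

lemma gag_on_atMost_le:
  assumes s: "0 < \<sigma>" and [measurable]: "u \<in> borel_measurable borel" and u0: "\<And>t. t \<le> 0 \<Longrightarrow> u t = 0"
  shows "gag_on \<sigma> {..T} u \<le> gag_on \<sigma> {0<..<T} u + ennreal (1 / \<sigma>) * sqn lborel (wt \<sigma> 0 T u)"
proof -
  let ?H = "\<lambda>t s. ennreal ((u t - u s)\<^sup>2 / \<bar>t - s\<bar> powr (1 + 2 * \<sigma>))"
  let ?A = "\<lambda>t. indicator {0<..<T} t :: ennreal" and ?N = "\<lambda>t::real. indicator {..0} t :: ennreal"
  let ?f = "\<lambda>t s. ?A t * (?A s * ?H t s) + (?A t * (?N s * ?H t s) + ?N t * (?A s * ?H t s))"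
  let ?L = "ennreal (1 / (2 * \<sigma>)) * sqn lborel (wt \<sigma> 0 T u)"
  have L: "(\<integral>\<^sup>+t. \<integral>\<^sup>+r. ?A t * (?N r * ?H t r) \<partial>lborel \<partial>lborel) = ?L"
  proof -
    have "(\<integral>\<^sup>+r. ?A t * (?N r * ?H t r) \<partial>lborel) = ennreal (1 / (2 * \<sigma>)) * ennreal ((wt \<sigma> 0 T u t)\<^sup>2)" for t
    proof (cases "0 < t \<and> t < T")
      case True
      then have "(\<integral>\<^sup>+r. ?A t * (?N r * ?H t r) \<partial>lborel) = (\<integral>\<^sup>+r. indicator {..0} r * ennreal ((u t)\<^sup>2 / \<bar>t - r\<bar> powr (1 + 2 * \<sigma>)) \<partial>lborel)"
        by (intro nn_integral_cong) (auto simp: indicator_def u0)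
      then show ?thesis using True by (simp add: nn_integral_gag_left_tail[OF s] wt_def)
    qed (auto simp: wt_def)
    then show ?thesis unfolding sqn_def by (simp add: nn_integral_cmult)
  qed
  have L': "(\<integral>\<^sup>+t. \<integral>\<^sup>+r. ?N t * (?A r * ?H t r) \<partial>lborel \<partial>lborel) = ?L"
  proof -
    have "(\<integral>\<^sup>+t. \<integral>\<^sup>+r. ?N t * (?A r * ?H t r) \<partial>lborel \<partial>lborel) = (\<integral>\<^sup>+r. \<integral>\<^sup>+t. ?N t * (?A r * ?H t r) \<partial>lborel \<partial>lborel)"
      by (rule lborel_pair.Fubini') simp
    also have "\<dots> = (\<integral>\<^sup>+t. \<integral>\<^sup>+r. ?A t * (?N r * ?H t r) \<partial>lborel \<partial>lborel)"
      by (intro nn_integral_cong) (simp add: mult.left_commute power2_commute abs_minus_commute)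
    finally show ?thesis using L by simp
  qed
  have "gag_on \<sigma> {..T} u = (\<integral>\<^sup>+t. \<integral>\<^sup>+r. indicator {..T} t * (indicator {..T} r * ?H t r) \<partial>lborel \<partial>lborel)"
    unfolding gag_on_def by (simp add: nn_integral_cmult)
  also have "\<dots> \<le> (\<integral>\<^sup>+t. \<integral>\<^sup>+r. ?f t r \<partial>lborel \<partial>lborel)"
  proof (rule nn_integral_mono_AE)
    show "AE t in lborel. (\<integral>\<^sup>+r. indicator {..T} t * (indicator {..T} r * ?H t r) \<partial>lborel) \<le> (\<integral>\<^sup>+r. ?f t r \<partial>lborel)"
      using AE_lborel_singleton[of T]
    proof eventually_elim
      case (elim t)
      show ?case
      proof (rule nn_integral_mono_AE)
        show "AE r in lborel. indicator {..T} t * (indicator {..T} r * ?H t r) \<le> ?f t r"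
          using AE_lborel_singleton[of T]
          by eventually_elim (use elim in \<open>auto simp: indicator_def u0\<close>)
      qed
    qed
  qed
  also have "\<dots> = (\<integral>\<^sup>+t. (\<integral>\<^sup>+r. ?A t * (?A r * ?H t r) \<partial>lborel) + ((\<integral>\<^sup>+r. ?A t * (?N r * ?H t r) \<partial>lborel) + (\<integral>\<^sup>+r. ?N t * (?A r * ?H t r) \<partial>lborel)) \<partial>lborel)"
    by (intro nn_integral_cong) (subst nn_integral_add, simp, simp, subst nn_integral_add, simp_all)
  also have "\<dots> = (\<integral>\<^sup>+t. \<integral>\<^sup>+r. ?A t * (?A r * ?H t r) \<partial>lborel \<partial>lborel) + (?L + ?L)"
    unfolding L[symmetric] by (subst (2) L[folded L'])
      (subst nn_integral_add, simp, simp, subst nn_integral_add, simp_all)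
  also have "(\<integral>\<^sup>+t. \<integral>\<^sup>+r. ?A t * (?A r * ?H t r) \<partial>lborel \<partial>lborel) = gag_on \<sigma> {0<..<T} u"
    unfolding gag_on_def by (simp add: nn_integral_cmult)
  also have "?L + ?L = (ennreal (1 / (2 * \<sigma>)) + ennreal (1 / (2 * \<sigma>))) * sqn lborel (wt \<sigma> 0 T u)"
    by (simp only: distrib_right)
  also have "ennreal (1 / (2 * \<sigma>)) + ennreal (1 / (2 * \<sigma>)) = ennreal (1 / (2 * \<sigma>) + 1 / (2 * \<sigma>))"
    using s by (intro ennreal_plus[symmetric]) auto
  also have "1 / (2 * \<sigma>) + 1 / (2 * \<sigma>) = 1 / \<sigma>" by (simp add: field_simps)
  finally show ?thesis .
qed

section \<open>Fractional Hardy inequalities\<close>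

lemma sqn_wt_scale:
  assumes [measurable]: "f \<in> borel_measurable borel" and l: "l > 0"
  shows "sqn lborel (wt \<sigma> a b (\<lambda>t. f (l * t))) = ennreal (l powr (2 * \<sigma> - 1)) * sqn lborel (wt \<sigma> (l * a) (l * b) f)"
proof -
  have eq: "(wt \<sigma> a b (\<lambda>t. f (l * t)) t)\<^sup>2 = l powr (2 * \<sigma>) * (wt \<sigma> (l * a) (l * b) f (l * t))\<^sup>2" for t
  proof -
    have "(l * t) powr - \<sigma> = l powr - \<sigma> * t powr - \<sigma>" by (rule powr_mult)
    moreover have "l powr (2 * \<sigma>) * (l powr - \<sigma>)\<^sup>2 = 1"
      unfolding power2_eq_square powr_add[symmetric] using l by simp
    ultimately show ?thesis using l
      by (simp add: wt_def indicator_def power_mult_distrib mult.assoc[symmetric])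
  qed
  have "sqn lborel (wt \<sigma> (l * a) (l * b) f) = ennreal l * (\<integral>\<^sup>+t. ennreal ((wt \<sigma> (l * a) (l * b) f (l * t))\<^sup>2) \<partial>lborel)"
    unfolding sqn_def using l by (subst nn_integral_real_affine[where c=l and t=0]) auto
  moreover have "sqn lborel (wt \<sigma> a b (\<lambda>t. f (l * t))) = ennreal (l powr (2 * \<sigma>)) * (\<integral>\<^sup>+t. ennreal ((wt \<sigma> (l * a) (l * b) f (l * t))\<^sup>2) \<partial>lborel)"
    unfolding sqn_def eq by (subst nn_integral_cmult[symmetric]) (auto simp: ennreal_mult')
  moreover have "ennreal (l powr (2 * \<sigma> - 1)) * ennreal l = ennreal (l powr (2 * \<sigma>))"
  proof -
    have "l powr (2 * \<sigma> - 1) * l powr 1 = l powr (2 * \<sigma>)" unfolding powr_add[symmetric] by simp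
    then show ?thesis using l by (simp flip: ennreal_mult)
  qed
  ultimately show ?thesis by (simp only: mult.assoc[symmetric])
qed

text \<open>
  The seminorm restricted to the pairs \<open>(t, l t)\<close> with \<open>2 \<le> l \<le> 3\<close> controls the average over
  \<open>l\<close>, on an interval of length one, of the weighted norms of $u(t) - u(lt)$; some \<open>l\<close> is at
  most average. The factor $2^{1+2\sigma}$ comes from \<open>\<bar>t - l t\<bar> \<le> 2 t\<close>.
\<close>

lemma exists_good_dilation:
  assumes s: "0 < \<sigma>" and [measurable]: "u \<in> borel_measurable borel"
  shows "\<exists>l\<in>{2..3}. sqn lborel (wt \<sigma> 0 (T / l) (\<lambda>t. u t - u (l * t))) \<le> ennreal (2 powr (1 + 2 * \<sigma>)) * gag_on \<sigma> {0<..<T} u"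
proof -
  let ?c = "ennreal (2 powr (1 + 2 * \<sigma>)) * gag_on \<sigma> {0<..<T} u"
  let ?D = "\<lambda>l t. indicator {0<..<T} t * (indicator {0<..<T} (l * t) * ennreal ((t powr - \<sigma> * (u t - u (l * t)))\<^sup>2))"
  have D: "sqn lborel (wt \<sigma> 0 (T / l) (\<lambda>t. u t - u (l * t))) = (\<integral>\<^sup>+t. ?D l t \<partial>lborel)" if "l \<in> {2..3}" for l
    unfolding sqn_def
  proof (rule nn_integral_cong)
    fix t
    have "0 < t \<and> t < T / l \<longleftrightarrow> (0 < t \<and> t < T) \<and> (0 < l * t \<and> l * t < T)"
    proof -
      have "1 * t \<le> l * t" if "t > 0" using \<open>l \<in> {2..3}\<close> that by (intro mult_right_mono) auto
      then have *: "t < T" if "t > 0" "l * t < T" using that by linarith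
      show ?thesis using that by (auto simp: pos_less_divide_eq mult.commute[of t] zero_less_mult_iff intro: *)
    qed
    then show "ennreal ((wt \<sigma> 0 (T / l) (\<lambda>t. u t - u (l * t)) t)\<^sup>2) = ?D l t"
      by (auto simp: wt_def indicator_def)
  qed
  have pw: "(\<integral>\<^sup>+l. indicator {2..3} l * ?D l t \<partial>lborel)
      \<le> ennreal (2 powr (1 + 2 * \<sigma>)) * (indicator {0<..<T} t * (\<integral>\<^sup>+r. indicator {0<..<T} r * ennreal ((u t - u r)\<^sup>2 / \<bar>t - r\<bar> powr (1 + 2 * \<sigma>)) \<partial>lborel))" for t
  proof (cases "0 < t \<and> t < T")
    case True
    then have t: "t > 0" by simp
    have b: "1 / t * (indicator {2..3} (r / t) * (t powr - \<sigma> * (u t - u r))\<^sup>2) \<le> 2 powr (1 + 2 * \<sigma>) * ((u t - u r)\<^sup>2 / \<bar>t - r\<bar> powr (1 + 2 * \<sigma>))" for r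
    proof (cases "r / t \<in> {2..3}")
      case r: True
      then have r': "2 * t \<le> r" "r \<le> 3 * t" using t by (auto simp: field_simps)
      have "\<bar>t - r\<bar> powr (1 + 2 * \<sigma>) \<le> (2 * t) powr (1 + 2 * \<sigma>)" using r' t s by (intro powr_mono2) auto
      also have "\<dots> = 2 powr (1 + 2 * \<sigma>) * t powr (1 + 2 * \<sigma>)" by (rule powr_mult)
      finally have le: "\<bar>t - r\<bar> powr (1 + 2 * \<sigma>) \<le> 2 powr (1 + 2 * \<sigma>) * t powr (1 + 2 * \<sigma>)" .
      have "1 / t * (t powr - \<sigma>)\<^sup>2 = t powr (- (1 + 2 * \<sigma>))"
      proof -
        have "1 / t = t powr (- 1)" using t by (simp add: powr_minus_divide)
        then show ?thesis unfolding power2_eq_square powr_add[symmetric] by (simp only: powr_add[symmetric]) simp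
      qed
      also have "\<dots> = 1 / t powr (1 + 2 * \<sigma>)" by (rule powr_minus_divide)
      also have "\<dots> \<le> 2 powr (1 + 2 * \<sigma>) / \<bar>t - r\<bar> powr (1 + 2 * \<sigma>)"
        using le t r' by (simp add: divide_simps)
      finally have "1 / t * (t powr - \<sigma>)\<^sup>2 * (u t - u r)\<^sup>2 \<le> 2 powr (1 + 2 * \<sigma>) / \<bar>t - r\<bar> powr (1 + 2 * \<sigma>) * (u t - u r)\<^sup>2"
        by (rule mult_right_mono) simp
      then show ?thesis using r by (simp add: power_mult_distrib)
    qed simp
    have "(\<integral>\<^sup>+l. indicator {2..3} l * ?D l t \<partial>lborel) = ennreal (1 / t) * (\<integral>\<^sup>+r. indicator {2..3} (r / t) * ?D (r / t) t \<partial>lborel)"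
      using t nn_integral_real_affine[of "\<lambda>l. indicator {2..3} l * ?D l t" "1 / t" 0] by simp
    also have "\<dots> = (\<integral>\<^sup>+r. ennreal (1 / t) * (indicator {2..3} (r / t) * ?D (r / t) t) \<partial>lborel)"
      by (rule nn_integral_cmult[symmetric]) simp
    also have "\<dots> \<le> (\<integral>\<^sup>+r. ennreal (2 powr (1 + 2 * \<sigma>)) * (indicator {0<..<T} r * ennreal ((u t - u r)\<^sup>2 / \<bar>t - r\<bar> powr (1 + 2 * \<sigma>))) \<partial>lborel)"
    proof (rule nn_integral_mono)
      fix r
      have "ennreal (1 / t) * (indicator {2..3} (r / t) * ?D (r / t) t)
        = indicator {0<..<T} r * ennreal (1 / t * (indicator {2..3} (r / t) * (t powr - \<sigma> * (u t - u r))\<^sup>2))"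
        using True by (auto simp: indicator_def ennreal_mult'[symmetric])
      also have "\<dots> \<le> indicator {0<..<T} r * ennreal (2 powr (1 + 2 * \<sigma>) * ((u t - u r)\<^sup>2 / \<bar>t - r\<bar> powr (1 + 2 * \<sigma>)))"
        by (intro mult_left_mono ennreal_leI b) simp
      also have "\<dots> = ennreal (2 powr (1 + 2 * \<sigma>)) * (indicator {0<..<T} r * ennreal ((u t - u r)\<^sup>2 / \<bar>t - r\<bar> powr (1 + 2 * \<sigma>)))"
        by (subst ennreal_mult) (auto simp: mult.left_commute)
      finally show "ennreal (1 / t) * (indicator {2..3} (r / t) * ?D (r / t) t)
        \<le> ennreal (2 powr (1 + 2 * \<sigma>)) * (indicator {0<..<T} r * ennreal ((u t - u r)\<^sup>2 / \<bar>t - r\<bar> powr (1 + 2 * \<sigma>)))" .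
    qed
    also have "\<dots> = ennreal (2 powr (1 + 2 * \<sigma>)) * (\<integral>\<^sup>+r. indicator {0<..<T} r * ennreal ((u t - u r)\<^sup>2 / \<bar>t - r\<bar> powr (1 + 2 * \<sigma>)) \<partial>lborel)"
      by (rule nn_integral_cmult) simp
    finally show ?thesis using True by simp
  next
    case False
    then have *: "indicator {2..3} l * ?D l t = 0" for l by auto
    show ?thesis unfolding * by simp
  qed
  \<comment> \<open>Tonelli's theorem, and the substitution \<open>r = l t\<close> of the previous step.\<close>
  have tot: "(\<integral>\<^sup>+l. indicator {2..3} l * (\<integral>\<^sup>+t. ?D l t \<partial>lborel) \<partial>lborel) \<le> ?c"
  proof -
    have "(\<integral>\<^sup>+l. indicator {2..3} l * (\<integral>\<^sup>+t. ?D l t \<partial>lborel) \<partial>lborel) = (\<integral>\<^sup>+l. (\<integral>\<^sup>+t. indicator {2..3} l * ?D l t \<partial>lborel) \<partial>lborel)"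
      by (intro nn_integral_cong nn_integral_cmult[symmetric]) simp
    also have "\<dots> = (\<integral>\<^sup>+t. (\<integral>\<^sup>+l. indicator {2..3} l * ?D l t \<partial>lborel) \<partial>lborel)"
      by (rule lborel_pair.Fubini') simp
    also have "\<dots> \<le> (\<integral>\<^sup>+t. ennreal (2 powr (1 + 2 * \<sigma>)) * (indicator {0<..<T} t * (\<integral>\<^sup>+r. indicator {0<..<T} r * ennreal ((u t - u r)\<^sup>2 / \<bar>t - r\<bar> powr (1 + 2 * \<sigma>)) \<partial>lborel)) \<partial>lborel)"
      by (intro nn_integral_mono pw)
    also have "\<dots> = ?c" unfolding gag_on_def by (rule nn_integral_cmult) simp
    finally show ?thesis .
  qed
  show ?thesis
  proof (rule ccontr)
    assume "\<not> ?thesis"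
    then have gt: "?c < (\<integral>\<^sup>+t. ?D l t \<partial>lborel)" if "l \<in> {2..3}" for l
      unfolding D[OF that, symmetric] using that by (meson not_le)
    have cfin: "?c \<noteq> \<infinity>" using gt[of 2] by auto
    have c1: "(\<integral>\<^sup>+l. ?c * indicator {2..3::real} l \<partial>lborel) = ?c" by (subst nn_integral_cmult_indicator) auto
    have "(\<integral>\<^sup>+l. ?c * indicator {2..3::real} l \<partial>lborel) < (\<integral>\<^sup>+l. indicator {2..3} l * (\<integral>\<^sup>+t. ?D l t \<partial>lborel) \<partial>lborel)"
    proof (rule nn_integral_less)
      show "AE l in lborel. ?c * indicator {2..3} l \<le> indicator {2..3} l * (\<integral>\<^sup>+t. ?D l t \<partial>lborel)"
        using gt by (intro AE_I2) (auto simp: indicator_def intro: less_imp_le)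
      show "\<not> (AE l in lborel. indicator {2..3} l * (\<integral>\<^sup>+t. ?D l t \<partial>lborel) \<le> ?c * indicator {2..3} l)"
      proof
        assume "AE l in lborel. indicator {2..3} l * (\<integral>\<^sup>+t. ?D l t \<partial>lborel) \<le> ?c * indicator {2..3} l"
        then have "AE l in lborel. l \<notin> {2..3::real}"
          by eventually_elim (use gt in \<open>auto simp: indicator_def not_le[symmetric]\<close>)
        then have "emeasure lborel {2..3::real} = 0" by (subst (asm) AE_iff_measurable[where N="{2..3}"]) auto
        then show False by simp
      qed
    qed (use cfin c1 in auto)
    with c1 tot show False by simp
  qed
qed

lemma ennreal_absorb:
  assumes le: "x \<le> y + ennreal \<rho> * x" and x: "x < \<infinity>" and r: "0 \<le> \<rho>" "\<rho> < 1"
  shows "x \<le> ennreal (1 / (1 - \<rho>)) * y"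
proof (cases "y = \<infinity>")
  case True
  then show ?thesis using r by (simp add: ennreal_mult_eq_top_iff top_unique ennreal_mult_top)
next
  case False
  obtain a where a: "x = ennreal a" "a \<ge> 0" using x by (cases x) auto
  obtain b where b: "y = ennreal b" "b \<ge> 0" using False by (cases y) auto
  have "ennreal a \<le> ennreal (b + \<rho> * a)"
    using le a b r by (simp add: ennreal_mult')
  then have "a \<le> b + \<rho> * a" using a b r by (subst (asm) ennreal_le_iff) auto
  then have "a \<le> 1 / (1 - \<rho>) * b" using r by (simp add: field_simps)
  then show ?thesis using a b r by (simp add: ennreal_leI flip: ennreal_mult)
qed

lemma contraction_parameters:
  assumes "0 < \<theta>" "\<theta> < (1::real)"
  obtains e \<rho> where "e > 0" "(1 + e) * \<theta> = \<rho>" "0 \<le> \<rho>" "\<rho> < 1"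
proof (rule that[of "(1 / \<theta> - 1) / 2" "(1 + \<theta>) / 2"])
  show "(1 / \<theta> - 1) / 2 > 0" using assms by (simp add: field_simps)
  show "(1 + (1 / \<theta> - 1) / 2) * \<theta> = (1 + \<theta>) / 2" using assms by (simp add: field_simps)
qed (use assms in auto)

lemma sqn_wt_mono: "{a<..<b} \<subseteq> {c<..<d} \<Longrightarrow> sqn lborel (wt \<sigma> a b f) \<le> sqn lborel (wt \<sigma> c d f)"
  by (rule sqn_mono) (auto simp: wt_def indicator_def)

text \<open>
  Write $u(t) = u(lt) + (u(t) - u(lt))$ with a good dilation \<open>l\<close>. The dilation multiplies the
  weighted squared norm by $l^{2\sigma-1}$, which is less than one for \<open>\<sigma> < 1/2\<close>, so that term
  is absorbed in the left-hand side. Only the part of the interval beyond \<open>T / l\<close>, where the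
  weight is bounded, needs the $L^2$ norm.
\<close>

theorem hardy_small:
  assumes s: "0 < \<sigma>" "\<sigma> < 1/2" and T: "T > 0"
  shows "\<exists>C\<ge>0. \<forall>u\<in>borel_measurable borel. sqn lborel (\<lambda>t. indicator {0<..<T} t * u t) < \<infinity> \<longrightarrow>
     sqn lborel (wt \<sigma> 0 T u) \<le> ennreal C * (sqn lborel (\<lambda>t. indicator {0<..<T} t * u t) + gag_on \<sigma> {0<..<T} u)"
proof -
  define \<theta> where "\<theta> = 2 powr (2 * \<sigma> - 1)"
  have th: "0 < \<theta>" "\<theta> < 1" using s by (auto simp: \<theta>_def powr_less_one)
  obtain e \<rho> where e: "e > 0" and \<rho>: "(1 + e) * \<theta> = \<rho>" "0 \<le> \<rho>" "\<rho> < 1"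
    using contraction_parameters[OF th] by blast
  define k where "k = (T / 3) powr (- \<sigma>)"
  define c1 where "c1 = (1 + 1 / e) * 2 powr (1 + 2 * \<sigma>)"
  define c2 where "c2 = k\<^sup>2"
  define C where "C = 1 / (1 - \<rho>) * (max c1 c2)"
  have c: "c1 \<ge> 0" "c2 \<ge> 0" using e by (auto simp: c1_def c2_def)
  have C: "C \<ge> 0" unfolding C_def using c \<rho> by (intro mult_nonneg_nonneg) auto
  show ?thesis
  proof (intro exI[of _ C] conjI ballI impI C)
    fix u :: "real \<Rightarrow> real"
    assume [measurable]: "u \<in> borel_measurable borel" and fin: "sqn lborel (\<lambda>t. indicator {0<..<T} t * u t) < \<infinity>"
    let ?n = "sqn lborel (\<lambda>t. indicator {0<..<T} t * u t)" and ?g = "gag_on \<sigma> {0<..<T} u"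
    obtain l where l: "2 \<le> l" "l \<le> 3"
      and D: "sqn lborel (wt \<sigma> 0 (T / l) (\<lambda>t. u t - u (l * t))) \<le> ennreal (2 powr (1 + 2 * \<sigma>)) * ?g"
      using exists_good_dilation[OF s(1), of u T] by auto
    \<comment> \<open>Absorption requires a finite left-hand side, so the weight is first cut off near \<open>0\<close>,
      uniformly in the cut-off \<open>a\<close>.\<close>
    have bd: "sqn lborel (wt \<sigma> a T u) \<le> ennreal C * (?n + ?g)" if a: "a > 0" for a
    proof -
      have finN: "sqn lborel (wt \<sigma> a T u) < \<infinity>"
      proof -
        have "sqn lborel (wt \<sigma> a T u) \<le> sqn lborel (\<lambda>t. a powr - \<sigma> * (indicator {0<..<T} t * u t))"
        proof (rule sqn_mono)
          fix t
          have "t powr - \<sigma> \<le> a powr - \<sigma>" if "a < t" using that a s by (intro powr_mono2') auto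
          then show "\<bar>wt \<sigma> a T u t\<bar> \<le> \<bar>a powr - \<sigma> * (indicator {0<..<T} t * u t)\<bar>"
            using a by (auto simp: wt_def indicator_def abs_mult intro!: mult_right_mono)
        qed
        also have "\<dots> < \<infinity>" using fin by (subst sqn_cmult) (auto simp: ennreal_mult_less_top)
        finally show ?thesis .
      qed
      have "sqn lborel (wt \<sigma> a (T / l) u) = sqn lborel (\<lambda>t. wt \<sigma> a (T / l) (\<lambda>t. u (l * t)) t + wt \<sigma> a (T / l) (\<lambda>t. u t - u (l * t)) t)"
        by (simp add: wt_add[symmetric])
      also have "\<dots> \<le> ennreal (1 + e) * sqn lborel (wt \<sigma> a (T / l) (\<lambda>t. u (l * t))) + ennreal (1 + 1 / e) * sqn lborel (wt \<sigma> a (T / l) (\<lambda>t. u t - u (l * t)))"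
        by (rule sqn_add_le_weighted) (use e in auto)
      also have "\<dots> \<le> ennreal \<rho> * sqn lborel (wt \<sigma> a T u) + ennreal c1 * ?g"
      proof (rule add_mono)
        have "sqn lborel (wt \<sigma> a (T / l) (\<lambda>t. u (l * t))) = ennreal (l powr (2 * \<sigma> - 1)) * sqn lborel (wt \<sigma> (l * a) T u)"
          using sqn_wt_scale[of u l \<sigma> a "T / l"] l by simp
        also have "\<dots> \<le> ennreal \<theta> * sqn lborel (wt \<sigma> a T u)"
        proof (intro mult_mono ennreal_leI sqn_wt_mono)
          show "l powr (2 * \<sigma> - 1) \<le> \<theta>" unfolding \<theta>_def using l s by (intro powr_mono2') auto
          have "a \<le> l * a" using l a by simp
          then show "{l * a<..<T} \<subseteq> {a<..<T}" by auto
        qed auto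
        finally have "ennreal (1 + e) * sqn lborel (wt \<sigma> a (T / l) (\<lambda>t. u (l * t))) \<le> ennreal (1 + e) * (ennreal \<theta> * sqn lborel (wt \<sigma> a T u))"
          by (rule mult_left_mono) simp
        also have "\<dots> = ennreal ((1 + e) * \<theta>) * sqn lborel (wt \<sigma> a T u)"
          using e th by (subst ennreal_mult) (auto simp: mult.assoc)
        finally show "ennreal (1 + e) * sqn lborel (wt \<sigma> a (T / l) (\<lambda>t. u (l * t))) \<le> ennreal \<rho> * sqn lborel (wt \<sigma> a T u)"
          by (simp only: \<rho>(1))
        have "sqn lborel (wt \<sigma> a (T / l) (\<lambda>t. u t - u (l * t))) \<le> ennreal (2 powr (1 + 2 * \<sigma>)) * ?g"
          by (rule order.trans[OF sqn_wt_mono D]) (use a in auto)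
        then have "ennreal (1 + 1 / e) * sqn lborel (wt \<sigma> a (T / l) (\<lambda>t. u t - u (l * t))) \<le> ennreal (1 + 1 / e) * (ennreal (2 powr (1 + 2 * \<sigma>)) * ?g)"
          by (rule mult_left_mono) simp
        also have "\<dots> = ennreal c1 * ?g" unfolding c1_def using e by (subst ennreal_mult) (auto simp: mult.assoc)
        finally show "ennreal (1 + 1 / e) * sqn lborel (wt \<sigma> a (T / l) (\<lambda>t. u t - u (l * t))) \<le> ennreal c1 * ?g" .
      qed
      finally have 1: "sqn lborel (wt \<sigma> a (T / l) u) \<le> ennreal \<rho> * sqn lborel (wt \<sigma> a T u) + ennreal c1 * ?g" .
      have "sqn lborel (wt \<sigma> a T u) \<le> sqn lborel (wt \<sigma> a (T / l) u) + sqn lborel (\<lambda>t. k * (indicator {0<..<T} t * u t))"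
        unfolding sqn_def
      proof (subst nn_integral_add[symmetric])
        show "(\<integral>\<^sup>+t. ennreal ((wt \<sigma> a T u t)\<^sup>2) \<partial>lborel) \<le> (\<integral>\<^sup>+t. ennreal ((wt \<sigma> a (T / l) u t)\<^sup>2) + ennreal ((k * (indicator {0<..<T} t * u t))\<^sup>2) \<partial>lborel)"
        proof (rule nn_integral_mono)
          fix t
          show "ennreal ((wt \<sigma> a T u t)\<^sup>2) \<le> ennreal ((wt \<sigma> a (T / l) u t)\<^sup>2) + ennreal ((k * (indicator {0<..<T} t * u t))\<^sup>2)"
          proof (cases "T / l \<le> t \<and> t < T \<and> a < t")
            case True
            have "T / 3 \<le> T / l" using l T by (intro divide_left_mono) auto
            then have "T / 3 \<le> t" using True by linarith
            then have "t powr - \<sigma> \<le> k" unfolding k_def using True T s by (intro powr_mono2') auto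
            then have "t powr - \<sigma> * \<bar>u t\<bar> \<le> k * \<bar>u t\<bar>" by (rule mult_right_mono) simp
            then have "\<bar>t powr - \<sigma> * u t\<bar> \<le> \<bar>k * u t\<bar>" by (simp add: abs_mult k_def)
            then have "(t powr - \<sigma> * u t)\<^sup>2 \<le> (k * u t)\<^sup>2" by (simp only: abs_le_square_iff)
            then show ?thesis using True a by (simp add: wt_def ennreal_leI add_increasing)
          next
            case False
            then have "(wt \<sigma> a T u t)\<^sup>2 \<le> (wt \<sigma> a (T / l) u t)\<^sup>2" by (auto simp: wt_def indicator_def)
            then show ?thesis by (simp add: ennreal_leI add_increasing2)
          qed
        qed
      qed auto
      also have "sqn lborel (\<lambda>t. k * (indicator {0<..<T} t * u t)) = ennreal c2 * ?n"
        unfolding c2_def by (rule sqn_cmult) simp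
      finally have "sqn lborel (wt \<sigma> a T u) \<le> (ennreal \<rho> * sqn lborel (wt \<sigma> a T u) + ennreal c1 * ?g) + ennreal c2 * ?n"
        using 1 by (meson add_right_mono order.trans)
      then have "sqn lborel (wt \<sigma> a T u) \<le> (ennreal c2 * ?n + ennreal c1 * ?g) + ennreal \<rho> * sqn lborel (wt \<sigma> a T u)"
        by (simp only: add_ac)
      from ennreal_absorb[OF this finN \<rho>(2,3)]
      have "sqn lborel (wt \<sigma> a T u) \<le> ennreal (1 / (1 - \<rho>)) * (ennreal c2 * ?n + ennreal c1 * ?g)" .
      also have "\<dots> \<le> ennreal (1 / (1 - \<rho>)) * (ennreal (max c1 c2) * ?n + ennreal (max c1 c2) * ?g)"
        by (intro mult_left_mono add_mono mult_right_mono ennreal_leI) auto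
      also have "\<dots> = ennreal C * (?n + ?g)"
        unfolding C_def using \<rho> c by (subst ennreal_mult) (auto simp: distrib_left mult.assoc)
      finally show ?thesis .
    qed
    show "sqn lborel (wt \<sigma> 0 T u) \<le> ennreal C * (?n + ?g)"
    proof (rule sqn_lim_le[where f="\<lambda>n. wt \<sigma> (1 / real (Suc n)) T u" and N=0])
      show "AE t in lborel. (\<lambda>n. wt \<sigma> (1 / real (Suc n)) T u t) \<longlonglongrightarrow> wt \<sigma> 0 T u t"
      proof (rule AE_I2)
        fix t
        have "eventually (\<lambda>n. wt \<sigma> (1 / real (Suc n)) T u t = wt \<sigma> 0 T u t) sequentially"
        proof (cases "t > 0")
          case True
          then obtain k where k: "1 / real (Suc k) < t" using nat_approx_posE by blast
          show ?thesis using eventually_ge_at_top[of k]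
          proof eventually_elim
            case (elim n)
            then have "1 / real (Suc n) \<le> 1 / real (Suc k)" by (simp add: field_simps)
            then show ?case using k True by (simp add: wt_def indicator_def)
          qed
        next
          case False
          have "\<not> 1 / real (Suc n) < t" for n using False by (meson less_trans of_nat_0_less_iff zero_less_Suc zero_less_divide_1_iff)
          then show ?thesis using False by (intro always_eventually) (auto simp: wt_def indicator_def)
        qed
        then show "(\<lambda>n. wt \<sigma> (1 / real (Suc n)) T u t) \<longlonglongrightarrow> wt \<sigma> 0 T u t" by (rule tendsto_eventually)
      qed
      show "sqn lborel (wt \<sigma> (1 / real (Suc n)) T u) \<le> ennreal C * (?n + ?g)" for n by (rule bd) simp
    qed simp
  qed
qed

text \<open>
  For \<open>\<sigma> > 1/2\<close> it is the inverse dilation that contracts the weighted norm. Iterating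
  $u(t) - u(t/l^{n+1}) = (u(t) - u(t/l)) + (u - u(\cdot/l^n))(t/l)$ gives a bound on
  $u(t) - u(t/l^n)$ that is uniform in \<open>n\<close>, and $u(t/l^n)$ tends to \<open>u 0 = 0\<close>.
\<close>

theorem hardy_large:
  assumes s: "1/2 < \<sigma>" and T: "T > 0"
  shows "\<exists>C\<ge>0. \<forall>u\<in>borel_measurable borel. continuous_on {0..T} u \<longrightarrow> u 0 = 0 \<longrightarrow>
     sqn lborel (wt \<sigma> 0 T u) \<le> ennreal C * gag_on \<sigma> {0<..<T} u"
proof -
  define \<theta> where "\<theta> = 2 powr (1 - 2 * \<sigma>)"
  have th: "0 < \<theta>" "\<theta> < 1" using s by (auto simp: \<theta>_def powr_less_one)
  obtain e \<rho> where e: "e > 0" and \<rho>: "(1 + e) * \<theta> = \<rho>" "0 \<le> \<rho>" "\<rho> < 1"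
    using contraction_parameters[OF th] by blast
  define c1 where "c1 = (1 + 1 / e) * 2 powr (1 + 2 * \<sigma>)"
  define C where "C = 1 / (1 - \<rho>) * c1"
  have c1: "c1 \<ge> 0" using e by (auto simp: c1_def)
  have C: "C \<ge> 0" unfolding C_def using c1 \<rho> by (intro mult_nonneg_nonneg) auto
  \<comment> \<open>\<open>C\<close> is the fixed point of the recursion for the bounds of the iterates.\<close>
  have C_eq: "C = c1 + \<rho> * C" unfolding C_def using \<rho> by (simp add: field_simps)
  show ?thesis
  proof (intro exI[of _ C] conjI ballI impI C)
    fix u :: "real \<Rightarrow> real"
    assume [measurable]: "u \<in> borel_measurable borel" and cont: "continuous_on {0..T} u" and u0: "u 0 = 0"
    let ?g = "gag_on \<sigma> {0<..<T} u"
    obtain l where l: "2 \<le> l" "l \<le> 3"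
      and D: "sqn lborel (wt \<sigma> 0 (T / l) (\<lambda>t. u t - u (l * t))) \<le> ennreal (2 powr (1 + 2 * \<sigma>)) * ?g"
      using exists_good_dilation[of \<sigma> u T] s by auto
    have scale: "sqn lborel (wt \<sigma> 0 T (\<lambda>t. f (1 / l * t))) \<le> ennreal \<theta> * sqn lborel (wt \<sigma> 0 (T / l) f)"
      if [measurable]: "f \<in> borel_measurable borel" for f
    proof -
      have "sqn lborel (wt \<sigma> 0 T (\<lambda>t. f (1 / l * t))) = ennreal ((1 / l) powr (2 * \<sigma> - 1)) * sqn lborel (wt \<sigma> 0 (T / l) f)"
        using sqn_wt_scale[of f "1 / l" \<sigma> 0 T] l by simp
      also have "(1 / l) powr (2 * \<sigma> - 1) = l powr (1 - 2 * \<sigma>)"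
        using l powr_minus_divide[of l "2 * \<sigma> - 1"] by (simp add: powr_divide)
      also have "ennreal (l powr (1 - 2 * \<sigma>)) * sqn lborel (wt \<sigma> 0 (T / l) f) \<le> ennreal \<theta> * sqn lborel (wt \<sigma> 0 (T / l) f)"
        unfolding \<theta>_def using l s by (intro mult_right_mono ennreal_leI powr_mono2') auto
      finally show ?thesis .
    qed
    have D': "sqn lborel (wt \<sigma> 0 T (\<lambda>t. u t - u (1 / l * t))) \<le> ennreal (2 powr (1 + 2 * \<sigma>)) * ?g"
    proof -
      have "sqn lborel (wt \<sigma> 0 T (\<lambda>t. u t - u (1 / l * t))) = sqn lborel (wt \<sigma> 0 T (\<lambda>t. (\<lambda>t. u (l * t) - u t) (1 / l * t)))"
        using l by simp
      also have "\<dots> \<le> ennreal \<theta> * sqn lborel (wt \<sigma> 0 (T / l) (\<lambda>t. u (l * t) - u t))"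
        by (rule scale) simp
      also have "sqn lborel (wt \<sigma> 0 (T / l) (\<lambda>t. u (l * t) - u t)) = sqn lborel (wt \<sigma> 0 (T / l) (\<lambda>t. u t - u (l * t)))"
        unfolding sqn_def wt_def by (simp add: power_mult_distrib power2_commute)
      also have "ennreal \<theta> * \<dots> \<le> 1 * \<dots>"
        using th by (intro mult_right_mono) (auto simp: ennreal_leI simp flip: ennreal_1)
      finally show ?thesis using D by simp
    qed
    have it: "sqn lborel (wt \<sigma> 0 T (\<lambda>t. u t - u ((1 / l)^n * t))) \<le> ennreal C * ?g" for n
    proof (induction n)
      case 0
      then show ?case by (simp add: sqn_def wt_def)
    next
      case (Suc n)
      let ?f = "\<lambda>t. u t - u ((1 / l)^n * t)"
      have "sqn lborel (wt \<sigma> 0 T (\<lambda>t. u t - u ((1 / l)^Suc n * t)))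
         = sqn lborel (\<lambda>t. wt \<sigma> 0 T (\<lambda>t. ?f (1 / l * t)) t + wt \<sigma> 0 T (\<lambda>t. u t - u (1 / l * t)) t)"
        by (simp add: wt_add[symmetric] mult_ac)
      also have "\<dots> \<le> ennreal (1 + e) * sqn lborel (wt \<sigma> 0 T (\<lambda>t. ?f (1 / l * t))) + ennreal (1 + 1 / e) * sqn lborel (wt \<sigma> 0 T (\<lambda>t. u t - u (1 / l * t)))"
        by (rule sqn_add_le_weighted) (use e in auto)
      also have "\<dots> \<le> ennreal (\<rho> * C) * ?g + ennreal c1 * ?g"
      proof (rule add_mono)
        have "sqn lborel (wt \<sigma> 0 T (\<lambda>t. ?f (1 / l * t))) \<le> ennreal \<theta> * sqn lborel (wt \<sigma> 0 (T / l) ?f)"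
          by (rule scale) simp
        also have "\<dots> \<le> ennreal \<theta> * (ennreal C * ?g)"
        proof (rule mult_left_mono)
          have "T / l \<le> T / 1" using l T by (intro divide_left_mono) auto
          then have "sqn lborel (wt \<sigma> 0 (T / l) ?f) \<le> sqn lborel (wt \<sigma> 0 T ?f)" by (intro sqn_wt_mono) auto
          then show "sqn lborel (wt \<sigma> 0 (T / l) ?f) \<le> ennreal C * ?g" using Suc by (rule order.trans)
        qed simp
        finally have "ennreal (1 + e) * sqn lborel (wt \<sigma> 0 T (\<lambda>t. ?f (1 / l * t))) \<le> ennreal (1 + e) * (ennreal \<theta> * (ennreal C * ?g))"
          by (rule mult_left_mono) simp
        also have "\<dots> = ennreal ((1 + e) * \<theta> * C) * ?g"
          using e th C by (simp only: ennreal_mult mult.assoc mult_nonneg_nonneg add_nonneg_nonneg less_imp_le zero_le_one)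
        finally show "ennreal (1 + e) * sqn lborel (wt \<sigma> 0 T (\<lambda>t. ?f (1 / l * t))) \<le> ennreal (\<rho> * C) * ?g"
          by (simp only: \<rho>(1))
        have "ennreal (1 + 1 / e) * sqn lborel (wt \<sigma> 0 T (\<lambda>t. u t - u (1 / l * t))) \<le> ennreal (1 + 1 / e) * (ennreal (2 powr (1 + 2 * \<sigma>)) * ?g)"
          by (rule mult_left_mono[OF D']) simp
        also have "\<dots> = ennreal c1 * ?g" unfolding c1_def using e by (subst ennreal_mult) (auto simp: mult.assoc)
        finally show "ennreal (1 + 1 / e) * sqn lborel (wt \<sigma> 0 T (\<lambda>t. u t - u (1 / l * t))) \<le> ennreal c1 * ?g" .
      qed
      also have "\<dots> = ennreal (\<rho> * C + c1) * ?g"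
        using c1 C \<rho> by (subst ennreal_plus) (auto simp: distrib_right)
      also have "\<rho> * C + c1 = C" using C_eq by simp
      finally show ?case .
    qed
    show "sqn lborel (wt \<sigma> 0 T u) \<le> ennreal C * ?g"
    proof (rule sqn_lim_le[where f="\<lambda>n. wt \<sigma> 0 T (\<lambda>t. u t - u ((1 / l)^n * t))" and N=0])
      show "AE t in lborel. (\<lambda>n. wt \<sigma> 0 T (\<lambda>t. u t - u ((1 / l)^n * t)) t) \<longlonglongrightarrow> wt \<sigma> 0 T u t"
      proof (rule AE_I2)
        fix t
        show "(\<lambda>n. wt \<sigma> 0 T (\<lambda>t. u t - u ((1 / l)^n * t)) t) \<longlonglongrightarrow> wt \<sigma> 0 T u t"
        proof (cases "0 < t \<and> t < T")
          case True
          have "(\<lambda>n. (1 / l)^n * t) \<longlonglongrightarrow> 0"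
            using l by (intro tendsto_mult_left_zero LIMSEQ_realpow_zero) auto
          moreover have "(1 / l)^n * t \<in> {0..T}" for n
          proof -
            have "(1 / l)^n \<le> 1" using l by (intro power_le_one) auto
            then have "(1 / l)^n * t \<le> 1 * t" using True by (intro mult_right_mono) auto
            moreover have "0 \<le> (1 / l)^n * t" using True l by (intro mult_nonneg_nonneg zero_le_power) auto
            ultimately show ?thesis unfolding atLeastAtMost_iff using True by linarith
          qed
          ultimately have "(\<lambda>n. u ((1 / l)^n * t)) \<longlonglongrightarrow> u 0"
            using T by (intro continuous_on_tendsto_compose[OF cont]) auto
          then have "(\<lambda>n. indicator {0<..<T} t * (t powr - \<sigma> * (u t - u ((1 / l)^n * t)))) \<longlonglongrightarrow> indicator {0<..<T} t * (t powr - \<sigma> * (u t - u 0))"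
            by (intro tendsto_intros)
          then show ?thesis by (simp add: wt_def u0)
        next
          case False
          then show ?thesis by (auto simp: wt_def)
        qed
      qed
      show "sqn lborel (wt \<sigma> 0 T (\<lambda>t. u t - u ((1 / l)^n * t))) \<le> ennreal C * ?g" for n by (rule it)
    qed simp
  qed
qed

section \<open>Square integrable functions on an interval\<close>

definition L2on :: "real \<Rightarrow> (real \<Rightarrow> real) \<Rightarrow> bool" where
  "L2on T v \<longleftrightarrow> L2half v \<and> (\<forall>t\<ge>T. v t = 0)"

lemma L2onD:
  assumes "L2on T v"
  shows "v \<in> borel_measurable borel" "L2half v" "L2loc v" "sqn lborel v < \<infinity>" "t \<le> 0 \<Longrightarrow> v t = 0" "t \<ge> T \<Longrightarrow> v t = 0"
  using assms L2halfD[of v] by (auto simp: L2on_def)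

lemma L2on_integrable: "L2on T v \<Longrightarrow> integrable lborel v"
  by (rule L2_compact_integrable[of _ T]) (auto simp: L2on_def)

lemma L2onI:
  assumes "v \<in> borel_measurable borel" "\<And>t. t \<le> 0 \<Longrightarrow> v t = 0" "\<And>t. t \<ge> T \<Longrightarrow> v t = 0" "sqn lborel v < \<infinity>"
  shows "L2on T v"
  using assms by (auto simp: L2on_def L2half_def)

lemma L2on_lincomb: "L2on T v \<Longrightarrow> L2on T w \<Longrightarrow> L2on T (\<lambda>t. x * v t + y * w t)"
  unfolding L2on_def using L2half_lincomb by auto

lemma L2on_trunc:
  assumes "L2loc v"
  shows "L2on T (\<lambda>t. indicator {0<..<T} t * v t)"
proof (rule L2onI)
  have [measurable]: "v \<in> borel_measurable borel" using assms by (rule L2loc_measurable)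
  show "(\<lambda>t. indicator {0<..<T} t * v t) \<in> borel_measurable borel" by simp
  have "sqn lborel (\<lambda>t. indicator {0<..<T} t * v t) \<le> sqn lborel (\<lambda>t. indicator {..T} t * v t)"
    by (rule sqn_mono) (auto simp: indicator_def)
  also have "\<dots> < \<infinity>" using assms by (auto simp: L2loc_def)
  finally show "sqn lborel (\<lambda>t. indicator {0<..<T} t * v t) < \<infinity>" .
qed auto

lemma L2on_bounded:
  assumes [measurable]: "f \<in> borel_measurable borel" and B: "\<And>t. t \<in> {0<..<T} \<Longrightarrow> \<bar>f t\<bar> \<le> B"
  shows "L2on T (\<lambda>t. indicator {0<..<T} t * f t)"
proof (rule L2onI)
  show "(\<lambda>t. indicator {0<..<T} t * f t) \<in> borel_measurable borel" by simp
  have "sqn lborel (\<lambda>t. indicator {0<..<T} t * f t) \<le> sqn lborel (\<lambda>t. B * ivl T t)"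
  proof (rule sqn_mono)
    fix t show "\<bar>indicator {0<..<T} t * f t\<bar> \<le> \<bar>B * ivl T t\<bar>"
      using B[of t] by (auto simp: indicator_def ivl_def)
  qed
  also have "\<dots> < \<infinity>" using sqn_ivl[of T] by (simp add: sqn_cmult ennreal_mult_less_top)
  finally show "sqn lborel (\<lambda>t. indicator {0<..<T} t * f t) < \<infinity>" .
qed auto

lemma L2_product_integrable:
  assumes [measurable]: "f \<in> borel_measurable M" "g \<in> borel_measurable M"
    and "sqn M f < \<infinity>" "sqn M g < \<infinity>"
  shows "integrable M (\<lambda>x. f x * g x)"
proof (rule Bochner_Integration.integrable_bound)
  show "integrable M (\<lambda>x. (f x)\<^sup>2 + (g x)\<^sup>2)"
    by (intro Bochner_Integration.integrable_add sqn_finite_integrable assms)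
  have "\<bar>f x * g x\<bar> \<le> (f x)\<^sup>2 + (g x)\<^sup>2" for x
  proof -
    have "0 \<le> (\<bar>f x\<bar> - \<bar>g x\<bar>)\<^sup>2" by simp
    then have "2 * (\<bar>f x\<bar> * \<bar>g x\<bar>) \<le> (f x)\<^sup>2 + (g x)\<^sup>2" by (simp add: power2_eq_square algebra_simps)
    moreover have "0 \<le> \<bar>f x\<bar> * \<bar>g x\<bar>" by simp
    ultimately show ?thesis unfolding abs_mult by linarith
  qed
  then show "AE x in M. norm (f x * g x) \<le> norm ((f x)\<^sup>2 + (g x)\<^sup>2)"
    by (intro AE_I2) (metis abs_ge_self order.trans real_norm_def)
qed simp

lemma L2_Cauchy_Schwarz:
  assumes [measurable]: "f \<in> borel_measurable M" "g \<in> borel_measurable M"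
  shows "ennreal ((LINT x|M. f x * g x)\<^sup>2) \<le> sqn M f * sqn M g"
proof (cases "integrable M (\<lambda>x. f x * g x)")
  case True
  have "ennreal \<bar>LINT x|M. f x * g x\<bar> \<le> (\<integral>\<^sup>+x. ennreal \<bar>f x\<bar> * ennreal \<bar>g x\<bar> \<partial>M)"
    using integral_norm_bound_ennreal[OF True] by (simp add: abs_mult ennreal_mult)
  then have "(ennreal \<bar>LINT x|M. f x * g x\<bar>)\<^sup>2 \<le> (\<integral>\<^sup>+x. ennreal \<bar>f x\<bar> * ennreal \<bar>g x\<bar> \<partial>M)\<^sup>2"
    by (rule power_mono) simp
  also have "\<dots> \<le> (\<integral>\<^sup>+x. (ennreal \<bar>f x\<bar>)\<^sup>2 \<partial>M) * (\<integral>\<^sup>+x. (ennreal \<bar>g x\<bar>)\<^sup>2 \<partial>M)"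
    by (rule Cauchy_Schwarz_nn_integral) simp_all
  finally show ?thesis by (simp add: sqn_def ennreal_power)
next
  case False
  then show ?thesis by (simp add: not_integrable_integral_eq)
qed

section \<open>Continuity of fractional integrals of order above one half\<close>

text \<open>
  The kernel is decreasing and \<open>(x - y)\<^sup>2 \<le> x\<^sup>2 - y\<^sup>2\<close> for \<open>x \<ge> y \<ge> 0\<close>. Hence on \<open>(0,s)\<close> the
  squared norm of the increment is at most a difference of squared norms of the kernel over
  intervals. These are explicit, as is the remaining part on \<open>(s,t)\<close>.
\<close>

lemma kern_increment_L2:
  assumes a: "1/2 < a" "a \<le> 1" and s: "0 \<le> s" "s \<le> t"
  shows "sqn lborel (\<lambda>r. indicator {0<..} r * (kern a (t - r) - kern a (s - r)))
     \<le> ennreal (2 / ((2 * a - 1) * (Gamma a)\<^sup>2) * (t - s) powr (2 * a - 1))"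
proof -
  define q where "q = 2 * a - 1"
  have q: "q > 0" using a by (simp add: q_def)
  define G where "G = 1 / (q * (Gamma a)\<^sup>2)"
  have Gp: "Gamma a > 0" using a by (intro Gamma_real_pos) auto
  have G: "G \<ge> 0" using q by (simp add: G_def)
  let ?K = "\<lambda>y. \<integral>\<^sup>+x. ennreal ((kern a x)\<^sup>2) * indicator {..y} x \<partial>lborel"
  have K: "?K y = ennreal (G * y powr q)" if "y \<ge> 0" for y
  proof -
    have "?K y = (\<integral>\<^sup>+x. ennreal (1 / (Gamma a)\<^sup>2) * (ennreal (x powr (2 * a - 2)) * indicator {0<..y} x) \<partial>lborel)"
    proof (rule nn_integral_cong)
      fix x :: real
      have "(x powr (a - 1))\<^sup>2 = x powr (2 * a - 2)" unfolding power2_eq_square powr_add[symmetric] by simp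
      then have "(kern a x)\<^sup>2 = 1 / (Gamma a)\<^sup>2 * x powr (2 * a - 2)" if "x > 0" using that by (simp add: kern_def power_divide)
      then show "ennreal ((kern a x)\<^sup>2) * indicator {..y} x = ennreal (1 / (Gamma a)\<^sup>2) * (ennreal (x powr (2 * a - 2)) * indicator {0<..y} x)"
        by (cases "x > 0") (simp_all only: ennreal_mult' zero_le_divide_1_iff zero_le_power2, auto simp: indicator_def)
    qed
    also have "\<dots> = ennreal (1 / (Gamma a)\<^sup>2) * ennreal (y powr (2 * a - 2 + 1) / (2 * a - 2 + 1))"
      by (subst nn_integral_cmult) (use that a in \<open>auto simp: nn_integral_powr_Ioc\<close>)
    also have "\<dots> = ennreal (1 / (Gamma a)\<^sup>2 * (y powr (2 * a - 2 + 1) / (2 * a - 2 + 1)))"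
      using a by (intro ennreal_mult[symmetric]) auto
    also have "1 / (Gamma a)\<^sup>2 * (y powr (2 * a - 2 + 1) / (2 * a - 2 + 1)) = G * y powr q"
      by (simp add: G_def q_def)
    finally show ?thesis .
  qed
  let ?d = "\<lambda>r. ennreal ((indicator {0<..} r * (kern a (t - r) - kern a (s - r)))\<^sup>2)"
  let ?k = "\<lambda>b y r. ennreal ((kern a (b - r))\<^sup>2) * indicator {..y} (b - r)"
  have Ki: "(\<integral>\<^sup>+r. ?k b y r \<partial>lborel) = ?K y" for b y
    by (rule nn_integral_reflect_shift[of "\<lambda>x. ennreal ((kern a x)\<^sup>2) * indicator {..y} x"]) simp
  have pw: "?d r + ?k t t r \<le> ?k s s r + 2 * ?k t (t - s) r" if r: "r \<noteq> 0" "r \<noteq> s" for r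
  proof -
    consider "r < 0" | "0 < r" "r < s" | "s < r" "0 < r"
      using r less_linear[of r 0] less_linear[of r s] by blast
    then show ?thesis
    proof cases
      case 1
      then show ?thesis using s by simp
    next
      case 2
      have "(t - r) powr (a - 1) \<le> (s - r) powr (a - 1)"
        using 2 s a by (intro powr_mono2') auto
      then have m: "0 \<le> kern a (t - r)" "kern a (t - r) \<le> kern a (s - r)"
        using 2 s Gp by (auto simp: kern_def divide_right_mono)
      have "(kern a (t - r) - kern a (s - r))\<^sup>2 + (kern a (t - r))\<^sup>2 \<le> (kern a (s - r))\<^sup>2"
      proof -
        have "kern a (t - r) * kern a (t - r) \<le> kern a (s - r) * kern a (t - r)" using m by (intro mult_right_mono)
        then show ?thesis by (simp add: power2_eq_square algebra_simps)
      qed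
      then have "ennreal ((kern a (t - r) - kern a (s - r))\<^sup>2 + (kern a (t - r))\<^sup>2) \<le> ennreal ((kern a (s - r))\<^sup>2)"
        by (rule ennreal_leI)
      then show ?thesis using 2 s by (auto simp: add_increasing2)
    next
      case 3
      then have "kern a (s - r) = 0" by simp
      then show ?thesis using 3 s by (simp add: mult_2[symmetric])
    qed
  qed
  have fin: "?K t < \<infinity>" using K[of t] s by simp
  have "sqn lborel (\<lambda>r. indicator {0<..} r * (kern a (t - r) - kern a (s - r))) + ?K t = (\<integral>\<^sup>+r. ?d r + ?k t t r \<partial>lborel)"
    unfolding sqn_def Ki[of t t, symmetric] by (rule nn_integral_add[symmetric]) simp_all
  also have "\<dots> \<le> (\<integral>\<^sup>+r. ?k s s r + 2 * ?k t (t - s) r \<partial>lborel)"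
  proof (rule nn_integral_mono_AE)
    show "AE r in lborel. ?d r + ?k t t r \<le> ?k s s r + 2 * ?k t (t - s) r"
      using AE_lborel_singleton[of 0] AE_lborel_singleton[of s] by eventually_elim (rule pw)
  qed
  also have "\<dots> = ?K s + 2 * ?K (t - s)"
    by (simp add: nn_integral_add nn_integral_cmult Ki)
  also have "\<dots> \<le> ?K t + 2 * ?K (t - s)"
    using s by (intro add_right_mono nn_integral_mono mult_left_mono) (auto simp: indicator_def)
  finally have "?K t + sqn lborel (\<lambda>r. indicator {0<..} r * (kern a (t - r) - kern a (s - r))) \<le> ?K t + 2 * ?K (t - s)"
    by (simp only: add.commute)
  then have "sqn lborel (\<lambda>r. indicator {0<..} r * (kern a (t - r) - kern a (s - r))) \<le> 2 * ?K (t - s)"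
    using fin by (auto simp: ennreal_add_left_cancel_le)
  also have "\<dots> = ennreal (2 * (G * (t - s) powr q))"
    using K[of "t - s"] s G by (simp add: two_times_ennreal)
  finally show ?thesis by (simp add: G_def q_def)
qed

lemma kern_L2_integrable:
  assumes a: "1/2 < a" "a \<le> 1" and v: "L2half v" and t: "t \<ge> 0"
  shows "integrable lborel (\<lambda>r. kern a (t - r) * v r)"
proof -
  note [measurable] = L2halfD(1)[OF v]
  have *: "kern a (t - r) * v r = (indicator {0<..} r * (kern a (t - r) - kern a (0 - r))) * v r" for r
    using L2halfD(2)[OF v, of r] by (cases "r > 0") auto
  have "sqn lborel (\<lambda>r. indicator {0<..} r * (kern a (t - r) - kern a (0 - r))) < \<infinity>"
    by (rule le_less_trans[OF kern_increment_L2[OF a _ t]]) auto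
  then show ?thesis unfolding * by (intro L2_product_integrable L2halfD(3)[OF v]) simp_all
qed

text \<open>
  By the Cauchy-Schwarz inequality, $|J^a v(t) - J^a v(s)|$ is at most the $L^2$ norm of $v$
  times that of the increment of the kernel: $J^a v$ is Hoelder continuous.
\<close>

lemma rl_continuous:
  assumes a: "1/2 < a" "a \<le> 1" and v: "L2half v"
  shows "continuous_on {0..T} (rl a v)"
proof -
  note [measurable] = L2halfD(1)[OF v]
  define B where "B = enn2real (sqn lborel v)"
  have B: "sqn lborel v = ennreal B" "B \<ge> 0" using L2halfD(3)[OF v] by (auto simp: B_def)
  define C where "C = 2 / ((2 * a - 1) * (Gamma a)\<^sup>2) * B"
  have C: "C \<ge> 0" using a B by (simp add: C_def)
  have h: "\<bar>rl a v t - rl a v s\<bar> \<le> sqrt (C * (t - s) powr (2 * a - 1))" if st: "0 \<le> s" "s \<le> t" for s t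
  proof -
    have "rl a v t - rl a v s = (LINT r|lborel. kern a (t - r) * v r - kern a (s - r) * v r)"
      unfolding rl_def by (rule Bochner_Integration.integral_diff[symmetric]) (use st in \<open>auto intro!: kern_L2_integrable[OF a v]\<close>)
    also have "\<dots> = (LINT r|lborel. (indicator {0<..} r * (kern a (t - r) - kern a (s - r))) * v r)"
      using L2halfD(2)[OF v] by (intro Bochner_Integration.integral_cong refl) (auto simp: indicator_def left_diff_distrib)
    finally have "ennreal ((rl a v t - rl a v s)\<^sup>2) \<le> sqn lborel (\<lambda>r. indicator {0<..} r * (kern a (t - r) - kern a (s - r))) * sqn lborel v"
      by (simp only:) (rule L2_Cauchy_Schwarz, simp_all)
    also have "\<dots> \<le> ennreal (2 / ((2 * a - 1) * (Gamma a)\<^sup>2) * (t - s) powr (2 * a - 1)) * ennreal B"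
      unfolding B(1) by (intro mult_right_mono kern_increment_L2[OF a st]) simp
    also have "\<dots> = ennreal (2 / ((2 * a - 1) * (Gamma a)\<^sup>2) * (t - s) powr (2 * a - 1) * B)"
      using a B by (intro ennreal_mult[symmetric]) auto
    also have "2 / ((2 * a - 1) * (Gamma a)\<^sup>2) * (t - s) powr (2 * a - 1) * B = C * (t - s) powr (2 * a - 1)"
      by (simp add: C_def)
    finally have "(rl a v t - rl a v s)\<^sup>2 \<le> C * (t - s) powr (2 * a - 1)" using C by (simp add: ennreal_le_iff)
    then have "sqrt ((rl a v t - rl a v s)\<^sup>2) \<le> sqrt (C * (t - s) powr (2 * a - 1))" by (rule real_sqrt_le_mono)
    then show ?thesis by simp
  qed
  show ?thesis unfolding continuous_on_def
  proof
    fix s assume s: "s \<in> {0..T}"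
    have "((\<lambda>t. sqrt (C * \<bar>t - s\<bar> powr (2 * a - 1))) \<longlongrightarrow> sqrt (C * \<bar>s - s\<bar> powr (2 * a - 1))) (at s within {0..T})"
      using a by (intro tendsto_intros) auto
    then have lim: "((\<lambda>t. sqrt (C * \<bar>t - s\<bar> powr (2 * a - 1))) \<longlongrightarrow> 0) (at s within {0..T})" by simp
    have "eventually (\<lambda>t. norm (rl a v t - rl a v s) \<le> sqrt (C * \<bar>t - s\<bar> powr (2 * a - 1))) (at s within {0..T})"
      unfolding eventually_at_topological
    proof (intro exI[of _ UNIV] conjI ballI impI)
      fix t assume "t \<in> {0..T}"
      then show "norm (rl a v t - rl a v s) \<le> sqrt (C * \<bar>t - s\<bar> powr (2 * a - 1))"
        using h[of s t] h[of t s] s by (cases "s \<le> t") (auto simp: abs_minus_commute)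
    qed auto
    then have "((\<lambda>t. rl a v t - rl a v s) \<longlongrightarrow> 0) (at s within {0..T})" by (rule Lim_null_comparison[OF _ lim])
    then show "(rl a v \<longlongrightarrow> rl a v s) (at s within {0..T})" by (rule Lim_null[THEN iffD2])
  qed
qed

section \<open>Left and right fractional integrals as adjoints\<close>

text \<open>
  The right-sided fractional integral: for \<open>p\<close> supported in \<open>[0,T]\<close> this is $J_a p$.
\<close>

definition rr :: "real \<Rightarrow> (real \<Rightarrow> real) \<Rightarrow> real \<Rightarrow> real" where
  "rr a p s = (LINT t|lborel. kern a (t - s) * p t)"

lemma rr_reflect: "rr a p s = rl a (\<lambda>t. p (T - t)) (T - s)"
proof -
  have "rr a p s = (LINT t|lborel. kern a (T - t - s) * p (T - t))"
    unfolding rr_def using lborel_integral_real_affine[of "-1" "\<lambda>t. kern a (t - s) * p t" T] by simp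
  also have "\<dots> = rl a (\<lambda>t. p (T - t)) (T - s)"
    unfolding rl_def by (intro Bochner_Integration.integral_cong refl) (simp add: diff_diff_eq add.commute)
  finally show ?thesis .
qed

lemma rl_duality:
  assumes a: "a > 0" and v: "L2on T v" and p: "L2on T p" and T: "T > 0"
  shows "(LINT t|lborel. rl a v t * p t) = (LINT s|lborel. v s * rr a p s)"
proof -
  note [measurable] = L2onD(1)[OF v] L2onD(1)[OF p]
  let ?g = "\<lambda>t s. kern a (t - s) * v s * p t"
  let ?N = "\<lambda>t. \<integral>\<^sup>+s. ennreal (kern a (t - s) * \<bar>v s\<bar>) \<partial>lborel"
  have "integrable (lborel \<Otimes>\<^sub>M lborel) (\<lambda>(t, s). ?g t s)"
  proof (rule integrableI_bounded)
    have "(\<integral>\<^sup>+x. ennreal (norm (case x of (t, s) \<Rightarrow> ?g t s)) \<partial>(lborel \<Otimes>\<^sub>M lborel))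
        = (\<integral>\<^sup>+t. (\<integral>\<^sup>+s. ennreal (norm (?g t s)) \<partial>lborel) \<partial>lborel)"
      by (subst lborel.nn_integral_fst[symmetric]) (simp_all add: split_beta')
    also have "\<dots> = (\<integral>\<^sup>+t. ennreal \<bar>p t\<bar> * (indicator {..T} t * ?N t) \<partial>lborel)"
    proof (rule nn_integral_cong)
      fix t
      have "(\<integral>\<^sup>+s. ennreal (norm (?g t s)) \<partial>lborel) = (\<integral>\<^sup>+s. ennreal \<bar>p t\<bar> * ennreal (kern a (t - s) * \<bar>v s\<bar>) \<partial>lborel)"
        using kern_nonneg[OF a] by (intro nn_integral_cong) (simp add: abs_mult ennreal_mult' mult_ac)
      also have "\<dots> = ennreal \<bar>p t\<bar> * ?N t" by (rule nn_integral_cmult) simp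
      finally show "(\<integral>\<^sup>+s. ennreal (norm (?g t s)) \<partial>lborel) = ennreal \<bar>p t\<bar> * (indicator {..T} t * ?N t)"
        using L2onD(6)[OF p, of t] by (cases "t \<le> T") auto
    qed
    also have "\<dots> < \<infinity>"
    proof -
      have "(\<integral>\<^sup>+t. ennreal \<bar>p t\<bar> * (indicator {..T} t * ?N t) \<partial>lborel)\<^sup>2
        \<le> (\<integral>\<^sup>+t. (ennreal \<bar>p t\<bar>)\<^sup>2 \<partial>lborel) * (\<integral>\<^sup>+t. (indicator {..T} t * ?N t)\<^sup>2 \<partial>lborel)"
        by (rule Cauchy_Schwarz_nn_integral) simp_all
      also have "(\<integral>\<^sup>+t. (ennreal \<bar>p t\<bar>)\<^sup>2 \<partial>lborel) = sqn lborel p" by (simp add: sqn_def ennreal_power)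
      also have "(\<integral>\<^sup>+t. (indicator {..T} t * ?N t)\<^sup>2 \<partial>lborel) = (\<integral>\<^sup>+t. indicator {..T} t * (?N t)\<^sup>2 \<partial>lborel)"
        by (intro nn_integral_cong) (auto simp: indicator_def)
      also have "sqn lborel p * (\<integral>\<^sup>+t. indicator {..T} t * (?N t)\<^sup>2 \<partial>lborel)
         \<le> sqn lborel p * (ennreal ((T powr a / Gamma (a + 1))\<^sup>2) * sqn lborel (\<lambda>t. indicator {..T} t * v t))"
        by (intro mult_left_mono rl_schur) (use a T L2onD(5)[OF v] in auto)
      also have "\<dots> < \<infinity>" using L2onD(4)[OF p] L2locD(2)[OF L2onD(3)[OF v], of T]
        by (simp add: ennreal_mult_less_top)
      finally show ?thesis by (simp add: power2_eq_square ennreal_mult_less_top less_top[symmetric] ennreal_mult_eq_top_iff)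
    qed
    finally show "(\<integral>\<^sup>+x. ennreal (norm (case x of (t, s) \<Rightarrow> ?g t s)) \<partial>(lborel \<Otimes>\<^sub>M lborel)) < \<infinity>" .
  qed measurable
  from lborel_pair.Fubini_integral[OF this]
  have "(LINT s|lborel. LINT t|lborel. ?g t s) = (LINT t|lborel. LINT s|lborel. ?g t s)" by simp
  moreover have "(LINT t|lborel. LINT s|lborel. ?g t s) = (LINT t|lborel. rl a v t * p t)"
    unfolding rl_def by simp
  moreover have "(LINT s|lborel. LINT t|lborel. ?g t s) = (LINT s|lborel. v s * rr a p s)"
  proof -
    have "(LINT t|lborel. ?g t s) = v s * rr a p s" for s
    proof -
      have "(\<lambda>t. ?g t s) = (\<lambda>t. v s * (kern a (t - s) * p t))" by (auto simp: mult_ac)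
      then show ?thesis unfolding rr_def by (simp only: integral_mult_right_zero)
    qed
    then show ?thesis by (simp only:)
  qed
  ultimately show ?thesis by simp
qed

section \<open>Test functions and the fundamental lemma\<close>

definition smooth :: "(real \<Rightarrow> real) \<Rightarrow> bool" where
  "smooth f \<longleftrightarrow> (\<forall>k x. (deriv ^^ k) f differentiable at x)"

lemma smooth_deriv_closed:
  assumes "\<And>f x. f \<in> S \<Longrightarrow> f differentiable at x" "\<And>f. f \<in> S \<Longrightarrow> deriv f \<in> S" "f \<in> S"
  shows "smooth f"
proof -
  have "(deriv ^^ k) f \<in> S" for k by (induction k) (use assms in auto)
  then show ?thesis using assms(1) by (auto simp: smooth_def)
qed

text \<open>
  The usual bump function, multiplied by a rational function: this enlarged family is closed
  under differentiation, which yields smoothness without a formula for higher derivatives. The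
  parameter \<open>e\<close> flattens the bump, and as \<open>e\<close> tends to zero the function tends to an
  indicator.
\<close>

definition bump :: "real \<Rightarrow> real \<Rightarrow> real \<Rightarrow> real poly \<Rightarrow> nat \<Rightarrow> real \<Rightarrow> real" where
  "bump e a b p k x = (if a < x \<and> x < b
     then poly p x / ((x - a) * (b - x))^k * exp (- e / ((x - a) * (b - x))) else 0)"

text \<open>
  The exponential beats every power of its argument. A quadratic bound around each point
  outside the interval gives derivative zero there, in particular at both endpoints.
\<close>

lemma bump_quadratic_bound:
  assumes e: "e > 0" and ab: "a < b"
  obtains K where "\<And>x y. x \<notin> {a<..<b} \<Longrightarrow> \<bar>bump e a b p k y\<bar> \<le> K * (y - x)\<^sup>2"
proof -
  have "compact (poly p ` {a..b})" by (intro compact_continuous_image continuous_intros) auto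
  then have "bounded (poly p ` {a..b})" by (rule compact_imp_bounded)
  then obtain B where B: "\<And>y. y \<in> {a..b} \<Longrightarrow> \<bar>poly p y\<bar> \<le> B" unfolding bounded_iff by (metis imageI real_norm_def)
  \<comment> \<open>Of the \<open>k + 2\<close> powers, \<open>k\<close> cancel the denominator and two give the quadratic bound.\<close>
  define n where "n = k + 2"
  define C where "C = fact n / e^n"
  have C: "C \<ge> 0" using e by (simp add: C_def)
  have B0: "B \<ge> 0" using B[of a] ab by auto
  show ?thesis
  proof (rule that[of "B * C * (b - a)\<^sup>2"])
    fix x y :: real assume x: "x \<notin> {a<..<b}"
    show "\<bar>bump e a b p k y\<bar> \<le> B * C * (b - a)\<^sup>2 * (y - x)\<^sup>2"
    proof (cases "a < y \<and> y < b")
      case True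
      define Q where "Q = (y - a) * (b - y)"
      have Q: "Q > 0" using True by (simp add: Q_def)
      have exp_le: "exp (- e / Q) \<le> C * Q^n"
      proof -
        have "sum (\<lambda>i. (e / Q)^i /\<^sub>R fact i) {n} \<le> (\<Sum>i. (e / Q)^i /\<^sub>R fact i)"
          by (rule sum_le_suminf[OF summable_exp_generic]) (use e Q in auto)
        also have "\<dots> = exp (e / Q)" by (simp add: exp_def)
        finally have "(e / Q)^n /\<^sub>R fact n \<le> exp (e / Q)" by simp
        then have "(e / Q)^n / fact n \<le> exp (e / Q)" by (simp add: divide_inverse mult.commute)
        then have "inverse (exp (e / Q)) \<le> inverse ((e / Q)^n / fact n)" using e Q by (intro le_imp_inverse_le) auto
        also have "\<dots> = C * Q^n" using e Q by (simp add: C_def power_divide)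
        finally show ?thesis by (simp add: exp_minus)
      qed
      have Q_le: "Q \<le> (b - a) * \<bar>y - x\<bar>"
      proof (cases "x \<le> a")
        case True
        have "Q \<le> \<bar>y - x\<bar> * (b - a)" unfolding Q_def using True \<open>a < y \<and> y < b\<close> by (intro mult_mono) auto
        then show ?thesis by (simp add: mult.commute)
      next
        case False
        then have "x \<ge> b" using x by auto
        then show ?thesis unfolding Q_def using \<open>a < y \<and> y < b\<close> by (intro mult_mono) auto
      qed
      have "\<bar>bump e a b p k y\<bar> = \<bar>poly p y\<bar> / Q^k * exp (- e / Q)"
        using True Q by (simp add: bump_def Q_def[symmetric] abs_mult)
      also have "\<dots> \<le> B / Q^k * (C * Q^n)"
        using B[of y] True Q exp_le B0 by (intro mult_mono divide_right_mono) auto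
      also have "\<dots> = B * C * Q\<^sup>2" using Q by (simp add: n_def power_add power2_eq_square)
      also have "\<dots> \<le> B * C * ((b - a) * \<bar>y - x\<bar>)\<^sup>2"
        using B0 C Q Q_le by (intro mult_left_mono power_mono) auto
      finally show ?thesis by (simp add: power_mult_distrib)
    next
      case False
      then show ?thesis using B0 C by (auto simp: bump_def)
    qed
  qed
qed

lemma bump_has_derivative:
  assumes e: "e > 0" and ab: "a < b"
  shows "(bump e a b p k has_real_derivative
     bump e a b (pderiv p * ([:-a, 1:] * [:b, -1:])^2 - smult (real k) (p * [:a + b, -2:] * ([:-a, 1:] * [:b, -1:])) + smult e (p * [:a + b, -2:])) (k + 2) x) (at x)"
proof (cases "a < x \<and> x < b")
  case True
  define Q where "Q y = (y - a) * (b - y)" for y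
  have Q: "Q x > 0" using True by (simp add: Q_def)
  have Qd: "(Q has_real_derivative (a + b - 2 * x)) (at x)"
    unfolding Q_def by (auto intro!: derivative_eq_intros simp: algebra_simps)
  define D where "D = ((poly (pderiv p) x * Q x ^ k - poly p x * (real k * Q x ^ (k - 1) * (a + b - 2 * x))) / (Q x ^ k)\<^sup>2) * exp (- e / Q x)
       + poly p x / Q x ^ k * (exp (- e / Q x) * (e * (a + b - 2 * x) / (Q x)\<^sup>2))"
  have d1: "((\<lambda>y. poly p y / Q y ^ k) has_real_derivative (poly (pderiv p) x * Q x ^ k - poly p x * (real k * Q x ^ (k - 1) * (a + b - 2 * x))) / (Q x ^ k)\<^sup>2) (at x)"
    using Q by (auto intro!: derivative_eq_intros Qd simp: power2_eq_square)
  have d2: "((\<lambda>y. exp (- e / Q y)) has_real_derivative exp (- e / Q x) * (e * (a + b - 2 * x) / (Q x)\<^sup>2)) (at x)"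
    using Q by (auto intro!: derivative_eq_intros Qd simp: power2_eq_square)
  have "((\<lambda>y. poly p y / Q y ^ k * exp (- e / Q y)) has_real_derivative D) (at x)"
    using DERIV_mult[OF d1 d2] by (simp add: D_def algebra_simps)
  moreover have "eventually (\<lambda>y. poly p y / Q y ^ k * exp (- e / Q y) = bump e a b p k y) (nhds x)"
  proof -
    have "eventually (\<lambda>y. y \<in> {a<..<b}) (nhds x)" using True by (intro eventually_nhds_in_open) auto
    then show ?thesis by eventually_elim (simp add: bump_def Q_def)
  qed
  ultimately have bd: "(bump e a b p k has_real_derivative D) (at x)"
    by (subst (asm) DERIV_cong_ev[OF refl _ refl]) auto
  have "D = (poly (pderiv p) x * (Q x)\<^sup>2 - real k * (poly p x * (a + b - 2 * x) * Q x) + e * (poly p x * (a + b - 2 * x))) / Q x ^ (k + 2) * exp (- e / Q x)"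
  proof (cases k)
    case 0
    then show ?thesis using Q by (simp add: D_def field_simps power2_eq_square)
  next
    case (Suc j)
    then show ?thesis using Q by (simp add: D_def field_simps power2_eq_square power_add)
  qed
  also have "\<dots> = bump e a b (pderiv p * ([:-a, 1:] * [:b, -1:])^2 - smult (real k) (p * [:a + b, -2:] * ([:-a, 1:] * [:b, -1:])) + smult e (p * [:a + b, -2:])) (k + 2) x"
  proof -
    have q: "poly ([:-a, 1:] * [:b, -1:]) x = Q x" by (simp add: Q_def algebra_simps)
    have q': "poly [:a + b, -2:] x = a + b - 2 * x" by simp
    show ?thesis unfolding bump_def Q_def[symmetric]
      using True by (simp only: if_True simp_thms poly_add poly_diff poly_smult poly_mult poly_power q[unfolded poly_mult] q')
  qed
  finally have eq: "D = bump e a b (pderiv p * ([:-a, 1:] * [:b, -1:])^2 - smult (real k) (p * [:a + b, -2:] * ([:-a, 1:] * [:b, -1:])) + smult e (p * [:a + b, -2:])) (k + 2) x" .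
  show ?thesis using bd unfolding eq .
next
  case False
  obtain K where K: "\<And>x y. x \<notin> {a<..<b} \<Longrightarrow> \<bar>bump e a b p k y\<bar> \<le> K * (y - x)\<^sup>2"
    using bump_quadratic_bound[OF e ab] by blast
  have "((\<lambda>y. (bump e a b p k y - bump e a b p k x) / (y - x)) \<longlongrightarrow> 0) (at x)"
  proof (rule Lim_null_comparison)
    show "((\<lambda>y. K * \<bar>y - x\<bar>) \<longlongrightarrow> 0) (at x)" by (auto intro!: tendsto_eq_intros)
    show "eventually (\<lambda>y. norm ((bump e a b p k y - bump e a b p k x) / (y - x)) \<le> K * \<bar>y - x\<bar>) (at x)"
      unfolding eventually_at_topological
    proof (intro exI[of _ UNIV] conjI ballI impI)
      fix y assume "y \<noteq> x"
      have "\<bar>bump e a b p k y\<bar> \<le> K * \<bar>y - x\<bar> * \<bar>y - x\<bar>"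
        using K[of x y] False by (auto simp: power2_eq_square mult.assoc abs_mult_self_eq)
      then show "norm ((bump e a b p k y - bump e a b p k x) / (y - x)) \<le> K * \<bar>y - x\<bar>"
        using False \<open>y \<noteq> x\<close> by (auto simp: bump_def pos_divide_le_eq abs_divide)
    qed auto
  qed
  then have "(bump e a b p k has_real_derivative 0) (at x)" by (simp add: has_field_derivative_iff)
  moreover have "bump e a b q j x = 0" for q j using False by (simp only: bump_def if_False)
  ultimately show ?thesis by (simp only:)
qed

lemma bump_test_function:
  assumes "e > 0" "0 < a" "a < b" "b < T"
  shows "test_function T (bump e a b p k)"
proof -
  have "smooth (bump e a b p k)"
  proof (rule smooth_deriv_closed[of "{bump e a b p k |p k. True}"])
    fix f x assume "f \<in> {bump e a b p k |p k. True}"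
    then obtain p k where f: "f = bump e a b p k" by auto
    note d = bump_has_derivative[OF assms(1,3), of p k]
    show "f differentiable at x" unfolding f using d real_differentiable_def by blast
    show "deriv f \<in> {bump e a b p k |p k. True}"
      unfolding f using DERIV_imp_deriv[OF d] by (auto simp: fun_eq_iff)
  qed auto
  moreover have "\<forall>x. x \<notin> {a..b} \<longrightarrow> bump e a b p k x = 0" by (auto simp: bump_def)
  ultimately show ?thesis using assms unfolding test_function_def smooth_def by blast
qed

lemma L2on_step_orthogonal_zero:
  assumes g: "L2on T g" and orth: "\<And>a. a \<ge> 0 \<Longrightarrow> (LINT t|lborel. ivl a t * g t) = 0"
  shows "AE t in lborel. g t = 0"
proof -
  note [measurable] = L2onD(1)[OF g]
  have "sqn lborel g \<le> 0 + ennreal 1 * ennreal e" if e: "e > 0" for e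
  proof -
    obtain w where w: "step w" "sqn lborel (\<lambda>t. g t - w t) \<le> ennreal e"
      using L2half_step_approx[OF L2onD(2)[OF g] e] by blast
    obtain A c where A: "finite A" "A \<subseteq> {0..}" "w = (\<lambda>t. \<Sum>a\<in>A. c a * ivl a t)"
      using w(1) unfolding step_def by blast
    note wh = L2halfD[OF step_L2half[OF w(1)]]
    note [measurable] = wh(1)
    have igw: "integrable lborel (\<lambda>t. w t * g t)" by (rule L2_product_integrable) (use L2onD(4)[OF g] wh(3) in auto)
    have "(LINT t|lborel. w t * g t) = (LINT t|lborel. (\<Sum>a\<in>A. c a * (ivl a t * g t)))"
      unfolding A(3) by (simp add: sum_distrib_right mult.assoc)
    also have "\<dots> = (\<Sum>a\<in>A. LINT t|lborel. c a * (ivl a t * g t))"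
    proof (rule Bochner_Integration.integral_sum)
      fix a assume "a \<in> A"
      have "integrable lborel (\<lambda>t. ivl a t * g t)"
        by (rule L2_product_integrable) (use L2onD(4)[OF g] sqn_ivl[of a] in auto)
      then show "integrable lborel (\<lambda>t. c a * (ivl a t * g t))" by (rule integrable_mult_right)
    qed
    also have "\<dots> = 0" using A orth by (intro sum.neutral) auto
    finally have gw: "(LINT t|lborel. w t * g t) = 0" .
    have i1: "integrable lborel (\<lambda>t. (g t)\<^sup>2)" "integrable lborel (\<lambda>t. (w t)\<^sup>2)"
      by (rule sqn_finite_integrable, use L2onD(4)[OF g] wh(3) in auto)+
    have eq: "(g t - w t)\<^sup>2 = (g t)\<^sup>2 + (w t)\<^sup>2 - 2 * (w t * g t)" for t by (simp add: power2_eq_square algebra_simps)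
    have i2: "integrable lborel (\<lambda>t. (g t - w t)\<^sup>2)" unfolding eq
      using i1 igw by (intro Bochner_Integration.integrable_diff Bochner_Integration.integrable_add integrable_mult_right)
    have "(LINT t|lborel. (g t - w t)\<^sup>2) = (LINT t|lborel. (g t)\<^sup>2) + (LINT t|lborel. (w t)\<^sup>2) - 2 * (LINT t|lborel. w t * g t)"
      unfolding eq using i1 igw by simp
    then have "(LINT t|lborel. (g t)\<^sup>2) \<le> (LINT t|lborel. (g t - w t)\<^sup>2)" using gw by simp
    then have "sqn lborel g \<le> sqn lborel (\<lambda>t. g t - w t)"
      unfolding sqn_eq_integral[OF i1(1)] sqn_eq_integral[OF i2] by (rule ennreal_leI)
    then show ?thesis using w(2) by simp
  qed
  note le = this
  have "sqn lborel g \<le> 0"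
  proof (rule ennreal_le_of_all_pos[where c="ennreal 1"])
    show "ennreal 1 < \<infinity>" using ennreal_less_top[of 1] by (simp only: infinity_ennreal_def)
  qed (rule le)
  then show ?thesis by (subst sqn_zero_iff[symmetric]) auto
qed

lemma test_function_integrable:
  assumes "test_function T f"
  shows "f \<in> borel_measurable borel" "continuous_on S f"
    "test_function T (deriv f)" "((f has_real_derivative deriv f x) (at x))" "x \<le> 0 \<Longrightarrow> f x = 0" "x \<ge> T \<Longrightarrow> f x = 0"
    "\<exists>B. \<forall>x. \<bar>f x\<bar> \<le> B"
proof -
  have d: "f differentiable (at x)" for x
    using assms[unfolded test_function_def, THEN conjunct1, rule_format, of 0 x] by simp
  then have c: "continuous_on UNIV f"
    by (intro continuous_at_imp_continuous_on ballI differentiable_imp_continuous_within)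
  then show "f \<in> borel_measurable borel" by (rule borel_measurable_continuous_onI)
  show "continuous_on S f" using c by (rule continuous_on_subset) simp
  show "(f has_real_derivative deriv f x) (at x)" for x
    using d[of x] by (simp add: DERIV_deriv_iff_real_differentiable)
  obtain a b where ab: "0 < a" "b < T" "\<And>x. x \<notin> {a..b} \<Longrightarrow> f x = 0"
    using assms unfolding test_function_def by blast
  show "x \<le> 0 \<Longrightarrow> f x = 0" "x \<ge> T \<Longrightarrow> f x = 0" using ab by auto
  have "bounded (f ` {a..b})" by (intro compact_imp_bounded compact_continuous_image continuous_on_subset[OF c]) auto
  then obtain B where B: "\<And>x. x \<in> {a..b} \<Longrightarrow> \<bar>f x\<bar> \<le> B" unfolding bounded_iff by (metis imageI real_norm_def)
  have "\<bar>f x\<bar> \<le> \<bar>B\<bar>" for x using B[of x] ab(3)[of x] by (cases "x \<in> {a..b}") auto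
  then show "\<exists>B. \<forall>x. \<bar>f x\<bar> \<le> B" by blast
  show "test_function T (deriv f)" unfolding test_function_def
  proof (intro conjI allI)
    fix k x
    show "(deriv ^^ k) (deriv f) differentiable at x"
      using assms[unfolded test_function_def, THEN conjunct1, rule_format, of "Suc k" x] by (simp add: funpow_swap1)
  next
    have "deriv f x = 0" if "x \<notin> {a..b}" for x
    proof -
      have "eventually (\<lambda>y. f y = 0) (nhds x)"
      proof -
        have "open (- {a..b})" by auto
        then have "eventually (\<lambda>y. y \<in> - {a..b}) (nhds x)" using that by (intro eventually_nhds_in_open) auto
        then show ?thesis by eventually_elim (use ab(3) in auto)
      qed
      then have "(f has_real_derivative 0) (at x)" by (subst DERIV_cong_ev[OF refl _ refl]) auto
      then show ?thesis by (rule DERIV_imp_deriv)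
    qed
    then show "\<exists>a b. 0 < a \<and> b < T \<and> (\<forall>x. x \<notin> {a..b} \<longrightarrow> deriv f x = 0)" using ab by blast
  qed
qed

lemma test_function_L2on:
  assumes f: "test_function T f"
  shows "L2on T f"
proof -
  note [measurable] = test_function_integrable(1)[OF f]
  obtain B where B: "\<And>x. \<bar>f x\<bar> \<le> B" using test_function_integrable(7)[OF f] by blast
  have "indicator {0<..<T} t * f t = f t" for t
    using test_function_integrable(5,6)[OF f, of t] by (cases "0 < t \<and> t < T") auto
  then have "(\<lambda>t. indicator {0<..<T} t * f t) = f" by auto
  then show ?thesis using L2on_bounded[of f T B] B by simp
qed

text \<open>
  Bumps bounded by one that fill up the interval \<open>(0,c)\<close> transfer the vanishing of the
  integrals from test functions to intervals, hence to step functions.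
\<close>

theorem fundamental_lemma:
  assumes g: "L2on T g" and z: "\<And>\<phi>. test_function T \<phi> \<Longrightarrow> (LINT t|lborel. g t * \<phi> t) = 0"
  shows "AE t in lborel. g t = 0"
proof (rule L2on_step_orthogonal_zero[OF g])
  fix a :: real assume a: "a \<ge> 0"
  note [measurable] = L2onD(1)[OF g]
  define c where "c = min a T"
  have eq: "ivl a t * g t = ivl c t * g t" for t
    using L2onD(6)[OF g, of t] by (auto simp: ivl_def indicator_def c_def min_def)
  show "(LINT t|lborel. ivl a t * g t) = 0"
  proof (cases "c > 0")
    case False
    then have *: "ivl c t * g t = 0" for t by (auto simp: ivl_def)
    show ?thesis unfolding eq * by simp
  next
    case True
    \<comment> \<open>The margin \<open>c * d n\<close> stays below \<open>c / 2\<close>, and \<open>d n\<close> is also the flattening parameter.\<close>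
    define d where "d n = 1 / real (n + 3)" for n :: nat
    have d: "0 < d n" "d n \<le> 1/3" for n by (auto simp: d_def field_simps)
    have dlim: "d \<longlonglongrightarrow> 0" unfolding d_def
      using LIMSEQ_ignore_initial_segment[OF lim_1_over_n, of 3] by simp
    define \<phi> where "\<phi> n = bump (d n) (c * d n) (c * (1 - d n)) 1 0" for n
    have tf: "test_function T (\<phi> n)" for n unfolding \<phi>_def
    proof (rule bump_test_function)
      show "0 < c * d n" using True d by simp
      show "c * d n < c * (1 - d n)" using True d[of n] by (intro mult_strict_left_mono) auto
      have "c * (1 - d n) < c * 1" using True d[of n] by (intro mult_strict_left_mono) auto
      then show "c * (1 - d n) < T" by (simp add: c_def)
    qed (rule d)
    have "(\<lambda>n. LINT t|lborel. g t * \<phi> n t) \<longlonglongrightarrow> (LINT t|lborel. ivl c t * g t)"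
    proof (rule integral_dominated_convergence[where w="\<lambda>t. \<bar>g t\<bar>"])
      show "(\<lambda>t. g t * \<phi> n t) \<in> borel_measurable lborel" for n using test_function_integrable(1)[OF tf] by simp
      show "integrable lborel (\<lambda>t. \<bar>g t\<bar>)" using L2on_integrable[OF g] by (rule integrable_abs)
      show "AE t in lborel. norm (g t * \<phi> n t) \<le> \<bar>g t\<bar>" for n
      proof (rule AE_I2)
        fix t
        have "\<bar>\<phi> n t\<bar> \<le> 1" using d[of n] by (auto simp: \<phi>_def bump_def)
        then show "norm (g t * \<phi> n t) \<le> \<bar>g t\<bar>" by (simp add: abs_mult mult_left_le)
      qed
      show "AE t in lborel. (\<lambda>n. g t * \<phi> n t) \<longlonglongrightarrow> ivl c t * g t"
        using AE_lborel_singleton[of c]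
      proof eventually_elim
        case (elim t)
        show ?case
        proof (cases "0 < t \<and> t < c")
          case t: True
          have l1: "(\<lambda>n. t - c * d n) \<longlonglongrightarrow> t - c * 0" "(\<lambda>n. c * (1 - d n) - t) \<longlonglongrightarrow> c * (1 - 0) - t"
            by (intro tendsto_intros dlim)+
          have "eventually (\<lambda>n. t - c * d n > 0) sequentially" "eventually (\<lambda>n. c * (1 - d n) - t > 0) sequentially"
            by (rule order_tendstoD(1)[OF l1(1)], use t in simp, rule order_tendstoD(1)[OF l1(2)], use t in simp)
          then have ev: "eventually (\<lambda>n. exp (- d n / ((t - c * d n) * (c * (1 - d n) - t))) = \<phi> n t) sequentially"
            by eventually_elim (simp add: \<phi>_def bump_def)
          have "(\<lambda>n. exp (- d n / ((t - c * d n) * (c * (1 - d n) - t)))) \<longlonglongrightarrow> exp (- 0 / ((t - c * 0) * (c * (1 - 0) - t)))"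
            using t by (intro tendsto_intros dlim) auto
          then have "(\<lambda>n. \<phi> n t) \<longlonglongrightarrow> exp (- 0 / ((t - c * 0) * (c * (1 - 0) - t)))"
            using ev by (rule Lim_transform_eventually)
          then have "(\<lambda>n. g t * \<phi> n t) \<longlonglongrightarrow> g t * 1" by (intro tendsto_intros) simp
          then show ?thesis using t by (simp add: ivl_def)
        next
          case False
          have "c * d n > 0" "c * (1 - d n) < c" for n using True d[of n] by (auto simp: algebra_simps)
          then have "\<phi> n t = 0" for n using False unfolding \<phi>_def bump_def
            by (smt (verit, best))
          moreover have "ivl c t = 0" using False elim by (auto simp: ivl_def)
          ultimately show ?thesis by simp
        qed
      qed
    qed simp
    then show ?thesis unfolding eq using z[OF tf] by (simp add: LIMSEQ_const_iff)
  qed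
qed

lemma rr_1_deriv:
  assumes f: "test_function T f" and s: "0 < s"
  shows "rr 1 (deriv f) s = - f s"
proof (cases "s < T")
  case True
  note tf' = test_function_integrable[OF test_function_integrable(3)[OF f]]
  have "rr 1 (deriv f) s = (LINT t|lborel. indicator {s..T} t *\<^sub>R deriv f t)"
    unfolding rr_def
  proof (rule integral_cong_AE)
    show "AE t in lborel. kern 1 (t - s) * deriv f t = indicator {s..T} t *\<^sub>R deriv f t"
      using AE_lborel_singleton[of s]
      by eventually_elim (use tf'(6) in \<open>auto simp: kern_1 indicator_def\<close>)
  qed (use tf'(1) in auto)
  also have "\<dots> = f T - f s"
    by (rule integral_FTC_Icc)
       (use True test_function_integrable(4)[OF f] tf'(2) in \<open>auto simp: has_real_derivative_iff_has_vector_derivative intro: has_vector_derivative_at_within\<close>)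
  finally show ?thesis using test_function_integrable(6)[OF f] by simp
next
  case False
  note tf' = test_function_integrable[OF test_function_integrable(3)[OF f]]
  have "kern 1 (t - s) * deriv f t = 0" for t using False tf'(6)[of t] by (cases "t > s") auto
  then show ?thesis unfolding rr_def using False test_function_integrable(6)[OF f, of s] by (simp only:) simp
qed

theorem rl_1_parts:
  assumes v: "L2on T v" and f: "test_function T f" and T: "T > 0"
  shows "(LINT t|lborel. rl 1 v t * deriv f t) = - (LINT t|lborel. v t * f t)"
proof -
  have "(LINT t|lborel. rl 1 v t * deriv f t) = (LINT s|lborel. v s * rr 1 (deriv f) s)"
    by (rule rl_duality[OF _ v test_function_L2on[OF test_function_integrable(3)[OF f]] T]) simp
  also have "\<dots> = (LINT s|lborel. - (v s * f s))"
  proof (intro Bochner_Integration.integral_cong refl)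
    fix s
    show "v s * rr 1 (deriv f) s = - (v s * f s)"
      using rr_1_deriv[OF f, of s] L2onD(5)[OF v, of s] by (cases "s > 0") auto
  qed
  finally show ?thesis by simp
qed

lemma smooth_lincomb:
  assumes "smooth f" "smooth g"
  shows "smooth (\<lambda>x. f x - c * g x)"
proof -
  have eq: "(deriv ^^ k) (\<lambda>x. f x - c * g x) = (\<lambda>x. (deriv ^^ k) f x - c * (deriv ^^ k) g x)" for k
  proof (induction k)
    case (Suc k)
    have "((deriv ^^ k) f has_real_derivative deriv ((deriv ^^ k) f) x) (at x)"
      "((deriv ^^ k) g has_real_derivative deriv ((deriv ^^ k) g) x) (at x)" for x
      using assms by (simp_all add: smooth_def DERIV_deriv_iff_real_differentiable)
    then have "deriv (\<lambda>x. (deriv ^^ k) f x - c * (deriv ^^ k) g x) x = deriv ((deriv ^^ k) f) x - c * deriv ((deriv ^^ k) g) x" for x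
      by (intro DERIV_imp_deriv DERIV_diff DERIV_cmult)
    then show ?case using Suc by auto
  qed auto
  show ?thesis unfolding smooth_def eq
    using assms unfolding smooth_def by (auto intro!: differentiable_diff differentiable_mult)
qed

text \<open>
  Derivatives of test functions are exactly the test functions with mean zero, and a test
  function becomes one after subtracting a multiple of a fixed bump.
\<close>

theorem weakly_constant:
  assumes w: "L2on T w" and T: "T > 0"
    and z: "\<And>\<phi>. test_function T \<phi> \<Longrightarrow> (LINT t|lborel. w t * deriv \<phi> t) = 0"
  obtains c where "AE t in lborel. t \<in> {0<..<T} \<longrightarrow> w t = c"
proof -
  define \<psi>0 where "\<psi>0 = bump 1 (T/3) (2*T/3) 1 0"
  have t0: "test_function T \<psi>0" unfolding \<psi>0_def by (rule bump_test_function) (use T in auto)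
  have i0: "integrable lborel \<psi>0" by (rule L2on_integrable[OF test_function_L2on[OF t0]])
  define m where "m = (LINT t|lborel. \<psi>0 t)"
  have m: "m \<noteq> 0"
  proof
    assume "m = 0"
    moreover have "\<psi>0 t \<ge> 0" for t by (auto simp: \<psi>0_def bump_def)
    ultimately have "AE t in lborel. \<psi>0 t = 0"
      using i0 by (simp add: m_def integral_nonneg_eq_0_iff_AE)
    then have "AE t in lborel. t \<notin> {T/3<..<2*T/3}"
      by eventually_elim (auto simp: \<psi>0_def bump_def)
    then have "emeasure lborel {T/3<..<2*T/3} = 0" by (subst (asm) AE_iff_measurable[where N="{T/3<..<2*T/3}"]) auto
    then show False using T by simp
  qed
  define c where "c = (LINT t|lborel. w t * \<psi>0 t) / m"
  have wL: "L2on T (\<lambda>t. w t - c * (indicator {0<..<T} t * 1))"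
    using L2on_lincomb[OF w L2on_bounded[of "\<lambda>_. 1" T 1], of 1 "- c"] by simp
  have "AE t in lborel. w t - c * (indicator {0<..<T} t * 1) = 0"
  proof (rule fundamental_lemma[OF wL])
    fix \<eta> assume eta: "test_function T \<eta>"
    \<comment> \<open>\<open>f\<close> has mean zero, so its primitive \<open>\<phi>\<close> has compact support in \<open>(0,T)\<close>.\<close>
    define k where "k = (LINT t|lborel. \<eta> t) / m"
    define f where "f t = \<eta> t - k * \<psi>0 t" for t
    have ie: "integrable lborel \<eta>" by (rule L2on_integrable[OF test_function_L2on[OF eta]])
    have fsm: "smooth f" unfolding f_def by (rule smooth_lincomb) (use eta t0 in \<open>auto simp: test_function_def smooth_def\<close>)
    obtain a1 b1 where ab1: "0 < a1" "b1 < T" "\<And>x. x \<notin> {a1..b1} \<Longrightarrow> \<eta> x = 0"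
      using eta unfolding test_function_def by blast
    obtain a2 b2 where ab2: "0 < a2" "b2 < T" "\<And>x. x \<notin> {a2..b2} \<Longrightarrow> \<psi>0 x = 0"
      using t0 unfolding test_function_def by blast
    define a b where "a = min a1 a2" and "b = max b1 b2"
    have ab: "0 < a" "b < T" using ab1 ab2 by (auto simp: a_def b_def)
    have ab3: "f x = 0" if "x \<notin> {a..b}" for x
    proof -
      have "x \<notin> {a1..b1}" "x \<notin> {a2..b2}" using that by (auto simp: a_def b_def)
      then show ?thesis using ab1(3)[of x] ab2(3)[of x] by (simp add: f_def)
    qed
    note ab = ab ab3
    have ftest: "test_function T f" using fsm ab unfolding test_function_def smooth_def by blast
    have fi: "integrable lborel f" by (rule L2on_integrable[OF test_function_L2on[OF ftest]])
    have fint: "(LINT t|lborel. f t) = 0"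
      unfolding f_def using ie i0 m by (simp add: k_def m_def[symmetric])
    define \<phi> where "\<phi> x = (LINT t|lborel. indicator {..x} t * f t)" for x
    have \<phi>1: "\<phi> x = integral {0..x} f" if "x \<ge> 0" for x
    proof -
      have "\<phi> x = (LINT t:{0..x}|lborel. f t)" unfolding \<phi>_def set_lebesgue_integral_def
        using ab by (intro Bochner_Integration.integral_cong refl) (auto simp: indicator_def)
      also have "\<dots> = integral {0..x} f"
      proof (rule set_borel_integral_eq_integral(2))
        show "set_integrable lborel {0..x} f" unfolding set_integrable_def using fi
          using integrable_indicator_mult[OF fi, of "{0..x}"] by simp
      qed
      finally show ?thesis .
    qed
    have \<phi>0: "\<phi> x = 0" if "x \<notin> {a..b}" for x
    proof (cases "x < a")
      case True
      have "indicator {..x} t * f t = 0" for t using True ab(3)[of t] by (auto simp: indicator_def)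
      then show ?thesis unfolding \<phi>_def by (simp only:) simp
    next
      case False
      then have "x > b" using that by auto
      then have "indicator {..x} t * f t = f t" for t using ab(3)[of t] by (auto simp: indicator_def)
      then show ?thesis unfolding \<phi>_def using fint by (simp only:)
    qed
    have \<phi>d: "(\<phi> has_real_derivative f x) (at x)" for x
    proof (cases "x > 0")
      case True
      have "((\<lambda>y. integral {0..y} f) has_vector_derivative f x) (at x within {0..x + 1})"
        by (rule integral_has_vector_derivative) (use True test_function_integrable(2)[OF ftest] in auto)
      then have "((\<lambda>y. integral {0..y} f) has_real_derivative f x) (at x within {0<..<x + 1})"
        unfolding has_real_derivative_iff_has_vector_derivative by (rule has_vector_derivative_within_subset) auto
      then have "((\<lambda>y. integral {0..y} f) has_real_derivative f x) (at x)"
        using True by (subst (asm) at_within_open) auto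
      moreover have "eventually (\<lambda>y. integral {0..y} f = \<phi> y) (nhds x)"
      proof -
        have "eventually (\<lambda>y. y \<in> {0<..}) (nhds x)" using True by (intro eventually_nhds_in_open) auto
        then show ?thesis by eventually_elim (simp add: \<phi>1)
      qed
      ultimately show ?thesis by (subst (asm) DERIV_cong_ev[OF refl _ refl]) auto
    next
      case False
      have "eventually (\<lambda>y. \<phi> y = 0) (nhds x)"
      proof -
        have "eventually (\<lambda>y. y \<in> {..<a}) (nhds x)" using False ab by (intro eventually_nhds_in_open) auto
        then show ?thesis by eventually_elim (simp add: \<phi>0)
      qed
      then have "(\<phi> has_real_derivative 0) (at x)" by (subst DERIV_cong_ev[OF refl _ refl]) auto
      then show ?thesis using ab(3)[of x] ab(1) False by simp
    qed
    have dphi: "deriv \<phi> = f" using DERIV_imp_deriv[OF \<phi>d] by auto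
    have "smooth \<phi>" unfolding smooth_def
    proof (intro allI)
      fix k x
      show "(deriv ^^ k) \<phi> differentiable at x"
      proof (cases k)
        case 0
        then show ?thesis using \<phi>d real_differentiable_def by auto
      next
        case (Suc j)
        then show ?thesis using fsm by (simp add: funpow_swap1 dphi smooth_def)
      qed
    qed
    then have "test_function T \<phi>" using \<phi>0 ab unfolding test_function_def smooth_def by blast
    from z[OF this] have zf: "(LINT t|lborel. w t * f t) = 0" by (simp add: dphi)
    have iw: "integrable lborel (\<lambda>t. w t * \<eta> t)" "integrable lborel (\<lambda>t. w t * \<psi>0 t)"
      by (intro L2_product_integrable L2onD(4) L2onD(1), use w test_function_L2on[OF eta] test_function_L2on[OF t0] in \<open>auto dest: L2onD(1,4)\<close>)+
    have "(LINT t|lborel. w t * f t) = (LINT t|lborel. w t * \<eta> t - k * (w t * \<psi>0 t))"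
      by (simp add: f_def algebra_simps)
    also have "\<dots> = (LINT t|lborel. w t * \<eta> t) - k * (LINT t|lborel. w t * \<psi>0 t)"
      using iw by simp
    finally have "(LINT t|lborel. w t * \<eta> t) = c * (LINT t|lborel. \<eta> t)"
      using zf m by (simp add: k_def c_def)
    moreover have "(LINT t|lborel. (w t - c * (indicator {0<..<T} t * 1)) * \<eta> t) = (LINT t|lborel. w t * \<eta> t - c * \<eta> t)"
    proof (intro Bochner_Integration.integral_cong refl)
      fix t
      show "(w t - c * (indicator {0<..<T} t * 1)) * \<eta> t = w t * \<eta> t - c * \<eta> t"
        using test_function_integrable(5,6)[OF eta, of t] by (cases "0 < t \<and> t < T") (auto simp: left_diff_distrib)
    qed
    ultimately show "(LINT t|lborel. (w t - c * (indicator {0<..<T} t * 1)) * \<eta> t) = 0"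
      using iw ie by simp
  qed
  then have "AE t in lborel. t \<in> {0<..<T} \<longrightarrow> w t = c" by eventually_elim auto
  then show thesis by (rule that)
qed

section \<open>Classes and representatives\<close>

lemma rep_ae_measurable [measurable]: "rep_ae U \<in> borel_measurable borel"
  using Quotient_rep_reflp[OF Quotient_aefun] by auto

lemma rep_abs_AE:
  assumes "f \<in> borel_measurable borel"
  shows "AE t in lborel. rep_ae (abs_ae f) t = f t"
  using Quotient_rep_abs[OF Quotient_aefun, of f] assms by auto

lemma aefun_eqI:
  assumes "AE t in lborel. rep_ae U t = rep_ae V t"
  shows "U = V"
  using Quotient_rel_rep[OF Quotient_aefun, of U V] assms by auto

text \<open>
  The cut-off makes statements on \<open>(0,T)\<close> accessible to the results on the line; for classes
  in $L^2$ it changes nothing up to a null set.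
\<close>

definition fn :: "real \<Rightarrow> aefun \<Rightarrow> real \<Rightarrow> real" where
  "fn T U t = indicator {0<..<T} t * rep_ae U t"

lemma fn_measurable [measurable]: "fn T U \<in> borel_measurable borel"
  unfolding fn_def by measurable

lemma fn_outside: "t \<le> 0 \<Longrightarrow> fn T U t = 0" "t \<ge> T \<Longrightarrow> fn T U t = 0"
  by (auto simp: fn_def)

lemma fn_outside': "t \<notin> {0<..<T} \<Longrightarrow> fn T U t = 0"
  by (auto simp: fn_def)

lemma fn_plus_AE: "AE t in lborel. fn T (U + V) t = fn T U t + fn T V t"
proof -
  have "U + V = abs_ae (\<lambda>t. rep_ae U t + rep_ae V t)"
    by (simp add: plus_aefun_def)
  then have "AE t in lborel. rep_ae (U + V) t = rep_ae U t + rep_ae V t"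
    using rep_abs_AE[of "\<lambda>t. rep_ae U t + rep_ae V t"] by simp
  then show ?thesis by eventually_elim (simp add: fn_def distrib_left)
qed

lemma rep_scaleR_AE: "AE t in lborel. rep_ae (c *\<^sub>R U) t = c * rep_ae U t"
proof -
  have "c *\<^sub>R U = abs_ae (\<lambda>t. c * rep_ae U t)"
    by (simp add: scaleR_aefun_def)
  then show ?thesis using rep_abs_AE[of "\<lambda>t. c * rep_ae U t"] by simp
qed

lemma fn_scaleR_AE: "AE t in lborel. fn T (c *\<^sub>R U) t = c * fn T U t"
  using rep_scaleR_AE[of c U] by eventually_elim (simp add: fn_def)

lemma fn_zero_AE: "AE t in lborel. fn T 0 t = 0"
  using fn_scaleR_AE[of T 0 0] by simp

lemma if_interval_eq: "(\<lambda>t. if t \<in> {0<..<T} then f t else 0) = (\<lambda>t. indicator {0<..<T} t * f t :: real)"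
  by (auto simp: indicator_def)

lemma rep_ae_on_AE:
  assumes "(\<lambda>t. indicator {0<..<T} t * f t) \<in> borel_measurable borel"
  shows "AE t in lborel. rep_ae (ae_on T f) t = indicator {0<..<T} t * f t"
  unfolding ae_on_def if_interval_eq by (rule rep_abs_AE[OF assms])

lemma fn_ae_on_AE:
  assumes "(\<lambda>t. indicator {0<..<T} t * f t) \<in> borel_measurable borel"
  shows "AE t in lborel. fn T (ae_on T f) t = indicator {0<..<T} t * f t"
  using rep_ae_on_AE[OF assms] by eventually_elim (simp add: fn_def indicator_def)

lemma ae_on_cong: "(\<And>t. t \<in> {0<..<T} \<Longrightarrow> f t = g t) \<Longrightarrow> ae_on T f = ae_on T g"
  unfolding ae_on_def by (rule arg_cong[where f=abs_ae]) auto

lemma ae_on_cong_AE: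
  assumes f: "(\<lambda>t. indicator {0<..<T} t * f t) \<in> borel_measurable borel"
    and g: "(\<lambda>t. indicator {0<..<T} t * g t) \<in> borel_measurable borel"
    and eq: "AE t in lborel. t \<in> {0<..<T} \<longrightarrow> f t = g t"
  shows "ae_on T f = ae_on T g"
  by (rule aefun_eqI) (use rep_ae_on_AE[OF f] rep_ae_on_AE[OF g] eq in eventually_elim, auto simp: indicator_def)

lemma L2_sq_fn: "L2_sq T U = sqn lborel (fn T U)"
  unfolding L2_sq_def sqn_def by (intro nn_integral_cong) (auto simp: fn_def indicator_def)

lemma L2_fn:
  assumes "U \<in> L2 T"
  shows "L2on T (fn T U)" "AE t in lborel. rep_ae U t = fn T U t" "ae_on T (fn T U) = U"
proof -
  show "L2on T (fn T U)" by (rule L2onI) (use assms in \<open>auto simp: fn_outside L2_def L2_sq_fn\<close>)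
  have "AE t in lborel. t \<notin> {0<..<T} \<longrightarrow> rep_ae U t = 0" using assms by (simp add: L2_def)
  then show eq: "AE t in lborel. rep_ae U t = fn T U t" by eventually_elim (auto simp: fn_def)
  show "ae_on T (fn T U) = U"
    by (rule aefun_eqI) (use rep_ae_on_AE[of T "fn T U"] eq in \<open>auto simp: fn_def mult.assoc[symmetric] indicator_inter_arith[symmetric] elim!: eventually_elim2\<close>)
qed

lemma ae_on_L2:
  assumes "L2on T (\<lambda>t. indicator {0<..<T} t * f t)"
  shows "ae_on T f \<in> L2 T"
proof -
  have m: "(\<lambda>t. indicator {0<..<T} t * f t) \<in> borel_measurable borel" by (rule L2onD(1)[OF assms])
  have "AE t in lborel. t \<notin> {0<..<T} \<longrightarrow> rep_ae (ae_on T f) t = 0"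
    using rep_ae_on_AE[OF m] by eventually_elim auto
  moreover have "L2_sq T (ae_on T f) = sqn lborel (\<lambda>t. indicator {0<..<T} t * f t)"
    unfolding L2_sq_fn by (rule sqn_cong_AE[OF fn_ae_on_AE[OF m]])
  ultimately show ?thesis using L2onD(4)[OF assms] by (simp add: L2_def)
qed

lemma L2_eqI:
  assumes "U \<in> L2 T" "V \<in> L2 T" "AE t in lborel. fn T U t = fn T V t"
  shows "U = V"
  by (rule aefun_eqI) (use L2_fn(2)[OF assms(1)] L2_fn(2)[OF assms(2)] assms(3) in eventually_elim, simp)

lemma L2_plus:
  assumes "U \<in> L2 T" "V \<in> L2 T"
  shows "U + V \<in> L2 T"
proof -
  have "U + V = abs_ae (\<lambda>t. rep_ae U t + rep_ae V t)" by (simp add: plus_aefun_def)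
  then have r: "AE t in lborel. rep_ae (U + V) t = rep_ae U t + rep_ae V t"
    using rep_abs_AE[of "\<lambda>t. rep_ae U t + rep_ae V t"] by simp
  have "AE t in lborel. t \<notin> {0<..<T} \<longrightarrow> rep_ae (U + V) t = 0"
    using r L2_fn(2)[OF assms(1)] L2_fn(2)[OF assms(2)] by eventually_elim (simp add: fn_outside')
  moreover have "L2_sq T (U + V) = sqn lborel (\<lambda>t. fn T U t + fn T V t)"
    unfolding L2_sq_fn by (rule sqn_cong_AE[OF fn_plus_AE])
  moreover have "sqn lborel (\<lambda>t. fn T U t + fn T V t) < \<infinity>"
    by (rule le_less_trans[OF sqn_add_le]) (use assms in \<open>auto simp: L2_def L2_sq_fn ennreal_mult_less_top\<close>)
  ultimately show ?thesis unfolding L2_def by (simp add: le_less_trans)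
qed

lemma L2_sq_scaleR: "L2_sq T (c *\<^sub>R U) = ennreal (c\<^sup>2) * L2_sq T U"
proof -
  have "L2_sq T (c *\<^sub>R U) = sqn lborel (\<lambda>t. c * fn T U t)"
    unfolding L2_sq_fn by (rule sqn_cong_AE[OF fn_scaleR_AE])
  then show ?thesis by (simp add: sqn_cmult L2_sq_fn)
qed

lemma L2_scaleR:
  assumes "U \<in> L2 T"
  shows "c *\<^sub>R U \<in> L2 T"
proof -
  have "AE t in lborel. t \<notin> {0<..<T} \<longrightarrow> rep_ae (c *\<^sub>R U) t = 0"
    using rep_scaleR_AE[of c U] L2_fn(2)[OF assms] by eventually_elim (simp add: fn_outside')
  then show ?thesis using assms by (simp add: L2_def L2_sq_scaleR ennreal_mult_less_top)
qed

lemma L2_zero: "0 \<in> L2 T"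
proof -
  have "AE t in lborel. t \<notin> {0<..<T} \<longrightarrow> rep_ae 0 t = 0"
    using rep_scaleR_AE[of 0 0] by eventually_elim auto
  moreover have "L2_sq T 0 = sqn lborel (\<lambda>_::real. 0)" unfolding L2_sq_fn by (rule sqn_cong_AE) (rule fn_zero_AE)
  ultimately show ?thesis by (simp add: L2_def sqn_def)
qed

lemma gag_on_cong_AE:
  assumes [measurable]: "A \<in> sets borel" and "AE t in lborel. t \<in> A \<longrightarrow> u t = w t"
  shows "gag_on \<sigma> A u = gag_on \<sigma> A w"
proof -
  have "AE t in lborel. indicator A t * (\<integral>\<^sup>+s. indicator A s * ennreal ((u t - u s)\<^sup>2 / \<bar>t - s\<bar> powr (1 + 2 * \<sigma>)) \<partial>lborel)
      = indicator A t * (\<integral>\<^sup>+s. indicator A s * ennreal ((w t - w s)\<^sup>2 / \<bar>t - s\<bar> powr (1 + 2 * \<sigma>)) \<partial>lborel)"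
    using assms(2)
  proof eventually_elim
    case (elim t)
    show ?case
    proof (cases "t \<in> A")
      case True
      then have "(\<integral>\<^sup>+s. indicator A s * ennreal ((u t - u s)\<^sup>2 / \<bar>t - s\<bar> powr (1 + 2 * \<sigma>)) \<partial>lborel)
        = (\<integral>\<^sup>+s. indicator A s * ennreal ((w t - w s)\<^sup>2 / \<bar>t - s\<bar> powr (1 + 2 * \<sigma>)) \<partial>lborel)"
        by (intro nn_integral_cong_AE) (use assms(2) elim in \<open>auto elim!: eventually_mono simp: indicator_def\<close>)
      then show ?thesis by simp
    qed simp
  qed
  then show ?thesis unfolding gag_on_def by (rule nn_integral_cong_AE)
qed

lemma slobodeckij_fn: "slobodeckij_sq T \<sigma> U = gag_on \<sigma> {0<..<T} (fn T U)"
proof -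
  have "slobodeckij_sq T \<sigma> U = gag_on \<sigma> {0<..<T} (rep_ae U)"
    unfolding slobodeckij_sq_def gag_on_def by (simp add: mult.commute)
  also have "\<dots> = gag_on \<sigma> {0<..<T} (fn T U)" by (rule gag_on_cong_AE) (auto simp: fn_def)
  finally show ?thesis .
qed

lemma weight_fn: "weight_sq T 0 U = sqn lborel (wt (1/2) 0 T (fn T U))"
  unfolding weight_sq_def sqn_def
proof (intro nn_integral_cong)
  fix t
  show "ennreal ((rep_ae U t)\<^sup>2 / \<bar>t - 0\<bar>) * indicator {0<..<T} t = ennreal ((wt (1/2) 0 T (fn T U) t)\<^sup>2)"
  proof (cases "0 < t \<and> t < T")
    case True
    have "(t powr - (1/2))\<^sup>2 = t powr (- 1)" unfolding power2_eq_square powr_add[symmetric] by simp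
    then have "(t powr - (1/2))\<^sup>2 = 1 / t" using True by (simp add: powr_minus_divide)
    then show ?thesis using True by (simp add: wt_def fn_def power_mult_distrib)
  qed (auto simp: wt_def)
qed

section \<open>Weak derivatives\<close>

lemma set_integral_fn: "(LINT t:{0<..<T}|lborel. rep_ae U t * p t) = (LINT t|lborel. fn T U t * p t)"
  unfolding set_lebesgue_integral_def fn_def by (simp add: mult.assoc)

lemma has_weak_deriv_fn: "has_weak_deriv T k U W \<longleftrightarrow>
   (\<forall>\<phi>. test_function T \<phi> \<longrightarrow> (LINT t|lborel. fn T U t * (deriv ^^ k) \<phi> t) = (-1) ^ k * (LINT t|lborel. fn T W t * \<phi> t))"
  unfolding has_weak_deriv_def set_integral_fn ..

lemma test_function_iterate: "test_function T \<phi> \<Longrightarrow> test_function T ((deriv ^^ k) \<phi>)"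
  by (induction k) (auto intro: test_function_integrable(3))

lemma fn_test_integrable: "U \<in> L2 T \<Longrightarrow> test_function T \<phi> \<Longrightarrow> integrable lborel (\<lambda>t. fn T U t * \<phi> t)"
  by (rule L2_product_integrable)
     (use L2onD(4)[OF L2_fn(1), of U T] L2onD(1,4)[OF test_function_L2on, of T \<phi>] in auto)

lemma weak_deriv_unique:
  assumes W: "W \<in> L2 T" "W' \<in> L2 T" and d: "has_weak_deriv T k U W" "has_weak_deriv T k U W'"
  shows "W = W'"
proof (rule L2_eqI[OF W])
  have "AE t in lborel. 1 * fn T W t + (-1) * fn T W' t = 0"
  proof (rule fundamental_lemma[OF L2on_lincomb[OF L2_fn(1)[OF W(1)] L2_fn(1)[OF W(2)]]])
    fix \<phi> assume \<phi>: "test_function T \<phi>"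
    have "(-1) ^ k * (LINT t|lborel. fn T W t * \<phi> t) = (-1) ^ k * (LINT t|lborel. fn T W' t * \<phi> t)"
      by (rule trans[OF d(1)[unfolded has_weak_deriv_fn, rule_format, OF \<phi>, symmetric] d(2)[unfolded has_weak_deriv_fn, rule_format, OF \<phi>]])
    then have eq: "(LINT t|lborel. fn T W t * \<phi> t) = (LINT t|lborel. fn T W' t * \<phi> t)" by simp
    have "(LINT t|lborel. (1 * fn T W t + (-1) * fn T W' t) * \<phi> t) = (LINT t|lborel. fn T W t * \<phi> t - fn T W' t * \<phi> t)"
      by (simp add: algebra_simps)
    also have "\<dots> = 0" using fn_test_integrable[OF W(1) \<phi>] fn_test_integrable[OF W(2) \<phi>] eq by simp
    finally show "(LINT t|lborel. (1 * fn T W t + (-1) * fn T W' t) * \<phi> t) = 0" .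
  qed
  then show "AE t in lborel. fn T W t = fn T W' t" by eventually_elim simp
qed

lemma weak_deriv_eqI:
  assumes "W \<in> L2 T" "has_weak_deriv T k U W"
  shows "weak_deriv T k U = W"
  unfolding weak_deriv_def using assms weak_deriv_unique by (intro the_equality) blast+

lemma has_weak_deriv_0: "has_weak_deriv T 0 U U"
  by (simp add: has_weak_deriv_def)

lemma weak_deriv_compose:
  assumes "has_weak_deriv T k U W" "has_weak_deriv T j W Z"
  shows "has_weak_deriv T (k + j) U Z"
  unfolding has_weak_deriv_fn
proof (intro allI impI)
  fix \<phi> assume \<phi>: "test_function T \<phi>"
  have "(LINT t|lborel. fn T U t * (deriv ^^ (k + j)) \<phi> t) = (LINT t|lborel. fn T U t * (deriv ^^ k) ((deriv ^^ j) \<phi>) t)"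
    by (simp add: funpow_add)
  also have "\<dots> = (-1) ^ k * (LINT t|lborel. fn T W t * (deriv ^^ j) \<phi> t)"
    using assms(1) test_function_iterate[OF \<phi>, of j] unfolding has_weak_deriv_fn by blast
  also have "(LINT t|lborel. fn T W t * (deriv ^^ j) \<phi> t) = (-1) ^ j * (LINT t|lborel. fn T Z t * \<phi> t)"
    using assms(2) \<phi> unfolding has_weak_deriv_fn by blast
  finally show "(LINT t|lborel. fn T U t * (deriv ^^ (k + j)) \<phi> t) = (-1) ^ (k + j) * (LINT t|lborel. fn T Z t * \<phi> t)"
    by (simp add: power_add)
qed

lemma weak_deriv_next:
  assumes "has_weak_deriv T k U W" "has_weak_deriv T (Suc k) U Z"
  shows "has_weak_deriv T 1 W Z"
  unfolding has_weak_deriv_fn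
proof (intro allI impI)
  fix \<phi> assume \<phi>: "test_function T \<phi>"
  have "(-1) ^ k * (LINT t|lborel. fn T W t * (deriv ^^ 1) \<phi> t) = (LINT t|lborel. fn T U t * (deriv ^^ k) ((deriv ^^ 1) \<phi>) t)"
    by (rule assms(1)[unfolded has_weak_deriv_fn, rule_format, OF test_function_iterate[OF \<phi>, of 1], symmetric])
  also have "\<dots> = (LINT t|lborel. fn T U t * (deriv ^^ Suc k) \<phi> t)" by (simp add: funpow_swap1)
  also have "\<dots> = (-1) ^ Suc k * (LINT t|lborel. fn T Z t * \<phi> t)"
    using assms(2) \<phi> unfolding has_weak_deriv_fn by blast
  finally have "(-1) ^ k * (LINT t|lborel. fn T W t * (deriv ^^ 1) \<phi> t) = (-1) ^ k * ((-1) ^ 1 * (LINT t|lborel. fn T Z t * \<phi> t))"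
    by simp
  then show "(LINT t|lborel. fn T W t * (deriv ^^ 1) \<phi> t) = (-1) ^ 1 * (LINT t|lborel. fn T Z t * \<phi> t)"
    by (subst (asm) mult_left_cancel) simp_all
qed

lemma has_weak_deriv_scaleR:
  assumes "has_weak_deriv T k U W"
  shows "has_weak_deriv T k (c *\<^sub>R U) (c *\<^sub>R W)"
  unfolding has_weak_deriv_fn
proof (intro allI impI)
  fix \<phi> assume \<phi>: "test_function T \<phi>"
  have *: "(LINT t|lborel. fn T (c *\<^sub>R V) t * p t) = c * (LINT t|lborel. fn T V t * p t)" if "p \<in> borel_measurable borel" for V p
  proof -
    have "(LINT t|lborel. fn T (c *\<^sub>R V) t * p t) = (LINT t|lborel. c * (fn T V t * p t))"
      by (rule integral_cong_AE) (use fn_scaleR_AE[of T c V] that in \<open>auto elim!: eventually_mono\<close>)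
    then show ?thesis by (simp only: integral_mult_right_zero)
  qed
  have m: "(deriv ^^ k) \<phi> \<in> borel_measurable borel" "\<phi> \<in> borel_measurable borel"
    using test_function_iterate[OF \<phi>] test_function_integrable(1) \<phi> by auto
  show "(LINT t|lborel. fn T (c *\<^sub>R U) t * (deriv ^^ k) \<phi> t) = (-1) ^ k * (LINT t|lborel. fn T (c *\<^sub>R W) t * \<phi> t)"
    using assms \<phi> unfolding *[OF m(1)] *[OF m(2)] has_weak_deriv_fn by simp
qed

section \<open>The fractional integral of a class\<close>

definition Jl :: "real \<Rightarrow> real \<Rightarrow> aefun \<Rightarrow> aefun" where
  "Jl T a U = ae_on T (rl a (fn T U))"

lemma fn_Jl_AE: "AE t in lborel. fn T (Jl T a U) t = indicator {0<..<T} t * rl a (fn T U) t"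
  unfolding Jl_def by (rule fn_ae_on_AE) simp

lemma Jl_L2:
  assumes "a > 0" "U \<in> L2 T"
  shows "Jl T a U \<in> L2 T"
  unfolding Jl_def by (intro ae_on_L2 L2on_trunc L2loc_rl assms L2onD(3)[OF L2_fn(1)])

lemma rl_fn_cong:
  assumes "AE t in lborel. t \<in> {0<..<T} \<longrightarrow> fn T U t = v t" "v \<in> borel_measurable borel" "t \<le> T" "\<And>t. t \<le> 0 \<Longrightarrow> v t = 0"
  shows "rl a (fn T U) t = rl a v t"
proof -
  have "rl a (fn T U) t = rl a (\<lambda>t. indicator {..<T} t * v t) t"
  proof (rule rl_cong_AE)
    show "AE t in lborel. fn T U t = indicator {..<T} t * v t"
      using assms(1)
    proof eventually_elim
      case (elim t)
      then show ?case using assms(4)[of t] by (cases "t \<le> 0"; cases "t < T") (auto simp: fn_outside)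
    qed
  qed (use assms(2) in auto)
  also have "\<dots> = rl a v t" by (rule rl_cong_before) (use assms(3) in auto)
  finally show ?thesis .
qed

lemma Jl_semigroup:
  assumes a: "a > 0" and b: "b > 0" and U: "U \<in> L2 T"
  shows "Jl T a (Jl T b U) = Jl T (a + b) U"
  unfolding Jl_def[of T a] Jl_def[of T "a + b"]
proof (rule ae_on_cong_AE)
  have L: "L2loc (fn T U)" by (rule L2onD(3)[OF L2_fn(1)[OF U]])
  have "rl a (fn T (Jl T b U)) t = rl a (rl b (fn T U)) t" if "t \<le> T" for t
    by (rule rl_fn_cong) (use fn_Jl_AE[of T b U] that rl_causal[of "fn T U"] in \<open>auto simp: fn_outside elim!: eventually_mono\<close>)
  then show "AE t in lborel. t \<in> {0<..<T} \<longrightarrow> rl a (fn T (Jl T b U)) t = rl (a + b) (fn T U) t"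
    using rl_semigroup_AE[OF a b L] by (auto elim!: eventually_mono)
qed simp_all

lemma Jl_plus:
  assumes a: "a > 0" and U: "U \<in> L2 T" and V: "V \<in> L2 T"
  shows "Jl T a (U + V) = Jl T a U + Jl T a V"
proof (rule L2_eqI)
  show "Jl T a (U + V) \<in> L2 T" "Jl T a U + Jl T a V \<in> L2 T" by (intro Jl_L2 L2_plus a U V)+
  have r: "rl a (fn T (U + V)) t = rl a (\<lambda>t. fn T U t + fn T V t) t" for t
    by (rule rl_cong_AE) (use fn_plus_AE in auto)
  show "AE t in lborel. fn T (Jl T a (U + V)) t = fn T (Jl T a U + Jl T a V) t"
    using fn_Jl_AE[of T a "U + V"] fn_Jl_AE[of T a U] fn_Jl_AE[of T a V] fn_plus_AE[of T "Jl T a U" "Jl T a V"]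
      rl_add_AE[OF a L2onD(3)[OF L2_fn(1)[OF U]] L2onD(3)[OF L2_fn(1)[OF V]]]
    by eventually_elim (simp add: distrib_left r)
qed

lemma Jl_scaleR:
  assumes a: "a > 0" and U: "U \<in> L2 T"
  shows "Jl T a (c *\<^sub>R U) = c *\<^sub>R Jl T a U"
proof (rule L2_eqI)
  show "Jl T a (c *\<^sub>R U) \<in> L2 T" "c *\<^sub>R Jl T a U \<in> L2 T" by (intro Jl_L2 L2_scaleR a U)+
  have r: "rl a (fn T (c *\<^sub>R U)) t = c * rl a (fn T U) t" for t
    unfolding rl_cmult[symmetric] by (rule rl_cong_AE) (use fn_scaleR_AE in auto)
  show "AE t in lborel. fn T (Jl T a (c *\<^sub>R U)) t = fn T (c *\<^sub>R Jl T a U) t"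
    using fn_Jl_AE[of T a "c *\<^sub>R U"] fn_Jl_AE[of T a U] fn_scaleR_AE[of T c "Jl T a U"]
    by eventually_elim (simp add: r)
qed

lemma Jl_L2_sq_le:
  assumes a: "a > 0" and T: "T > 0" and U: "U \<in> L2 T"
  shows "L2_sq T (Jl T a U) \<le> ennreal ((T powr a / Gamma (a + 1))\<^sup>2) * L2_sq T U"
proof -
  have "L2_sq T (Jl T a U) = sqn lborel (\<lambda>t. indicator {0<..<T} t * rl a (fn T U) t)"
    unfolding L2_sq_fn by (rule sqn_cong_AE[OF fn_Jl_AE])
  also have "\<dots> \<le> sqn lborel (\<lambda>t. indicator {..T} t * rl a (fn T U) t)"
    by (rule sqn_mono) (auto simp: indicator_def)
  also have "\<dots> \<le> ennreal ((T powr a / Gamma (a + 1))\<^sup>2) * sqn lborel (\<lambda>t. indicator {..T} t * fn T U t)"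
    by (rule rl_sqn_le) (use a T in \<open>auto simp: fn_outside\<close>)
  also have "\<dots> \<le> ennreal ((T powr a / Gamma (a + 1))\<^sup>2) * L2_sq T U"
    unfolding L2_sq_fn by (intro mult_left_mono sqn_mono) (auto simp: indicator_def)
  finally show ?thesis .
qed

lemma Jl_1_weak_deriv:
  assumes T: "T > 0" and U: "U \<in> L2 T"
  shows "has_weak_deriv T 1 (Jl T 1 U) U"
  unfolding has_weak_deriv_fn
proof (intro allI impI)
  fix \<phi> assume \<phi>: "test_function T \<phi>"
  note tf' = test_function_integrable[OF test_function_integrable(3)[OF \<phi>]]
  note [measurable] = tf'(1)
  have "(LINT t|lborel. fn T (Jl T 1 U) t * (deriv ^^ 1) \<phi> t) = (LINT t|lborel. rl 1 (fn T U) t * deriv \<phi> t)"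
  proof (rule integral_cong_AE)
    show "AE t in lborel. fn T (Jl T 1 U) t * (deriv ^^ 1) \<phi> t = rl 1 (fn T U) t * deriv \<phi> t"
      using fn_Jl_AE[of T 1 U]
    proof eventually_elim
      case (elim t)
      then show ?case using tf'(5,6)[of t] by (cases "0 < t \<and> t < T") auto
    qed
  qed auto
  also have "\<dots> = - (LINT t|lborel. fn T U t * \<phi> t)" by (rule rl_1_parts[OF L2_fn(1)[OF U] \<phi> T])
  finally show "(LINT t|lborel. fn T (Jl T 1 U) t * (deriv ^^ 1) \<phi> t) = (-1) ^ 1 * (LINT t|lborel. fn T U t * \<phi> t)" by simp
qed

lemma Jl_1_power_L2: "U \<in> L2 T \<Longrightarrow> (Jl T 1 ^^ k) U \<in> L2 T"
  by (induction k) (auto intro: Jl_L2)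

lemma Jl_1_power_weak_deriv:
  assumes T: "T > 0" and U: "U \<in> L2 T"
  shows "has_weak_deriv T k ((Jl T 1 ^^ (k + j)) U) ((Jl T 1 ^^ j) U)"
proof (induction k arbitrary: j)
  case 0
  then show ?case by (simp add: has_weak_deriv_0)
next
  case (Suc k)
  have "has_weak_deriv T 1 ((Jl T 1 ^^ Suc j) U) ((Jl T 1 ^^ j) U)"
    using Jl_1_weak_deriv[OF T Jl_1_power_L2[OF U]] by simp
  from weak_deriv_compose[OF Suc[of "Suc j"] this] show ?case by simp
qed

lemma Jl_1_power:
  assumes "a > 0" "U \<in> L2 T"
  shows "(Jl T 1 ^^ k) (Jl T a U) = Jl T (real k + a) U"
proof (induction k)
  case (Suc k)
  have "(Jl T 1 ^^ Suc k) (Jl T a U) = Jl T 1 (Jl T (real k + a) U)" using Suc by simp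
  also have "\<dots> = Jl T (1 + (real k + a)) U" by (rule Jl_semigroup) (use assms in auto)
  finally show ?case by (simp add: add.assoc)
qed simp

lemma Jl_1_power': "U \<in> L2 T \<Longrightarrow> (Jl T 1 ^^ Suc k) U = Jl T (real (Suc k)) U"
  using Jl_1_power[of 1 U T k] by (simp add: funpow_swap1 add.commute)

text \<open>
  Composing with one more fractional integral makes the order a natural number, and integer
  order integrals are inverted by weak derivatives.
\<close>

lemma Jl_inj:
  assumes T: "T > 0" and a: "a > 0" and U: "U \<in> L2 T" "V \<in> L2 T" and eq: "Jl T a U = Jl T a V"
  shows "U = V"
proof -
  obtain n where n: "a < real (Suc n)" using reals_Archimedean2[of a] by (metis less_Suc_eq less_trans of_nat_less_iff)
  have sg: "Jl T (real (Suc n) - a) (Jl T a W) = Jl T (real (Suc n)) W" if "W \<in> L2 T" for W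
    using Jl_semigroup[of "real (Suc n) - a" a W T] n a that by simp
  have "Jl T (real (Suc n)) U = Jl T (real (Suc n)) V" using sg[OF U(1)] sg[OF U(2)] eq by metis
  then have "(Jl T 1 ^^ Suc n) U = (Jl T 1 ^^ Suc n) V"
    by (simp only: Jl_1_power'[OF U(1)] Jl_1_power'[OF U(2)])
  then have "has_weak_deriv T (Suc n) ((Jl T 1 ^^ Suc n) U) U" "has_weak_deriv T (Suc n) ((Jl T 1 ^^ Suc n) U) V"
    using Jl_1_power_weak_deriv[OF T U(1), of "Suc n" 0] Jl_1_power_weak_deriv[OF T U(2), of "Suc n" 0] by simp_all
  then show ?thesis by (rule weak_deriv_unique[OF U])
qed

section \<open>The range for order at most one\<close>

lemma continuous_interval_measurable:
  fixes f :: "real \<Rightarrow> real"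
  assumes "continuous_on {0..T} f"
  shows "(\<lambda>t. indicator {0<..<T} t * f t) \<in> borel_measurable borel"
proof -
  have "continuous_on {0<..<T} f" by (rule continuous_on_subset[OF assms]) auto
  then show ?thesis using borel_measurable_continuous_on_indicator[of "{0<..<T}" f] by simp
qed

lemma continuous_AE_const_at_0:
  fixes g :: "real \<Rightarrow> real"
  assumes g: "continuous_on {0..T} g" and T: "T > 0" and eq: "AE t in lborel. t \<in> {0<..<T} \<longrightarrow> g t = (c::real)"
  shows "g 0 = c"
proof (rule ccontr)
  assume ne: "g 0 \<noteq> c"
  have "(g \<longlongrightarrow> g 0) (at 0 within {0..T})"
  proof -
    have "0 \<in> {0..T}" using T by simp
    then show ?thesis using g unfolding continuous_on_def by blast
  qed
  then have "eventually (\<lambda>t. g t \<noteq> c) (at 0 within {0..T})" using ne by (rule tendsto_imp_eventually_ne)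
  then obtain d where d: "d > 0" "\<And>t. t \<in> {0..T} \<Longrightarrow> t \<noteq> 0 \<Longrightarrow> dist t 0 < d \<Longrightarrow> g t \<noteq> c"
    unfolding eventually_at by blast
  define e where "e = min d T"
  have "AE t in lborel. t \<notin> {0<..<e}"
    using eq
  proof eventually_elim
    case (elim t)
    then show ?case using d(2)[of t] by (auto simp: e_def)
  qed
  then have "emeasure lborel {0<..<e} = 0" by (subst (asm) AE_iff_measurable[where N="{0<..<e}"]) auto
  then show False using d T by (simp add: e_def)
qed

lemma Jl_vanishes:
  assumes "1/2 < a" "a \<le> 1" "V \<in> L2 T"
  shows "vanishes_at T 0 (Jl T a V)"
  unfolding vanishes_at_def
proof (intro exI conjI)
  show "continuous_on {0..T} (rl a (fn T V))" by (rule rl_continuous[OF assms(1,2) L2onD(2)[OF L2_fn(1)[OF assms(3)]]])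
  show "Jl T a V = ae_on T (rl a (fn T V))" by (rule Jl_def)
  show "rl a (fn T V) 0 = 0" by (rule rl_causal) (auto simp: fn_outside)
qed

text \<open>
  $U - J^1 W$ has weak derivative zero, so it is constant; both functions have continuous
  representatives that vanish at \<open>0\<close>, so the constant is zero.
\<close>

lemma H1_characterization:
  assumes T: "T > 0" and W: "W \<in> L2 T" and U: "U \<in> L2 T"
    and d: "has_weak_deriv T 1 U W" and v: "vanishes_at T 0 U"
  shows "U = Jl T 1 W"
proof -
  obtain f where f: "continuous_on {0..T} f" "U = ae_on T f" "f 0 = 0" using v unfolding vanishes_at_def by blast
  have fm: "(\<lambda>t. indicator {0<..<T} t * f t) \<in> borel_measurable borel" by (rule continuous_interval_measurable[OF f(1)])
  have fU: "AE t in lborel. fn T U t = indicator {0<..<T} t * f t" unfolding f(2) by (rule fn_ae_on_AE[OF fm])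
  let ?g = "\<lambda>t. indicator {0<..<T} t * rl 1 (fn T W) t"
  have gL: "L2on T ?g" by (rule L2on_trunc[OF L2loc_rl[OF _ L2onD(3)[OF L2_fn(1)[OF W]]]]) simp
  have JW: "AE t in lborel. fn T (Jl T 1 W) t = ?g t" by (rule fn_Jl_AE)
  have JL: "Jl T 1 W \<in> L2 T" by (rule Jl_L2[OF _ W]) simp
  have dJ: "has_weak_deriv T 1 (Jl T 1 W) W" by (rule Jl_1_weak_deriv[OF T W])
  obtain c where c: "AE t in lborel. t \<in> {0<..<T} \<longrightarrow> 1 * fn T U t + (-1) * fn T (Jl T 1 W) t = c"
  proof (rule weakly_constant[OF L2on_lincomb[OF L2_fn(1)[OF U] L2_fn(1)[OF JL]] T])
    fix \<phi> assume \<phi>: "test_function T \<phi>"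
    note \<phi>' = test_function_integrable(3)[OF \<phi>]
    have eq: "(LINT t|lborel. fn T U t * deriv \<phi> t) = (LINT t|lborel. fn T (Jl T 1 W) t * deriv \<phi> t)"
      using d dJ \<phi> unfolding has_weak_deriv_fn by simp
    have "(LINT t|lborel. (1 * fn T U t + (-1) * fn T (Jl T 1 W) t) * deriv \<phi> t)
       = (LINT t|lborel. fn T U t * deriv \<phi> t - fn T (Jl T 1 W) t * deriv \<phi> t)" by (simp add: algebra_simps)
    also have "\<dots> = 0" using fn_test_integrable[OF U \<phi>'] fn_test_integrable[OF JL \<phi>'] eq by simp
    finally show "(LINT t|lborel. (1 * fn T U t + (-1) * fn T (Jl T 1 W) t) * deriv \<phi> t) = 0" .
  qed blast
  have "AE t in lborel. t \<in> {0<..<T} \<longrightarrow> f t - rl 1 (fn T W) t = c"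
    using c fU JW by eventually_elim auto
  moreover have "continuous_on {0..T} (\<lambda>t. f t - rl 1 (fn T W) t)"
    by (intro continuous_on_diff f(1) rl_continuous L2onD(2)[OF L2_fn(1)[OF W]]) auto
  ultimately have "f 0 - rl 1 (fn T W) 0 = c" by (intro continuous_AE_const_at_0[OF _ T])
  moreover have "rl 1 (fn T W) 0 = 0" by (rule rl_causal) (auto simp: fn_outside)
  ultimately have "c = 0" using f(3) by simp
  show ?thesis
    by (rule L2_eqI[OF U JL])
       (use c in eventually_elim, auto simp: \<open>c = 0\<close> fn_def indicator_def)
qed

text \<open>
  The estimates on the line restrict to \<open>(0,T)\<close>. The seminorm on the line also bounds the
  Hardy weight, which for \<open>\<sigma> = 1/2\<close> is the additional term of the norm.
\<close>

lemma Jl_into_Hz_unit: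
  assumes T: "T > 0" and s: "0 < \<sigma>" "\<sigma> \<le> 1"
  shows "\<exists>C\<ge>0. \<forall>V\<in>L2 T. Jl T \<sigma> V \<in> Hz_unit T 0 \<sigma> \<and> Hz_unit_sq T 0 \<sigma> (Jl T \<sigma> V) \<le> ennreal C * L2_sq T V"
proof (cases "\<sigma> = 1")
  case True
  define K where "K = (T powr 1 / Gamma (1 + 1))\<^sup>2"
  have K: "K \<ge> 0" by (simp add: K_def)
  show ?thesis
  proof (intro exI[of _ "K + 1"] conjI ballI)
    fix V assume V: "V \<in> L2 T"
    have wd: "weak_deriv T 1 (Jl T 1 V) = V" by (rule weak_deriv_eqI[OF V Jl_1_weak_deriv[OF T V]])
    have JL: "Jl T 1 V \<in> L2 T" by (rule Jl_L2[OF _ V]) simp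
    have "\<exists>w\<in>L2 T. has_weak_deriv T k (Jl T 1 V) w" if "k \<le> 1" for k
    proof (cases k)
      case 0
      then show ?thesis using JL has_weak_deriv_0 by blast
    next
      case (Suc j)
      then have "k = 1" using that by simp
      then show ?thesis using V Jl_1_weak_deriv[OF T V] by blast
    qed
    then show "Jl T \<sigma> V \<in> Hz_unit T 0 \<sigma>"
      using True JL Jl_vanishes[of 1 V T] V by (simp add: Hz_unit_def sobolev_nat_def)
    have "Hz_unit_sq T 0 \<sigma> (Jl T \<sigma> V) = L2_sq T (Jl T 1 V) + L2_sq T V"
      using True wd by (simp add: Hz_unit_sq_def)
    also have "\<dots> \<le> ennreal K * L2_sq T V + ennreal 1 * L2_sq T V"
      unfolding K_def by (intro add_mono Jl_L2_sq_le T V) auto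
    also have "\<dots> = ennreal (K + 1) * L2_sq T V" using K by (simp add: distrib_right ennreal_plus)
    finally show "Hz_unit_sq T 0 \<sigma> (Jl T \<sigma> V) \<le> ennreal (K + 1) * L2_sq T V" .
  qed (use K in simp)
next
  case False
  then have s1: "\<sigma> < 1" using s by simp
  define K where "K = (T powr \<sigma> / Gamma (\<sigma> + 1))\<^sup>2"
  define G where "G = 2 * gagc \<sigma>"
  have K: "K \<ge> 0" by (simp add: K_def)
  have G: "G \<ge> 0" using gagc_pos[OF s(1) s1] by (simp add: G_def)
  show ?thesis
  proof (intro exI[of _ "K + G + (2 * \<sigma>) * G"] conjI ballI)
    fix V assume V: "V \<in> L2 T"
    let ?v = "fn T V" and ?u = "rl \<sigma> (fn T V)"
    note vL = L2_fn(1)[OF V]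
    have JL: "Jl T \<sigma> V \<in> L2 T" by (rule Jl_L2[OF s(1) V])
    have u0: "?u t = 0" if "t \<le> 0" for t by (rule rl_causal) (use that in \<open>auto simp: fn_outside\<close>)
    have gg: "gag_sq \<sigma> ?u \<le> ennreal G * L2_sq T V"
      unfolding G_def L2_sq_fn by (rule rl_gag_upper[OF s(1) s1 L2onD(2)[OF vL]])
    have sl: "slobodeckij_sq T \<sigma> (Jl T \<sigma> V) \<le> ennreal G * L2_sq T V"
    proof -
      have "slobodeckij_sq T \<sigma> (Jl T \<sigma> V) = gag_on \<sigma> {0<..<T} ?u"
        unfolding slobodeckij_fn by (rule gag_on_cong_AE) (use fn_Jl_AE[of T \<sigma> V] in \<open>auto elim!: eventually_mono\<close>)
      also have "\<dots> \<le> gag_sq \<sigma> ?u" by (rule gag_on_le_gag_sq) simp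
      finally show ?thesis using gg by simp
    qed
    have w: "sqn lborel (wt \<sigma> 0 T (fn T (Jl T \<sigma> V))) \<le> ennreal (2 * \<sigma> * G) * L2_sq T V"
    proof -
      have "sqn lborel (wt \<sigma> 0 T (fn T (Jl T \<sigma> V))) = sqn lborel (wt \<sigma> 0 T ?u)"
        by (rule sqn_cong_AE) (use fn_Jl_AE[of T \<sigma> V] in \<open>auto elim!: eventually_mono simp: wt_def indicator_def\<close>)
      also have "\<dots> = ennreal (2 * \<sigma>) * (ennreal (1 / (2 * \<sigma>)) * sqn lborel (wt \<sigma> 0 T ?u))"
      proof -
        have "ennreal (2 * \<sigma>) * ennreal (1 / (2 * \<sigma>)) = 1" using s by (simp flip: ennreal_mult)
        then show ?thesis by (simp add: mult.assoc[symmetric])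
      qed
      also have "\<dots> \<le> ennreal (2 * \<sigma>) * gag_sq \<sigma> ?u"
        by (intro mult_left_mono weight_le_gag_sq s u0) auto
      also have "\<dots> \<le> ennreal (2 * \<sigma>) * (ennreal G * L2_sq T V)" by (intro mult_left_mono gg) simp
      also have "\<dots> = ennreal (2 * \<sigma> * G) * L2_sq T V" using s G by (subst ennreal_mult) (auto simp: mult.assoc)
      finally show ?thesis .
    qed
    have Vfin: "L2_sq T V < \<infinity>" using V by (simp add: L2_def)
    have slf: "slobodeckij_sq T \<sigma> (Jl T \<sigma> V) < \<infinity>"
      by (rule le_less_trans[OF sl]) (use Vfin in \<open>simp add: ennreal_mult_less_top\<close>)
    have wf: "sqn lborel (wt \<sigma> 0 T (fn T (Jl T \<sigma> V))) < \<infinity>"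
      by (rule le_less_trans[OF w]) (use Vfin in \<open>simp add: ennreal_mult_less_top\<close>)
    have "weight_sq T 0 (Jl T \<sigma> V) < \<infinity>" if "\<sigma> = 1/2" using wf unfolding weight_fn that .
    moreover have "vanishes_at T 0 (Jl T \<sigma> V)" if "1/2 < \<sigma>" by (rule Jl_vanishes[OF that s(2) V])
    ultimately show "Jl T \<sigma> V \<in> Hz_unit T 0 \<sigma>"
      using slf JL s1 by (auto simp: Hz_unit_def sobolev_frac_def)
    have "Hz_unit_sq T 0 \<sigma> (Jl T \<sigma> V) \<le> L2_sq T (Jl T \<sigma> V) + slobodeckij_sq T \<sigma> (Jl T \<sigma> V) + sqn lborel (wt \<sigma> 0 T (fn T (Jl T \<sigma> V)))"
    proof -
      have "weight_sq T 0 (Jl T \<sigma> V) = sqn lborel (wt \<sigma> 0 T (fn T (Jl T \<sigma> V)))" if "\<sigma> = 1/2"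
        using weight_fn[of T "Jl T \<sigma> V"] by (simp only: that)
      then show ?thesis using s1 by (auto simp: Hz_unit_sq_def)
    qed
    also have "\<dots> \<le> ennreal K * L2_sq T V + ennreal G * L2_sq T V + ennreal (2 * \<sigma> * G) * L2_sq T V"
      unfolding K_def by (intro add_mono Jl_L2_sq_le s T V sl w)
    also have "\<dots> = ennreal (K + G + 2 * \<sigma> * G) * L2_sq T V"
      using K G s by (simp add: distrib_right ennreal_plus)
    finally show "Hz_unit_sq T 0 \<sigma> (Jl T \<sigma> V) \<le> ennreal (K + G + 2 * \<sigma> * G) * L2_sq T V" .
  qed (use K G s in simp)
qed

text \<open>
  The three cases in the definition of $H_\sigma$ match this bound: the Hardy inequality for
  small \<open>\<sigma>\<close>, the weight as a part of the norm at \<open>1/2\<close>, and the Hardy inequality for functions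
  that vanish at \<open>0\<close> above \<open>1/2\<close>.
\<close>

lemma Hz_unit_hardy:
  assumes T: "T > 0" and s: "0 < \<sigma>" "\<sigma> < 1"
  shows "\<exists>C\<ge>0. \<forall>U\<in>Hz_unit T 0 \<sigma>. sqn lborel (wt \<sigma> 0 T (fn T U)) \<le> ennreal C * Hz_unit_sq T 0 \<sigma> U"
proof -
  consider "\<sigma> < 1/2" | "\<sigma> = 1/2" | "\<sigma> > 1/2" by linarith
  then show ?thesis
  proof cases
    case 1
    obtain C where C: "C \<ge> 0" and h: "\<And>u. u \<in> borel_measurable borel \<Longrightarrow> sqn lborel (\<lambda>t. indicator {0<..<T} t * u t) < \<infinity> \<Longrightarrow>
       sqn lborel (wt \<sigma> 0 T u) \<le> ennreal C * (sqn lborel (\<lambda>t. indicator {0<..<T} t * u t) + gag_on \<sigma> {0<..<T} u)"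
      using hardy_small[OF s(1) 1 T] by blast
    show ?thesis
    proof (intro exI[of _ C] conjI ballI C)
      fix U assume "U \<in> Hz_unit T 0 \<sigma>"
      then have U: "U \<in> L2 T" using 1 by (simp add: Hz_unit_def sobolev_frac_def)
      have eq: "(\<lambda>t. indicator {0<..<T} t * fn T U t) = fn T U" by (auto simp: fn_def indicator_def)
      show "sqn lborel (wt \<sigma> 0 T (fn T U)) \<le> ennreal C * Hz_unit_sq T 0 \<sigma> U"
        using h[of "fn T U"] U 1 unfolding eq by (simp add: Hz_unit_sq_def L2_sq_fn slobodeckij_fn L2_def)
    qed
  next
    case 2
    show ?thesis
    proof (intro exI[of _ 1] conjI ballI)
      fix U assume "U \<in> Hz_unit T 0 \<sigma>"
      show "sqn lborel (wt \<sigma> 0 T (fn T U)) \<le> ennreal 1 * Hz_unit_sq T 0 \<sigma> U"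
        unfolding 2 by (simp add: Hz_unit_sq_def weight_fn)
    qed simp
  next
    case 3
    obtain C where C: "C \<ge> 0" and h: "\<And>u. u \<in> borel_measurable borel \<Longrightarrow> continuous_on {0..T} u \<Longrightarrow> u 0 = 0 \<Longrightarrow>
       sqn lborel (wt \<sigma> 0 T u) \<le> ennreal C * gag_on \<sigma> {0<..<T} u"
      using hardy_large[OF 3 T] by blast
    show ?thesis
    proof (intro exI[of _ C] conjI ballI C)
      fix U assume UH: "U \<in> Hz_unit T 0 \<sigma>"
      then obtain f where f: "continuous_on {0..T} f" "U = ae_on T f" "f 0 = 0"
        using 3 s unfolding Hz_unit_def vanishes_at_def by auto
      have fm: "(\<lambda>t. indicator {0<..<T} t * f t) \<in> borel_measurable borel" by (rule continuous_interval_measurable[OF f(1)])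
      define g where "g t = indicator {0..T} t * f t" for t
      have gm: "g \<in> borel_measurable borel" unfolding g_def
        using borel_measurable_continuous_on_indicator[of "{0..T}" f] f(1) by auto
      have gc: "continuous_on {0..T} g" using f(1) by (rule continuous_on_eq) (auto simp: g_def)
      have eq: "AE t in lborel. t \<in> {0<..<T} \<longrightarrow> fn T U t = g t"
        using fn_ae_on_AE[OF fm] unfolding f(2)[symmetric] by eventually_elim (auto simp: g_def)
      have "sqn lborel (wt \<sigma> 0 T (fn T U)) = sqn lborel (wt \<sigma> 0 T g)"
        by (rule sqn_cong_AE) (use eq in \<open>auto elim!: eventually_mono simp: wt_def indicator_def\<close>)
      also have "\<dots> \<le> ennreal C * gag_on \<sigma> {0<..<T} g"
        by (rule h[OF gm gc]) (simp add: g_def f(3))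
      also have "gag_on \<sigma> {0<..<T} g = slobodeckij_sq T \<sigma> U"
        unfolding slobodeckij_fn by (rule gag_on_cong_AE[symmetric]) (use eq in auto)
      also have "ennreal C * slobodeckij_sq T \<sigma> U \<le> ennreal C * Hz_unit_sq T 0 \<sigma> U"
        using 3 s by (intro mult_left_mono) (auto simp: Hz_unit_sq_def)
      finally show "sqn lborel (wt \<sigma> 0 T (fn T U)) \<le> ennreal C * Hz_unit_sq T 0 \<sigma> U" .
    qed
  qed
qed

lemma Hz_unit_L2: "U \<in> Hz_unit T e \<sigma> \<Longrightarrow> U \<in> L2 T"
  by (auto simp: Hz_unit_def sobolev_frac_def sobolev_nat_def split: if_splits)

lemma Hz_unit_sq_finite:
  assumes "U \<in> Hz_unit T e \<sigma>"
  shows "Hz_unit_sq T e \<sigma> U < \<infinity>"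
proof -
  have "L2_sq T U < \<infinity>" using Hz_unit_L2[OF assms] by (simp add: L2_def)
  moreover have "L2_sq T (weak_deriv T 1 U) < \<infinity>" if "\<not> \<sigma> < 1"
  proof -
    have "U \<in> sobolev_nat T 1" using assms that by (auto simp: Hz_unit_def split: if_splits)
    then obtain w where "w \<in> L2 T" "has_weak_deriv T 1 U w" by (auto simp: sobolev_nat_def)
    then show ?thesis using weak_deriv_eqI[of w T 1 U] by (simp add: L2_def)
  qed
  ultimately show ?thesis using assms
    by (auto simp: Hz_unit_def Hz_unit_sq_def sobolev_frac_def split: if_splits)
qed

text \<open>
  Extended by zero to the left of \<open>0\<close> and evenly around \<open>T\<close>, an element of $H_\sigma$ has
  compact support and finite seminorm on the line, so it is a fractional integral up to time
  \<open>T\<close>.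
\<close>

lemma Hz_unit_preimage:
  assumes T: "T > 0" and s: "0 < \<sigma>" "\<sigma> \<le> 1"
  shows "\<exists>C\<ge>0. \<forall>U\<in>Hz_unit T 0 \<sigma>. \<exists>V\<in>L2 T. U = Jl T \<sigma> V \<and> L2_sq T V \<le> ennreal C * Hz_unit_sq T 0 \<sigma> U"
proof (cases "\<sigma> = 1")
  case True
  show ?thesis
  proof (intro exI[of _ 1] conjI ballI)
    fix U assume U: "U \<in> Hz_unit T 0 \<sigma>"
    then have "U \<in> sobolev_nat T 1" and v: "vanishes_at T 0 U" using True by (auto simp: Hz_unit_def)
    then obtain W where W: "W \<in> L2 T" "has_weak_deriv T 1 U W" by (auto simp: sobolev_nat_def)
    have "U = Jl T 1 W" by (rule H1_characterization[OF T W(1) Hz_unit_L2[OF U] W(2) v])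
    moreover have "L2_sq T W \<le> ennreal 1 * Hz_unit_sq T 0 \<sigma> U"
      using weak_deriv_eqI[OF W] True by (simp add: Hz_unit_sq_def)
    ultimately show "\<exists>V\<in>L2 T. U = Jl T \<sigma> V \<and> L2_sq T V \<le> ennreal 1 * Hz_unit_sq T 0 \<sigma> U" using W True by blast
  qed simp
next
  case False
  then have s1: "\<sigma> < 1" using s by simp
  obtain C where C: "C \<ge> 0" and hardy: "\<And>U. U \<in> Hz_unit T 0 \<sigma> \<Longrightarrow> sqn lborel (wt \<sigma> 0 T (fn T U)) \<le> ennreal C * Hz_unit_sq T 0 \<sigma> U"
    using Hz_unit_hardy[OF T s(1) s1] by blast
  have c: "gagc \<sigma> > 0" by (rule gagc_pos[OF s(1) s1])
  define K where "K = 1 / gagc \<sigma> * (32 * (1 + 1 / \<sigma> * C))"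
  have K: "K \<ge> 0" using c C s by (simp add: K_def)
  show ?thesis
  proof (intro exI[of _ K] conjI ballI K)
    fix U assume U: "U \<in> Hz_unit T 0 \<sigma>"
    let ?u = "fn T U"
    have UL: "U \<in> L2 T" by (rule Hz_unit_L2[OF U])
    note uL = L2_fn(1)[OF UL]
    let ?f = "\<lambda>t. ?u (fold_at T t)"
    have fL: "L2half ?f" unfolding L2half_def
    proof (intro conjI allI impI)
      show "?f t = 0" if "t \<le> 0" for t using that T by (intro fn_outside) (simp add: fold_at_def)
      have "sqn lborel ?f \<le> 2 * (\<integral>\<^sup>+t. indicator {..T} t * ennreal ((?u t)\<^sup>2) \<partial>lborel)"
        unfolding sqn_def by (rule nn_integral_fold_at) simp
      also have "\<dots> \<le> 2 * sqn lborel ?u"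
        unfolding sqn_def by (intro mult_left_mono nn_integral_mono) (auto simp: indicator_def)
      also have "\<dots> < \<infinity>" using L2onD(4)[OF uL] by (simp add: ennreal_mult_less_top)
      finally show "sqn lborel ?f < \<infinity>" .
    qed simp
    have f2: "?f t = 0" if "t > 2 * T" for t using that T by (intro fn_outside) (simp add: fold_at_def)
    have gle: "gag_sq \<sigma> ?f \<le> ennreal (4 * (1 + 1 / \<sigma> * C)) * Hz_unit_sq T 0 \<sigma> U"
    proof -
      have "gag_sq \<sigma> ?f \<le> 4 * gag_on \<sigma> {..T} ?u" by (rule gag_sq_fold[OF s(1)]) simp
      also have "\<dots> \<le> 4 * (gag_on \<sigma> {0<..<T} ?u + ennreal (1 / \<sigma>) * sqn lborel (wt \<sigma> 0 T ?u))"
        by (intro mult_left_mono gag_on_atMost_le s) (auto simp: fn_outside)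
      also have "\<dots> \<le> 4 * (Hz_unit_sq T 0 \<sigma> U + ennreal (1 / \<sigma>) * (ennreal C * Hz_unit_sq T 0 \<sigma> U))"
        using s1 by (intro mult_left_mono add_mono hardy[OF U]) (auto simp: Hz_unit_sq_def slobodeckij_fn add_increasing add_increasing2)
      also have "\<dots> = ennreal (4 * (1 + 1 / \<sigma> * C)) * Hz_unit_sq T 0 \<sigma> U"
      proof -
        have "ennreal (4 * (1 + 1 / \<sigma> * C)) = 4 * (1 + ennreal (1 / \<sigma>) * ennreal C)"
          using s C by (simp add: ennreal_mult'[symmetric] ennreal_mult''[symmetric] ennreal_plus[symmetric] del: ennreal_plus flip: ennreal_1 ennreal_numeral)
        then show ?thesis by (simp add: distrib_left distrib_right mult.assoc)
      qed
      finally show ?thesis .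
    qed
    have gfin: "gag_sq \<sigma> ?f < \<infinity>"
      by (rule le_less_trans[OF gle]) (use Hz_unit_sq_finite[OF U] in \<open>simp add: ennreal_mult_less_top\<close>)
    obtain v where v: "L2half v" "\<And>t. t > T \<Longrightarrow> v t = 0" "AE t in lborel. t \<le> T \<longrightarrow> rl \<sigma> v t = ?f t"
      "ennreal (gagc \<sigma>) * sqn lborel v \<le> 8 * gag_sq \<sigma> ?f"
      using rl_gag_surj[OF s(1) s1 fL, of "2 * T" T] f2 gfin T by auto
    note [measurable] = L2halfD(1)[OF v(1)]
    define V where "V = ae_on T v"
    have tr: "L2on T (\<lambda>t. indicator {0<..<T} t * v t)" by (rule L2on_trunc[OF L2halfD(4)[OF v(1)]])
    have V: "V \<in> L2 T" unfolding V_def by (rule ae_on_L2[OF tr])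
    have fV: "AE t in lborel. fn T V t = indicator {0<..<T} t * v t" unfolding V_def by (rule fn_ae_on_AE) simp
    have "U = Jl T \<sigma> V"
    proof -
      have "rl \<sigma> (fn T V) t = rl \<sigma> v t" if "t \<le> T" for t
        by (rule rl_fn_cong) (use fV that L2halfD(2)[OF v(1)] in \<open>auto elim!: eventually_mono\<close>)
      then have "AE t in lborel. t \<in> {0<..<T} \<longrightarrow> ?u t = rl \<sigma> (fn T V) t"
        using v(3) by (auto elim!: eventually_mono simp: fold_at_def)
      then have "ae_on T ?u = ae_on T (rl \<sigma> (fn T V))" by (intro ae_on_cong_AE) auto
      then show ?thesis unfolding Jl_def L2_fn(3)[OF UL] .
    qed
    moreover have "L2_sq T V \<le> ennreal K * Hz_unit_sq T 0 \<sigma> U"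
    proof -
      have "L2_sq T V = sqn lborel (\<lambda>t. indicator {0<..<T} t * v t)" unfolding L2_sq_fn by (rule sqn_cong_AE[OF fV])
      also have "\<dots> \<le> sqn lborel v" by (rule sqn_mono) (auto simp: indicator_def)
      also have "\<dots> = ennreal (1 / gagc \<sigma>) * (ennreal (gagc \<sigma>) * sqn lborel v)"
      proof -
        have "ennreal (1 / gagc \<sigma>) * ennreal (gagc \<sigma>) = 1" using c by (simp flip: ennreal_mult)
        then show ?thesis by (simp add: mult.assoc[symmetric])
      qed
      also have "\<dots> \<le> ennreal (1 / gagc \<sigma>) * (8 * gag_sq \<sigma> ?f)" by (intro mult_left_mono v) simp
      also have "\<dots> \<le> ennreal (1 / gagc \<sigma>) * (8 * (ennreal (4 * (1 + 1 / \<sigma> * C)) * Hz_unit_sq T 0 \<sigma> U))"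
        by (intro mult_left_mono gle) simp_all
      also have "\<dots> = ennreal K * Hz_unit_sq T 0 \<sigma> U"
      proof -
        have "ennreal K = ennreal (1 / gagc \<sigma>) * (ennreal 8 * ennreal (4 * (1 + 1 / \<sigma> * C)))"
        proof -
          have m: "ennreal (a * (8 * x)) = ennreal a * (ennreal 8 * ennreal x)" if "a \<ge> 0" "x \<ge> 0" for a x
            using that by (simp add: ennreal_mult)
          have "K = 1 / gagc \<sigma> * (8 * (4 * (1 + 1 / \<sigma> * C)))" by (simp add: K_def)
          then show ?thesis using m[of "1 / gagc \<sigma>" "4 * (1 + 1 / \<sigma> * C)"] c C s by simp
        qed
        then show ?thesis by (simp add: mult.assoc)
      qed
      finally show ?thesis .
    qed
    ultimately show "\<exists>V\<in>L2 T. U = Jl T \<sigma> V \<and> L2_sq T V \<le> ennreal K * Hz_unit_sq T 0 \<sigma> U" using V by blast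
  qed
qed

section \<open>The range for arbitrary order\<close>

text \<open>
  The largest integer below \<open>\<alpha>\<close>, in the strict sense: an integer order \<open>m + 1\<close> is split into
  \<open>m\<close> and the remainder \<open>1\<close>.
\<close>

definition int_part :: "real \<Rightarrow> nat" where
  "int_part \<alpha> = nat (\<lceil>\<alpha>\<rceil> - 1)"

lemma int_part:
  assumes "\<alpha> > 0"
  shows "0 < \<alpha> - real (int_part \<alpha>)" "\<alpha> - real (int_part \<alpha>) \<le> 1"
proof -
  have "\<lceil>\<alpha>\<rceil> \<ge> 1" using assms by (simp add: one_le_ceiling)
  then have "real (int_part \<alpha>) = real_of_int \<lceil>\<alpha>\<rceil> - 1" by (simp add: int_part_def)
  then show "0 < \<alpha> - real (int_part \<alpha>)" "\<alpha> - real (int_part \<alpha>) \<le> 1" by linarith+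
qed

definition Hz_sq :: "real \<Rightarrow> real \<Rightarrow> real \<Rightarrow> aefun \<Rightarrow> ennreal" where
  "Hz_sq T e \<alpha> U = (if \<alpha> = 0 then L2_sq T U
     else if int_part \<alpha> = 0 then Hz_unit_sq T e \<alpha> U
     else L2_sq T (weak_deriv T (int_part \<alpha>) U) + Hz_unit_sq T e (\<alpha> - real (int_part \<alpha>)) (weak_deriv T (int_part \<alpha>) U))"

lemma nrm_Hz: "nrm (Hz T e \<alpha>) U = sqrt (enn2real (Hz_sq T e \<alpha> U))"
  by (auto simp: Hz_def Hz_sq_def Let_def int_part_def[symmetric])

lemma elems_Hz: "elems (Hz T e \<alpha>) = (if \<alpha> = 0 then L2 T
     else if int_part \<alpha> = 0 then Hz_unit T e \<alpha>
     else {U \<in> Hz_nat T e (int_part \<alpha>). weak_deriv T (int_part \<alpha>) U \<in> Hz_unit T e (\<alpha> - real (int_part \<alpha>))})"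
  by (auto simp: Hz_def Let_def int_part_def[symmetric])

lemma Hz_subset_L2: "U \<in> elems (Hz T e \<alpha>) \<Longrightarrow> U \<in> L2 T"
  by (auto simp: elems_Hz Hz_nat_def sobolev_nat_def dest: Hz_unit_L2 split: if_splits)

lemma Hz_sq_finite: "U \<in> elems (Hz T e \<alpha>) \<Longrightarrow> Hz_sq T e \<alpha> U < \<infinity>"
  using Hz_unit_sq_finite Hz_unit_L2
  by (auto simp: elems_Hz Hz_sq_def split: if_splits) (auto simp: L2_def)

text \<open>
  The kernel of order zero is identically zero by the conventions for \<open>Gamma\<close> and division, so
  the identity has to be prescribed for \<open>\<alpha> = 0\<close>.
\<close>

definition Jz :: "real \<Rightarrow> real \<Rightarrow> aefun \<Rightarrow> aefun" where
  "Jz T \<alpha> U = (if \<alpha> = 0 then U else Jl T \<alpha> U)"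

text \<open>
  $J^{m+\sigma} V = (J^1)^m J^\sigma V$: its weak derivatives up to order \<open>m\<close> are the
  partially integrated functions, and those of order less than \<open>m\<close> lie in the range of $J^1$,
  hence vanish at \<open>0\<close>.
\<close>

lemma Jz_into_Hz:
  assumes T: "T > 0" and a: "\<alpha> \<ge> 0"
  shows "\<exists>C\<ge>0. \<forall>V\<in>L2 T. Jz T \<alpha> V \<in> elems (Hz T 0 \<alpha>) \<and> Hz_sq T 0 \<alpha> (Jz T \<alpha> V) \<le> ennreal C * L2_sq T V"
proof (cases "\<alpha> = 0")
  case True
  then show ?thesis by (intro exI[of _ 1]) (simp add: Jz_def elems_Hz Hz_sq_def)
next
  case False
  define m where "m = int_part \<alpha>"
  define \<sigma> where "\<sigma> = \<alpha> - real m"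
  have s: "0 < \<sigma>" "\<sigma> \<le> 1" using int_part[of \<alpha>] a False by (auto simp: \<sigma>_def m_def)
  have am: "\<alpha> = real m + \<sigma>" by (simp add: \<sigma>_def)
  obtain C where C: "C \<ge> 0" and A: "\<And>V. V \<in> L2 T \<Longrightarrow> Jl T \<sigma> V \<in> Hz_unit T 0 \<sigma>"
    "\<And>V. V \<in> L2 T \<Longrightarrow> Hz_unit_sq T 0 \<sigma> (Jl T \<sigma> V) \<le> ennreal C * L2_sq T V"
    using Jl_into_Hz_unit[OF T s] by blast
  define K where "K = (T powr \<sigma> / Gamma (\<sigma> + 1))\<^sup>2"
  have K: "K \<ge> 0" by (simp add: K_def)
  show ?thesis
  proof (intro exI[of _ "K + C"] conjI ballI)
    fix V assume V: "V \<in> L2 T"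
    let ?U = "Jz T \<alpha> V" and ?W = "Jl T \<sigma> V"
    have W: "?W \<in> L2 T" by (rule Jl_L2[OF s(1) V])
    have U: "?U = (Jl T 1 ^^ m) ?W"
      using False am Jl_1_power[OF s(1) V, of m] by (simp add: Jz_def)
    have wd: "has_weak_deriv T k ?U ((Jl T 1 ^^ (m - k)) ?W)" if "k \<le> m" for k
      using Jl_1_power_weak_deriv[OF T W, of k "m - k"] that by (simp add: U)
    have wdL: "(Jl T 1 ^^ (m - k)) ?W \<in> L2 T" for k by (rule Jl_1_power_L2[OF W])
    have wde: "weak_deriv T k ?U = (Jl T 1 ^^ (m - k)) ?W" if "k \<le> m" for k
      by (rule weak_deriv_eqI[OF wdL wd[OF that]])
    have van: "vanishes_at T 0 (weak_deriv T k ?U)" if "k < m" for k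
    proof -
      define j where "j = m - Suc k"
      have j: "m - k = Suc j" using that by (simp add: j_def)
      have "weak_deriv T k ?U = Jl T 1 ((Jl T 1 ^^ j) ?W)" using wde[of k] that by (simp add: j)
      then show ?thesis using Jl_vanishes[OF _ _ Jl_1_power_L2[OF W, of j], of 1] by simp
    qed
    have "?U \<in> Hz_nat T 0 m"
      unfolding Hz_nat_def sobolev_nat_def using wd wdL van Jl_1_power_L2[OF W, of m] U by auto
    note Un = this
    have wm: "weak_deriv T m ?U = ?W" using wde[of m] by simp
    have m0: "?U = ?W" "\<sigma> = \<alpha>" if "m = 0" using U that by (simp_all add: \<sigma>_def)
    show "?U \<in> elems (Hz T 0 \<alpha>)"
    proof (cases "m = 0")
      case True
      then have "?U \<in> Hz_unit T 0 \<alpha>" using A(1)[OF V] m0 by metis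
      then show ?thesis using False True by (simp add: elems_Hz m_def[symmetric])
    next
      case m: False
      then show ?thesis using False Un A(1)[OF V] wm by (simp add: elems_Hz m_def[symmetric] \<sigma>_def[symmetric])
    qed
    have "Hz_sq T 0 \<alpha> ?U \<le> L2_sq T ?W + Hz_unit_sq T 0 \<sigma> ?W"
    proof (cases "m = 0")
      case True
      then have "Hz_sq T 0 \<alpha> ?U = Hz_unit_sq T 0 \<alpha> ?U" using False by (simp add: Hz_sq_def m_def[symmetric])
      also have "\<dots> = Hz_unit_sq T 0 \<sigma> ?W" by (simp only: m0[OF True])
      finally show ?thesis by (simp add: add_increasing)
    next
      case m: False
      then show ?thesis using False wm by (simp add: Hz_sq_def m_def[symmetric] \<sigma>_def[symmetric])
    qed
    also have "\<dots> \<le> ennreal K * L2_sq T V + ennreal C * L2_sq T V"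
      unfolding K_def by (intro add_mono Jl_L2_sq_le s T V A)
    also have "\<dots> = ennreal (K + C) * L2_sq T V" using K C by (simp add: distrib_right ennreal_plus)
    finally show "Hz_sq T 0 \<alpha> ?U \<le> ennreal (K + C) * L2_sq T V" .
  qed (use K C in simp)
qed

text \<open>
  An element of $H_{m+\sigma}$ is recovered from its derivative of order \<open>m\<close> by integrating
  \<open>m\<close> times from \<open>0\<close>, because all lower derivatives vanish there. That derivative lies in
  $H_\sigma$.
\<close>

lemma Hz_preimage:
  assumes T: "T > 0" and a: "\<alpha> \<ge> 0"
  shows "\<exists>C\<ge>0. \<forall>U\<in>elems (Hz T 0 \<alpha>). \<exists>V\<in>L2 T. U = Jz T \<alpha> V \<and> L2_sq T V \<le> ennreal C * Hz_sq T 0 \<alpha> U"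
proof (cases "\<alpha> = 0")
  case True
  then show ?thesis by (intro exI[of _ 1]) (simp add: Jz_def elems_Hz Hz_sq_def)
next
  case False
  define m where "m = int_part \<alpha>"
  define \<sigma> where "\<sigma> = \<alpha> - real m"
  have s: "0 < \<sigma>" "\<sigma> \<le> 1" using int_part[of \<alpha>] a False by (auto simp: \<sigma>_def m_def)
  have am: "\<alpha> = real m + \<sigma>" by (simp add: \<sigma>_def)
  obtain C where C: "C \<ge> 0" and B: "\<And>U. U \<in> Hz_unit T 0 \<sigma> \<Longrightarrow> \<exists>V\<in>L2 T. U = Jl T \<sigma> V \<and> L2_sq T V \<le> ennreal C * Hz_unit_sq T 0 \<sigma> U"
    using Hz_unit_preimage[OF T s] by blast
  show ?thesis
  proof (intro exI[of _ C] conjI ballI C)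
    fix U assume U: "U \<in> elems (Hz T 0 \<alpha>)"
    show "\<exists>V\<in>L2 T. U = Jz T \<alpha> V \<and> L2_sq T V \<le> ennreal C * Hz_sq T 0 \<alpha> U"
    proof (cases "m = 0")
      case True
      then have ip: "int_part \<alpha> = 0" and sa: "\<sigma> = \<alpha>" by (simp_all add: m_def \<sigma>_def)
      show ?thesis using U B[of U] False ip unfolding sa by (auto simp: elems_Hz Hz_sq_def Jz_def)
    next
      case m: False
      have Un: "U \<in> Hz_nat T 0 m" and WU: "weak_deriv T m U \<in> Hz_unit T 0 \<sigma>"
        using U False m by (auto simp: elems_Hz m_def[symmetric] \<sigma>_def[symmetric])
      have wd: "weak_deriv T k U \<in> L2 T \<and> has_weak_deriv T k U (weak_deriv T k U)" if km: "k \<le> m" for k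
      proof -
        obtain w where "w \<in> L2 T" "has_weak_deriv T k U w" using Un km by (auto simp: Hz_nat_def sobolev_nat_def)
        then show ?thesis using weak_deriv_eqI[of w T k U] by simp
      qed
      have "U = (Jl T 1 ^^ k) (weak_deriv T k U)" if "k \<le> m" for k
        using that
      proof (induction k)
        case 0
        have "weak_deriv T 0 U = U" using Hz_subset_L2[OF U] has_weak_deriv_0 by (rule weak_deriv_eqI)
        then show ?case by simp
      next
        case (Suc k)
        have "weak_deriv T k U = Jl T 1 (weak_deriv T (Suc k) U)"
        proof (rule H1_characterization[OF T])
          show "has_weak_deriv T 1 (weak_deriv T k U) (weak_deriv T (Suc k) U)"
            by (rule weak_deriv_next) (use wd Suc in auto)
          show "vanishes_at T 0 (weak_deriv T k U)" using Un Suc by (auto simp: Hz_nat_def)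
        qed (use wd Suc in auto)
        then show ?case using Suc by (simp add: funpow_swap1)
      qed
      from this[of m] have Ueq: "U = (Jl T 1 ^^ m) (weak_deriv T m U)" by simp
      obtain V where V: "V \<in> L2 T" "weak_deriv T m U = Jl T \<sigma> V" "L2_sq T V \<le> ennreal C * Hz_unit_sq T 0 \<sigma> (weak_deriv T m U)"
        using B[OF WU] by blast
      have "U = Jz T \<alpha> V" using Ueq False Jl_1_power[OF s(1) V(1), of m] by (simp add: V(2) Jz_def am[symmetric])
      moreover have "L2_sq T V \<le> ennreal C * Hz_sq T 0 \<alpha> U"
      proof (rule order.trans[OF V(3)], rule mult_left_mono)
        show "Hz_unit_sq T 0 \<sigma> (weak_deriv T m U) \<le> Hz_sq T 0 \<alpha> U"
          using False m by (auto simp: Hz_sq_def m_def[symmetric] \<sigma>_def[symmetric] add_increasing)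
      qed simp
      ultimately show ?thesis using V(1) by blast
    qed
  qed
qed

section \<open>Reflection of the interval\<close>

lemma AE_lborel_reflect:
  assumes "AE t in lborel. P t"
  shows "AE t in lborel. P (T - t :: real)"
proof -
  obtain N where N: "{x \<in> space lborel. \<not> P x} \<subseteq> N" "emeasure lborel N = 0" "N \<in> sets lborel"
    using assms by (rule AE_E)
  have [measurable]: "N \<in> sets borel" using N by simp
  have "(\<integral>\<^sup>+t. indicator N (T - t) \<partial>lborel) = (\<integral>\<^sup>+t. indicator N t \<partial>lborel)"
    by (rule nn_integral_reflect_shift) simp
  also have "\<dots> = 0" using N by simp
  finally have "AE t in lborel. indicator N (T - t) = (0::ennreal)"
    by (subst (asm) nn_integral_0_iff_AE) auto
  then show ?thesis by eventually_elim (use N(1) in \<open>auto simp: indicator_def split: if_splits\<close>)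
qed

text \<open>
  Reflection exchanges the endpoints, so the facts about the scale at \<open>T\<close> are obtained from
  those at \<open>0\<close>. Stated for a general endpoint \<open>e\<close>, each of the following lemmas serves both
  directions.
\<close>

definition Rf :: "real \<Rightarrow> aefun \<Rightarrow> aefun" where
  "Rf T U = ae_on T (\<lambda>t. fn T U (T - t))"

lemma fn_Rf_AE: "AE t in lborel. fn T (Rf T U) t = fn T U (T - t)"
proof -
  have "AE t in lborel. fn T (Rf T U) t = indicator {0<..<T} t * fn T U (T - t)"
    unfolding Rf_def by (rule fn_ae_on_AE) simp
  then show ?thesis by eventually_elim (auto simp: fn_def indicator_def)
qed

lemma sqn_reflect:
  fixes f :: "real \<Rightarrow> real"
  assumes [measurable]: "f \<in> borel_measurable borel"
  shows "sqn lborel (\<lambda>t. f (T - t)) = sqn lborel f"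
  unfolding sqn_def by (rule nn_integral_reflect_shift[of "\<lambda>t. ennreal ((f t)\<^sup>2)"]) simp

lemma L2_sq_Rf: "L2_sq T (Rf T U) = L2_sq T U"
proof -
  have "L2_sq T (Rf T U) = sqn lborel (\<lambda>t. fn T U (T - t))"
    unfolding L2_sq_fn by (rule sqn_cong_AE[OF fn_Rf_AE])
  then show ?thesis by (simp add: sqn_reflect L2_sq_fn)
qed

lemma Rf_L2:
  assumes "U \<in> L2 T"
  shows "Rf T U \<in> L2 T"
  unfolding Rf_def
proof (rule ae_on_L2, rule L2onI)
  have eq: "indicator {0<..<T} t * fn T U (T - t) = fn T U (T - t)" for t by (auto simp: fn_def indicator_def)
  show "sqn lborel (\<lambda>t. indicator {0<..<T} t * fn T U (T - t)) < \<infinity>"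
    unfolding eq using assms by (simp add: sqn_reflect L2_def L2_sq_fn)
qed auto

lemma Rf_Rf:
  assumes U: "U \<in> L2 T"
  shows "Rf T (Rf T U) = U"
proof (rule L2_eqI[OF Rf_L2[OF Rf_L2[OF U]] U])
  show "AE t in lborel. fn T (Rf T (Rf T U)) t = fn T U t"
    using fn_Rf_AE[of T "Rf T U"] AE_lborel_reflect[OF fn_Rf_AE[of T U], of T] by eventually_elim simp
qed

lemma Rf_scaleR:
  assumes U: "U \<in> L2 T"
  shows "Rf T (c *\<^sub>R U) = c *\<^sub>R Rf T U"
proof (rule L2_eqI)
  show "AE t in lborel. fn T (Rf T (c *\<^sub>R U)) t = fn T (c *\<^sub>R Rf T U) t"
    using fn_Rf_AE[of T "c *\<^sub>R U"] fn_Rf_AE[of T U] fn_scaleR_AE[of T c "Rf T U"] AE_lborel_reflect[OF fn_scaleR_AE[of T c U], of T]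
    by eventually_elim simp
qed (intro Rf_L2 L2_scaleR U)+

lemma Rf_plus:
  assumes U: "U \<in> L2 T" and V: "V \<in> L2 T"
  shows "Rf T (U + V) = Rf T U + Rf T V"
proof (rule L2_eqI)
  show "AE t in lborel. fn T (Rf T (U + V)) t = fn T (Rf T U + Rf T V) t"
    using fn_Rf_AE[of T "U + V"] fn_Rf_AE[of T U] fn_Rf_AE[of T V] fn_plus_AE[of T "Rf T U" "Rf T V"] AE_lborel_reflect[OF fn_plus_AE[of T U V], of T]
    by eventually_elim simp
qed (intro Rf_L2 L2_plus U V)+

lemma slobodeckij_Rf: "slobodeckij_sq T \<sigma> (Rf T U) = slobodeckij_sq T \<sigma> U"
proof -
  let ?u = "fn T U" and ?A = "{0<..<T}"
  let ?H = "\<lambda>t s. ennreal ((?u t - ?u s)\<^sup>2 / \<bar>t - s\<bar> powr (1 + 2 * \<sigma>))"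
  have iA: "indicator ?A t = (indicator ?A (T - t) :: ennreal)" for t by (auto simp: indicator_def)
  have iH: "ennreal ((?u (T - t) - ?u (T - s))\<^sup>2 / \<bar>t - s\<bar> powr (1 + 2 * \<sigma>)) = ?H (T - t) (T - s)" for t s
    by (simp add: abs_minus_commute)
  have "slobodeckij_sq T \<sigma> (Rf T U) = gag_on \<sigma> ?A (\<lambda>t. ?u (T - t))"
    unfolding slobodeckij_fn by (rule gag_on_cong_AE) (use fn_Rf_AE[of T U] in \<open>auto elim!: eventually_mono\<close>)
  also have "\<dots> = (\<integral>\<^sup>+t. indicator ?A (T - t) * (\<integral>\<^sup>+s. indicator ?A (T - s) * ?H (T - t) (T - s) \<partial>lborel) \<partial>lborel)"
    unfolding gag_on_def iH by (simp only: iA[symmetric])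
  also have "\<dots> = (\<integral>\<^sup>+t. indicator ?A (T - t) * (\<integral>\<^sup>+s. indicator ?A s * ?H (T - t) s \<partial>lborel) \<partial>lborel)"
  proof (rule nn_integral_cong)
    fix t
    have "(\<integral>\<^sup>+s. indicator ?A (T - s) * ?H (T - t) (T - s) \<partial>lborel) = (\<integral>\<^sup>+s. indicator ?A s * ?H (T - t) s \<partial>lborel)"
      by (rule nn_integral_reflect_shift[of "\<lambda>s. indicator ?A s * ?H (T - t) s"]) simp
    then show "indicator ?A (T - t) * (\<integral>\<^sup>+s. indicator ?A (T - s) * ?H (T - t) (T - s) \<partial>lborel) = indicator ?A (T - t) * (\<integral>\<^sup>+s. indicator ?A s * ?H (T - t) s \<partial>lborel)"
      by (simp only:)
  qed
  also have "\<dots> = (\<integral>\<^sup>+t. indicator ?A t * (\<integral>\<^sup>+s. indicator ?A s * ?H t s \<partial>lborel) \<partial>lborel)"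
    by (rule nn_integral_reflect_shift[of "\<lambda>t. indicator ?A t * (\<integral>\<^sup>+s. indicator ?A s * ?H t s \<partial>lborel)"]) simp
  also have "\<dots> = slobodeckij_sq T \<sigma> U" unfolding slobodeckij_fn gag_on_def ..
  finally show ?thesis .
qed

lemma weight_sq_fn: "weight_sq T e U = (\<integral>\<^sup>+t. ennreal ((fn T U t)\<^sup>2 / \<bar>t - e\<bar>) \<partial>lborel)"
  unfolding weight_sq_def by (intro nn_integral_cong) (auto simp: fn_def indicator_def)

lemma weight_sq_Rf: "weight_sq T (T - e) (Rf T U) = weight_sq T e U"
proof -
  have "weight_sq T (T - e) (Rf T U) = (\<integral>\<^sup>+t. ennreal ((fn T U (T - t))\<^sup>2 / \<bar>(T - t) - e\<bar>) \<partial>lborel)"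
    unfolding weight_sq_fn
  proof (rule nn_integral_cong_AE)
    show "AE t in lborel. ennreal ((fn T (Rf T U) t)\<^sup>2 / \<bar>t - (T - e)\<bar>) = ennreal ((fn T U (T - t))\<^sup>2 / \<bar>(T - t) - e\<bar>)"
      using fn_Rf_AE[of T U]
    proof eventually_elim
      case (elim t)
      have "\<bar>t - (T - e)\<bar> = \<bar>(T - t) - e\<bar>" by linarith
      then show ?case by (simp only: elim)
    qed
  qed
  also have "\<dots> = weight_sq T e U" unfolding weight_sq_fn
    by (rule nn_integral_reflect_shift[of "\<lambda>t. ennreal ((fn T U t)\<^sup>2 / \<bar>t - e\<bar>)"]) simp
  finally show ?thesis .
qed

lemma vanishes_at_Rf:
  assumes U: "U \<in> L2 T" and v: "vanishes_at T e U"
  shows "vanishes_at T (T - e) (Rf T U)"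
proof -
  obtain f where f: "continuous_on {0..T} f" "U = ae_on T f" "f e = 0" using v unfolding vanishes_at_def by blast
  note fm = continuous_interval_measurable[OF f(1)]
  have c: "continuous_on {0..T} (\<lambda>t. f (T - t))"
    by (rule continuous_on_compose2[OF f(1)]) (auto intro!: continuous_intros)
  have fU: "AE t in lborel. fn T U t = indicator {0<..<T} t * f t" unfolding f(2) by (rule fn_ae_on_AE[OF fm])
  have "Rf T U = ae_on T (\<lambda>t. f (T - t))"
    unfolding Rf_def
  proof (rule ae_on_cong_AE)
    show "AE t in lborel. t \<in> {0<..<T} \<longrightarrow> fn T U (T - t) = f (T - t)"
      using AE_lborel_reflect[OF fU, of T] by eventually_elim auto
  qed (use continuous_interval_measurable[OF c] in auto)
  then show ?thesis unfolding vanishes_at_def using c f(3) by (intro exI[of _ "\<lambda>t. f (T - t)"]) auto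
qed

lemma test_function_reflect:
  assumes \<phi>: "test_function T \<phi>"
  shows "(deriv ^^ k) (\<lambda>x. \<phi> (T - x)) = (\<lambda>x. (-1) ^ k * (deriv ^^ k) \<phi> (T - x))" "test_function T (\<lambda>x. \<phi> (T - x))"
proof -
  have d: "((\<lambda>x. (-1) ^ k * (deriv ^^ k) \<phi> (T - x)) has_real_derivative (-1) ^ Suc k * (deriv ^^ Suc k) \<phi> (T - x)) (at x)" for k x
  proof -
    have "((deriv ^^ k) \<phi> has_real_derivative (deriv ^^ Suc k) \<phi> (T - x)) (at (T - x))"
      using test_function_integrable(4)[OF test_function_iterate[OF \<phi>, of k]] by simp
    then have "((\<lambda>x. (deriv ^^ k) \<phi> (T - x)) has_real_derivative (deriv ^^ Suc k) \<phi> (T - x) * (-1)) (at x)"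
      by (rule DERIV_chain2) (auto intro!: derivative_eq_intros)
    from DERIV_cmult[OF this, of "(-1) ^ k"] show ?thesis by simp
  qed
  have eq: "(deriv ^^ k) (\<lambda>x. \<phi> (T - x)) = (\<lambda>x. (-1) ^ k * (deriv ^^ k) \<phi> (T - x))" for k
  proof (induction k)
    case (Suc k)
    have "(deriv ^^ Suc k) (\<lambda>x. \<phi> (T - x)) = deriv (\<lambda>x. (-1) ^ k * (deriv ^^ k) \<phi> (T - x))" using Suc by simp
    also have "\<dots> = (\<lambda>x. (-1) ^ Suc k * (deriv ^^ Suc k) \<phi> (T - x))"
      by (rule ext) (rule DERIV_imp_deriv[OF d])
    finally show ?case .
  qed simp
  then show "(deriv ^^ k) (\<lambda>x. \<phi> (T - x)) = (\<lambda>x. (-1) ^ k * (deriv ^^ k) \<phi> (T - x))" .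
  obtain a b where ab: "0 < a" "b < T" "\<And>x. x \<notin> {a..b} \<Longrightarrow> \<phi> x = 0" using \<phi> unfolding test_function_def by blast
  show "test_function T (\<lambda>x. \<phi> (T - x))" unfolding test_function_def
  proof (intro conjI allI)
    show "(deriv ^^ k) (\<lambda>x. \<phi> (T - x)) differentiable at x" for k x
      unfolding eq using d real_differentiable_def by blast
    have "\<phi> (T - x) = 0" if "x \<notin> {T - b..T - a}" for x using that by (intro ab(3)) auto
    then show "\<exists>a b. 0 < a \<and> b < T \<and> (\<forall>x. x \<notin> {a..b} \<longrightarrow> \<phi> (T - x) = 0)"
      using ab by (intro exI[of _ "T - b"] exI[of _ "T - a"]) auto
  qed
qed

lemma LINT_reflect: "(LINT t|lborel. f (T - t :: real)) = (LINT t|lborel. f t :: real)"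
  using lborel_integral_real_affine[of "-1" f T] by simp

text \<open>
  The chain rule produces the sign; it disappears from all norms.
\<close>

lemma weak_deriv_Rf:
  assumes d: "has_weak_deriv T k U W"
  shows "has_weak_deriv T k (Rf T U) ((-1) ^ k *\<^sub>R Rf T W)"
  unfolding has_weak_deriv_fn
proof (intro allI impI)
  fix \<phi> assume \<phi>: "test_function T \<phi>"
  note r = test_function_reflect[OF \<phi>]
  have m: "(deriv ^^ k) \<phi> \<in> borel_measurable borel" "\<phi> \<in> borel_measurable borel"
    using test_function_iterate[OF \<phi>] test_function_integrable(1) \<phi> by auto
  note [measurable] = m
  have "(LINT t|lborel. fn T (Rf T U) t * (deriv ^^ k) \<phi> t) = (LINT t|lborel. fn T U (T - t) * (deriv ^^ k) \<phi> (T - (T - t)))"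
    by (rule integral_cong_AE) (use fn_Rf_AE[of T U] in \<open>auto elim!: eventually_mono\<close>)
  also have "\<dots> = (LINT t|lborel. fn T U t * (deriv ^^ k) \<phi> (T - t))"
    by (rule LINT_reflect[of "\<lambda>t. fn T U t * (deriv ^^ k) \<phi> (T - t)"])
  also have "\<dots> = (LINT t|lborel. (-1) ^ k * (fn T U t * (deriv ^^ k) (\<lambda>x. \<phi> (T - x)) t))"
    unfolding r(1) by (intro Bochner_Integration.integral_cong refl) (simp add: mult.left_commute[of "fn T U _"] mult.assoc[symmetric] power_add[symmetric])
  also have "\<dots> = (-1) ^ k * (LINT t|lborel. fn T U t * (deriv ^^ k) (\<lambda>x. \<phi> (T - x)) t)"
    by (rule integral_mult_right_zero)
  also have "(LINT t|lborel. fn T U t * (deriv ^^ k) (\<lambda>x. \<phi> (T - x)) t) = (-1) ^ k * (LINT t|lborel. fn T W t * \<phi> (T - t))"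
    using d r(2) unfolding has_weak_deriv_fn by blast
  also have "(LINT t|lborel. fn T W t * \<phi> (T - t)) = (LINT t|lborel. fn T W (T - t) * \<phi> (T - (T - t)))"
    by (rule LINT_reflect[of "\<lambda>t. fn T W t * \<phi> (T - t)", symmetric])
  also have "(-1) ^ k * \<dots> = (LINT t|lborel. (-1) ^ k * (fn T W (T - t) * \<phi> (T - (T - t))))"
    by (rule integral_mult_right_zero[symmetric])
  also have "\<dots> = (LINT t|lborel. fn T ((-1) ^ k *\<^sub>R Rf T W) t * \<phi> t)"
  proof (rule integral_cong_AE)
    show "AE t in lborel. (-1) ^ k * (fn T W (T - t) * \<phi> (T - (T - t))) = fn T ((-1) ^ k *\<^sub>R Rf T W) t * \<phi> t"
      using fn_Rf_AE[of T W] fn_scaleR_AE[of T "(-1) ^ k" "Rf T W"] by eventually_elim (simp add: mult.assoc)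
  qed auto
  finally show "(LINT t|lborel. fn T (Rf T U) t * (deriv ^^ k) \<phi> t) = (-1) ^ k * (LINT t|lborel. fn T ((-1) ^ k *\<^sub>R Rf T W) t * \<phi> t)" .
qed

section \<open>Scalar multiples and reflections in the scales\<close>

lemma slobodeckij_scaleR: "slobodeckij_sq T \<sigma> (c *\<^sub>R U) = ennreal (c\<^sup>2) * slobodeckij_sq T \<sigma> U"
proof -
  have eq: "ennreal ((c * fn T U t - c * fn T U s)\<^sup>2 / \<bar>t - s\<bar> powr (1 + 2 * \<sigma>)) = ennreal (c\<^sup>2) * ennreal ((fn T U t - fn T U s)\<^sup>2 / \<bar>t - s\<bar> powr (1 + 2 * \<sigma>))" for t s
    by (simp add: right_diff_distrib[symmetric] power_mult_distrib ennreal_mult'[symmetric])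
  have "slobodeckij_sq T \<sigma> (c *\<^sub>R U) = gag_on \<sigma> {0<..<T} (\<lambda>t. c * fn T U t)"
    unfolding slobodeckij_fn by (rule gag_on_cong_AE) (use fn_scaleR_AE[of T c U] in \<open>auto elim!: eventually_mono\<close>)
  also have "\<dots> = ennreal (c\<^sup>2) * gag_on \<sigma> {0<..<T} (fn T U)"
    unfolding gag_on_def eq by (simp add: mult.left_commute[of _ "ennreal (c\<^sup>2)"] nn_integral_cmult)
  finally show ?thesis by (simp only: slobodeckij_fn)
qed

lemma weight_sq_scaleR: "weight_sq T e (c *\<^sub>R U) = ennreal (c\<^sup>2) * weight_sq T e U"
proof -
  have "weight_sq T e (c *\<^sub>R U) = (\<integral>\<^sup>+t. ennreal (c\<^sup>2) * ennreal ((fn T U t)\<^sup>2 / \<bar>t - e\<bar>) \<partial>lborel)"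
    unfolding weight_sq_fn
  proof (rule nn_integral_cong_AE)
    show "AE t in lborel. ennreal ((fn T (c *\<^sub>R U) t)\<^sup>2 / \<bar>t - e\<bar>) = ennreal (c\<^sup>2) * ennreal ((fn T U t)\<^sup>2 / \<bar>t - e\<bar>)"
      using fn_scaleR_AE[of T c U] by eventually_elim (simp add: power_mult_distrib ennreal_mult'[symmetric])
  qed
  also have "\<dots> = ennreal (c\<^sup>2) * weight_sq T e U" unfolding weight_sq_fn by (rule nn_integral_cmult) simp
  finally show ?thesis .
qed

lemma vanishes_at_scaleR:
  assumes "vanishes_at T e U"
  shows "vanishes_at T e (c *\<^sub>R U)"
proof -
  obtain f where f: "continuous_on {0..T} f" "U = ae_on T f" "f e = 0" using assms unfolding vanishes_at_def by blast
  note fm = continuous_interval_measurable[OF f(1)]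
  have c: "continuous_on {0..T} (\<lambda>t. c * f t)" by (intro continuous_intros f)
  have r1: "AE t in lborel. rep_ae U t = indicator {0<..<T} t * f t" unfolding f(2) by (rule rep_ae_on_AE[OF fm])
  have r2: "AE t in lborel. rep_ae (ae_on T (\<lambda>t. c * f t)) t = indicator {0<..<T} t * (c * f t)"
    by (rule rep_ae_on_AE[OF continuous_interval_measurable[OF c]])
  have "c *\<^sub>R U = ae_on T (\<lambda>t. c * f t)"
    by (rule aefun_eqI) (use rep_scaleR_AE[of c U] r1 r2 in eventually_elim, simp)
  then show ?thesis unfolding vanishes_at_def using c f(3) by auto
qed

lemma sobolev_nat_deriv:
  assumes "U \<in> sobolev_nat T m" "k \<le> m"
  shows "weak_deriv T k U \<in> L2 T" "has_weak_deriv T k U (weak_deriv T k U)"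
proof -
  obtain w where "w \<in> L2 T" "has_weak_deriv T k U w" using assms by (auto simp: sobolev_nat_def)
  then show "weak_deriv T k U \<in> L2 T" "has_weak_deriv T k U (weak_deriv T k U)"
    using weak_deriv_eqI[of w T k U] by simp_all
qed

lemma sobolev_nat_scaleR:
  assumes U: "U \<in> sobolev_nat T m"
  shows "c *\<^sub>R U \<in> sobolev_nat T m" "k \<le> m \<Longrightarrow> weak_deriv T k (c *\<^sub>R U) = c *\<^sub>R weak_deriv T k U"
proof -
  note d = sobolev_nat_deriv[OF U]
  have w: "has_weak_deriv T k (c *\<^sub>R U) (c *\<^sub>R weak_deriv T k U)" "c *\<^sub>R weak_deriv T k U \<in> L2 T" if "k \<le> m" for k
    using has_weak_deriv_scaleR[OF d(2)[OF that]] L2_scaleR[OF d(1)[OF that]] by auto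
  show "c *\<^sub>R U \<in> sobolev_nat T m" using U w L2_scaleR unfolding sobolev_nat_def by blast
  show "k \<le> m \<Longrightarrow> weak_deriv T k (c *\<^sub>R U) = c *\<^sub>R weak_deriv T k U" using w weak_deriv_eqI by blast
qed

lemma sobolev_nat_Rf:
  assumes U: "U \<in> sobolev_nat T m"
  shows "Rf T U \<in> sobolev_nat T m" "k \<le> m \<Longrightarrow> weak_deriv T k (Rf T U) = (-1) ^ k *\<^sub>R Rf T (weak_deriv T k U)"
proof -
  note d = sobolev_nat_deriv[OF U]
  have w: "has_weak_deriv T k (Rf T U) ((-1) ^ k *\<^sub>R Rf T (weak_deriv T k U))" "(-1) ^ k *\<^sub>R Rf T (weak_deriv T k U) \<in> L2 T" if "k \<le> m" for k
    using weak_deriv_Rf[OF d(2)[OF that]] L2_scaleR[OF Rf_L2[OF d(1)[OF that]]] by auto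
  show "Rf T U \<in> sobolev_nat T m" using U w Rf_L2 unfolding sobolev_nat_def by blast
  show "k \<le> m \<Longrightarrow> weak_deriv T k (Rf T U) = (-1) ^ k *\<^sub>R Rf T (weak_deriv T k U)" using w weak_deriv_eqI by blast
qed

lemma Hz_unit_scaleR:
  assumes U: "U \<in> Hz_unit T e \<sigma>"
  shows "c *\<^sub>R U \<in> Hz_unit T e \<sigma>" "Hz_unit_sq T e \<sigma> (c *\<^sub>R U) = ennreal (c\<^sup>2) * Hz_unit_sq T e \<sigma> U"
proof -
  show "c *\<^sub>R U \<in> Hz_unit T e \<sigma>"
    using U sobolev_nat_scaleR(1)[of U T 1 c] vanishes_at_scaleR[of T e U c] L2_scaleR[of U T c]
    by (auto simp: Hz_unit_def sobolev_frac_def slobodeckij_scaleR weight_sq_scaleR ennreal_mult_less_top split: if_splits)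
  have "U \<in> sobolev_nat T 1" if "\<not> \<sigma> < 1" using U that by (auto simp: Hz_unit_def split: if_splits)
  then show "Hz_unit_sq T e \<sigma> (c *\<^sub>R U) = ennreal (c\<^sup>2) * Hz_unit_sq T e \<sigma> U"
    using sobolev_nat_scaleR(2)[of U T 1 1 c]
    by (auto simp: Hz_unit_sq_def slobodeckij_scaleR weight_sq_scaleR L2_sq_scaleR distrib_left)
qed

lemma Hz_unit_Rf:
  assumes U: "U \<in> Hz_unit T e \<sigma>"
  shows "Rf T U \<in> Hz_unit T (T - e) \<sigma>" "Hz_unit_sq T (T - e) \<sigma> (Rf T U) = Hz_unit_sq T e \<sigma> U"
proof -
  have UL: "U \<in> L2 T" by (rule Hz_unit_L2[OF U])
  show "Rf T U \<in> Hz_unit T (T - e) \<sigma>"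
    using U sobolev_nat_Rf(1)[of U T 1] vanishes_at_Rf[OF UL, of e] Rf_L2[OF UL]
    by (auto simp: Hz_unit_def sobolev_frac_def slobodeckij_Rf weight_sq_Rf split: if_splits)
  have "U \<in> sobolev_nat T 1" if "\<not> \<sigma> < 1" using U that by (auto simp: Hz_unit_def split: if_splits)
  then show "Hz_unit_sq T (T - e) \<sigma> (Rf T U) = Hz_unit_sq T e \<sigma> U"
    using sobolev_nat_Rf(2)[of U T 1 1] L2_sq_scaleR[of T "-1" "Rf T (weak_deriv T 1 U)"]
    by (auto simp: Hz_unit_sq_def slobodeckij_Rf weight_sq_Rf L2_sq_Rf)
qed

lemma Hz_scaleR:
  assumes U: "U \<in> elems (Hz T e \<alpha>)"
  shows "c *\<^sub>R U \<in> elems (Hz T e \<alpha>)" "Hz_sq T e \<alpha> (c *\<^sub>R U) = ennreal (c\<^sup>2) * Hz_sq T e \<alpha> U"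
proof -
  let ?m = "int_part \<alpha>"
  have n: "U \<in> sobolev_nat T ?m" "\<And>k. k < ?m \<Longrightarrow> vanishes_at T e (weak_deriv T k U)"
     "weak_deriv T ?m U \<in> Hz_unit T e (\<alpha> - real ?m)" if "\<alpha> \<noteq> 0" "?m \<noteq> 0"
    using U that by (auto simp: elems_Hz Hz_nat_def)
  show "c *\<^sub>R U \<in> elems (Hz T e \<alpha>)"
  proof (cases "\<alpha> \<noteq> 0 \<and> ?m \<noteq> 0")
    case True
    then show ?thesis using n sobolev_nat_scaleR[OF n(1)] Hz_unit_scaleR(1)[OF n(3)] vanishes_at_scaleR
      by (auto simp: elems_Hz Hz_nat_def)
  next
    case False
    then show ?thesis using U L2_scaleR Hz_unit_scaleR(1) by (auto simp: elems_Hz split: if_splits)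
  qed
  show "Hz_sq T e \<alpha> (c *\<^sub>R U) = ennreal (c\<^sup>2) * Hz_sq T e \<alpha> U"
  proof (cases "\<alpha> \<noteq> 0 \<and> ?m \<noteq> 0")
    case True
    then show ?thesis using n sobolev_nat_scaleR(2)[OF n(1), of ?m] Hz_unit_scaleR(2)[OF n(3)]
      by (simp add: Hz_sq_def L2_sq_scaleR distrib_left)
  next
    case False
    then show ?thesis using U Hz_unit_scaleR(2)[of U T e \<alpha>] by (auto simp: elems_Hz Hz_sq_def L2_sq_scaleR split: if_splits)
  qed
qed

lemma Hz_Rf:
  assumes U: "U \<in> elems (Hz T e \<alpha>)"
  shows "Rf T U \<in> elems (Hz T (T - e) \<alpha>)" "Hz_sq T (T - e) \<alpha> (Rf T U) = Hz_sq T e \<alpha> U"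
proof -
  let ?m = "int_part \<alpha>"
  have n: "U \<in> sobolev_nat T ?m" "\<And>k. k < ?m \<Longrightarrow> vanishes_at T e (weak_deriv T k U)"
     "weak_deriv T ?m U \<in> Hz_unit T e (\<alpha> - real ?m)" if "\<alpha> \<noteq> 0" "?m \<noteq> 0"
    using U that by (auto simp: elems_Hz Hz_nat_def)
  have pm: "((-1 :: real) ^ k)\<^sup>2 = 1" for k by (simp add: power2_eq_square power_add[symmetric])
  show "Rf T U \<in> elems (Hz T (T - e) \<alpha>)"
  proof (cases "\<alpha> \<noteq> 0 \<and> ?m \<noteq> 0")
    case True
    have "vanishes_at T (T - e) (weak_deriv T k (Rf T U))" if "k < ?m" for k
      using True that n(2)[of k] sobolev_nat_Rf(2)[OF n(1), of k] sobolev_nat_deriv(1)[OF n(1), of k]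
      by (auto intro!: vanishes_at_scaleR vanishes_at_Rf)
    moreover have "weak_deriv T ?m (Rf T U) \<in> Hz_unit T (T - e) (\<alpha> - real ?m)"
      using True n sobolev_nat_Rf(2)[OF n(1), of ?m] by (auto intro!: Hz_unit_scaleR(1) Hz_unit_Rf(1))
    ultimately show ?thesis using True sobolev_nat_Rf(1)[OF n(1)]
      by (auto simp: elems_Hz Hz_nat_def)
  next
    case False
    then show ?thesis using U Rf_L2 Hz_unit_Rf(1) by (auto simp: elems_Hz split: if_splits)
  qed
  show "Hz_sq T (T - e) \<alpha> (Rf T U) = Hz_sq T e \<alpha> U"
  proof (cases "\<alpha> \<noteq> 0 \<and> ?m \<noteq> 0")
    case True
    then show ?thesis using n sobolev_nat_Rf(2)[OF n(1), of ?m] Hz_unit_Rf[OF n(3)]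
      Hz_unit_scaleR(2)[OF Hz_unit_Rf(1)[OF n(3)], of "(-1) ^ ?m"]
      by (simp add: Hz_sq_def L2_sq_scaleR L2_sq_Rf pm)
  next
    case False
    then show ?thesis using U Hz_unit_Rf(2)[of U T e \<alpha>] by (auto simp: elems_Hz Hz_sq_def L2_sq_Rf split: if_splits)
  qed
qed

lemma J_right_Rf:
  assumes T: "T > 0" and a: "a > 0" and U: "U \<in> L2 T"
  shows "AE t in lborel. fn T (J_right T a U) t = indicator {0<..<T} t * rr a (fn T U) t"
    and "J_right T a U = Rf T (Jl T a (Rf T U))"
proof -
  have eq: "J_right T a U = ae_on T (rr a (fn T U))"
    unfolding J_right_def
  proof (rule ae_on_cong)
    fix t assume t: "t \<in> {0<..<T}"
    have "1 / Gamma a * (LINT \<xi>:{t<..<T}|lborel. (\<xi> - t) powr (a - 1) * rep_ae U \<xi>)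
       = (LINT \<xi>|lborel. 1 / Gamma a * (indicator {t<..<T} \<xi> *\<^sub>R ((\<xi> - t) powr (a - 1) * rep_ae U \<xi>)))"
      unfolding set_lebesgue_integral_def by (rule integral_mult_right_zero[symmetric])
    also have "\<dots> = rr a (fn T U) t"
      unfolding rr_def using t by (intro Bochner_Integration.integral_cong refl) (auto simp: kern_def fn_def indicator_def)
    finally show "1 / Gamma a * (LINT \<xi>:{t<..<T}|lborel. (\<xi> - t) powr (a - 1) * rep_ae U \<xi>) = rr a (fn T U) t" .
  qed
  have m: "rr a (fn T U) \<in> borel_measurable borel" unfolding rr_def by measurable
  show "AE t in lborel. fn T (J_right T a U) t = indicator {0<..<T} t * rr a (fn T U) t"
    unfolding eq by (rule fn_ae_on_AE) (use m in simp)
  have r: "rr a (fn T U) t = rl a (fn T (Rf T U)) (T - t)" for t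
    unfolding rr_reflect[of a "fn T U" t T] by (rule rl_cong_AE) (use AE_symmetric[OF fn_Rf_AE[of T U]] in auto)
  show "J_right T a U = Rf T (Jl T a (Rf T U))"
    unfolding eq Rf_def[of T "Jl T a (Rf T U)"]
  proof (rule ae_on_cong_AE)
    show "AE t in lborel. t \<in> {0<..<T} \<longrightarrow> rr a (fn T U) t = fn T (Jl T a (Rf T U)) (T - t)"
      using AE_lborel_reflect[OF fn_Jl_AE[of T a "Rf T U"], of T] by eventually_elim (auto simp: r)
  qed (use m in auto)
qed

section \<open>Isomorphisms and their duals\<close>

text \<open>
  The properties of a norm on which duality relies: closure under the linear operations makes
  the defining supremum nonempty, and homogeneity extends the bound on the unit ball to the
  whole space.
\<close>

definition linear_nspace :: "'a::real_vector nspace \<Rightarrow> bool" where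
  "linear_nspace X \<longleftrightarrow> elems X \<noteq> {} \<and>
     (\<forall>x\<in>elems X. \<forall>y\<in>elems X. x + y \<in> elems X) \<and>
     (\<forall>c. \<forall>x\<in>elems X. c *\<^sub>R x \<in> elems X \<and> nrm X (c *\<^sub>R x) = \<bar>c\<bar> * nrm X x) \<and>
     (\<forall>x\<in>elems X. nrm X x \<ge> 0)"

lemma linear_nspace_zero:
  assumes "linear_nspace X"
  shows "0 \<in> elems X" "nrm X 0 = 0"
proof -
  obtain x where x: "x \<in> elems X" using assms by (auto simp: linear_nspace_def)
  then have "0 *\<^sub>R x \<in> elems X \<and> nrm X (0 *\<^sub>R x) = \<bar>0\<bar> * nrm X x" using assms unfolding linear_nspace_def by blast
  then show "0 \<in> elems X" "nrm X 0 = 0" by auto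
qed

lemma is_isomorphismI:
  assumes bij: "bij_betw D (elems X) (elems Y)"
    and add: "\<And>x y. x \<in> elems X \<Longrightarrow> y \<in> elems X \<Longrightarrow> x + y \<in> elems X \<and> D (x + y) = D x + D y"
    and scale: "\<And>c x. x \<in> elems X \<Longrightarrow> c *\<^sub>R x \<in> elems X \<and> D (c *\<^sub>R x) = c *\<^sub>R D x"
    and up: "\<And>x. x \<in> elems X \<Longrightarrow> nrm Y (D x) \<le> C * nrm X x"
    and lo: "\<And>x. x \<in> elems X \<Longrightarrow> nrm X x \<le> C' * nrm Y (D x)"
  shows "is_isomorphism X Y D" "is_isomorphism Y X (the_inv_into (elems X) D)"
proof -
  let ?I = "the_inv_into (elems X) D"
  have inj: "inj_on D (elems X)" using bij by (simp add: bij_betw_def)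
  have I: "?I (D x) = x" if "x \<in> elems X" for x by (rule the_inv_into_f_f[OF inj that])
  have surj: "\<exists>x\<in>elems X. y = D x" if "y \<in> elems Y" for y using that bij by (auto simp: bij_betw_def)
  have D_in: "D x \<in> elems Y" if "x \<in> elems X" for x using that bij by (auto simp: bij_betw_def)
  have bD: "bounded_linear_map X Y D" unfolding bounded_linear_map_def using D_in add scale up by blast
  have bI: "bounded_linear_map Y X ?I" unfolding bounded_linear_map_def
  proof (intro conjI ballI allI exI[of _ C'])
    fix y assume y: "y \<in> elems Y"
    then obtain x where x: "x \<in> elems X" "y = D x" using surj by blast
    show "?I y \<in> elems X" using x I by simp
    show "nrm X (?I y) \<le> C' * nrm Y y" using x I lo by simp
    fix c show "?I (c *\<^sub>R y) = c *\<^sub>R ?I y"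
    proof -
      have "c *\<^sub>R y = D (c *\<^sub>R x)" using x scale by simp
      then have "?I (c *\<^sub>R y) = c *\<^sub>R x" using I[OF scale[OF x(1), THEN conjunct1]] by (simp only:)
      then show ?thesis using I[OF x(1)] x(2) by (simp only:)
    qed
  next
    fix y z assume "y \<in> elems Y" "z \<in> elems Y"
    then obtain x w where x: "x \<in> elems X" "y = D x" and w: "w \<in> elems X" "z = D w" using surj by meson
    have "y + z = D (x + w)" using x w add by simp
    then have "?I (y + z) = x + w" using I[OF add[OF x(1) w(1), THEN conjunct1]] by (simp only:)
    then show "?I (y + z) = ?I y + ?I z" using I[OF x(1)] I[OF w(1)] x(2) w(2) by (simp only:)
  qed
  have bijI: "bij_betw ?I (elems Y) (elems X)" by (rule bij_betw_the_inv_into[OF bij])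
  show "is_isomorphism X Y D" unfolding is_isomorphism_def using bij bD bI by blast
  have II: "the_inv_into (elems Y) ?I x = D x" if "x \<in> elems X" for x
  proof -
    have "the_inv_into (elems Y) ?I (?I (D x)) = D x"
      using bijI D_in[OF that] by (intro the_inv_into_f_f) (auto simp: bij_betw_def)
    then show ?thesis using I[OF that] by simp
  qed
  have "bounded_linear_map X Y (the_inv_into (elems Y) ?I)"
    using bD add scale unfolding bounded_linear_map_def by (simp add: II)
  then show "is_isomorphism Y X ?I" unfolding is_isomorphism_def using bijI bI by blast
qed

lemma dual_elemD:
  assumes "F \<in> elems (dual X)"
  shows "x \<in> elems X \<Longrightarrow> y \<in> elems X \<Longrightarrow> F (x + y) = F x + F y" "x \<in> elems X \<Longrightarrow> F (c *\<^sub>R x) = c * F x"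
    "\<exists>C. \<forall>x\<in>elems X. \<bar>F x\<bar> \<le> C * nrm X x" "x \<notin> elems X \<Longrightarrow> F x = 0"
  using assms unfolding dual_def by auto

lemma dual_elemI:
  assumes "\<And>x y. x \<in> elems X \<Longrightarrow> y \<in> elems X \<Longrightarrow> F (x + y) = F x + F y" "\<And>c x. x \<in> elems X \<Longrightarrow> F (c *\<^sub>R x) = c * F x"
    "\<And>x. x \<in> elems X \<Longrightarrow> \<bar>F x\<bar> \<le> C * nrm X x" "\<And>x. x \<notin> elems X \<Longrightarrow> F x = 0"
  shows "F \<in> elems (dual X)"
  using assms unfolding dual_def by (auto intro!: exI[of _ C])

lemma dual_nrm_bound:
  assumes X: "linear_nspace X" and F: "F \<in> elems (dual X)" and x: "x \<in> elems X"
  shows "\<bar>F x\<bar> \<le> nrm (dual X) F * nrm X x"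
proof -
  obtain C where C: "\<And>x. x \<in> elems X \<Longrightarrow> \<bar>F x\<bar> \<le> C * nrm X x" using dual_elemD(3)[OF F] by blast
  have n0: "nrm X y \<ge> 0" if "y \<in> elems X" for y using X that by (auto simp: linear_nspace_def)
  let ?S = "{\<bar>F x\<bar> |x. x \<in> elems X \<and> nrm X x \<le> 1}"
  have "\<bar>F y\<bar> \<le> \<bar>C\<bar>" if "y \<in> elems X" "nrm X y \<le> 1" for y
  proof -
    have "C * nrm X y \<le> \<bar>C\<bar> * nrm X y" using n0[OF that(1)] by (intro mult_right_mono) auto
    also have "\<dots> \<le> \<bar>C\<bar> * 1" using that by (intro mult_left_mono) auto
    finally show ?thesis using C[OF that(1)] by simp
  qed
  then have bdd: "bdd_above ?S" by (auto simp: bdd_above_def)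
  \<comment> \<open>A vector of norm zero cannot be normalised, but a bounded functional vanishes on it.\<close>
  show ?thesis
  proof (cases "nrm X x = 0")
    case True
    then show ?thesis using C[OF x] by simp
  next
    case False
    then have p: "nrm X x > 0" using n0[OF x] by simp
    let ?y = "(1 / nrm X x) *\<^sub>R x"
    have y: "?y \<in> elems X" "nrm X ?y = \<bar>1 / nrm X x\<bar> * nrm X x"
      using X x unfolding linear_nspace_def by blast+
    then have "nrm X ?y \<le> 1" using p by simp
    then have "\<bar>F ?y\<bar> \<le> Sup ?S" using y by (intro cSup_upper bdd) blast
    also have "Sup ?S = nrm (dual X) F" by (simp add: dual_def)
    finally show ?thesis using p dual_elemD(2)[OF F x, of "1 / nrm X x"] by (simp add: abs_mult field_simps)
  qed
qed

lemma dual_nrm_le: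
  assumes X: "linear_nspace X" and K: "K \<ge> 0" and b: "\<And>x. x \<in> elems X \<Longrightarrow> \<bar>F x\<bar> \<le> K * nrm X x"
  shows "nrm (dual X) F \<le> K"
proof -
  have "Sup {\<bar>F x\<bar> |x. x \<in> elems X \<and> nrm X x \<le> 1} \<le> K"
  proof (rule cSup_least)
    show "{\<bar>F x\<bar> |x. x \<in> elems X \<and> nrm X x \<le> 1} \<noteq> {}" using linear_nspace_zero[OF X] by force
    fix r assume "r \<in> {\<bar>F x\<bar> |x. x \<in> elems X \<and> nrm X x \<le> 1}"
    then obtain x where x: "r = \<bar>F x\<bar>" "x \<in> elems X" "nrm X x \<le> 1" by blast
    have "\<bar>F x\<bar> \<le> K * nrm X x" by (rule b[OF x(2)])
    also have "\<dots> \<le> K * 1" using x K by (intro mult_left_mono) auto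
    finally show "r \<le> K" using x by simp
  qed
  then show ?thesis by (simp add: dual_def)
qed

lemma dual_nrm_nonneg: "linear_nspace X \<Longrightarrow> F \<in> elems (dual X) \<Longrightarrow> nrm (dual X) F \<ge> 0"
proof -
  assume X: "linear_nspace X" and F: "F \<in> elems (dual X)"
  obtain C where C: "\<And>x. x \<in> elems X \<Longrightarrow> \<bar>F x\<bar> \<le> C * nrm X x" using dual_elemD(3)[OF F] by blast
  have n0: "nrm X y \<ge> 0" if "y \<in> elems X" for y using X that by (auto simp: linear_nspace_def)
  let ?S = "{\<bar>F x\<bar> |x. x \<in> elems X \<and> nrm X x \<le> 1}"
  have "\<bar>F y\<bar> \<le> \<bar>C\<bar>" if "y \<in> elems X" "nrm X y \<le> 1" for y
  proof -
    have "C * nrm X y \<le> \<bar>C\<bar> * nrm X y" using n0[OF that(1)] by (intro mult_right_mono) auto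
    also have "\<dots> \<le> \<bar>C\<bar> * 1" using that by (intro mult_left_mono) auto
    finally show ?thesis using C[OF that(1)] by simp
  qed
  then have bdd: "bdd_above ?S" by (auto simp: bdd_above_def)
  have "\<bar>F 0\<bar> \<le> Sup ?S" using linear_nspace_zero[OF X] by (intro cSup_upper bdd) force
  then show ?thesis by (simp add: dual_def)
qed

text \<open>
  The transpose of a bijection $J$ with two-sided bounds: its inverse is composition with
  $J^{-1}$, and the two bounds exchange their roles. The map is cut off outside \<open>elems Y\<close> to
  respect the convention that functionals vanish outside their space.
\<close>

lemma dual_isomorphism:
  assumes X: "linear_nspace X" and Y: "linear_nspace Y" and bij: "bij_betw J (elems Y) (elems X)"
    and add: "\<And>x y. x \<in> elems Y \<Longrightarrow> y \<in> elems Y \<Longrightarrow> J (x + y) = J x + J y"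
    and scale: "\<And>c x. x \<in> elems Y \<Longrightarrow> J (c *\<^sub>R x) = c *\<^sub>R J x"
    and up: "C \<ge> 0" "\<And>x. x \<in> elems Y \<Longrightarrow> nrm X (J x) \<le> C * nrm Y x"
    and lo: "C' \<ge> 0" "\<And>x. x \<in> elems Y \<Longrightarrow> nrm Y x \<le> C' * nrm X (J x)"
  defines "D \<equiv> \<lambda>F \<phi>. if \<phi> \<in> elems Y then F (J \<phi>) else (0::real)"
  shows "is_isomorphism (dual X) (dual Y) D"
    "is_isomorphism (dual Y) (dual X) (the_inv_into (elems (dual X)) D)"
    "inj_on D (elems (dual X))"
proof -
  have J_in: "J y \<in> elems X" if "y \<in> elems Y" for y using that bij by (auto simp: bij_betw_def)
  have surj: "\<exists>y\<in>elems Y. x = J y" if "x \<in> elems X" for x using that bij by (auto simp: bij_betw_def)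
  have Y_cl: "x + y \<in> elems Y" "c *\<^sub>R x \<in> elems Y" if "x \<in> elems Y" "y \<in> elems Y" for x y c
    using Y that by (auto simp: linear_nspace_def)
  have X_cl: "x + y \<in> elems X" "c *\<^sub>R x \<in> elems X" if "x \<in> elems X" "y \<in> elems X" for x y c
    using X that by (auto simp: linear_nspace_def)
  have nX: "nrm X x \<ge> 0" if "x \<in> elems X" for x using X that by (auto simp: linear_nspace_def)
  have DF: "\<bar>D F y\<bar> \<le> nrm (dual X) F * C * nrm Y y" if F: "F \<in> elems (dual X)" and y: "y \<in> elems Y" for F y
  proof -
    have "\<bar>D F y\<bar> \<le> nrm (dual X) F * nrm X (J y)" using y dual_nrm_bound[OF X F J_in[OF y]] by (simp add: D_def)
    also have "\<dots> \<le> nrm (dual X) F * (C * nrm Y y)" by (intro mult_left_mono up y dual_nrm_nonneg[OF X F])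
    finally show ?thesis by (simp add: mult.assoc)
  qed
  have D_in: "D F \<in> elems (dual Y)" if F: "F \<in> elems (dual X)" for F
  proof (rule dual_elemI[where C="nrm (dual X) F * C"])
    show "D F (x + y) = D F x + D F y" if "x \<in> elems Y" "y \<in> elems Y" for x y
      using that Y_cl add J_in dual_elemD(1)[OF F] by (simp add: D_def)
    show "D F (c *\<^sub>R x) = c * D F x" if "x \<in> elems Y" for c x
      using that Y_cl scale J_in dual_elemD(2)[OF F] by (simp add: D_def)
    show "\<bar>D F x\<bar> \<le> nrm (dual X) F * C * nrm Y x" if "x \<in> elems Y" for x by (rule DF[OF F that])
  qed (simp add: D_def)
  show inj: "inj_on D (elems (dual X))"
  proof (rule inj_onI)
    fix F G assume F: "F \<in> elems (dual X)" and G: "G \<in> elems (dual X)" and eq: "D F = D G"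
    show "F = G"
    proof
      fix x show "F x = G x"
      proof (cases "x \<in> elems X")
        case True
        then obtain y where y: "y \<in> elems Y" "x = J y" using surj by blast
        then show ?thesis using fun_cong[OF eq, of y] by (simp add: D_def)
      next
        case False
        then show ?thesis using dual_elemD(4)[OF F False] dual_elemD(4)[OF G False] by simp
      qed
    qed
  qed
  have bijD: "bij_betw D (elems (dual X)) (elems (dual Y))"
    unfolding bij_betw_def
  proof (intro conjI inj equalityI subsetI)
    fix G assume "G \<in> D ` elems (dual X)"
    then show "G \<in> elems (dual Y)" using D_in by auto
  next
    fix G assume G: "G \<in> elems (dual Y)"
    let ?I = "the_inv_into (elems Y) J"
    define F where "F x = (if x \<in> elems X then G (?I x) else 0)" for x
    have I: "?I (J y) = y" if "y \<in> elems Y" for y using bij that by (intro the_inv_into_f_f) (auto simp: bij_betw_def)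
    have FJ: "F (J y) = G y" if "y \<in> elems Y" for y using that J_in I by (simp add: F_def)
    have "F \<in> elems (dual X)"
    proof (rule dual_elemI[where C="nrm (dual Y) G * C'"])
      fix x z assume "x \<in> elems X" "z \<in> elems X"
      then obtain y w where y: "y \<in> elems Y" "x = J y" and w: "w \<in> elems Y" "z = J w" using surj by meson
      have "F (x + z) = F (J (y + w))" using y w add by simp
      also have "\<dots> = G (y + w)" by (rule FJ[OF Y_cl(1)[OF y(1) w(1)]])
      finally show "F (x + z) = F x + F z" using y w FJ dual_elemD(1)[OF G] by simp
    next
      fix c x assume "x \<in> elems X"
      then obtain y where y: "y \<in> elems Y" "x = J y" using surj by blast
      have "F (c *\<^sub>R x) = F (J (c *\<^sub>R y))" using y scale by simp
      also have "\<dots> = G (c *\<^sub>R y)" by (rule FJ[OF Y_cl(2)[OF y(1) y(1)]])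
      finally show "F (c *\<^sub>R x) = c * F x" using y FJ dual_elemD(2)[OF G] by simp
    next
      fix x assume "x \<in> elems X"
      then obtain y where y: "y \<in> elems Y" "x = J y" using surj by blast
      have "\<bar>F x\<bar> \<le> nrm (dual Y) G * nrm Y y" using y FJ dual_nrm_bound[OF Y G y(1)] by simp
      also have "\<dots> \<le> nrm (dual Y) G * (C' * nrm X x)" unfolding y(2) by (intro mult_left_mono lo y dual_nrm_nonneg[OF Y G])
      finally show "\<bar>F x\<bar> \<le> nrm (dual Y) G * C' * nrm X x" by (simp add: mult.assoc)
    qed (simp add: F_def)
    moreover have "D F = G" using FJ dual_elemD(4)[OF G] by (auto simp: D_def)
    ultimately show "G \<in> D ` elems (dual X)" by blast
  qed
  have up': "nrm (dual Y) (D F) \<le> C * nrm (dual X) F" if F: "F \<in> elems (dual X)" for F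
  proof (rule dual_nrm_le[OF Y])
    show "0 \<le> C * nrm (dual X) F" using up(1) dual_nrm_nonneg[OF X F] by simp
    show "\<bar>D F x\<bar> \<le> C * nrm (dual X) F * nrm Y x" if "x \<in> elems Y" for x
      using DF[OF F that] by (simp add: mult_ac)
  qed
  have lo': "nrm (dual X) F \<le> C' * nrm (dual Y) (D F)" if F: "F \<in> elems (dual X)" for F
  proof (rule dual_nrm_le[OF X])
    show "0 \<le> C' * nrm (dual Y) (D F)" using lo(1) dual_nrm_nonneg[OF Y D_in[OF F]] by simp
    fix x assume "x \<in> elems X"
    then obtain y where y: "y \<in> elems Y" "x = J y" using surj by blast
    have "\<bar>F x\<bar> \<le> nrm (dual Y) (D F) * nrm Y y"
      using dual_nrm_bound[OF Y D_in[OF F] y(1)] y by (simp add: D_def)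
    also have "\<dots> \<le> nrm (dual Y) (D F) * (C' * nrm X x)" unfolding y(2)
      by (intro mult_left_mono lo y dual_nrm_nonneg[OF Y D_in[OF F]])
    finally show "\<bar>F x\<bar> \<le> C' * nrm (dual Y) (D F) * nrm X x" by (simp add: mult_ac)
  qed
  have add': "F + G \<in> elems (dual X) \<and> D (F + G) = D F + D G" if F: "F \<in> elems (dual X)" and G: "G \<in> elems (dual X)" for F G
  proof
    obtain C1 where C1: "\<forall>x\<in>elems X. \<bar>F x\<bar> \<le> C1 * nrm X x" using dual_elemD(3)[OF F] by blast
    obtain C2 where C2: "\<forall>x\<in>elems X. \<bar>G x\<bar> \<le> C2 * nrm X x" using dual_elemD(3)[OF G] by blast
    show "F + G \<in> elems (dual X)"
    proof (rule dual_elemI[where C="C1 + C2"])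
      show "\<bar>(F + G) x\<bar> \<le> (C1 + C2) * nrm X x" if "x \<in> elems X" for x
        using C1[rule_format, OF that] C2[rule_format, OF that] by (simp add: distrib_right)
    qed (use dual_elemD[OF F] dual_elemD[OF G] in \<open>simp_all add: distrib_left\<close>)
    show "D (F + G) = D F + D G" by (auto simp: D_def)
  qed
  have scale': "c *\<^sub>R F \<in> elems (dual X) \<and> D (c *\<^sub>R F) = c *\<^sub>R D F" if F: "F \<in> elems (dual X)" for c F
  proof
    obtain C1 where C1: "\<forall>x\<in>elems X. \<bar>F x\<bar> \<le> C1 * nrm X x" using dual_elemD(3)[OF F] by blast
    show "c *\<^sub>R F \<in> elems (dual X)"
    proof (rule dual_elemI[where C="\<bar>c\<bar> * C1"])
      show "\<bar>(c *\<^sub>R F) x\<bar> \<le> \<bar>c\<bar> * C1 * nrm X x" if "x \<in> elems X" for x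
        using mult_left_mono[OF C1[rule_format, OF that], of "\<bar>c\<bar>"] by (simp add: scaleR_fun_def abs_mult mult.assoc)
    qed (use dual_elemD[OF F] in \<open>simp_all add: scaleR_fun_def distrib_left\<close>)
    show "D (c *\<^sub>R F) = c *\<^sub>R D F" by (auto simp: D_def scaleR_fun_def)
  qed
  note iso = is_isomorphismI[OF bijD add' scale' up' lo']
  show "is_isomorphism (dual X) (dual Y) D" by (rule iso(1))
  show "is_isomorphism (dual Y) (dual X) (the_inv_into (elems (dual X)) D)" by (rule iso(2))
qed

section \<open>The fractional integrals between the scales\<close>

lemma Jz_plus: "\<alpha> \<ge> 0 \<Longrightarrow> U \<in> L2 T \<Longrightarrow> V \<in> L2 T \<Longrightarrow> Jz T \<alpha> (U + V) = Jz T \<alpha> U + Jz T \<alpha> V"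
  by (auto simp: Jz_def intro: Jl_plus)

lemma left_elem_iff:
  assumes "T > 0" "\<alpha> \<ge> 0"
  shows "U \<in> elems (H_left T \<alpha>) \<longleftrightarrow> (\<exists>V\<in>L2 T. U = Jz T \<alpha> V)"
  using Jz_into_Hz[OF assms] Hz_preimage[OF assms] by blast

lemma nrm_Hz_scaleR:
  assumes "U \<in> elems (Hz T e \<alpha>)"
  shows "nrm (Hz T e \<alpha>) (c *\<^sub>R U) = \<bar>c\<bar> * nrm (Hz T e \<alpha>) U"
  unfolding nrm_Hz Hz_scaleR(2)[OF assms] by (simp add: enn2real_mult real_sqrt_mult)

lemma linear_nspace_left:
  assumes T: "T > 0" and a: "\<alpha> \<ge> 0"
  shows "linear_nspace (H_left T \<alpha>)"
  unfolding linear_nspace_def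
proof (intro conjI ballI allI)
  show "elems (H_left T \<alpha>) \<noteq> {}" using left_elem_iff[OF T a] L2_zero by blast
  show "x + y \<in> elems (H_left T \<alpha>)" if xy: "x \<in> elems (H_left T \<alpha>)" "y \<in> elems (H_left T \<alpha>)" for x y
  proof -
    obtain U V where "U \<in> L2 T" "x = Jz T \<alpha> U" "V \<in> L2 T" "y = Jz T \<alpha> V"
      using xy left_elem_iff[OF T a] by blast
    then show ?thesis using left_elem_iff[OF T a] Jz_plus[OF a] L2_plus by metis
  qed
qed (use nrm_Hz_scaleR Hz_scaleR(1) in \<open>auto simp: nrm_Hz\<close>)

lemma sqrt_enn2real_mono:
  assumes "x \<le> ennreal C * y" "C \<ge> 0" "y < \<infinity>"
  shows "sqrt (enn2real x) \<le> sqrt C * sqrt (enn2real y)"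
proof -
  have "enn2real x \<le> enn2real (ennreal C * y)" using assms by (intro enn2real_mono) (auto simp: ennreal_mult_less_top)
  also have "\<dots> = C * enn2real y" using assms by (simp add: enn2real_mult)
  finally show ?thesis by (simp add: real_sqrt_mult[symmetric])
qed

text \<open>
  $J^\alpha J^\beta = J^{\alpha+\beta}$, and both $J^\beta$ and $J^{\alpha+\beta}$ are
  isomorphisms from $L^2(0,T)$ onto their ranges $H_\beta$ and $H_{\alpha+\beta}$.
\<close>

theorem Jl_left_isomorphism:
  assumes T: "T > 0" and a: "\<alpha> > 0" and b: "\<beta> \<ge> 0"
  shows "bij_betw (Jl T \<alpha>) (elems (H_left T \<beta>)) (elems (H_left T (\<alpha> + \<beta>)))"
    "\<exists>C\<ge>0. \<forall>U\<in>elems (H_left T \<beta>). nrm (H_left T (\<alpha> + \<beta>)) (Jl T \<alpha> U) \<le> C * nrm (H_left T \<beta>) U"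
    "\<exists>C\<ge>0. \<forall>U\<in>elems (H_left T \<beta>). nrm (H_left T \<beta>) U \<le> C * nrm (H_left T (\<alpha> + \<beta>)) (Jl T \<alpha> U)"
proof -
  have ab: "\<alpha> + \<beta> \<ge> 0" using a b by simp
  obtain A1 where A1: "A1 \<ge> 0" "\<And>V. V \<in> L2 T \<Longrightarrow> Jz T \<beta> V \<in> elems (H_left T \<beta>)" "\<And>V. V \<in> L2 T \<Longrightarrow> Hz_sq T 0 \<beta> (Jz T \<beta> V) \<le> ennreal A1 * L2_sq T V"
    using Jz_into_Hz[OF T b] by blast
  obtain A2 where A2: "A2 \<ge> 0" "\<And>V. V \<in> L2 T \<Longrightarrow> Jz T (\<alpha> + \<beta>) V \<in> elems (H_left T (\<alpha> + \<beta>))" "\<And>V. V \<in> L2 T \<Longrightarrow> Hz_sq T 0 (\<alpha> + \<beta>) (Jz T (\<alpha> + \<beta>) V) \<le> ennreal A2 * L2_sq T V"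
    using Jz_into_Hz[OF T ab] by blast
  obtain B1 where B1: "B1 \<ge> 0" "\<And>U. U \<in> elems (H_left T \<beta>) \<Longrightarrow> \<exists>V\<in>L2 T. U = Jz T \<beta> V \<and> L2_sq T V \<le> ennreal B1 * Hz_sq T 0 \<beta> U"
    using Hz_preimage[OF T b] by blast
  obtain B2 where B2: "B2 \<ge> 0" "\<And>U. U \<in> elems (H_left T (\<alpha> + \<beta>)) \<Longrightarrow> \<exists>V\<in>L2 T. U = Jz T (\<alpha> + \<beta>) V \<and> L2_sq T V \<le> ennreal B2 * Hz_sq T 0 (\<alpha> + \<beta>) U"
    using Hz_preimage[OF T ab] by blast
  have comp: "Jl T \<alpha> (Jz T \<beta> V) = Jz T (\<alpha> + \<beta>) V" if "V \<in> L2 T" for V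
    using Jl_semigroup[OF a _ that, of \<beta>] a b that by (auto simp: Jz_def)
  have inj: "V = V'" if "V \<in> L2 T" "V' \<in> L2 T" "Jz T (\<alpha> + \<beta>) V = Jz T (\<alpha> + \<beta>) V'" for V V'
    using Jl_inj[OF T _ that(1,2), of "\<alpha> + \<beta>"] that(3) a b by (simp add: Jz_def split: if_splits)
  show "bij_betw (Jl T \<alpha>) (elems (H_left T \<beta>)) (elems (H_left T (\<alpha> + \<beta>)))"
    unfolding bij_betw_def
  proof (intro conjI equalityI subsetI)
    show "inj_on (Jl T \<alpha>) (elems (H_left T \<beta>))"
      by (rule inj_onI) (rule Jl_inj[OF T a], auto dest: Hz_subset_L2)
  next
    fix U assume "U \<in> Jl T \<alpha> ` elems (H_left T \<beta>)"
    then obtain W where W: "W \<in> elems (H_left T \<beta>)" "U = Jl T \<alpha> W" by blast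
    obtain V where "V \<in> L2 T" "W = Jz T \<beta> V" using B1(2)[OF W(1)] by blast
    then show "U \<in> elems (H_left T (\<alpha> + \<beta>))" using W comp A2(2) by simp
  next
    fix U assume U: "U \<in> elems (H_left T (\<alpha> + \<beta>))"
    obtain V where "V \<in> L2 T" "U = Jz T (\<alpha> + \<beta>) V" using B2(2)[OF U] by blast
    then show "U \<in> Jl T \<alpha> ` elems (H_left T \<beta>)" using comp A1(2) by (metis imageI)
  qed
  show "\<exists>C\<ge>0. \<forall>U\<in>elems (H_left T \<beta>). nrm (H_left T (\<alpha> + \<beta>)) (Jl T \<alpha> U) \<le> C * nrm (H_left T \<beta>) U"
  proof (intro exI[of _ "sqrt (A2 * B1)"] conjI ballI)
    fix U assume U: "U \<in> elems (H_left T \<beta>)"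
    obtain V where V: "V \<in> L2 T" "U = Jz T \<beta> V" "L2_sq T V \<le> ennreal B1 * Hz_sq T 0 \<beta> U" using B1(2)[OF U] by blast
    have "Hz_sq T 0 (\<alpha> + \<beta>) (Jl T \<alpha> U) \<le> ennreal A2 * L2_sq T V" using comp[OF V(1)] A2(3)[OF V(1)] V(2) by simp
    also have "\<dots> \<le> ennreal A2 * (ennreal B1 * Hz_sq T 0 \<beta> U)" by (intro mult_left_mono V) simp
    also have "\<dots> = ennreal (A2 * B1) * Hz_sq T 0 \<beta> U" using A2(1) B1(1) by (simp add: ennreal_mult mult.assoc)
    finally show "nrm (H_left T (\<alpha> + \<beta>)) (Jl T \<alpha> U) \<le> sqrt (A2 * B1) * nrm (H_left T \<beta>) U"
      unfolding nrm_Hz by (rule sqrt_enn2real_mono) (use A2(1) B1(1) Hz_sq_finite[OF U] in auto)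
  qed (use A2(1) B1(1) in simp)
  show "\<exists>C\<ge>0. \<forall>U\<in>elems (H_left T \<beta>). nrm (H_left T \<beta>) U \<le> C * nrm (H_left T (\<alpha> + \<beta>)) (Jl T \<alpha> U)"
  proof (intro exI[of _ "sqrt (A1 * B2)"] conjI ballI)
    fix U assume U: "U \<in> elems (H_left T \<beta>)"
    obtain W where W: "W \<in> L2 T" "U = Jz T \<beta> W" using B1(2)[OF U] by blast
    have JU: "Jl T \<alpha> U \<in> elems (H_left T (\<alpha> + \<beta>))" using W comp A2(2) by simp
    obtain V where V: "V \<in> L2 T" "Jl T \<alpha> U = Jz T (\<alpha> + \<beta>) V" "L2_sq T V \<le> ennreal B2 * Hz_sq T 0 (\<alpha> + \<beta>) (Jl T \<alpha> U)"
      using B2(2)[OF JU] by blast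
    have "Jz T (\<alpha> + \<beta>) W = Jz T (\<alpha> + \<beta>) V" using V(2) comp[OF W(1)] W(2) by simp
    then have "W = V" by (rule inj[OF W(1) V(1)])
    then have "Hz_sq T 0 \<beta> U \<le> ennreal A1 * L2_sq T V" using A1(3)[OF W(1)] W(2) by simp
    also have "\<dots> \<le> ennreal A1 * (ennreal B2 * Hz_sq T 0 (\<alpha> + \<beta>) (Jl T \<alpha> U))" by (intro mult_left_mono V) simp
    also have "\<dots> = ennreal (A1 * B2) * Hz_sq T 0 (\<alpha> + \<beta>) (Jl T \<alpha> U)" using A1(1) B2(1) by (simp add: ennreal_mult mult.assoc)
    finally show "nrm (H_left T \<beta>) U \<le> sqrt (A1 * B2) * nrm (H_left T (\<alpha> + \<beta>)) (Jl T \<alpha> U)"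
      unfolding nrm_Hz by (rule sqrt_enn2real_mono) (use A1(1) B2(1) Hz_sq_finite[OF JU] in auto)
  qed (use A1(1) B2(1) in simp)
qed

lemma Rf_bij: "bij_betw (Rf T) (elems (H_left T \<alpha>)) (elems (H_right T \<alpha>))"
proof (rule bij_betw_byWitness[where f'="Rf T"])
  show "Rf T ` elems (H_left T \<alpha>) \<subseteq> elems (H_right T \<alpha>)" using Hz_Rf(1)[of _ T 0 \<alpha>] by auto
  show "Rf T ` elems (H_right T \<alpha>) \<subseteq> elems (H_left T \<alpha>)" using Hz_Rf(1)[of _ T T \<alpha>] by auto
qed (auto simp: Rf_Rf dest!: Hz_subset_L2)

lemma nrm_Rf: "U \<in> elems (H_left T \<alpha>) \<Longrightarrow> nrm (H_right T \<alpha>) (Rf T U) = nrm (H_left T \<alpha>) U"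
  "U \<in> elems (H_right T \<alpha>) \<Longrightarrow> nrm (H_left T \<alpha>) (Rf T U) = nrm (H_right T \<alpha>) U"
  using Hz_Rf(2)[of U T 0 \<alpha>] Hz_Rf(2)[of U T T \<alpha>] by (auto simp: nrm_Hz)

lemma Rf_right_left: "U \<in> elems (H_right T \<alpha>) \<Longrightarrow> Rf T U \<in> elems (H_left T \<alpha>)"
  using Hz_Rf(1)[of U T T \<alpha>] by auto

lemma Rf_left_right: "U \<in> elems (H_left T \<alpha>) \<Longrightarrow> Rf T U \<in> elems (H_right T \<alpha>)"
  using Hz_Rf(1)[of U T 0 \<alpha>] by auto

lemma linear_nspace_right:
  assumes T: "T > 0" and a: "\<alpha> \<ge> 0"
  shows "linear_nspace (H_right T \<alpha>)"
proof -
  note L = linear_nspace_left[OF T a, unfolded linear_nspace_def]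
  show ?thesis unfolding linear_nspace_def
  proof (intro conjI ballI allI)
    show "elems (H_right T \<alpha>) \<noteq> {}" using L Rf_left_right by blast
    show "x + y \<in> elems (H_right T \<alpha>)" if xy: "x \<in> elems (H_right T \<alpha>)" "y \<in> elems (H_right T \<alpha>)" for x y
    proof -
      note xL = Hz_subset_L2[OF xy(1)] and yL = Hz_subset_L2[OF xy(2)]
      have "Rf T x + Rf T y \<in> elems (H_left T \<alpha>)" using L Rf_right_left xy by blast
      then have "Rf T (Rf T x + Rf T y) \<in> elems (H_right T \<alpha>)" by (rule Rf_left_right)
      then show ?thesis using Rf_plus[OF Rf_L2[OF xL] Rf_L2[OF yL]] Rf_Rf[OF xL] Rf_Rf[OF yL] by simp
    qed
  qed (use nrm_Hz_scaleR Hz_scaleR(1) in \<open>auto simp: nrm_Hz\<close>)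
qed

theorem J_right_isomorphism:
  assumes T: "T > 0" and a: "\<alpha> > 0" and b: "\<beta> \<ge> 0"
  shows "bij_betw (J_right T \<alpha>) (elems (H_right T \<beta>)) (elems (H_right T (\<alpha> + \<beta>)))"
    "\<exists>C\<ge>0. \<forall>U\<in>elems (H_right T \<beta>). nrm (H_right T (\<alpha> + \<beta>)) (J_right T \<alpha> U) \<le> C * nrm (H_right T \<beta>) U"
    "\<exists>C\<ge>0. \<forall>U\<in>elems (H_right T \<beta>). nrm (H_right T \<beta>) U \<le> C * nrm (H_right T (\<alpha> + \<beta>)) (J_right T \<alpha> U)"
proof -
  note left = Jl_left_isomorphism[OF T a b]
  have J: "J_right T \<alpha> U = Rf T (Jl T \<alpha> (Rf T U))" if "U \<in> elems (H_right T \<beta>)" for U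
    by (rule J_right_Rf(2)[OF T a Hz_subset_L2[OF that]])
  have bR: "bij_betw (Rf T) (elems (H_right T \<beta>)) (elems (H_left T \<beta>))"
    by (rule bij_betw_byWitness[where f'="Rf T"]) (auto simp: Rf_Rf intro: Rf_right_left Rf_left_right dest: Hz_subset_L2)
  have "bij_betw (Rf T \<circ> (Jl T \<alpha> \<circ> Rf T)) (elems (H_right T \<beta>)) (elems (H_right T (\<alpha> + \<beta>)))"
    by (rule bij_betw_trans[OF bij_betw_trans[OF bR left(1)] Rf_bij])
  then show "bij_betw (J_right T \<alpha>) (elems (H_right T \<beta>)) (elems (H_right T (\<alpha> + \<beta>)))"
    by (rule bij_betw_cong[THEN iffD1, rotated]) (simp add: J)
  have JL: "Jl T \<alpha> (Rf T U) \<in> elems (H_left T (\<alpha> + \<beta>))" if "U \<in> elems (H_right T \<beta>)" for U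
    using left(1) Rf_right_left[OF that] by (auto simp: bij_betw_def)
  have n1: "nrm (H_right T (\<alpha> + \<beta>)) (J_right T \<alpha> U) = nrm (H_left T (\<alpha> + \<beta>)) (Jl T \<alpha> (Rf T U))" if "U \<in> elems (H_right T \<beta>)" for U
    using J[OF that] nrm_Rf(1)[OF JL[OF that]] by simp
  show "\<exists>C\<ge>0. \<forall>U\<in>elems (H_right T \<beta>). nrm (H_right T (\<alpha> + \<beta>)) (J_right T \<alpha> U) \<le> C * nrm (H_right T \<beta>) U"
    using left(2) n1 nrm_Rf(2) Rf_right_left by (metis (no_types, lifting))
  show "\<exists>C\<ge>0. \<forall>U\<in>elems (H_right T \<beta>). nrm (H_right T \<beta>) U \<le> C * nrm (H_right T (\<alpha> + \<beta>)) (J_right T \<alpha> U)"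
    using left(3) n1 nrm_Rf(2) Rf_right_left by (metis (no_types, lifting))
qed

lemma J_right_linear:
  assumes T: "T > 0" and a: "\<alpha> > 0" and U: "U \<in> L2 T" and V: "V \<in> L2 T"
  shows "J_right T \<alpha> (U + V) = J_right T \<alpha> U + J_right T \<alpha> V" "J_right T \<alpha> (c *\<^sub>R U) = c *\<^sub>R J_right T \<alpha> U"
  using U V by (simp_all add: J_right_Rf(2)[OF T a] L2_plus L2_scaleR Rf_plus Rf_scaleR Rf_L2 Jl_plus[OF a] Jl_scaleR[OF a] Jl_L2[OF a])

lemma J_dual_isomorphism:
  assumes T: "T > 0" and a: "\<alpha> > 0" and b: "\<beta> \<ge> 0"
  shows "is_isomorphism (H_dual T \<beta>) (H_dual T (\<alpha> + \<beta>)) (frac_deriv T \<alpha> \<beta>)"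
    "inj_on (J_dual T \<alpha> \<beta>) (elems (H_dual T (\<alpha> + \<beta>)))"
proof -
  note J = J_right_isomorphism[OF T a b]
  obtain C where C: "C \<ge> 0" "\<And>U. U \<in> elems (H_right T \<beta>) \<Longrightarrow> nrm (H_right T (\<alpha> + \<beta>)) (J_right T \<alpha> U) \<le> C * nrm (H_right T \<beta>) U"
    using J(2) by blast
  obtain C' where C': "C' \<ge> 0" "\<And>U. U \<in> elems (H_right T \<beta>) \<Longrightarrow> nrm (H_right T \<beta>) U \<le> C' * nrm (H_right T (\<alpha> + \<beta>)) (J_right T \<alpha> U)"
    using J(3) by blast
  have ab: "\<alpha> + \<beta> \<ge> 0" using a b by simp
  have Jd: "J_dual T \<alpha> \<beta> = (\<lambda>F \<phi>. if \<phi> \<in> elems (H_right T \<beta>) then F (J_right T \<alpha> \<phi>) else 0)"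
    by (auto simp: J_dual_def fun_eq_iff)
  note iso = dual_isomorphism[OF linear_nspace_right[OF T ab] linear_nspace_right[OF T b] J(1) _ _ C C',
      OF J_right_linear(1)[OF T a Hz_subset_L2 Hz_subset_L2] J_right_linear(2)[OF T a Hz_subset_L2 Hz_subset_L2], folded Jd H_dual_def]
  show "is_isomorphism (H_dual T \<beta>) (H_dual T (\<alpha> + \<beta>)) (frac_deriv T \<alpha> \<beta>)"
    unfolding frac_deriv_def by (rule iso(2))
  show "inj_on (J_dual T \<alpha> \<beta>) (elems (H_dual T (\<alpha> + \<beta>)))" by (rule iso(3))
qed

section \<open>The restriction to functions\<close>

lemma L2_incl_fn: "L2_incl T \<gamma> U \<phi> = (if \<phi> \<in> elems (H_right T \<gamma>) then LINT t|lborel. fn T U t * fn T \<phi> t else 0)"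
proof -
  have "(LINT t:{0<..<T}|lborel. rep_ae U t * rep_ae \<phi> t) = (LINT t|lborel. fn T U t * fn T \<phi> t)"
    unfolding set_lebesgue_integral_def by (intro Bochner_Integration.integral_cong refl) (auto simp: fn_def indicator_def)
  then show ?thesis by (simp add: L2_incl_def)
qed

lemma fn_product_integrable: "U \<in> L2 T \<Longrightarrow> V \<in> L2 T \<Longrightarrow> integrable lborel (\<lambda>t. fn T U t * fn T V t)"
  by (rule L2_product_integrable) (auto simp: L2_def L2_sq_fn)

lemma LINT_fn_plus:
  assumes "U \<in> L2 T" "V \<in> L2 T" "W \<in> L2 T"
  shows "(LINT t|lborel. fn T (U + V) t * fn T W t) = (LINT t|lborel. fn T U t * fn T W t) + (LINT t|lborel. fn T V t * fn T W t)"
proof -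
  have "(LINT t|lborel. fn T (U + V) t * fn T W t) = (LINT t|lborel. fn T U t * fn T W t + fn T V t * fn T W t)"
    by (rule integral_cong_AE) (use fn_plus_AE[of T U V] in \<open>auto elim!: eventually_mono simp: distrib_right\<close>)
  also have "\<dots> = (LINT t|lborel. fn T U t * fn T W t) + (LINT t|lborel. fn T V t * fn T W t)"
    by (rule Bochner_Integration.integral_add) (use assms fn_product_integrable in auto)
  finally show ?thesis .
qed

lemma LINT_fn_scaleR:
  "(LINT t|lborel. fn T (c *\<^sub>R U) t * fn T W t) = c * (LINT t|lborel. fn T U t * fn T W t)"
proof -
  have "(LINT t|lborel. fn T (c *\<^sub>R U) t * fn T W t) = (LINT t|lborel. c * (fn T U t * fn T W t))"
    by (rule integral_cong_AE) (use fn_scaleR_AE[of T c U] in \<open>auto elim!: eventually_mono\<close>)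
  then show ?thesis by (simp only: integral_mult_right_zero)
qed

lemma L2_incl_plus:
  assumes "U \<in> L2 T" "V \<in> L2 T"
  shows "L2_incl T \<gamma> (U + V) = L2_incl T \<gamma> U + L2_incl T \<gamma> V"
  by (rule ext) (use LINT_fn_plus[OF assms] in \<open>auto simp: L2_incl_fn dest: Hz_subset_L2\<close>)

lemma L2_incl_scaleR: "L2_incl T \<gamma> (c *\<^sub>R U) = c *\<^sub>R L2_incl T \<gamma> U"
  by (rule ext) (auto simp: L2_incl_fn scaleR_fun_def LINT_fn_scaleR)

lemma J_right_adjoint:
  assumes T: "T > 0" and a: "a > 0" and U: "U \<in> L2 T" and V: "V \<in> L2 T"
  shows "(LINT t|lborel. fn T U t * fn T (J_right T a V) t) = (LINT t|lborel. fn T (Jl T a U) t * fn T V t)"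
proof -
  have m: "rr a (fn T V) \<in> borel_measurable borel" unfolding rr_def by measurable
  note [measurable] = m
  have "(LINT t|lborel. fn T U t * fn T (J_right T a V) t) = (LINT t|lborel. fn T U t * rr a (fn T V) t)"
    by (rule integral_cong_AE) (use J_right_Rf(1)[OF T a V] in \<open>auto elim!: eventually_mono simp: fn_def indicator_def\<close>)
  also have "\<dots> = (LINT t|lborel. rl a (fn T U) t * fn T V t)"
    by (rule rl_duality[OF a L2_fn(1)[OF U] L2_fn(1)[OF V] T, symmetric])
  also have "\<dots> = (LINT t|lborel. fn T (Jl T a U) t * fn T V t)"
    by (rule integral_cong_AE) (use fn_Jl_AE[of T a U] in \<open>auto elim!: eventually_mono simp: fn_def indicator_def\<close>)
  finally show ?thesis .
qed

lemma L2_separated: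
  assumes U: "U \<in> L2 T" "V \<in> L2 T" and eq: "\<And>W. W \<in> L2 T \<Longrightarrow> (LINT t|lborel. fn T U t * fn T W t) = (LINT t|lborel. fn T V t * fn T W t)"
  shows "U = V"
proof (rule weak_deriv_unique[OF U])
  show "has_weak_deriv T 0 U U" by (rule has_weak_deriv_0)
  show "has_weak_deriv T 0 U V" unfolding has_weak_deriv_fn
  proof (intro allI impI)
    fix \<phi> assume \<phi>: "test_function T \<phi>"
    note L = test_function_L2on[OF \<phi>]
    note [measurable] = L2onD(1)[OF L]
    have ind: "indicator {0<..<T} t * \<phi> t = \<phi> t" for t
      using L2onD(5,6)[OF L, of t] by (cases "0 < t \<and> t < T") auto
    have W: "ae_on T \<phi> \<in> L2 T" by (rule ae_on_L2) (simp add: ind L)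
    have f: "AE t in lborel. fn T (ae_on T \<phi>) t = \<phi> t" using fn_ae_on_AE[of T \<phi>] by (simp add: ind)
    have "(LINT t|lborel. fn T X t * fn T (ae_on T \<phi>) t) = (LINT t|lborel. fn T X t * \<phi> t)" for X
      by (rule integral_cong_AE) (use f in \<open>auto elim!: eventually_mono\<close>)
    then show "(LINT t|lborel. fn T U t * (deriv ^^ 0) \<phi> t) = (-1) ^ 0 * (LINT t|lborel. fn T V t * \<phi> t)"
      using eq[OF W] by simp
  qed
qed

text \<open>
  Two functions with equal pairings against ${}^{\gamma}H = J_\gamma L^2$ have, by
  adjointness, fractional integrals $J^\gamma U$ and $J^\gamma V$ with equal pairings against
  $L^2$; and $J^\gamma$ is injective. So ${}^{\gamma}H$ separates the elements of $L^2$.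
\<close>

lemma L2_incl_inj:
  assumes T: "T > 0" and g: "\<gamma> \<ge> 0"
  shows "inj_on (L2_incl T \<gamma>) (L2 T)"
proof (rule inj_onI)
  fix U V assume UV: "U \<in> L2 T" "V \<in> L2 T" and eq: "L2_incl T \<gamma> U = L2_incl T \<gamma> V"
  have e: "(LINT t|lborel. fn T U t * fn T \<phi> t) = (LINT t|lborel. fn T V t * fn T \<phi> t)" if "\<phi> \<in> elems (H_right T \<gamma>)" for \<phi>
    using fun_cong[OF eq, of \<phi>] that by (simp add: L2_incl_fn)
  show "U = V"
  proof (cases "\<gamma> = 0")
    case True
    then show ?thesis using e by (intro L2_separated[OF UV]) (simp add: elems_Hz)
  next
    case False
    then have g: "\<gamma> > 0" using g by simp
    have "Jl T \<gamma> U = Jl T \<gamma> V"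
    proof (rule L2_separated[where T=T])
      fix W assume W: "W \<in> L2 T"
      have "J_right T \<gamma> W \<in> elems (H_right T (\<gamma> + 0))"
        using J_right_isomorphism(1)[OF T g, of 0] W by (auto simp: bij_betw_def elems_Hz)
      then show "(LINT t|lborel. fn T (Jl T \<gamma> U) t * fn T W t) = (LINT t|lborel. fn T (Jl T \<gamma> V) t * fn T W t)"
        using e J_right_adjoint[OF T g UV(1) W] J_right_adjoint[OF T g UV(2) W] by simp
    qed (intro Jl_L2 g UV)+
    then show ?thesis by (rule Jl_inj[OF T g UV])
  qed
qed

lemma L2_sq_le_Hz_sq:
  assumes T: "T > 0" and g: "\<gamma> \<ge> 0"
  shows "\<exists>C\<ge>0. \<forall>U\<in>elems (H_right T \<gamma>). L2_sq T U \<le> ennreal C * Hz_sq T T \<gamma> U"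
proof -
  obtain B where B: "B \<ge> 0" "\<And>U. U \<in> elems (H_left T \<gamma>) \<Longrightarrow> \<exists>V\<in>L2 T. U = Jz T \<gamma> V \<and> L2_sq T V \<le> ennreal B * Hz_sq T 0 \<gamma> U"
    using Hz_preimage[OF T g] by blast
  define K where "K = (if \<gamma> = 0 then 1 else (T powr \<gamma> / Gamma (\<gamma> + 1))\<^sup>2)"
  have K: "K \<ge> 0" by (simp add: K_def)
  show ?thesis
  proof (intro exI[of _ "K * B"] conjI ballI)
    fix U assume U: "U \<in> elems (H_right T \<gamma>)"
    obtain V where V: "V \<in> L2 T" "Rf T U = Jz T \<gamma> V" "L2_sq T V \<le> ennreal B * Hz_sq T 0 \<gamma> (Rf T U)"
      using B(2)[OF Rf_right_left[OF U]] by blast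
    have "L2_sq T U = L2_sq T (Jz T \<gamma> V)" using V(2) L2_sq_Rf[of T U] by simp
    also have "\<dots> \<le> ennreal K * L2_sq T V"
      using Jl_L2_sq_le[OF _ T V(1), of \<gamma>] g by (auto simp: Jz_def K_def)
    also have "\<dots> \<le> ennreal K * (ennreal B * Hz_sq T 0 \<gamma> (Rf T U))" by (intro mult_left_mono V) simp
    also have "Hz_sq T 0 \<gamma> (Rf T U) = Hz_sq T T \<gamma> U" using Hz_Rf(2)[OF U] by simp
    finally show "L2_sq T U \<le> ennreal (K * B) * Hz_sq T T \<gamma> U" using K B(1) by (simp add: ennreal_mult mult.assoc)
  qed (use K B in simp)
qed

lemma L2_incl_dual:
  assumes T: "T > 0" and g: "\<gamma> \<ge> 0" and U: "U \<in> L2 T"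
  shows "L2_incl T \<gamma> U \<in> elems (H_dual T \<gamma>)"
proof -
  obtain C where C: "C \<ge> 0" "\<And>\<phi>. \<phi> \<in> elems (H_right T \<gamma>) \<Longrightarrow> L2_sq T \<phi> \<le> ennreal C * Hz_sq T T \<gamma> \<phi>"
    using L2_sq_le_Hz_sq[OF T g] by blast
  note lin = linear_nspace_right[OF T g, unfolded linear_nspace_def]
  define u where "u = enn2real (L2_sq T U)"
  have u: "L2_sq T U = ennreal u" "u \<ge> 0" using U by (auto simp: u_def L2_def)
  show ?thesis unfolding H_dual_def
  proof (rule dual_elemI[where C="sqrt u * sqrt C"])
    fix x y assume xy: "x \<in> elems (H_right T \<gamma>)" "y \<in> elems (H_right T \<gamma>)"
    show "L2_incl T \<gamma> U (x + y) = L2_incl T \<gamma> U x + L2_incl T \<gamma> U y"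
      using xy lin LINT_fn_plus[OF Hz_subset_L2[OF xy(1)] Hz_subset_L2[OF xy(2)] U]
      by (simp add: L2_incl_fn mult.commute[of "fn T U _"])
  next
    fix c x assume x: "x \<in> elems (H_right T \<gamma>)"
    then show "L2_incl T \<gamma> U (c *\<^sub>R x) = c * L2_incl T \<gamma> U x"
      using lin LINT_fn_scaleR[of T c x U] by (simp add: L2_incl_fn mult.commute[of "fn T U _"])
  next
    fix x assume x: "x \<in> elems (H_right T \<gamma>)"
    define h where "h = enn2real (Hz_sq T T \<gamma> x)"
    have h: "Hz_sq T T \<gamma> x = ennreal h" "h \<ge> 0" using Hz_sq_finite[OF x] by (auto simp: h_def)
    have "ennreal ((LINT t|lborel. fn T U t * fn T x t)\<^sup>2) \<le> L2_sq T U * L2_sq T x"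
      unfolding L2_sq_fn by (rule L2_Cauchy_Schwarz) auto
    also have "\<dots> \<le> ennreal u * (ennreal C * ennreal h)"
      unfolding u(1) h(1)[symmetric] by (intro mult_left_mono C x) simp
    also have "\<dots> = ennreal (u * (C * h))" using u C h by (simp add: ennreal_mult)
    finally have "(LINT t|lborel. fn T U t * fn T x t)\<^sup>2 \<le> u * (C * h)" using u C h by (simp add: ennreal_le_iff)
    then have "sqrt ((LINT t|lborel. fn T U t * fn T x t)\<^sup>2) \<le> sqrt (u * (C * h))" by (rule real_sqrt_le_mono)
    then show "\<bar>L2_incl T \<gamma> U x\<bar> \<le> sqrt u * sqrt C * nrm (H_right T \<gamma>) x"
      using x by (simp add: L2_incl_fn nrm_Hz h_def real_sqrt_mult mult.assoc)
  qed (simp add: L2_incl_fn)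
qed

text \<open>
  The dual of $J_\alpha$ extends $J^\alpha$ from functions to functionals.
\<close>

lemma J_dual_L2_incl:
  assumes T: "T > 0" and a: "\<alpha> > 0" and g: "\<gamma> \<ge> 0" and U: "U \<in> L2 T"
  shows "J_dual T \<alpha> \<gamma> (L2_incl T (\<alpha> + \<gamma>) U) = L2_incl T \<gamma> (Jl T \<alpha> U)"
proof
  fix \<phi>
  show "J_dual T \<alpha> \<gamma> (L2_incl T (\<alpha> + \<gamma>) U) \<phi> = L2_incl T \<gamma> (Jl T \<alpha> U) \<phi>"
  proof (cases "\<phi> \<in> elems (H_right T \<gamma>)")
    case True
    then have "J_right T \<alpha> \<phi> \<in> elems (H_right T (\<alpha> + \<gamma>))"
      using J_right_isomorphism(1)[OF T a g] by (auto simp: bij_betw_def)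
    then show ?thesis using True J_right_adjoint[OF T a U Hz_subset_L2[OF True]]
      by (simp add: J_dual_def L2_incl_fn)
  qed (simp add: J_dual_def L2_incl_fn)
qed

theorem frac_deriv_L2_incl:
  assumes T: "T > 0" and a: "\<alpha> > 0" and g: "\<gamma> \<ge> 0" and U: "U \<in> L2 T"
  shows "frac_deriv T \<alpha> \<gamma> (L2_incl T \<gamma> (Jl T \<alpha> U)) = L2_incl T (\<alpha> + \<gamma>) U"
  unfolding frac_deriv_def J_dual_L2_incl[OF assms, symmetric]
  by (rule the_inv_into_f_f[OF J_dual_isomorphism(2)[OF T a g] L2_incl_dual[OF T _ U]]) (use a g in simp)

text \<open>
  Under the inclusions of $L^2$ into the negative scale, which preserve the norms by the
  definition of \<open>as_subspace\<close>, the fractional derivative is the inverse of $J^\alpha$ from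
  $H_\beta$ onto $H_{\alpha+\beta}$. So every element of the domain can be written as
  $J^\alpha W$ and the fractional derivative sends it to $W$.
\<close>

lemma frac_deriv_function_isomorphism:
  assumes T: "T > 0" and a: "\<alpha> > 0" and b: "\<beta> \<ge> 0" and g: "\<gamma> \<ge> 0"
  shows "is_isomorphism (as_subspace T \<gamma> (H_left T (\<alpha> + \<beta>))) (as_subspace T (\<alpha> + \<gamma>) (H_left T \<beta>)) (frac_deriv T \<alpha> \<gamma>)"
proof -
  have ab: "\<alpha> + \<beta> \<ge> 0" and ag: "\<alpha> + \<gamma> \<ge> 0" using a b g by auto
  note J = Jl_left_isomorphism[OF T a b]
  obtain C where C: "\<And>U. U \<in> elems (H_left T \<beta>) \<Longrightarrow> nrm (H_left T (\<alpha> + \<beta>)) (Jl T \<alpha> U) \<le> C * nrm (H_left T \<beta>) U"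
    using J(2) by blast
  obtain C' where C': "\<And>U. U \<in> elems (H_left T \<beta>) \<Longrightarrow> nrm (H_left T \<beta>) U \<le> C' * nrm (H_left T (\<alpha> + \<beta>)) (Jl T \<alpha> U)"
    using J(3) by blast
  let ?X = "as_subspace T \<gamma> (H_left T (\<alpha> + \<beta>))" and ?Y = "as_subspace T (\<alpha> + \<gamma>) (H_left T \<beta>)" and ?D = "frac_deriv T \<alpha> \<gamma>"
  have i: "inj_on (L2_incl T \<delta>) (elems (H_left T \<epsilon>))" if "\<delta> \<ge> 0" for \<delta> \<epsilon>
    using L2_incl_inj[OF T that] by (rule inj_on_subset) (auto dest: Hz_subset_L2)
  have n: "nrm (as_subspace T \<delta> (H_left T \<epsilon>)) (L2_incl T \<delta> U) = nrm (H_left T \<epsilon>) U" if "\<delta> \<ge> 0" "U \<in> elems (H_left T \<epsilon>)" for \<delta> \<epsilon> U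
    using the_inv_into_f_f[OF i[OF that(1)] that(2)] by (simp add: as_subspace_def)
  have X_iff: "x \<in> elems ?X \<longleftrightarrow> (\<exists>W\<in>elems (H_left T \<beta>). x = L2_incl T \<gamma> (Jl T \<alpha> W))" for x
  proof -
    have im: "elems (H_left T (\<alpha> + \<beta>)) = Jl T \<alpha> ` elems (H_left T \<beta>)" using J(1) by (simp add: bij_betw_def)
    show ?thesis by (auto simp: as_subspace_def im)
  qed
  have JX: "Jl T \<alpha> W \<in> elems (H_left T (\<alpha> + \<beta>))" if "W \<in> elems (H_left T \<beta>)" for W
    using J(1) that by (auto simp: bij_betw_def)
  have D: "?D (L2_incl T \<gamma> (Jl T \<alpha> W)) = L2_incl T (\<alpha> + \<gamma>) W" if "W \<in> elems (H_left T \<beta>)" for W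
    by (rule frac_deriv_L2_incl[OF T a g Hz_subset_L2[OF that]])
  have bij: "bij_betw ?D (elems ?X) (elems ?Y)"
    unfolding bij_betw_def
  proof (intro conjI inj_onI)
    fix x y assume "x \<in> elems ?X" "y \<in> elems ?X" and eq: "?D x = ?D y"
    then obtain V W where V: "V \<in> elems (H_left T \<beta>)" "x = L2_incl T \<gamma> (Jl T \<alpha> V)"
      and W: "W \<in> elems (H_left T \<beta>)" "y = L2_incl T \<gamma> (Jl T \<alpha> W)" unfolding X_iff by blast
    have "L2_incl T (\<alpha> + \<gamma>) V = L2_incl T (\<alpha> + \<gamma>) W" using eq V W D by simp
    then have "V = W" using inj_onD[OF i[OF ag] _ V(1) W(1)] by simp
    then show "x = y" using V W by simp
  next
    have "?D ` elems ?X = (\<lambda>W. L2_incl T (\<alpha> + \<gamma>) W) ` elems (H_left T \<beta>)"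
    proof (intro equalityI subsetI)
      fix z assume "z \<in> ?D ` elems ?X"
      then show "z \<in> (\<lambda>W. L2_incl T (\<alpha> + \<gamma>) W) ` elems (H_left T \<beta>)" using X_iff D by auto
    next
      fix z assume "z \<in> (\<lambda>W. L2_incl T (\<alpha> + \<gamma>) W) ` elems (H_left T \<beta>)"
      then obtain W where W: "W \<in> elems (H_left T \<beta>)" "z = L2_incl T (\<alpha> + \<gamma>) W" by blast
      then have "L2_incl T \<gamma> (Jl T \<alpha> W) \<in> elems ?X" using X_iff by blast
      then show "z \<in> ?D ` elems ?X" using D[OF W(1)] W(2) by (metis imageI)
    qed
    then show "?D ` elems ?X = elems ?Y" by (simp add: as_subspace_def)
  qed
  note L = linear_nspace_left[OF T b, unfolded linear_nspace_def]
  show ?thesis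
  proof (rule is_isomorphismI(1)[OF bij])
    fix x y assume "x \<in> elems ?X" "y \<in> elems ?X"
    then obtain V W where V: "V \<in> elems (H_left T \<beta>)" "x = L2_incl T \<gamma> (Jl T \<alpha> V)"
      and W: "W \<in> elems (H_left T \<beta>)" "y = L2_incl T \<gamma> (Jl T \<alpha> W)" unfolding X_iff by blast
    note VL = Hz_subset_L2[OF V(1)] and WL = Hz_subset_L2[OF W(1)]
    have VW: "V + W \<in> elems (H_left T \<beta>)" using L V W by blast
    have xy: "x + y = L2_incl T \<gamma> (Jl T \<alpha> (V + W))"
      using V W by (simp add: Jl_plus[OF a VL WL] L2_incl_plus[OF Jl_L2[OF a VL] Jl_L2[OF a WL]])
    show "x + y \<in> elems ?X \<and> ?D (x + y) = ?D x + ?D y"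
      using X_iff VW xy D[OF VW] D[OF V(1)] D[OF W(1)] V W L2_incl_plus[OF VL WL] by auto
  next
    fix c x assume "x \<in> elems ?X"
    then obtain V where V: "V \<in> elems (H_left T \<beta>)" "x = L2_incl T \<gamma> (Jl T \<alpha> V)" unfolding X_iff by blast
    note VL = Hz_subset_L2[OF V(1)]
    have cV: "c *\<^sub>R V \<in> elems (H_left T \<beta>)" using L V by blast
    have cx: "c *\<^sub>R x = L2_incl T \<gamma> (Jl T \<alpha> (c *\<^sub>R V))"
      using V by (simp add: Jl_scaleR[OF a VL] L2_incl_scaleR)
    show "c *\<^sub>R x \<in> elems ?X \<and> ?D (c *\<^sub>R x) = c *\<^sub>R ?D x"
      using X_iff cV cx D[OF cV] D[OF V(1)] V L2_incl_scaleR[of T "\<alpha> + \<gamma>" c V] by auto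
  next
    fix x assume "x \<in> elems ?X"
    then obtain V where V: "V \<in> elems (H_left T \<beta>)" "x = L2_incl T \<gamma> (Jl T \<alpha> V)" unfolding X_iff by blast
    have nx: "nrm ?X x = nrm (H_left T (\<alpha> + \<beta>)) (Jl T \<alpha> V)" using n[OF g JX[OF V(1)]] V(2) by simp
    have ny: "nrm ?Y (?D x) = nrm (H_left T \<beta>) V" using n[OF ag V(1)] D[OF V(1)] V(2) by simp
    show "nrm ?Y (?D x) \<le> C' * nrm ?X x" unfolding nx ny by (rule C'[OF V(1)])
    show "nrm ?X x \<le> C * nrm ?Y (?D x)" unfolding nx ny by (rule C[OF V(1)])
  qed
qed

theorem theorem2p1:
  fixes T \<alpha> \<beta> :: real
  assumes "T > 0" and "\<alpha> > 0" and "\<beta> \<ge> 0"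
  shows "is_isomorphism (H_dual T \<beta>) (H_dual T (\<alpha> + \<beta>)) (frac_deriv T \<alpha> \<beta>)
    \<and> (\<forall>\<gamma>\<ge>0. is_isomorphism (as_subspace T \<gamma> (H_left T (\<alpha> + \<beta>)))
                 (as_subspace T (\<alpha> + \<gamma>) (H_left T \<beta>)) (frac_deriv T \<alpha> \<gamma>))"
  using J_dual_isomorphism(1)[OF assms] frac_deriv_function_isomorphism[OF assms] by blast

end
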